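(* Let $\eta\in L^2(\Omega,\mathcal F_T,\mathbb P;H)$ and $f\in L^2_{\mathcal P}(\Omega\times[0,T];H)$. Then there is at most one pair $(P,Q)$ (a mild solution of the linear BSDE $-dP_t=[A^*P_t+\sum_{i=1}^\infty C_i^*(t)Q_te_i+f_t]dt-\sum_{i=1}^\infty Q_te_i\,d\beta^i_t$, $P_T=\eta$) satisfying: (1) $P\in L^2_{\mathcal P}(\Omega\times[0,T];H)$, $Q\in L^2_{\mathcal P}(\Omega\times[0,T];L_2(H))$; (2) $\mathbb E\int_0^T(T-s)^{2\alpha}|Q_s|^2_{L_1(H)}ds<\infty$; (3) $\sup_n\mathbb E\int_0^T(T-s)^{2\alpha}\big|\sum_{i=1}^nC_i^*(s)Q_se_i\big|^2ds<\infty$; (4) for every $t\in[0,T]$, $$P_t=e^{(T-t)A^*}\eta+\sum_{i=1}^\infty\int_t^Te^{(s-t)A^*}C_i^*(s)Q_se_i\,ds+\int_t^Te^{(s-t)A^*}f_s\,ds-\sum_{i=1}^\infty\int_t^Te^{(s-t)A^*}Q_se_i\,d\beta^i_s,$$ where the first series is the limit in $L^1(\Omega;H)$ of its partial sums.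
   Context: $H$ is a real separable Hilbert space, $T>0$, $W$ a cylindrical Wiener process on $H$ on $(\Omega,\mathcal F,\mathbb P)$ with completed natural filtration $(\mathcal F_t)$; $(e_i)$ a fixed orthonormal basis, $\beta^i_t=\langle e_i,W_t\rangle$. $L_2(H)$: Hilbert–Schmidt operators; $L_1(H)$: trace-class operators with trace norm $|\cdot|_{L_1(H)}$; $L^2_{\mathcal P}$: progressively measurable square-integrable processes. Standing assumptions: $A$ generates a $C_0$-semigroup $(e^{tA})$ with $|e^{tA}|^2_{L_2(H)}\le ct^{-2\alpha}$ for $0<t\le1$, $\alpha\in[0,1/2)$; $e^{tA^*}=(e^{tA})^*$; $C_i:[0,T]\times\Omega\to L(H)$ strongly progressively measurable with $|C_i(t)|_{L(H)}\le c$ and $\sum_i|e^{tA}C_i(s)y|^2\le ct^{-2\alpha}|y|^2$ for $y\in H$, $s\in[0,T]$, $0<t\le1$. *)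

theory Defs
  imports "HOL-Probability.Probability"
begin

definition hadj :: "('h::real_inner \<Rightarrow> 'h) \<Rightarrow> 'h \<Rightarrow> 'h" where
  "hadj K y = (THE z. \<forall>x. inner z x = inner y (K x))"

definition orthonormal_basis :: "(nat \<Rightarrow> 'h::real_inner) \<Rightarrow> bool" where
  "orthonormal_basis e \<longleftrightarrow>
     (\<forall>i j. inner (e i) (e j) = (if i = j then 1 else 0)) \<and>
     (\<forall>x. (\<lambda>n. \<Sum>i<n. inner x (e i) *\<^sub>R e i) \<longlonglongrightarrow> x)"

definition hs_norm2 :: "(nat \<Rightarrow> 'h::real_normed_vector) \<Rightarrow> ('h \<Rightarrow> 'h) \<Rightarrow> ennreal" where
  "hs_norm2 e K = (\<Sum>i. ennreal ((norm (K (e i)))\<^sup>2))"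

text \<open>Trace (nuclear) norm: infimum of \<open>\<Sum> |a_j| |b_j|\<close> over representations
  \<open>K x = \<Sum>j \<langle>a_j, x\<rangle> b_j\<close>; equals \<open>\<infinity>\<close> if \<open>K\<close> is not trace class.\<close>
definition nuclear_norm :: "('h::real_inner \<Rightarrow> 'h) \<Rightarrow> ennreal" where
  "nuclear_norm K =
     (INF ab \<in> {(a, b). \<forall>x. (\<lambda>j. inner (a j) x *\<^sub>R b j) sums K x}.
        \<Sum>j. ennreal (norm (fst ab j) * norm (snd ab j)))"

text \<open>\<open>S t = e^{tA}\<close>: a \<open>C_0\<close>-semigroup (its generator is \<open>A\<close>).\<close>
definition c0_semigroup :: "(real \<Rightarrow> 'h::real_normed_vector \<Rightarrow> 'h) \<Rightarrow> bool" where
  "c0_semigroup S \<longleftrightarrow>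
     (\<forall>t\<ge>0. bounded_linear (S t)) \<and> S 0 = id \<and>
     (\<forall>t s. t \<ge> 0 \<longrightarrow> s \<ge> 0 \<longrightarrow> S (t + s) = S t \<circ> S s) \<and>
     (\<forall>x. ((\<lambda>t. S t x) \<longlongrightarrow> x) (at_right 0))"

definition std_bm :: "'w measure \<Rightarrow> real \<Rightarrow> (real \<Rightarrow> 'w \<Rightarrow> real) \<Rightarrow> bool" where
  "std_bm M T b \<longleftrightarrow>
     (\<forall>t\<in>{0..T}. b t \<in> borel_measurable M) \<and>
     (AE \<omega> in M. b 0 \<omega> = 0) \<and>
     (AE \<omega> in M. continuous_on {0..T} (\<lambda>t. b t \<omega>)) \<and>
     (\<forall>s t. 0 \<le> s \<longrightarrow> s < t \<longrightarrow> t \<le> T \<longrightarrow>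
        distributed M lborel (\<lambda>\<omega>. b t \<omega> - b s \<omega>) (normal_density 0 (sqrt (t - s)))) \<and>
     (\<forall>s t. 0 \<le> s \<longrightarrow> s < t \<longrightarrow> t \<le> T \<longrightarrow>
        prob_space.indep_set M
          (sigma_sets (space M) {(\<lambda>\<omega>. b t \<omega> - b s \<omega>) -` U \<inter> space M | U. U \<in> sets borel})
          (sigma_sets (space M) (\<Union>r\<in>{0..s}. {b r -` U \<inter> space M | U. U \<in> sets borel})))"

text \<open>Coordinates \<open>\<beta>^i = \<langle>e_i, W\<rangle>\<close> of a cylindrical Wiener process on \<open>[0,T]\<close>:
  independent standard real Brownian motions.\<close>
definition cyl_wiener :: "'w measure \<Rightarrow> real \<Rightarrow> (nat \<Rightarrow> real \<Rightarrow> 'w \<Rightarrow> real) \<Rightarrow> bool" where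
  "cyl_wiener M T \<beta> \<longleftrightarrow>
     prob_space M \<and> (\<forall>i. std_bm M T (\<beta> i)) \<and>
     prob_space.indep_vars M (\<lambda>_. PiM {0..T} (\<lambda>_. borel))
        (\<lambda>i \<omega>. restrict (\<lambda>t. \<beta> i t \<omega>) {0..T}) UNIV"

definition nat_filtration :: "'w measure \<Rightarrow> (nat \<Rightarrow> real \<Rightarrow> 'w \<Rightarrow> real) \<Rightarrow> real \<Rightarrow> 'w measure" where
  "nat_filtration M \<beta> t =
     sigma (space M)
       ((\<Union>i. \<Union>r\<in>{0..t}. {\<beta> i r -` U \<inter> space M | U. U \<in> sets borel}) \<union> null_sets M)"

definition progressive ::
  "'w measure \<Rightarrow> (real \<Rightarrow> 'w measure) \<Rightarrow> real \<Rightarrow> (real \<Rightarrow> 'w \<Rightarrow> 'b::topological_space) \<Rightarrow> bool" where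
  "progressive M F T X \<longleftrightarrow>
     (\<forall>t\<in>{0..T}. (\<lambda>z. X (fst z) (snd z)) \<in> borel_measurable (restrict_space lborel {0..t} \<Otimes>\<^sub>M F t))"

definition sq_int :: "'w measure \<Rightarrow> real \<Rightarrow> (real \<Rightarrow> 'w \<Rightarrow> 'b::real_normed_vector) \<Rightarrow> bool" where
  "sq_int M T X \<longleftrightarrow>
     (\<integral>\<^sup>+z. ennreal ((norm (X (fst z) (snd z)))\<^sup>2) \<partial>(restrict_space lborel {0..T} \<Otimes>\<^sub>M M)) < \<infinity>"

definition simple_adapted ::
  "'w measure \<Rightarrow> (real \<Rightarrow> 'w measure) \<Rightarrow> real \<Rightarrow> real \<Rightarrow> (nat \<Rightarrow> real) \<Rightarrow> nat
     \<Rightarrow> (nat \<Rightarrow> 'w \<Rightarrow> 'b::real_normed_vector) \<Rightarrow> bool" where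
  "simple_adapted M F a c ts n \<xi> \<longleftrightarrow>
     ts 0 = a \<and> ts n = c \<and> (\<forall>k<n. ts k < ts (Suc k)) \<and>
     (\<forall>k<n. \<xi> k \<in> borel_measurable (F (ts k)) \<and> (\<exists>B. \<forall>\<omega>\<in>space M. norm (\<xi> k \<omega>) \<le> B))"

definition simple_proc :: "(nat \<Rightarrow> real) \<Rightarrow> nat \<Rightarrow> (nat \<Rightarrow> 'w \<Rightarrow> 'b::real_normed_vector) \<Rightarrow> real \<Rightarrow> 'w \<Rightarrow> 'b" where
  "simple_proc ts n \<xi> s \<omega> = (\<Sum>k<n. if ts k \<le> s \<and> s < ts (Suc k) then \<xi> k \<omega> else 0)"

definition simple_int :: "(real \<Rightarrow> 'w \<Rightarrow> real) \<Rightarrow> (nat \<Rightarrow> real) \<Rightarrow> nat \<Rightarrow> (nat \<Rightarrow> 'w \<Rightarrow> 'b::real_normed_vector) \<Rightarrow> 'w \<Rightarrow> 'b" where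
  "simple_int b ts n \<xi> \<omega> = (\<Sum>k<n. (b (ts (Suc k)) \<omega> - b (ts k) \<omega>) *\<^sub>R \<xi> k \<omega>)"

definition ito_int ::
  "'w measure \<Rightarrow> (real \<Rightarrow> 'w measure) \<Rightarrow> (real \<Rightarrow> 'w \<Rightarrow> real) \<Rightarrow> real \<Rightarrow> real
     \<Rightarrow> (real \<Rightarrow> 'w \<Rightarrow> 'b::real_normed_vector) \<Rightarrow> ('w \<Rightarrow> 'b) \<Rightarrow> bool" where
  "ito_int M F b a c \<Phi> X \<longleftrightarrow>
     X \<in> borel_measurable M \<and>
     (\<exists>ts n \<xi>. (\<forall>m. simple_adapted M F a c (ts m) (n m) (\<xi> m)) \<and>
        (\<lambda>m. \<integral>\<^sup>+z. ennreal ((norm (\<Phi> (fst z) (snd z) - simple_proc (ts m) (n m) (\<xi> m) (fst z) (snd z)))\<^sup>2)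
               \<partial>(restrict_space lborel {a..c} \<Otimes>\<^sub>M M)) \<longlonglongrightarrow> 0 \<and>
        (\<lambda>m. \<integral>\<^sup>+\<omega>. ennreal ((norm (X \<omega> - simple_int b (ts m) (n m) (\<xi> m) \<omega>))\<^sup>2) \<partial>M) \<longlonglongrightarrow> 0)"

definition mild_solution ::
  "'w measure \<Rightarrow> (nat \<Rightarrow> real \<Rightarrow> 'w \<Rightarrow> real) \<Rightarrow> (nat \<Rightarrow> 'h::{real_inner,complete_space,second_countable_topology})
   \<Rightarrow> (real \<Rightarrow> 'h \<Rightarrow> 'h) \<Rightarrow> (nat \<Rightarrow> real \<Rightarrow> 'w \<Rightarrow> 'h \<Rightarrow> 'h) \<Rightarrow> real \<Rightarrow> real
   \<Rightarrow> ('w \<Rightarrow> 'h) \<Rightarrow> (real \<Rightarrow> 'w \<Rightarrow> 'h)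
   \<Rightarrow> (real \<Rightarrow> 'w \<Rightarrow> 'h) \<Rightarrow> (real \<Rightarrow> 'w \<Rightarrow> 'h \<Rightarrow> 'h) \<Rightarrow> bool" where
  "mild_solution M \<beta> e S C T \<alpha> \<eta> f P Q \<longleftrightarrow>
     \<comment> \<open>(1)\<close>
     progressive M (nat_filtration M \<beta>) T P \<and> sq_int M T P \<and>
     (\<forall>s\<in>{0..T}. \<forall>\<omega>\<in>space M. bounded_linear (Q s \<omega>) \<and> summable (\<lambda>i. (norm (Q s \<omega> (e i)))\<^sup>2)) \<and>
     (\<forall>y. progressive M (nat_filtration M \<beta>) T (\<lambda>s \<omega>. Q s \<omega> y)) \<and>
     (\<integral>\<^sup>+z. hs_norm2 e (Q (fst z) (snd z)) \<partial>(restrict_space lborel {0..T} \<Otimes>\<^sub>M M)) < \<infinity> \<and>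
     \<comment> \<open>(2)\<close>
     (\<integral>\<^sup>+z. ennreal ((T - fst z) powr (2 * \<alpha>)) * (nuclear_norm (Q (fst z) (snd z)))\<^sup>2
        \<partial>(restrict_space lborel {0..T} \<Otimes>\<^sub>M M)) < \<infinity> \<and>
     \<comment> \<open>(3)\<close>
     (SUP n. \<integral>\<^sup>+z. ennreal ((T - fst z) powr (2 * \<alpha>) *
          (norm (\<Sum>i<n. hadj (C i (fst z) (snd z)) (Q (fst z) (snd z) (e i))))\<^sup>2)
        \<partial>(restrict_space lborel {0..T} \<Otimes>\<^sub>M M)) < \<infinity> \<and>
     \<comment> \<open>(4)\<close>
     (\<forall>t\<in>{0..T}. \<exists>D I SI.
        D \<in> borel_measurable M \<and>
        (\<lambda>n. \<integral>\<^sup>+\<omega>. ennreal (norm ((\<Sum>i<n. integral\<^sup>L (restrict_space lborel {t..T})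
               (\<lambda>s. hadj (S (s - t)) (hadj (C i s \<omega>) (Q s \<omega> (e i))))) - D \<omega>)) \<partial>M) \<longlonglongrightarrow> 0 \<and>
        (\<forall>i. ito_int M (nat_filtration M \<beta>) (\<beta> i) t T (\<lambda>s \<omega>. hadj (S (s - t)) (Q s \<omega> (e i))) (I i)) \<and>
        SI \<in> borel_measurable M \<and>
        (\<lambda>n. \<integral>\<^sup>+\<omega>. ennreal ((norm ((\<Sum>i<n. I i \<omega>) - SI \<omega>))\<^sup>2) \<partial>M) \<longlonglongrightarrow> 0 \<and>
        (AE \<omega> in M. P t \<omega> = hadj (S (T - t)) (\<eta> \<omega>) + D \<omega>
            + integral\<^sup>L (restrict_space lborel {t..T}) (\<lambda>s. hadj (S (s - t)) (f s \<omega>)) - SI \<omega>))"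

end

theory Submission
  imports Defs
begin

text \<open>Let \<open>x\<^sub>j\<close> be the difference of the columns \<open>Q e\<^sub>j\<close> of two solutions and
  \<open>g\<^sub>n = \<Sum>i<n. C\<^sub>i\<^sup>* x\<^sub>i\<close>. Pairing the mild equation at time \<open>u\<close> with an increment of
  \<open>\<beta>\<^sup>j\<close> after \<open>u\<close> times an \<open>F\<^sub>u\<close>-measurable variable removes all terms but the drift and the
  stochastic integral. Summed over a fine grid of times, these identities say that the pairing of
  \<open>(x\<^sub>i)\<close> with any bounded progressive family \<open>(\<Gamma>\<^sub>i)\<close> is the limit of the pairings of \<open>g\<^sub>n\<close>
  with the stochastic convolution \<open>X\<^sub>r = \<Sum>i. \<integral> e\<^bsup>(r - s)A\<^esup> \<Gamma>\<^sub>i(s) d\<beta>\<^sup>i\<^sub>s\<close>, whose second moment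
  is explicit. For \<open>\<Gamma>\<^sub>i = C\<^sub>i Y\<close> with \<open>Y = (b - s)\<^bsup>2\<alpha>\<^esup> g\<^sub>N\<close> the smoothing hypothesis on
  \<open>e\<^bsup>tA\<^esup> C\<^sub>i\<close> turns this into a contraction for the weighted norms of \<open>g\<^sub>n\<close> on short intervals, so all
  \<open>g\<^sub>n\<close> vanish. Then every pairing of \<open>(x\<^sub>i)\<close> vanishes, which gives \<open>Q\<close>, and \<open>P\<close> follows from
  the equation.\<close>

section \<open>Operators on Hilbert space\<close>


text \<open>The mild equation is available only at each fixed time and has no differential form, and
  its drift series converges merely in L1. Hence neither an Ito formula nor a stochastic Fubini
  theorem is applied: every step is a pairing with explicit Gaussian increments, and X is formed
  only on grids. Condition (3) acts twice. It turns the L1 convergence of the drift into weak L2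
  convergence, which admits unbounded increments as tests, and it gives the finite bound from which
  the contraction starts. The exponents balance as follows. Cauchy-Schwarz puts the weight (b -
  r)^(-2\<alpha>) on E|X_r|^2, smoothing contributes (r - s)^(-2\<alpha>), and integration over r
  leaves a multiple of (b - s)^(1 - 4\<alpha>), which may be singular. The weight in Y, once
  squared, supplies (b - s)^(4\<alpha>); so (b - s)^(1 - 2\<alpha>) remains in front of the weighted
  energy of g_N, small on short intervals because \<alpha> < 1/2. The admissible length is the same
  everywhere, so finitely many backward steps from T reach 0.\<close>

lemma norm_sum_orthonormal:
  fixes e :: "nat \<Rightarrow> 'h::real_inner"
  assumes e: "orthonormal_basis e" and A: "finite A"
  shows "(norm (\<Sum>i\<in>A. a i *\<^sub>R e i))\<^sup>2 = (\<Sum>i\<in>A. (a i)\<^sup>2)"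
proof -
  have ee: "inner (e i) (e j) = (if i = j then 1 else 0)" for i j
    using e by (simp add: orthonormal_basis_def)
  show ?thesis
    using A by (simp add: power2_norm_eq_inner inner_sum_left inner_sum_right ee if_distrib cong: if_cong)
      (simp add: power2_eq_square)
qed

text \<open>Let s be the partial sum. Then <x, s> = |s|^2, and Cauchy-Schwarz gives |s|^2 <= |x|
  |s|.\<close>

lemma bessel_inequality:
  fixes e :: "nat \<Rightarrow> 'h::real_inner"
  assumes e: "orthonormal_basis e"
  shows "norm (\<Sum>i<n. inner x (e i) *\<^sub>R e i) \<le> norm x"
proof -
  let ?s = "\<Sum>i<n. inner x (e i) *\<^sub>R e i"
  have "inner x ?s = (\<Sum>i<n. (inner x (e i))\<^sup>2)"
    by (simp add: inner_sum_right power2_eq_square)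
  also have "\<dots> = (norm ?s)\<^sup>2" by (rule norm_sum_orthonormal[OF e finite_lessThan, symmetric])
  finally have "norm ?s * norm ?s \<le> norm x * norm ?s"
    using norm_cauchy_schwarz[of x ?s] by (simp add: power2_eq_square[of "norm ?s"])
  then show ?thesis
    by (cases "norm ?s = 0") (auto simp: mult_le_cancel_right)
qed

text \<open>This is the existence half of the Riesz representation; the candidate is the vector with
  coordinates \<open>L (e i)\<close>. Applying L to a finite sum v of the terms L(e_i) e_i gives
  |v|^2 = L v <= K |v|, so the squared coordinates have sum at most K^2.\<close>

lemma bessel_partial_sums_convergent:
  fixes e :: "nat \<Rightarrow> 'h::{real_inner,complete_space}" and L :: "'h \<Rightarrow> real"
  assumes e: "orthonormal_basis e" and L: "bounded_linear L"
  shows "convergent (\<lambda>n. \<Sum>i<n. L (e i) *\<^sub>R e i)"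
proof -
  interpret L: bounded_linear L by fact
  obtain K where K: "\<And>x. \<bar>L x\<bar> \<le> norm x * K" "K > 0"
    using L.pos_bounded by auto
  note nrm = norm_sum_orthonormal[OF e]
  have bnd: "(\<Sum>i\<in>A. (L (e i))\<^sup>2) \<le> K\<^sup>2" if A: "finite A" for A
  proof -
    let ?s = "\<Sum>i\<in>A. (L (e i))\<^sup>2" and ?v = "\<Sum>i\<in>A. L (e i) *\<^sub>R e i"
    have "?s = L ?v"
      by (simp add: L.sum L.scaleR power2_eq_square)
    also have "\<dots> \<le> norm ?v * K" using K(1)[of ?v] by simp
    finally have 1: "?s \<le> norm ?v * K" .
    have 2: "(norm ?v)\<^sup>2 = ?s" by (rule nrm[OF A])
    show ?thesis
    proof (cases "norm ?v = 0")
      case True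
      then have "?s = 0" using 2 by simp
      then show ?thesis by simp
    next
      case False
      have "norm ?v * norm ?v = ?s" using 2 by (simp only: power2_eq_square[of "norm ?v"])
      then have "norm ?v * norm ?v \<le> norm ?v * K" using 1 by linarith
      then have "norm ?v \<le> K" by (rule mult_left_le_imp_le) (use False in simp)
      from power_mono[OF this norm_ge_zero, of 2] show ?thesis by (simp only: 2)
    qed
  qed
  have "summable (\<lambda>i. (L (e i))\<^sup>2)"
    by (rule summableI_nonneg_bounded[where x="K\<^sup>2"]) (auto intro: bnd)
  then have C: "Cauchy (\<lambda>n. \<Sum>i<n. (L (e i))\<^sup>2)"
    by (metis summable_iff_convergent Cauchy_convergent_iff)
  \<comment> \<open>By orthogonality the squared distance of two partial sums is the difference of
    the scalar partial sums of squares.\<close>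
  have "Cauchy (\<lambda>n. \<Sum>i<n. L (e i) *\<^sub>R e i)"
  proof (rule metric_CauchyI)
    fix \<epsilon> :: real assume \<epsilon>: "\<epsilon> > 0"
    then obtain N where N: "\<And>m n. m \<ge> N \<Longrightarrow> n \<ge> N \<Longrightarrow>
        dist (\<Sum>i<m. (L (e i))\<^sup>2) (\<Sum>i<n. (L (e i))\<^sup>2) < \<epsilon>\<^sup>2"
      using metric_CauchyD[OF C, of "\<epsilon>\<^sup>2"] by auto
    have *: "dist (\<Sum>i<m. L (e i) *\<^sub>R e i) (\<Sum>i<n. L (e i) *\<^sub>R e i) < \<epsilon>" if "m \<le> n" "N \<le> m" for m n
    proof -
      have s: "(\<Sum>i<n. g i) - (\<Sum>i<m. g i) = (\<Sum>i=m..<n. g i)" for g :: "nat \<Rightarrow> 'c::ab_group_add"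
        using that by (simp add: lessThan_atLeast0 sum_diff_nat_ivl)
      have "(norm (\<Sum>i=m..<n. L (e i) *\<^sub>R e i))\<^sup>2 = (\<Sum>i<n. (L (e i))\<^sup>2) - (\<Sum>i<m. (L (e i))\<^sup>2)"
        unfolding s by (rule nrm) simp
      also have "\<dots> < \<epsilon>\<^sup>2" using N[of n m] that by (simp add: dist_real_def)
      finally show ?thesis
        unfolding dist_norm norm_minus_commute[of "sum _ {..<m}"] s
        using \<epsilon> by (rule_tac power_less_imp_less_base[of _ 2]) auto
    qed
    show "\<exists>M. \<forall>m\<ge>M. \<forall>n\<ge>M. dist (\<Sum>i<m. L (e i) *\<^sub>R e i) (\<Sum>i<n. L (e i) *\<^sub>R e i) < \<epsilon>"
    proof (intro exI allI impI)
      fix m n assume "N \<le> m" "N \<le> n"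
      then show "dist (\<Sum>i<m. L (e i) *\<^sub>R e i) (\<Sum>i<n. L (e i) *\<^sub>R e i) < \<epsilon>"
        using *[of m n] *[of n m] by (cases "m \<le> n") (auto simp: dist_commute)
    qed
  qed
  then show ?thesis by (simp add: Cauchy_convergent)
qed

text \<open>\<open>hadj\<close> is a definite description, so nothing is known about it before
  existence and uniqueness of the representing vector are shown. Existence is the Riesz sum of the
  functional x -> <y, K x>; uniqueness follows by testing a difference against itself. All later
  facts on adjoints rest on this identity.\<close>

lemma hadj_inner:
  fixes e :: "nat \<Rightarrow> 'h::{real_inner,complete_space}" and K :: "'h \<Rightarrow> 'h"
  assumes e: "orthonormal_basis e" and K: "bounded_linear K"
  shows "inner (hadj K y) x = inner y (K x)"
proof -
  let ?L = "\<lambda>x::'h. inner y (K x)"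
  have L: "bounded_linear ?L"
    using bounded_linear_compose[OF bounded_linear_inner_right K] .
  interpret L: bounded_linear ?L by fact
  obtain z where z: "(\<lambda>n. \<Sum>i<n. ?L (e i) *\<^sub>R e i) \<longlonglongrightarrow> z"
    using bessel_partial_sums_convergent[OF e L] by (auto simp: convergent_def)
  have zx: "inner z x = ?L x" for x
  proof -
    have "(\<lambda>n. inner (\<Sum>i<n. ?L (e i) *\<^sub>R e i) x) \<longlonglongrightarrow> inner z x"
      by (intro tendsto_intros z)
    moreover have "inner (\<Sum>i<n. ?L (e i) *\<^sub>R e i) x = ?L (\<Sum>i<n. inner x (e i) *\<^sub>R e i)" for n
      unfolding L.sum L.scaleR by (simp add: inner_sum_left inner_commute[of x] mult.commute)
    moreover have "(\<lambda>n. ?L (\<Sum>i<n. inner x (e i) *\<^sub>R e i)) \<longlonglongrightarrow> ?L x"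
      by (rule L.tendsto) (use e in \<open>simp add: orthonormal_basis_def\<close>)
    ultimately show ?thesis using LIMSEQ_unique by fastforce
  qed
  have "hadj K y = z"
    unfolding hadj_def
  proof (rule the_equality)
    show "\<forall>x. inner z x = inner y (K x)" using zx by simp
    fix w assume "\<forall>x. inner w x = inner y (K x)"
    then have "inner (w - z) (w - z) = 0" using zx by (simp add: inner_diff_left)
    then show "w = z" by simp
  qed
  then show ?thesis using zx by simp
qed

lemma hadj_eqI:
  fixes e :: "nat \<Rightarrow> 'h::{real_inner,complete_space}" and K :: "'h \<Rightarrow> 'h"
  assumes "orthonormal_basis e" "bounded_linear K" "\<And>x. inner z x = inner y (K x)"
  shows "hadj K y = z"
proof -
  have "inner (hadj K y - z) (hadj K y - z) = 0"
    using assms by (simp add: inner_diff_left hadj_inner)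
  then show ?thesis by simp
qed

lemma hadj_diff:
  fixes e :: "nat \<Rightarrow> 'h::{real_inner,complete_space}" and K :: "'h \<Rightarrow> 'h"
  assumes e: "orthonormal_basis e" and K: "bounded_linear K"
  shows "hadj K (x - y) = hadj K x - hadj K y"
  using assms by (intro hadj_eqI[OF assms]) (simp add: inner_diff_left hadj_inner)

lemma hadj_sum:
  fixes e :: "nat \<Rightarrow> 'h::{real_inner,complete_space}" and K :: "'h \<Rightarrow> 'h"
  assumes e: "orthonormal_basis e" and K: "bounded_linear K"
  shows "hadj K (\<Sum>i\<in>I. f i) = (\<Sum>i\<in>I. hadj K (f i))"
  using assms by (intro hadj_eqI[OF assms]) (simp add: inner_sum_left hadj_inner)

lemma norm_hadj_le:
  fixes e :: "nat \<Rightarrow> 'h::{real_inner,complete_space}" and K :: "'h \<Rightarrow> 'h"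
  assumes e: "orthonormal_basis e" and K: "bounded_linear K" and B: "\<And>x. norm (K x) \<le> B * norm x"
  shows "norm (hadj K y) \<le> B * norm y"
proof (cases "norm (hadj K y) = 0")
  case True
  have "0 \<le> B * norm y" using B[of y] norm_ge_zero order_trans by blast
  then show ?thesis using True by simp
next
  case False
  let ?z = "hadj K y"
  have "norm ?z * norm ?z = inner y (K ?z)"
    using hadj_inner[OF e K, of y ?z] by (simp add: dot_square_norm power2_eq_square)
  also have "\<dots> \<le> norm y * norm (K ?z)" by (rule norm_cauchy_schwarz)
  also have "\<dots> \<le> norm y * (B * norm ?z)" by (intro mult_left_mono B) auto
  finally have "norm ?z * norm ?z \<le> (B * norm y) * norm ?z" by (simp add: mult_ac)
  then show ?thesis using False by (simp add: mult_le_cancel_right)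
qed

text \<open>Adjoints and Bochner integrals are accessible through their pairings with basis vectors,
  so measurability is checked there. The coordinates suffice because X is the pointwise limit of its
  finite expansions.\<close>

lemma borel_measurable_coordinates:
  fixes e :: "nat \<Rightarrow> 'h::{real_inner,second_countable_topology}"
  assumes e: "orthonormal_basis e" and X: "\<And>k. (\<lambda>z. inner (X z) (e k)) \<in> borel_measurable \<mu>"
  shows "X \<in> borel_measurable \<mu>"
proof (rule borel_measurable_LIMSEQ_metric)
  show "(\<lambda>z. \<Sum>i<n. inner (X z) (e i) *\<^sub>R e i) \<in> borel_measurable \<mu>" for n
    using X by measurable
  show "(\<lambda>n. \<Sum>i<n. inner (X z) (e i) *\<^sub>R e i) \<longlonglongrightarrow> X z" for z
    using e by (simp add: orthonormal_basis_def)
qed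

text \<open>The operators are measurable only when applied to fixed vectors. Expanding the random
  argument X in the basis turns \<open>K z (X z)\<close> into a limit of finite sums of measurable
  products, by continuity of each \<open>K z\<close>.\<close>

lemma borel_measurable_apply_operator:
  fixes e :: "nat \<Rightarrow> 'h::{real_inner,second_countable_topology}"
  assumes e: "orthonormal_basis e" and K: "\<And>k. (\<lambda>z. K z (e k) :: 'h) \<in> borel_measurable \<mu>"
    and lin: "\<And>z. z \<in> space \<mu> \<Longrightarrow> bounded_linear (K z)" and X: "X \<in> borel_measurable \<mu>"
  shows "(\<lambda>z. K z (X z)) \<in> borel_measurable \<mu>"
proof (rule borel_measurable_LIMSEQ_metric)
  show "(\<lambda>z. \<Sum>i<n. inner (X z) (e i) *\<^sub>R K z (e i)) \<in> borel_measurable \<mu>" for n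
    using X K by measurable
  fix z assume z: "z \<in> space \<mu>"
  interpret K: bounded_linear "K z" by (rule lin[OF z])
  have "(\<lambda>n. K z (\<Sum>i<n. inner (X z) (e i) *\<^sub>R e i)) \<longlonglongrightarrow> K z (X z)"
    by (rule K.tendsto) (use e in \<open>simp add: orthonormal_basis_def\<close>)
  then show "(\<lambda>n. \<Sum>i<n. inner (X z) (e i) *\<^sub>R K z (e i)) \<longlonglongrightarrow> K z (X z)"
    by (simp add: K.sum K.scaleR)
qed

section \<open>Uniform boundedness and strongly continuous semigroups\<close>

text \<open>Baire category: the open sets \<open>U n\<close>, where some \<open>A m\<close> exceeds
  n, have empty intersection, so one of them is not dense. All \<open>A m\<close> are then bounded
  by n on a ball in the complement of its closure, and linearity rescales this ball to the whole
  space.\<close>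

lemma uniform_boundedness:
  fixes A :: "nat \<Rightarrow> 'h::{real_normed_vector,complete_space} \<Rightarrow> 'h"
  assumes lin: "\<And>m. bounded_linear (A m)" and pt: "\<And>x. \<exists>B. \<forall>m. norm (A m x) \<le> B"
  shows "\<exists>B. \<forall>m x. norm (A m x) \<le> B * norm x"
proof -
  define U where "U n = {x. \<exists>m. norm (A m x) > real n}" for n
  have opU: "open (U n)" for n
  proof -
    have "U n = (\<Union>m. {x. norm (A m x) > real n})" by (auto simp: U_def)
    moreover have "open {x. norm (A m x) > real n}" for m
      by (intro open_Collect_less continuous_intros linear_continuous_on lin)
    ultimately show ?thesis by auto
  qed
  have empty: "(\<Inter>n. U n) = {}"
  proof (intro equals0I)
    fix x assume "x \<in> (\<Inter>n. U n)"
    then have "\<exists>m. norm (A m x) > real n" for n by (auto simp: U_def)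
    moreover obtain B where "\<And>m. norm (A m x) \<le> B" using pt by blast
    moreover obtain n where "real n \<ge> B" using real_arch_simple by blast
    ultimately show False by (meson leD order_trans less_le_trans)
  qed
  obtain n where n: "closure (U n) \<noteq> UNIV"
  proof (rule ccontr)
    assume "\<not> thesis"
    then have d: "closure (U n) = UNIV" for n using that by blast
    have "Met_TC.mtopology closure_of \<Inter> (range U) = (UNIV :: 'h set)"
    proof (rule Met_TC.metric_Baire_category)
      show "Met_TC.mcomplete TYPE('h)"
        by (simp add: complete_UNIV)
      show "countable (range U)" by simp
      fix V assume "V \<in> range U"
      then show "openin Met_TC.mtopology V \<and> Met_TC.mtopology closure_of V = UNIV"
        using d opU by (auto simp: )
    qed
    then show False using empty by simp
  qed
  then obtain x0 where "x0 \<in> - closure (U n)" by auto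
  then obtain r where r: "r > 0" "ball x0 r \<subseteq> - closure (U n)"
    using open_contains_ball by (metis closed_closure open_Compl)
  have bd: "norm (A m x) \<le> real n" if "x \<in> ball x0 r" for m x
  proof -
    have "x \<notin> U n" using that r(2) closure_subset by blast
    then show ?thesis by (auto simp: U_def not_less)
  qed
  \<comment> \<open>For t = r / (2 |x|) the point x0 + t x stays in the ball, so t |A m x| is at
    most 2 n, the sum of the bounds at x0 + t x and at x0.\<close>
  have "norm (A m x) \<le> (4 * real n / r) * norm x" for m x
  proof (cases "x = 0")
    case True
    interpret bounded_linear "A m" by (rule lin)
    show ?thesis using True by (simp add: zero)
  next
    case False
    interpret bounded_linear "A m" by (rule lin)
    define t where "t = r / (2 * norm x)"
    have t: "t > 0" using False r by (simp add: t_def)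
    have "norm (A m (x0 + t *\<^sub>R x)) \<le> real n"
      by (rule bd) (use False r in \<open>simp add: t_def dist_norm\<close>)
    moreover have "norm (A m x0) \<le> real n" by (rule bd) (use r in simp)
    ultimately have "norm (A m (x0 + t *\<^sub>R x) - A m x0) \<le> 2 * real n"
      using norm_triangle_ineq4[of "A m (x0 + t *\<^sub>R x)" "A m x0"] by linarith
    then have "t * norm (A m x) \<le> 2 * real n" using t by (simp add: add scaleR)
    then have "norm (A m x) \<le> 2 * real n / t" using t by (simp add: field_simps)
    then show ?thesis by (simp add: t_def)
  qed
  then show ?thesis by blast
qed

text \<open>Only strong continuity from the right at 0 is given. Without a bound near 0 there would
  be times tending to 0 with operator norms tending to infinity, against uniform boundedness, since
  S converges strongly along them. The semigroup law carries the bound from a short interval to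
  \<open>{0..T}\<close>.\<close>

lemma c0_semigroup_bounded:
  fixes S :: "real \<Rightarrow> 'h::{real_normed_vector,complete_space} \<Rightarrow> 'h"
  assumes S: "c0_semigroup S"
  shows "\<exists>K\<ge>1. \<forall>t\<in>{0..T}. \<forall>x. norm (S t x) \<le> K * norm x"
proof -
  have lin: "bounded_linear (S t)" if "t \<ge> 0" for t using S that by (simp add: c0_semigroup_def)
  have S0: "S 0 = id" using S by (simp add: c0_semigroup_def)
  have Sadd: "S (t + s) x = S t (S s x)" if "t \<ge> 0" "s \<ge> 0" for t s x
    using S that by (simp add: c0_semigroup_def)
  have lim: "((\<lambda>t. S t x) \<longlongrightarrow> x) (at_right 0)" for x using S by (simp add: c0_semigroup_def)
  have "\<exists>n. \<forall>t\<in>{0<..1/Suc n}. \<forall>x. norm (S t x) \<le> real n * norm x"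
  proof (rule ccontr)
    assume "\<not> ?thesis"
    then have "\<forall>n. \<exists>t. t \<in> {0<..1/Suc n} \<and> (\<exists>x. norm (S t x) > real n * norm x)"
      by (meson not_le)
    then obtain t where t: "\<And>n. t n \<in> {0<..1/Suc n}" "\<And>n. \<exists>x. norm (S (t n) x) > real n * norm x"
      by metis
    have t0: "t \<longlonglongrightarrow> 0"
    proof (rule tendsto_sandwich[of "\<lambda>_. 0" _ _ "\<lambda>n. 1 / real (Suc n)"])
      show "(\<lambda>n. 1 / real (Suc n)) \<longlonglongrightarrow> 0" by (rule LIMSEQ_Suc[OF lim_1_over_n])
    qed (use t(1) in \<open>auto intro!: always_eventually less_imp_le\<close>)
    have tr: "filterlim t (at_right 0) sequentially"
      using t0 t(1) by (auto simp: filterlim_at intro!: always_eventually) (metis less_irrefl)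
    have "\<exists>B. \<forall>m. norm (S (t m) x) \<le> B" for x
    proof -
      have "(\<lambda>m. S (t m) x) \<longlonglongrightarrow> x" by (rule filterlim_compose[OF lim tr])
      then have "Bseq (\<lambda>m. S (t m) x)" by (rule convergent_imp_Bseq[OF convergentI])
      then show ?thesis unfolding Bseq_def by blast
    qed
    then obtain B where B: "\<And>m x. norm (S (t m) x) \<le> B * norm x"
      using uniform_boundedness[of "\<lambda>m. S (t m)"] lin t(1) by (meson greaterThanAtMost_iff less_imp_le)
    obtain n where "real n \<ge> B" using real_arch_simple by blast
    moreover obtain x where "norm (S (t n) x) > real n * norm x" using t(2) by blast
    ultimately show False using B[of n x] mult_right_mono[of B "real n" "norm x"] by auto
  qed
  then obtain n where n: "\<And>t x. t \<in> {0<..1/Suc n} \<Longrightarrow> norm (S t x) \<le> real n * norm x" by blast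
  define K where "K = real n + 1"
  define d where "d = 1 / real (Suc n)"
  have K: "K \<ge> 1" and d: "d > 0" by (simp_all add: K_def d_def)
  have Kd: "norm (S t x) \<le> K * norm x" if "t \<in> {0..d}" for t x
  proof (cases "t = 0")
    case True then show ?thesis by (simp add: S0 K_def algebra_simps)
  next
    case False
    then have "norm (S t x) \<le> real n * norm x" using n that by (simp add: d_def)
    also have "\<dots> \<le> K * norm x" by (intro mult_right_mono) (auto simp: K_def)
    finally show ?thesis .
  qed
  \<comment> \<open>Each step of length d costs one factor K; K >= 1 makes the bounds increase with
    the number of steps.\<close>
  have pw: "norm (S t x) \<le> K ^ Suc m * norm x" if "t \<in> {0..real (Suc m) * d}" for m t x
    using that
  proof (induction m arbitrary: t x)
    case 0 then show ?case using Kd by simp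
  next
    case (Suc m)
    show ?case
    proof (cases "t \<le> d")
      case True
      then have "norm (S t x) \<le> K * norm x" using Kd Suc by auto
      also have "\<dots> \<le> K ^ Suc (Suc m) * norm x"
        using power_increasing[of 1 "Suc (Suc m)" K] K by (intro mult_right_mono) simp_all
      finally show ?thesis .
    next
      case False
      have "S t x = S d (S (t - d) x)" using Sadd[of d "t - d" x] False d by simp
      then have "norm (S t x) \<le> K * norm (S (t - d) x)" using Kd[of d] d by simp
      also have "\<dots> \<le> K * (K ^ Suc m * norm x)"
        using K False Suc.prems by (intro mult_left_mono Suc.IH) (auto simp: algebra_simps)
      finally show ?thesis by (simp add: mult_ac)
    qed
  qed
  obtain m where m: "real m * d \<ge> T" using reals_Archimedean3[OF d] less_imp_le by blast
  have "T \<le> real (Suc m) * d" using m d by (simp add: algebra_simps)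
  then have "\<forall>t\<in>{0..T}. \<forall>x. norm (S t x) \<le> K ^ Suc m * norm x"
    using pw[where m=m] by (auto simp del: power_Suc)
  moreover have "K ^ Suc m \<ge> 1" using K by (rule one_le_power)
  ultimately show ?thesis by blast
qed

text \<open>Clipping the time at 0 makes the orbit continuous on the whole line, so that it can be
  composed with any measurable real function. Continuity from both sides follows from S b x - S a x
  = S a (S (b - a) x - x) for a <= b and the local bound on \<open>S a\<close>.\<close>

lemma c0_semigroup_continuous:
  fixes S :: "real \<Rightarrow> 'h::{real_normed_vector,complete_space} \<Rightarrow> 'h"
  assumes S: "c0_semigroup S"
  shows "continuous_on UNIV (\<lambda>t. S (max 0 t) x)"
proof -
  have S0: "S 0 = id" using S by (simp add: c0_semigroup_def)
  have lin: "bounded_linear (S t)" if "t \<ge> 0" for t using S that by (simp add: c0_semigroup_def)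
  have Sadd: "S (t + s) x = S t (S s x)" if "t \<ge> 0" "s \<ge> 0" for t s x
    using S that by (simp add: c0_semigroup_def)
  have lim: "((\<lambda>t. S t x) \<longlongrightarrow> x) (at_right 0)" using S by (simp add: c0_semigroup_def)
  have small: "\<exists>d>0. \<forall>h\<in>{0..<d}. norm (S h x - x) < r" if "r > 0" for r
  proof -
    obtain d where d: "d > 0" "\<And>h. 0 < h \<Longrightarrow> h < d \<Longrightarrow> dist (S h x) x < r"
      using tendstoD[OF lim \<open>r > 0\<close>] unfolding eventually_at_right_field by auto
    then have "\<forall>h\<in>{0..<d}. norm (S h x - x) < r"
      using S0 \<open>r > 0\<close> by (metis atLeastLessThan_iff dist_norm id_apply less_eq_real_def norm_zero right_minus_eq)
    then show ?thesis using d by blast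
  qed
  have "continuous_on {0..} (\<lambda>t. S t x)"
    unfolding continuous_on_iff
  proof (intro ballI allI impI)
    fix t r :: real assume t: "t \<in> {0..}" and r: "r > 0"
    obtain K where K: "K \<ge> 1" "\<And>s x. s \<in> {0..t + 1} \<Longrightarrow> norm (S s x) \<le> K * norm x"
      using c0_semigroup_bounded[OF S, of "t+1"] by blast
    obtain d where d: "d > 0" "\<And>h. h \<in> {0..<d} \<Longrightarrow> norm (S h x - x) < r / K"
      using small[of "r / K"] r K by (metis divide_pos_pos less_le_trans zero_less_one)
    have key: "norm (S b x - S a x) < r" if ab: "0 \<le> a" "a \<le> b" "a \<le> t + 1" "b - a < d" for a b
    proof -
      interpret bounded_linear "S a" by (rule lin) (rule ab)
      have "S b x - S a x = S a (S (b - a) x - x)"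
        using Sadd[of a "b - a" x] ab by (simp add: diff)
      then have "norm (S b x - S a x) \<le> K * norm (S (b - a) x - x)" using K ab by simp
      also have "\<dots> < K * (r / K)" using d(2)[of "b - a"] ab K by (intro mult_strict_left_mono) auto
      finally show ?thesis using K by simp
    qed
    show "\<exists>d>0. \<forall>t'\<in>{0..}. dist t' t < d \<longrightarrow> dist (S t' x) (S t x) < r"
    proof (intro exI[of _ d] conjI d(1) ballI impI)
      fix t' :: real assume "t' \<in> {0..}" "dist t' t < d"
      then show "dist (S t' x) (S t x) < r"
        using key[of t t'] key[of t' t] t by (cases "t \<le> t'") (auto simp: dist_norm norm_minus_commute)
    qed
  qed
  then show ?thesis
    by (rule continuous_on_compose2) (auto intro!: continuous_intros)
qed

section \<open>Square-integrable functions\<close>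


definition L2 :: "'a measure \<Rightarrow> ('a \<Rightarrow> 'b::{real_inner,second_countable_topology}) \<Rightarrow> bool" where
  "L2 \<mu> X \<longleftrightarrow> X \<in> borel_measurable \<mu> \<and> (\<integral>\<^sup>+z. ennreal ((norm (X z))\<^sup>2) \<partial>\<mu>) < \<infinity>"

lemma L2_measurable [measurable_dest]: "L2 \<mu> X \<Longrightarrow> X \<in> borel_measurable \<mu>"
  by (simp add: L2_def)

lemma L2_integrable_norm2: "L2 \<mu> X \<Longrightarrow> integrable \<mu> (\<lambda>z. (norm (X z))\<^sup>2)"
  by (rule integrableI_bounded) (auto simp: L2_def)

lemma L2I: "X \<in> borel_measurable \<mu> \<Longrightarrow> integrable \<mu> (\<lambda>z. (norm (X z))\<^sup>2) \<Longrightarrow> L2 \<mu> X"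
  by (auto simp: L2_def integrable_iff_bounded)

lemma L2_nn_integral: "L2 \<mu> X \<Longrightarrow> (\<integral>\<^sup>+z. ennreal ((norm (X z))\<^sup>2) \<partial>\<mu>) = ennreal (\<integral>z. (norm (X z))\<^sup>2 \<partial>\<mu>)"
  by (rule nn_integral_eq_integral[OF L2_integrable_norm2]) auto

lemma L2_mono:
  assumes X: "L2 \<mu> X" and Y: "Y \<in> borel_measurable \<mu>"
    and le: "\<And>z. z \<in> space \<mu> \<Longrightarrow> norm (Y z) \<le> K * norm (X z)"
  shows "L2 \<mu> Y"
proof (rule L2I[OF Y])
  show "integrable \<mu> (\<lambda>z. (norm (Y z))\<^sup>2)"
  proof (rule Bochner_Integration.integrable_bound)
    show "integrable \<mu> (\<lambda>z. K\<^sup>2 * (norm (X z))\<^sup>2)" using L2_integrable_norm2[OF X] by simp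
    show "AE z in \<mu>. norm ((norm (Y z))\<^sup>2) \<le> norm (K\<^sup>2 * (norm (X z))\<^sup>2)"
      using power_mono[OF le norm_ge_zero, of _ 2] by (intro AE_I2) (simp add: power_mult_distrib)
  qed (use Y in simp)
qed

lemma L2_scaleR: "L2 \<mu> X \<Longrightarrow> L2 \<mu> (\<lambda>z. c *\<^sub>R X z)"
  by (rule L2_mono[where K="\<bar>c\<bar>"]) auto

lemma norm_add_power2_le: "(norm (x + y))\<^sup>2 \<le> 2 * (norm x)\<^sup>2 + 2 * (norm (y::'b::real_normed_vector))\<^sup>2"
proof -
  have "(norm (x + y))\<^sup>2 \<le> (norm x + norm y)\<^sup>2" by (intro power_mono norm_triangle_ineq) auto
  also have "\<dots> \<le> 2 * (norm x)\<^sup>2 + 2 * (norm y)\<^sup>2"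
    using zero_le_power2[of "norm x - norm y"] by (simp add: power2_sum power2_diff)
  finally show ?thesis .
qed

lemma norm_diff_power2_le: "(norm (x - y))\<^sup>2 \<le> 2 * (norm x)\<^sup>2 + 2 * (norm (y::'b::real_normed_vector))\<^sup>2"
  using norm_add_power2_le[of x "-y"] by simp

lemma L2_add:
  assumes X: "L2 \<mu> X" and Y: "L2 \<mu> Y" shows "L2 \<mu> (\<lambda>z. X z + Y z)"
proof (rule L2I)
  show "integrable \<mu> (\<lambda>z. (norm (X z + Y z))\<^sup>2)"
  proof (rule Bochner_Integration.integrable_bound)
    show "integrable \<mu> (\<lambda>z. 2 * (norm (X z))\<^sup>2 + 2 * (norm (Y z))\<^sup>2)"
      by (intro Bochner_Integration.integrable_add integrable_mult_right L2_integrable_norm2 X Y)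
    show "AE z in \<mu>. norm ((norm (X z + Y z))\<^sup>2) \<le> norm (2 * (norm (X z))\<^sup>2 + 2 * (norm (Y z))\<^sup>2)"
      using norm_add_power2_le by (intro AE_I2) auto
  qed (use X Y in measurable)
qed (use X Y in measurable)

lemma L2_diff: "L2 \<mu> X \<Longrightarrow> L2 \<mu> Y \<Longrightarrow> L2 \<mu> (\<lambda>z. X z - Y z)"
  using L2_add[of \<mu> X "\<lambda>z. (-1) *\<^sub>R Y z"] L2_scaleR[of \<mu> Y "-1"] by simp

lemma L2_zero: "L2 \<mu> (\<lambda>z. 0)"
  by (simp add: L2_def)

lemma L2_sum: "(\<And>i. i \<in> I \<Longrightarrow> L2 \<mu> (X i)) \<Longrightarrow> L2 \<mu> (\<lambda>z. \<Sum>i\<in>I. X i z)"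
  by (induction I rule: infinite_finite_induct) (auto intro!: L2_add L2_zero)

lemma (in finite_measure) L2_bounded:
  assumes "X \<in> borel_measurable M" "\<And>z. z \<in> space M \<Longrightarrow> norm (X z) \<le> B"
  shows "L2 M X"
proof (rule L2I)
  show "integrable M (\<lambda>z. (norm (X z))\<^sup>2)"
  proof (rule integrable_const_bound[of _ "B\<^sup>2"])
    show "AE z in M. norm ((norm (X z))\<^sup>2) \<le> B\<^sup>2"
      using power_mono[OF assms(2) norm_ge_zero, of _ 2] by (intro AE_I2) simp
  qed (use assms in measurable)
qed fact

lemma L2_inner_integrable:
  assumes X: "L2 \<mu> X" and Y: "L2 \<mu> Y" shows "integrable \<mu> (\<lambda>z. inner (X z) (Y z))"
proof (rule Bochner_Integration.integrable_bound)
  show "integrable \<mu> (\<lambda>z. (norm (X z))\<^sup>2 + (norm (Y z))\<^sup>2)"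
    by (intro Bochner_Integration.integrable_add L2_integrable_norm2 X Y)
  have "\<bar>inner x y\<bar> \<le> (norm x)\<^sup>2 + (norm y)\<^sup>2" for x y :: 'b
  proof -
    have "\<bar>inner x y\<bar> \<le> norm x * norm y" by (rule Cauchy_Schwarz_ineq2)
    moreover have "2 * (norm x * norm y) \<le> (norm x)\<^sup>2 + (norm y)\<^sup>2"
      using zero_le_power2[of "norm x - norm y"] by (simp add: power2_diff)
    moreover have "0 \<le> norm x * norm y" by simp
    ultimately show ?thesis by linarith
  qed
  then show "AE z in \<mu>. norm (inner (X z) (Y z)) \<le> norm ((norm (X z))\<^sup>2 + (norm (Y z))\<^sup>2)"
    by (intro AE_I2) auto
qed (use X Y in measurable)

lemma L2_Cauchy_Schwarz:
  assumes X: "L2 \<mu> X" and Y: "L2 \<mu> Y"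
  shows "(\<integral>z. inner (X z) (Y z) \<partial>\<mu>)\<^sup>2 \<le> (\<integral>z. (norm (X z))\<^sup>2 \<partial>\<mu>) * (\<integral>z. (norm (Y z))\<^sup>2 \<partial>\<mu>)"
proof -
  let ?a = "\<integral>z. (norm (X z))\<^sup>2 \<partial>\<mu>" and ?b = "\<integral>z. (norm (Y z))\<^sup>2 \<partial>\<mu>" and ?i = "\<integral>z. inner (X z) (Y z) \<partial>\<mu>"
  note [simp] = L2_integrable_norm2[OF X] L2_integrable_norm2[OF Y] L2_inner_integrable[OF X Y]
  have q: "0 \<le> ?a - 2 * t * ?i + t\<^sup>2 * ?b" for t
  proof -
    have "0 \<le> (\<integral>z. (norm (X z - t *\<^sub>R Y z))\<^sup>2 \<partial>\<mu>)" by simp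
    also have "\<dots> = (\<integral>z. (norm (X z))\<^sup>2 - 2 * t * inner (X z) (Y z) + t\<^sup>2 * (norm (Y z))\<^sup>2 \<partial>\<mu>)"
      by (intro Bochner_Integration.integral_cong refl)
        (simp add: power2_norm_eq_inner inner_diff_left inner_diff_right inner_commute algebra_simps power2_eq_square[of t])
    also have "\<dots> = ?a - 2 * t * ?i + t\<^sup>2 * ?b" by simp
    finally show ?thesis .
  qed
  show ?thesis
  proof (cases "?b = 0")
    case True
    \<comment> \<open>With ?b = 0 the quadratic q is affine in t, and t = (?a + 1) / (2 ?i) would
      give it the value -1. In the other case t = ?i / ?b is its minimiser.\<close>
    have "?i = 0"
    proof (rule ccontr)
      assume i: "?i \<noteq> 0"
      have "2 * ((?a + 1) / (2 * ?i)) * ?i = ?a + 1" using i by simp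
      then show False using q[of "(?a + 1) / (2 * ?i)"] unfolding True by linarith
    qed
    then show ?thesis by (simp add: True)
  next
    case False
    then have b: "?b > 0" by (simp add: less_le)
    have "2 * (?i / ?b) * ?i = 2 * (?i\<^sup>2 / ?b)" "(?i / ?b)\<^sup>2 * ?b = ?i\<^sup>2 / ?b"
      using b by (auto simp: power2_eq_square)
    with q[of "?i / ?b"] have "?i\<^sup>2 / ?b \<le> ?a" by linarith
    then show ?thesis using b by (simp add: field_simps)
  qed
qed

lemma L2_Cauchy_Schwarz_sqrt:
  assumes X: "L2 \<mu> X" and Y: "L2 \<mu> Y"
  shows "\<bar>\<integral>z. inner (X z) (Y z) \<partial>\<mu>\<bar> \<le> sqrt (\<integral>z. (norm (X z))\<^sup>2 \<partial>\<mu>) * sqrt (\<integral>z. (norm (Y z))\<^sup>2 \<partial>\<mu>)"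
  using L2_Cauchy_Schwarz[OF assms, THEN real_sqrt_le_mono] by (simp add: real_sqrt_mult)

text \<open>Ito integrals and the stochastic series are given as merely measurable functions whose
  extended-valued distance to square-integrable ones tends to 0. Once one distance is finite the
  limit is square integrable as well, and Cauchy-Schwarz lets the pairings converge.\<close>

lemma L2_limit:
  assumes X: "X \<in> borel_measurable \<mu>" and Xm: "\<And>m. L2 \<mu> (Xs m)"
    and lim: "(\<lambda>m. \<integral>\<^sup>+z. ennreal ((norm (X z - Xs m z))\<^sup>2) \<partial>\<mu>) \<longlonglongrightarrow> 0"
  shows "L2 \<mu> X" and "L2 \<mu> Y \<Longrightarrow> (\<lambda>m. \<integral>z. inner (Xs m z) (Y z) \<partial>\<mu>) \<longlonglongrightarrow> (\<integral>z. inner (X z) (Y z) \<partial>\<mu>)"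
proof -
  have ev: "\<forall>\<^sub>F m in sequentially. L2 \<mu> (\<lambda>z. X z - Xs m z)"
    using order_tendstoD(2)[OF lim zero_less_one]
    by (rule eventually_mono) (use X Xm in \<open>auto simp: L2_def intro: less_trans[of _ 1] borel_measurable_diff\<close>)
  then obtain m where "L2 \<mu> (\<lambda>z. X z - Xs m z)" by (auto simp: eventually_sequentially)
  from L2_add[OF this Xm[of m]] show X2: "L2 \<mu> X" by simp
  assume Y: "L2 \<mu> Y"
  have D: "L2 \<mu> (\<lambda>z. X z - Xs m z)" for m by (rule L2_diff[OF X2 Xm])
  have "(\<lambda>m. ennreal (\<integral>z. (norm (X z - Xs m z))\<^sup>2 \<partial>\<mu>)) \<longlonglongrightarrow> ennreal 0"
    using lim by (simp add: L2_nn_integral[OF D])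
  then have 0: "(\<lambda>m. \<integral>z. (norm (X z - Xs m z))\<^sup>2 \<partial>\<mu>) \<longlonglongrightarrow> 0"
    by (subst (asm) tendsto_ennreal_iff) auto
  have "(\<lambda>m. \<integral>z. inner (X z) (Y z) \<partial>\<mu> - (\<integral>z. inner (Xs m z) (Y z) \<partial>\<mu>)) \<longlonglongrightarrow> 0"
  proof (rule Lim_null_comparison)
    show "\<forall>\<^sub>F m in sequentially. norm (\<integral>z. inner (X z) (Y z) \<partial>\<mu> - (\<integral>z. inner (Xs m z) (Y z) \<partial>\<mu>))
        \<le> sqrt (\<integral>z. (norm (X z - Xs m z))\<^sup>2 \<partial>\<mu>) * sqrt (\<integral>z. (norm (Y z))\<^sup>2 \<partial>\<mu>)"
      using L2_Cauchy_Schwarz_sqrt[OF D Y]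
      by (intro always_eventually allI) (simp add: inner_diff_left L2_inner_integrable X2 Xm Y)
    show "(\<lambda>m. sqrt (\<integral>z. (norm (X z - Xs m z))\<^sup>2 \<partial>\<mu>) * sqrt (\<integral>z. (norm (Y z))\<^sup>2 \<partial>\<mu>)) \<longlonglongrightarrow> 0"
      using tendsto_mult[OF tendsto_real_sqrt[OF 0] tendsto_const] by simp
  qed
  then show "(\<lambda>m. \<integral>z. inner (Xs m z) (Y z) \<partial>\<mu>) \<longlonglongrightarrow> (\<integral>z. inner (X z) (Y z) \<partial>\<mu>)"
    by (rule Lim_transform2[OF tendsto_const])
qed

lemma L2_truncation:
  assumes Y: "L2 \<mu> Y"
  shows "(\<lambda>n. \<integral>z. (norm (if norm (Y z) \<le> real n then 0 else Y z))\<^sup>2 \<partial>\<mu>) \<longlonglongrightarrow> 0"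
proof -
  have "(\<lambda>n. \<integral>z. (norm (if norm (Y z) \<le> real n then 0 else Y z))\<^sup>2 \<partial>\<mu>) \<longlonglongrightarrow> (\<integral>z. 0 \<partial>\<mu>)"
  proof (rule integral_dominated_convergence[OF _ _ L2_integrable_norm2[OF Y]])
    show "AE z in \<mu>. (\<lambda>n. (norm (if norm (Y z) \<le> real n then 0 else Y z))\<^sup>2) \<longlonglongrightarrow> 0"
    proof (intro AE_I2 tendsto_eventually)
      fix z
      obtain n where "norm (Y z) \<le> real n" using real_arch_simple by blast
      then show "\<forall>\<^sub>F n in sequentially. (norm (if norm (Y z) \<le> real n then 0 else Y z))\<^sup>2 = 0"
        by (intro eventually_sequentiallyI[of n]) auto
    qed
  qed (use Y in \<open>auto intro!: AE_I2\<close>)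
  then show ?thesis by simp
qed

text \<open>An L1 limit of a sequence bounded in L2 is also its weak L2 limit. Fatou along an almost
  everywhere convergent subsequence puts D into L2. For the pairings Y is cut off at level m: the
  bounded part is handled by L1 convergence, the rest by the uniform L2 bound. This allows the drift
  series, which converges only in L1, to be tested against unbounded Gaussian increments.\<close>

lemma L2_bounded_L1_limit:
  assumes D: "D \<in> borel_measurable \<mu>" and Dn: "\<And>n. L2 \<mu> (Ds n)"
    and bd: "\<And>n. (\<integral>z. (norm (Ds n z))\<^sup>2 \<partial>\<mu>) \<le> B"
    and lim: "(\<lambda>n. \<integral>\<^sup>+z. ennreal (norm (Ds n z - D z)) \<partial>\<mu>) \<longlonglongrightarrow> 0"
  shows "L2 \<mu> D" and "L2 \<mu> Y \<Longrightarrow> (\<lambda>n. \<integral>z. inner (Ds n z) (Y z) \<partial>\<mu>) \<longlonglongrightarrow> (\<integral>z. inner (D z) (Y z) \<partial>\<mu>)"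
proof -
  note [measurable] = D L2_measurable[OF Dn]
  have "\<forall>\<^sub>F n in sequentially. (\<integral>\<^sup>+z. ennreal (norm (Ds n z - D z)) \<partial>\<mu>) < 1"
    by (rule order_tendstoD(2)[OF lim]) simp
  then obtain n0 where n0: "\<And>n. n \<ge> n0 \<Longrightarrow> (\<integral>\<^sup>+z. ennreal (norm (Ds n z - D z)) \<partial>\<mu>) < 1"
    by (auto simp: eventually_sequentially)
  define E where "E n = Ds (n + n0)" for n
  have int: "integrable \<mu> (\<lambda>z. norm (E n z - D z))" for n
    using less_trans[OF n0[of "n + n0"] ennreal_one_less_top] by (intro integrableI_bounded) (auto simp: E_def)
  have limE: "(\<lambda>n. \<integral>\<^sup>+z. ennreal (norm (norm (E n z - D z) - 0)) \<partial>\<mu>) \<longlonglongrightarrow> 0"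
    using LIMSEQ_ignore_initial_segment[OF lim, of n0] by (simp add: E_def)
  obtain r where r: "strict_mono r" "AE z in \<mu>. (\<lambda>n. norm (E (r n) z - D z)) \<longlonglongrightarrow> 0"
  proof -
    have "(\<lambda>n. \<integral>z. norm (norm (E n z - D z)) \<partial>\<mu>) \<longlonglongrightarrow> 0"
    proof -
      have "(\<lambda>n. ennreal (\<integral>z. norm (E n z - D z) \<partial>\<mu>)) \<longlonglongrightarrow> ennreal 0"
        using limE by (simp add: nn_integral_eq_integral[OF int])
      then show ?thesis by (subst (asm) tendsto_ennreal_iff) auto
    qed
    from tendsto_L1_AE_subseq[OF int this] show ?thesis using that by blast
  qed
  have "(\<integral>\<^sup>+z. ennreal ((norm (D z))\<^sup>2) \<partial>\<mu>) \<le> (\<integral>\<^sup>+z. liminf (\<lambda>n. ennreal ((norm (E (r n) z))\<^sup>2)) \<partial>\<mu>)"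
  proof (rule nn_integral_mono_AE)
    show "AE z in \<mu>. ennreal ((norm (D z))\<^sup>2) \<le> liminf (\<lambda>n. ennreal ((norm (E (r n) z))\<^sup>2))"
      using r(2)
    proof eventually_elim
      fix z assume "(\<lambda>n. norm (E (r n) z - D z)) \<longlonglongrightarrow> 0"
      then have "(\<lambda>n. E (r n) z) \<longlonglongrightarrow> D z"
        by (simp add: tendsto_norm_zero_iff LIM_zero_iff)
      then have "(\<lambda>n. ennreal ((norm (E (r n) z))\<^sup>2)) \<longlonglongrightarrow> ennreal ((norm (D z))\<^sup>2)"
        by (intro tendsto_ennrealI tendsto_intros)
      then show "ennreal ((norm (D z))\<^sup>2) \<le> liminf (\<lambda>n. ennreal ((norm (E (r n) z))\<^sup>2))"
        using lim_imp_Liminf[OF sequentially_bot] by (metis order_refl)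
    qed
  qed
  also have "\<dots> \<le> liminf (\<lambda>n. \<integral>\<^sup>+z. ennreal ((norm (E (r n) z))\<^sup>2) \<partial>\<mu>)"
    by (rule nn_integral_liminf) (simp add: E_def)
  also have "\<dots> \<le> ennreal B"
  proof -
    have "(\<integral>\<^sup>+z. ennreal ((norm (E (r n) z))\<^sup>2) \<partial>\<mu>) \<le> ennreal B" for n
      unfolding E_def L2_nn_integral[OF Dn] by (intro ennreal_leI bd)
    then have "liminf (\<lambda>n. \<integral>\<^sup>+z. ennreal ((norm (E (r n) z))\<^sup>2) \<partial>\<mu>) \<le> liminf (\<lambda>n. ennreal B)"
      by (intro Liminf_mono always_eventually) auto
    then show ?thesis by (simp add: Liminf_const)
  qed
  also have "\<dots> < \<infinity>" by simp
  finally show D2: "L2 \<mu> D" by (simp add: L2_def D)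
  assume Y: "L2 \<mu> Y"
  define B' where "B' = 2 * B + 2 * (\<integral>z. (norm (D z))\<^sup>2 \<partial>\<mu>)"
  have diff: "L2 \<mu> (\<lambda>z. Ds n z - D z)" for n by (rule L2_diff[OF Dn D2])
  have B': "(\<integral>z. (norm (Ds n z - D z))\<^sup>2 \<partial>\<mu>) \<le> B'" for n
  proof -
    have "(\<integral>z. (norm (Ds n z - D z))\<^sup>2 \<partial>\<mu>) \<le> (\<integral>z. 2 * (norm (Ds n z))\<^sup>2 + 2 * (norm (D z))\<^sup>2 \<partial>\<mu>)"
      by (intro integral_mono norm_diff_power2_le Bochner_Integration.integrable_add integrable_mult_right
          L2_integrable_norm2 diff Dn D2)
    also have "\<dots> \<le> B'" using bd[of n] by (simp add: B'_def L2_integrable_norm2 Dn D2)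
    finally show ?thesis .
  qed
  have B'0: "0 \<le> B'" using B'[of 0] by (rule order_trans[rotated]) simp
  let ?T = "\<lambda>m z. if norm (Y z) \<le> real m then 0 else Y z"
  note [measurable] = L2_measurable[OF Y]
  have T2: "L2 \<mu> (?T m)" for m by (rule L2_mono[OF Y, where K=1]) auto
  have "(\<lambda>n. \<integral>z. inner (Ds n z - D z) (Y z) \<partial>\<mu>) \<longlonglongrightarrow> 0"
  proof (rule metric_LIMSEQ_I)
    fix \<epsilon> :: real assume \<epsilon>: "\<epsilon> > 0"
    \<comment> \<open>The level m is fixed so that the part of Y above m costs less than \<epsilon>
      / 2 for every n at once; n1 depends on m and makes the bounded part small. The divisor m + 1
      rather than m allows m = 0.\<close>
    have "(\<lambda>m. sqrt B' * sqrt (\<integral>z. (norm (?T m z))\<^sup>2 \<partial>\<mu>)) \<longlonglongrightarrow> sqrt B' * sqrt 0"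
      by (intro tendsto_intros L2_truncation Y)
    then have "\<forall>\<^sub>F m in sequentially. sqrt B' * sqrt (\<integral>z. (norm (?T m z))\<^sup>2 \<partial>\<mu>) < \<epsilon> / 2"
      by (rule order_tendstoD) (use \<epsilon> in simp)
    then obtain m where m: "sqrt B' * sqrt (\<integral>z. (norm (?T m z))\<^sup>2 \<partial>\<mu>) < \<epsilon> / 2"
      by (auto simp: eventually_sequentially)
    have "\<forall>\<^sub>F n in sequentially. (\<integral>\<^sup>+z. ennreal (norm (Ds n z - D z)) \<partial>\<mu>) < ennreal (\<epsilon> / (2 * (real m + 1)))"
      by (rule order_tendstoD(2)[OF lim]) (use \<epsilon> in simp)
    then obtain n1 where n1: "\<And>n. n \<ge> n1 \<Longrightarrow> (\<integral>\<^sup>+z. ennreal (norm (Ds n z - D z)) \<partial>\<mu>) < ennreal (\<epsilon> / (2 * (real m + 1)))"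
      by (auto simp: eventually_sequentially)
    have "dist (\<integral>z. inner (Ds n z - D z) (Y z) \<partial>\<mu>) 0 < \<epsilon>" if n: "n \<ge> n1" for n
    proof -
      have i1: "integrable \<mu> (\<lambda>z. norm (Ds n z - D z))"
        using less_trans[OF n1[OF n] ennreal_less_top] by (intro integrableI_bounded) auto
      have "ennreal (\<integral>z. norm (Ds n z - D z) \<partial>\<mu>) < ennreal (\<epsilon> / (2 * (real m + 1)))"
        using n1[OF n] by (simp add: nn_integral_eq_integral[OF i1])
      then have s1: "(\<integral>z. norm (Ds n z - D z) \<partial>\<mu>) < \<epsilon> / (2 * (real m + 1))"
        by (simp add: ennreal_less_iff)
      have "(\<integral>z. inner (Ds n z - D z) (Y z) \<partial>\<mu>)
          = (\<integral>z. inner (Ds n z - D z) (Y z - ?T m z) \<partial>\<mu>) + (\<integral>z. inner (Ds n z - D z) (?T m z) \<partial>\<mu>)"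
        by (subst Bochner_Integration.integral_add[symmetric])
          (auto intro!: L2_inner_integrable[OF diff] L2_diff Y T2 Bochner_Integration.integral_cong
            simp del: if_split simp flip: inner_add_right)
      moreover have "\<bar>\<integral>z. inner (Ds n z - D z) (?T m z) \<partial>\<mu>\<bar> < \<epsilon> / 2"
      proof -
        have "\<bar>\<integral>z. inner (Ds n z - D z) (?T m z) \<partial>\<mu>\<bar>
            \<le> sqrt (\<integral>z. (norm (Ds n z - D z))\<^sup>2 \<partial>\<mu>) * sqrt (\<integral>z. (norm (?T m z))\<^sup>2 \<partial>\<mu>)"
          by (rule L2_Cauchy_Schwarz_sqrt[OF diff T2])
        also have "\<dots> \<le> sqrt B' * sqrt (\<integral>z. (norm (?T m z))\<^sup>2 \<partial>\<mu>)"
          by (intro mult_right_mono real_sqrt_le_mono B') simp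
        finally show ?thesis using m by linarith
      qed
      moreover have "\<bar>\<integral>z. inner (Ds n z - D z) (Y z - ?T m z) \<partial>\<mu>\<bar> \<le> \<epsilon> / 2"
      proof -
        have "\<bar>\<integral>z. inner (Ds n z - D z) (Y z - ?T m z) \<partial>\<mu>\<bar> \<le> (\<integral>z. \<bar>inner (Ds n z - D z) (Y z - ?T m z)\<bar> \<partial>\<mu>)"
          by (rule integral_abs_bound)
        also have "\<dots> \<le> (\<integral>z. (real m + 1) * norm (Ds n z - D z) \<partial>\<mu>)"
        proof (rule integral_mono)
          show "integrable \<mu> (\<lambda>z. \<bar>inner (Ds n z - D z) (Y z - ?T m z)\<bar>)"
            by (intro integrable_abs L2_inner_integrable[OF diff] L2_diff Y T2)
          fix z
          have "norm (Y z - ?T m z) \<le> real m + 1" by auto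
          then have "norm (Ds n z - D z) * norm (Y z - ?T m z) \<le> norm (Ds n z - D z) * (real m + 1)"
            by (intro mult_left_mono) auto
          with Cauchy_Schwarz_ineq2[of "Ds n z - D z" "Y z - ?T m z"]
          show "\<bar>inner (Ds n z - D z) (Y z - ?T m z)\<bar> \<le> (real m + 1) * norm (Ds n z - D z)"
            by (simp only: mult.commute[of "real m + 1"])
        qed (use i1 in simp)
        also have "\<dots> = (real m + 1) * (\<integral>z. norm (Ds n z - D z) \<partial>\<mu>)" by simp
        also have "\<dots> \<le> (real m + 1) * (\<epsilon> / (2 * (real m + 1)))"
          using s1 by (intro mult_left_mono) auto
        also have "\<dots> = \<epsilon> / 2" by (simp add: field_simps)
        finally show ?thesis .
      qed
      ultimately show ?thesis by (simp add: dist_real_def)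
    qed
    then show "\<exists>no. \<forall>n\<ge>no. dist (\<integral>z. inner (Ds n z - D z) (Y z) \<partial>\<mu>) 0 < \<epsilon>" by blast
  qed
  then have "(\<lambda>n. (\<integral>z. inner (Ds n z) (Y z) \<partial>\<mu>) - (\<integral>z. inner (D z) (Y z) \<partial>\<mu>)) \<longlonglongrightarrow> 0"
    by (simp add: inner_diff_left L2_inner_integrable Dn D2 Y)
  then show "(\<lambda>n. \<integral>z. inner (Ds n z) (Y z) \<partial>\<mu>) \<longlonglongrightarrow> (\<integral>z. inner (D z) (Y z) \<partial>\<mu>)"
    by (simp add: LIM_zero_iff)
qed

text \<open>The library version of the following fact asks for the class \<open>banach\<close>, which is not
  implied by the sort of the Hilbert space.\<close>

lemma integrable_iff_bounded_complete:
  fixes f :: "'a \<Rightarrow> 'b::{real_normed_vector,complete_space,second_countable_topology}"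
  shows "integrable \<mu> f \<longleftrightarrow> f \<in> borel_measurable \<mu> \<and> (\<integral>\<^sup>+z. ennreal (norm (f z)) \<partial>\<mu>) < \<infinity>"
proof safe
  assume f: "f \<in> borel_measurable \<mu>" and fin: "(\<integral>\<^sup>+z. ennreal (norm (f z)) \<partial>\<mu>) < \<infinity>"
  obtain s where s: "\<And>i. simple_function \<mu> (s i)" "\<And>z. z \<in> space \<mu> \<Longrightarrow> (\<lambda>i. s i z) \<longlonglongrightarrow> f z"
    and le: "\<And>i z. z \<in> space \<mu> \<Longrightarrow> norm (s i z) \<le> 2 * norm (f z)"
    using borel_measurable_implies_sequence_metric[OF f, of 0] by simp metis
  have 2: "(\<integral>\<^sup>+z. ennreal (2 * norm (f z)) \<partial>\<mu>) < \<infinity>"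
    using fin f by (simp add: ennreal_mult nn_integral_cmult ennreal_mult_less_top)
  have "(\<integral>\<^sup>+z. ennreal (norm (s i z)) \<partial>\<mu>) < \<infinity>" for i
    by (rule le_less_trans[OF nn_integral_mono 2]) (simp add: le)
  then have sb: "Bochner_Integration.simple_bochner_integrable \<mu> (s i)" for i
    by (rule simple_bochner_integrableI_bounded[OF s(1)])
  have lim: "(\<lambda>i. \<integral>\<^sup>+z. ennreal (norm (f z - s i z)) \<partial>\<mu>) \<longlonglongrightarrow> 0"
    using f 2 s le by (intro nn_integral_dominated_convergence_norm[where w="\<lambda>z. 2 * norm (f z)"])
      (auto intro: borel_measurable_simple_function)
  \<comment> \<open>Completeness of the value space provides the limit of the integrals of the
    approximating simple functions.\<close>
  have "Cauchy (\<lambda>i. Bochner_Integration.simple_bochner_integral \<mu> (s i))"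
  proof (rule metric_CauchyI)
    fix r :: real assume "r > 0"
    then have "\<forall>\<^sub>F i in sequentially. (\<integral>\<^sup>+z. ennreal (norm (f z - s i z)) \<partial>\<mu>) < ennreal (r / 2)"
      by (intro order_tendstoD(2)[OF lim]) simp
    then obtain k where k: "\<And>i. i \<ge> k \<Longrightarrow> (\<integral>\<^sup>+z. ennreal (norm (f z - s i z)) \<partial>\<mu>) < ennreal (r / 2)"
      by (auto simp: eventually_sequentially)
    have "dist (Bochner_Integration.simple_bochner_integral \<mu> (s i)) (Bochner_Integration.simple_bochner_integral \<mu> (s j)) < r" if "i \<ge> k" "j \<ge> k" for i j
    proof -
      have "ennreal (dist (Bochner_Integration.simple_bochner_integral \<mu> (s i)) (Bochner_Integration.simple_bochner_integral \<mu> (s j))) < ennreal (r / 2) + ennreal (r / 2)"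
        unfolding dist_norm
        by (rule le_less_trans[OF simple_bochner_integral_bounded[OF f sb sb] add_strict_mono[OF k k]]) (use that in auto)
      then show ?thesis using \<open>r > 0\<close> by (simp add: ennreal_less_iff flip: ennreal_plus)
    qed
    then show "\<exists>M. \<forall>m\<ge>M. \<forall>n\<ge>M. dist (Bochner_Integration.simple_bochner_integral \<mu> (s m)) (Bochner_Integration.simple_bochner_integral \<mu> (s n)) < r"
      by blast
  qed
  then obtain x where "(\<lambda>i. Bochner_Integration.simple_bochner_integral \<mu> (s i)) \<longlonglongrightarrow> x"
    using Cauchy_convergent convergent_def by blast
  with f sb lim show "integrable \<mu> f"
    by (intro integrable.intros has_bochner_integral.intros)
next
  assume "integrable \<mu> f"
  then show "(\<integral>\<^sup>+z. ennreal (norm (f z)) \<partial>\<mu>) < \<infinity>"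
    using has_bochner_integral_implies_finite_norm has_bochner_integral_integrable by blast
qed auto

section \<open>Products of a time interval with the probability space\<close>

abbreviation slab :: "'w measure \<Rightarrow> real \<Rightarrow> real \<Rightarrow> (real \<times> 'w) measure" where
  "slab M a b \<equiv> restrict_space lborel {a..b} \<Otimes>\<^sub>M M"

lemma finite_measure_Icc: "finite_measure (restrict_space lborel {a..b::real})"
proof
  show "emeasure (restrict_space lborel {a..b}) (space (restrict_space lborel {a..b})) \<noteq> \<infinity>"
    by (cases "a \<le> b") (simp_all add: emeasure_restrict_space)
qed

lemma pair_sigma_finite_slab: "prob_space M \<Longrightarrow> pair_sigma_finite (restrict_space lborel {a..b::real}) M"
  by (simp add: pair_sigma_finite.intro finite_measure.axioms(1)[OF finite_measure_Icc] prob_space.axioms(1) finite_measure.axioms(1) finite_measure_Icc prob_space_imp_sigma_finite)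

lemma finite_measure_slab: "prob_space M \<Longrightarrow> finite_measure (slab M a b)"
  by (intro finite_measure_pair_measure finite_measure_Icc prob_space.finite_measure)

lemma measurable_slab_mono:
  assumes "{a..b} \<subseteq> {a'..b'}"
  shows "f \<in> measurable (slab M a' b') R \<Longrightarrow> f \<in> measurable (slab M a b) R"
proof -
  assume f: "f \<in> measurable (slab M a' b') R"
  have "(\<lambda>z. z) \<in> measurable (slab M a b) (slab M a' b')"
  proof -
    have "fst \<in> measurable (slab M a b) (restrict_space lborel {a'..b'})"
      using assms by (intro measurable_restrict_space2) (auto simp: space_pair_measure space_restrict_space
          intro!: measurable_compose[OF measurable_fst] measurable_restrict_space1)
    then have "(\<lambda>z. (fst z, snd z)) \<in> measurable (slab M a b) (slab M a' b')"
      by (intro measurable_Pair measurable_snd)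
    then show ?thesis by simp
  qed
  from measurable_comp[OF this f] show ?thesis by (simp add: comp_def)
qed

text \<open>The restriction sits inside one factor of the product measure, so the comparison is made
  on iterated integrals, where it becomes the indicator of the smaller time interval.\<close>

lemma nn_integral_slab_restrict:
  assumes M: "prob_space M" and sub: "{a..b} \<subseteq> {a'..b'}"
    and f: "f \<in> borel_measurable (slab M a' b')"
  shows "(\<integral>\<^sup>+z. f z \<partial>slab M a b) = (\<integral>\<^sup>+z. f z * indicator {a..b} (fst z) \<partial>slab M a' b')"
proof -
  interpret M: prob_space M by fact
  have f': "f \<in> borel_measurable (slab M a b)" by (rule measurable_slab_mono[OF sub f])
  have m[measurable]: "(\<lambda>z. indicator {a..b} (fst z) :: ennreal) \<in> borel_measurable (slab M a' b')"
    by (intro measurable_compose[OF measurable_fst] measurable_restrict_space1) simp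
  have "(\<integral>\<^sup>+z. f z \<partial>slab M a b) = (\<integral>\<^sup>+s. (\<integral>\<^sup>+\<omega>. f (s, \<omega>) \<partial>M) \<partial>restrict_space lborel {a..b})"
    by (rule M.nn_integral_fst[OF f', symmetric])
  also have "\<dots> = (\<integral>\<^sup>+s. (\<integral>\<^sup>+\<omega>. f (s, \<omega>) \<partial>M) * indicator {a..b} s \<partial>lborel)"
    by (rule nn_integral_restrict_space) simp
  also have "\<dots> = (\<integral>\<^sup>+s. (\<integral>\<^sup>+\<omega>. f (s, \<omega>) * indicator {a..b} s \<partial>M) * indicator {a'..b'} s \<partial>lborel)"
  proof (rule nn_integral_cong)
    fix s :: real
    show "(\<integral>\<^sup>+\<omega>. f (s, \<omega>) \<partial>M) * indicator {a..b} s = (\<integral>\<^sup>+\<omega>. f (s, \<omega>) * indicator {a..b} s \<partial>M) * indicator {a'..b'} s"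
      using sub by (cases "s \<in> {a..b}") auto
  qed
  also have "\<dots> = (\<integral>\<^sup>+s. (\<integral>\<^sup>+\<omega>. f (s, \<omega>) * indicator {a..b} s \<partial>M) \<partial>restrict_space lborel {a'..b'})"
    by (rule nn_integral_restrict_space[symmetric]) simp
  also have "\<dots> = (\<integral>\<^sup>+z. f z * indicator {a..b} (fst z) \<partial>slab M a' b')"
    using M.nn_integral_fst[of "\<lambda>z. f z * indicator {a..b} (fst z)"] f by simp
  finally show ?thesis .
qed

lemma L2_slab_mono:
  assumes M: "prob_space M" and sub: "{a..b} \<subseteq> {a'..b'}" and X: "L2 (slab M a' b') X"
  shows "L2 (slab M a b) X"
proof -
  have "(\<integral>\<^sup>+z. ennreal ((norm (X z))\<^sup>2) \<partial>slab M a b) \<le> (\<integral>\<^sup>+z. ennreal ((norm (X z))\<^sup>2) \<partial>slab M a' b')"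
    using X by (subst nn_integral_slab_restrict[OF M sub]) (auto simp: L2_def indicator_def intro!: nn_integral_mono)
  then show ?thesis
    using X measurable_slab_mono[OF sub] unfolding L2_def by (meson le_less_trans)
qed

section \<open>Increments of the Wiener process\<close>


locale cyl_wiener_space = prob_space M for M :: "'w measure" +
  fixes T :: real and \<beta> :: "nat \<Rightarrow> real \<Rightarrow> 'w \<Rightarrow> real"
  assumes W: "cyl_wiener M T \<beta>"
begin

abbreviation "F \<equiv> nat_filtration M \<beta>"

definition incr :: "nat \<Rightarrow> real \<Rightarrow> real \<Rightarrow> 'w \<Rightarrow> real" where
  "incr i s t \<omega> = \<beta> i t \<omega> - \<beta> i s \<omega>"

lemma borel_measurable_\<beta>: "t \<in> {0..T} \<Longrightarrow> \<beta> i t \<in> borel_measurable M"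
  using W by (simp add: cyl_wiener_def std_bm_def)

lemma space_F [simp]: "space (F t) = space M"
  by (simp add: nat_filtration_def space_measure_of_conv)

lemma sets_F: "sets (F t) = sigma_sets (space M)
    ((\<Union>i. \<Union>r\<in>{0..t}. {\<beta> i r -` U \<inter> space M | U. U \<in> sets borel}) \<union> null_sets M)"
  unfolding nat_filtration_def by (rule sets_measure_of) (auto dest: sets.sets_into_space)

lemma sets_F_mono: "s \<le> t \<Longrightarrow> sets (F s) \<subseteq> sets (F t)"
  unfolding sets_F by (rule sigma_sets_mono') force

lemma sets_F_subset: "t \<le> T \<Longrightarrow> sets (F t) \<subseteq> sets M"
  unfolding sets_F
proof (rule sets.sigma_sets_subset, safe)
  fix i r and U :: "real set" assume "t \<le> T" "r \<in> {0..t}" "U \<in> sets borel"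
  then show "\<beta> i r -` U \<inter> space M \<in> sets M"
    by (intro measurable_sets[OF borel_measurable_\<beta>]) auto
qed auto

lemma measurable_F_mono: "f \<in> measurable (F s) R \<Longrightarrow> s \<le> t \<Longrightarrow> f \<in> measurable (F t) R"
  using measurable_from_subalg[of "F t" "F s"] by (simp add: subalgebra_def sets_F_mono)

lemma measurable_F_M: "f \<in> measurable (F t) R \<Longrightarrow> t \<le> T \<Longrightarrow> f \<in> measurable M R"
  using measurable_from_subalg[of M "F t"] by (simp add: subalgebra_def sets_F_subset)

lemma borel_measurable_\<beta>_F: "0 \<le> r \<Longrightarrow> r \<le> t \<Longrightarrow> \<beta> i r \<in> borel_measurable (F t)"
proof (rule measurableI)
  fix U :: "real set" assume "0 \<le> r" "r \<le> t" "U \<in> sets borel"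
  then show "\<beta> i r -` U \<inter> space (F t) \<in> sets (F t)"
    unfolding sets_F by (intro sigma_sets.Basic) (auto intro!: bexI[of _ r])
qed auto

text \<open>Everything an increment of \<open>\<beta> j\<close> after time \<open>a\<close> is independent of: the past of
  \<open>\<beta> j\<close> and the whole trajectories of the other coordinates.\<close>

definition indep_gens :: "nat \<Rightarrow> real \<Rightarrow> 'w set set" where
  "indep_gens j a = (\<Union>i\<in>-{j}. \<Union>r\<in>{0..T}. {\<beta> i r -` U \<inter> space M | U. U \<in> sets borel}) \<union>
     (\<Union>r\<in>{0..a}. {\<beta> j r -` U \<inter> space M | U. U \<in> sets borel}) \<union> null_sets M"

definition indep_alg :: "nat \<Rightarrow> real \<Rightarrow> 'w measure" where
  "indep_alg j a = sigma (space M) (indep_gens j a)"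

lemma space_indep_alg [simp]: "space (indep_alg j a) = space M"
  by (simp add: indep_alg_def space_measure_of_conv)

lemma sets_indep_alg: "sets (indep_alg j a) = sigma_sets (space M) (indep_gens j a)"
  unfolding indep_alg_def by (rule sets_measure_of) (auto simp: indep_gens_def dest: sets.sets_into_space)

text \<open>Independence from \<open>indep_alg j t\<close> thereby covers the usual independence
  from the filtration: for t <= T a generator of \<open>F t\<close> belongs to another coordinate,
  to the past of \<open>\<beta> j\<close>, or is a null set.\<close>

lemma measurable_F_indep_alg:
  assumes "f \<in> measurable (F t) R" "t \<le> T" shows "f \<in> measurable (indep_alg j t) R"
proof -
  have "sets (F t) \<subseteq> sets (indep_alg j t)"
    unfolding sets_F sets_indep_alg
  proof (rule sigma_sets_mono')
    show "(\<Union>i. \<Union>r\<in>{0..t}. {\<beta> i r -` U \<inter> space M | U. U \<in> sets borel}) \<union> null_sets M \<subseteq> indep_gens j t"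
    proof safe
      fix i r and U :: "real set" assume *: "r \<in> {0..t}" "U \<in> sets borel"
      then show "\<beta> i r -` U \<inter> space M \<in> indep_gens j t"
        unfolding indep_gens_def using assms(2) by (cases "i = j") (auto intro!: bexI[of _ r] bexI[of _ i])
    qed (auto simp: indep_gens_def)
  qed
  then show ?thesis
    using measurable_from_subalg[of "indep_alg j t" "F t"] assms by (simp add: subalgebra_def)
qed

lemma borel_measurable_\<beta>_indep_alg: "i \<noteq> j \<Longrightarrow> r \<in> {0..T} \<Longrightarrow> \<beta> i r \<in> borel_measurable (indep_alg j a)"
proof (rule measurableI)
  fix U :: "real set" assume "i \<noteq> j" "r \<in> {0..T}" "U \<in> sets borel"
  then show "\<beta> i r -` U \<inter> space (indep_alg j a) \<in> sets (indep_alg j a)"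
    unfolding sets_indep_alg indep_gens_def by (intro sigma_sets.Basic) (auto intro!: bexI[of _ r] bexI[of _ i])
qed auto

text \<open>Two independences are combined: the trajectory of \<open>\<beta> j\<close> is
  independent of the other coordinates, and within that trajectory the increment is independent of
  the past. For events x of the increment, b of the past and c of the other coordinates, P(x b c) =
  P(x b) P(c) = P(x) P(b) P(c) = P(x) P(b c). The intersections b c together with the null sets form
  a pi-system whose generated sigma-algebra contains \<open>indep_alg j a\<close>.\<close>

lemma indep_set_incr:
  assumes ab: "0 \<le> a" "a < b" "b \<le> T"
  shows "indep_set (sigma_sets (space M) {incr j a b -` U \<inter> space M | U. U \<in> sets borel}) (sets (indep_alg j a))"
proof -
  define P where "P = (\<Pi>\<^sub>M t\<in>{0..T}. (borel :: real measure))"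
  define X where "X i \<omega> = restrict (\<lambda>t. \<beta> i t \<omega>) {0..T}" for i \<omega>
  define O' where "O' i = vimage_algebra (space M) (X i) P" for i
  have X: "X i \<in> space M \<rightarrow> space P" for i by (auto simp: X_def P_def space_PiM)
  have spO[simp]: "space (O' i) = space M" for i by (simp add: O'_def)
  have \<beta>O: "\<beta> i r \<in> borel_measurable (O' i)" if "r \<in> {0..T}" for i r
  proof -
    have "(\<lambda>\<omega>. X i \<omega> r) \<in> borel_measurable (O' i)"
      unfolding O'_def
      by (rule measurable_compose[OF measurable_vimage_algebra1[OF X]])
        (use that in \<open>simp add: P_def measurable_component_singleton\<close>)
    moreover have "(\<lambda>\<omega>. X i \<omega> r) = \<beta> i r" using that by (simp add: X_def)
    ultimately show ?thesis by simp
  qed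
  have ind: "indep_sets (\<lambda>i. sets (O' i)) UNIV"
    using W unfolding cyl_wiener_def indep_vars_def O'_def sets_vimage_algebra X_def P_def by auto
  \<comment> \<open>The indices are split into \<open>{j}\<close> and its complement, coded by
    booleans; grouping turns the joint independence of all trajectories into the independence of two
    blocks.\<close>
  have "indep_sets (\<lambda>b. sigma_sets (space M) (\<Union>i\<in>case_bool {j} (-{j}) b. sets (O' i))) UNIV"
  proof (rule indep_sets_collect_sigma)
    show "indep_sets (\<lambda>i. sets (O' i)) (\<Union>b\<in>UNIV. case_bool {j} (-{j}) b)"
      by (rule indep_sets_mono_index[OF _ ind]) simp
    show "Int_stable (sets (O' i))" for i by (rule sets.Int_stable)
    show "disjoint_family_on (case_bool {j} (-{j})) (UNIV :: bool set)"
      by (auto simp: disjoint_family_on_def split: bool.splits)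
  qed
  moreover define Co where "Co = sigma_sets (space M) (\<Union>i\<in>-{j}. sets (O' i))"
  moreover have "sigma_sets (space M) (\<Union>i\<in>{j}. sets (O' i)) = sets (O' j)"
    using sets.sigma_sets_eq[of "O' j"] by simp
  ultimately have ind2: "indep_set (sets (O' j)) Co"
    unfolding indep_set_def
  proof -
    assume *: "indep_sets (\<lambda>b. sigma_sets (space M) (\<Union>i\<in>case_bool {j} (-{j}) b. sets (O' i))) UNIV"
      and Co: "Co = sigma_sets (space M) (\<Union>i\<in>-{j}. sets (O' i))"
      and j: "sigma_sets (space M) (\<Union>i\<in>{j}. sets (O' i)) = sets (O' j)"
    have "(\<lambda>b. sigma_sets (space M) (\<Union>i\<in>case_bool {j} (-{j}) b. sets (O' i))) = case_bool (sets (O' j)) Co"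
      by (rule ext) (simp only: Co j split: bool.split, simp)
    with * show "indep_sets (case_bool (sets (O' j)) Co) UNIV" by (simp only:)
  qed
  have bm: "std_bm M T (\<beta> j)" using W by (simp add: cyl_wiener_def)
  define A where "A = sigma_sets (space M) {incr j a b -` U \<inter> space M | U. U \<in> sets borel}"
  define B where "B = sigma_sets (space M) (\<Union>r\<in>{0..a}. {\<beta> j r -` U \<inter> space M | U. U \<in> sets borel})"
  have ind1: "indep_set A B"
    using bm ab by (simp add: std_bm_def A_def B_def incr_def[abs_def])
  have A_sub: "A \<subseteq> sets (O' j)"
  proof -
    have "incr j a b \<in> borel_measurable (O' j)"
      unfolding incr_def[abs_def] using ab by (intro borel_measurable_diff \<beta>O) auto
    then have "{incr j a b -` U \<inter> space M | U. U \<in> sets borel} \<subseteq> sets (O' j)"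
      using measurable_sets[of "incr j a b" "O' j" borel] by (auto simp only: spO)
    then show ?thesis
      unfolding A_def using sets.sigma_sets_subset[of _ "O' j"] by (simp only: spO)
  qed
  have B_sub: "B \<subseteq> sets (O' j)"
    unfolding B_def spO[of j, symmetric]
  proof (rule sets.sigma_sets_subset, safe)
    fix r and U :: "real set" assume "r \<in> {0..a}" "U \<in> sets borel"
    then show "\<beta> j r -` U \<inter> space (O' j) \<in> sets (O' j)"
      using ab by (intro measurable_sets[OF \<beta>O]) auto
  qed
  \<comment> \<open>Null sets are independent of every event, and intersecting with one yields
    another, so adding them preserves both stability and independence.\<close>
  define PP where "PP = {b \<inter> c | b c. b \<in> B \<and> c \<in> Co} \<union> null_sets M"
  interpret B: sigma_algebra "space M" B
    unfolding B_def by (rule sigma_algebra_sigma_sets) auto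
  interpret Co: sigma_algebra "space M" Co
    unfolding Co_def by (rule sigma_algebra_sigma_sets) (use sets.space_closed[of "O' _"] in auto)
  have Aev: "A \<subseteq> events" and Bev: "B \<subseteq> events" using ind1 by (auto simp: indep_sets2_eq)
  have Cev: "Co \<subseteq> events" using ind2 by (auto simp: indep_sets2_eq)
  have PPE: "x \<in> null_sets M \<or> (\<exists>b\<in>B. \<exists>c\<in>Co. x = b \<inter> c)" if "x \<in> PP" for x
    using that unfolding PP_def by blast
  have PPI: "b \<in> B \<Longrightarrow> c \<in> Co \<Longrightarrow> b \<inter> c \<in> PP" "x \<in> null_sets M \<Longrightarrow> x \<in> PP" for b c x
    unfolding PP_def by blast+
  have PPev: "x \<in> events" if "x \<in> PP" for x
    using PPE[OF that] Bev Cev by (auto intro!: sets.Int)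
  have stab: "Int_stable PP"
  proof (rule Int_stableI)
    fix x y assume xy: "x \<in> PP" "y \<in> PP"
    show "x \<inter> y \<in> PP"
    proof (cases "x \<in> null_sets M \<or> y \<in> null_sets M")
      case True
      then have "x \<inter> y \<in> null_sets M"
        using xy[THEN PPev] null_set_Int1[of x M y] null_set_Int2[of y M x] by (auto simp: Int_commute)
      then show ?thesis by (rule PPI(2))
    next
      case False
      then obtain b c b' c' where *: "b \<in> B" "b' \<in> B" "c \<in> Co" "c' \<in> Co" "x = b \<inter> c" "y = b' \<inter> c'"
        using xy[THEN PPE] by auto
      then have "x \<inter> y = (b \<inter> b') \<inter> (c \<inter> c')" by auto
      moreover have "b \<inter> b' \<in> B" "c \<inter> c' \<in> Co" using * by (auto intro: B.Int Co.Int)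
      ultimately show ?thesis by (simp add: PPI(1))
    qed
  qed
  have "indep_set A PP"
    unfolding indep_sets2_eq
  proof (intro conjI ballI)
    show "A \<subseteq> events" by fact
    show "PP \<subseteq> events" using PPev by blast
    fix x y assume x: "x \<in> A" and y: "y \<in> PP"
    from PPE[OF y] show "prob (x \<inter> y) = prob x * prob y"
    proof (elim disjE bexE)
      fix b c assume b: "b \<in> B" and c: "c \<in> Co" and yeq: "y = b \<inter> c"
      have xb: "x \<inter> b \<in> sets (O' j)" using x b A_sub B_sub by blast
      have "prob (x \<inter> (b \<inter> c)) = prob ((x \<inter> b) \<inter> c)" by (simp add: Int_assoc)
      also have "\<dots> = prob (x \<inter> b) * prob c" by (rule indep_setD[OF ind2 xb c])
      also have "\<dots> = prob x * (prob b * prob c)" by (simp add: indep_setD[OF ind1 x b])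
      also have "prob b * prob c = prob (b \<inter> c)"
        using b B_sub by (intro indep_setD[OF ind2 _ c, symmetric]) auto
      finally show "prob (x \<inter> y) = prob x * prob y" unfolding yeq .
    next
      assume N: "y \<in> null_sets M"
      then have "x \<inter> y \<in> null_sets M" using x Aev null_set_Int1 by blast
      then show "prob (x \<inter> y) = prob x * prob y" using N by (simp add: measure_eq_0_null_sets)
    qed
  qed
  moreover have "Int_stable A"
  proof -
    interpret A: sigma_algebra "space M" A unfolding A_def by (rule sigma_algebra_sigma_sets) auto
    show ?thesis by (auto simp: Int_stable_def)
  qed
  ultimately have "indep_set (sigma_sets (space M) A) (sigma_sets (space M) PP)"
    using stab by (intro indep_set_sigma_sets)
  moreover have "sigma_sets (space M) A = A"
    unfolding A_def by (rule sigma_sets_sigma_sets_eq) auto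
  moreover have "sets (indep_alg j a) \<subseteq> sigma_sets (space M) PP"
    unfolding sets_indep_alg
  proof (rule sigma_sets_mono, safe)
    fix x assume "x \<in> indep_gens j a"
    then consider i r U where "i \<noteq> j" "r \<in> {0..T}" "U \<in> sets (borel :: real measure)" "x = \<beta> i r -` U \<inter> space M"
      | r U where "r \<in> {0..a}" "U \<in> sets (borel :: real measure)" "x = \<beta> j r -` U \<inter> space M" | "x \<in> null_sets M"
      unfolding indep_gens_def by blast
    then show "x \<in> sigma_sets (space M) PP"
    proof cases
      case 1
      have "x \<in> sets (O' i)" using measurable_sets[OF \<beta>O[OF 1(2), of i] 1(3)] by (simp add: 1(4))
      then have "x \<in> Co" unfolding Co_def using 1(1) by (intro sigma_sets.Basic) auto
      moreover have "x = space M \<inter> x" using 1(4) by auto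
      ultimately show ?thesis using PPI(1)[OF B.top] by (metis sigma_sets.Basic)
    next
      case 2
      then have "x \<in> B" unfolding B_def by (intro sigma_sets.Basic) blast
      moreover have "x = x \<inter> space M" using 2(3) by auto
      ultimately show ?thesis using PPI(1)[OF _ Co.top] by (metis sigma_sets.Basic)
    next
      case 3 then show ?thesis by (intro sigma_sets.Basic PPI(2))
    qed
  qed
  ultimately show ?thesis
    unfolding A_def[symmetric] indep_sets2_eq by auto
qed

lemma distributed_incr:
  "0 \<le> a \<Longrightarrow> a < b \<Longrightarrow> b \<le> T \<Longrightarrow> distributed M lborel (incr j a b) (normal_density 0 (sqrt (b - a)))"
  using W by (simp add: cyl_wiener_def std_bm_def incr_def[abs_def])

text \<open>A normal law of variance 0 has no density, so the distributional hypothesis covers a < b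
  only; for a = b the increment is constantly 0. The degenerate case is included because pieces may
  be empty when intervals are split.\<close>

lemma incr_moments:
  assumes ab: "0 \<le> a" "a \<le> b" "b \<le> T"
  shows "integrable M (incr j a b)" "expectation (incr j a b) = 0"
    "integrable M (\<lambda>\<omega>. (incr j a b \<omega>)\<^sup>2)" "expectation (\<lambda>\<omega>. (incr j a b \<omega>)\<^sup>2) = b - a"
proof -
  have "integrable M (incr j a b) \<and> expectation (incr j a b) = 0 \<and>
    integrable M (\<lambda>\<omega>. (incr j a b \<omega>)\<^sup>2) \<and> expectation (\<lambda>\<omega>. (incr j a b \<omega>)\<^sup>2) = b - a"
  proof (cases "a = b")
    case True
    then show ?thesis by (simp add: incr_def[abs_def])
  next
    case False
    then have lt: "a < b" using ab by simp
    let ?n = "normal_density 0 (sqrt (b - a))"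
    have D: "distributed M lborel (incr j a b) ?n" using distributed_incr lt ab by simp
    have s: "sqrt (b - a) > 0" using lt by simp
    have "integrable lborel (\<lambda>x. ?n x * (x - 0) ^ 1)" "integrable lborel (\<lambda>x. ?n x * (x - 0) ^ 2)"
      by (rule integrable_normal_moment[OF s])+
    then have "integrable M (\<lambda>\<omega>. (incr j a b \<omega>) ^ 1)" "integrable M (\<lambda>\<omega>. (incr j a b \<omega>) ^ 2)"
      using distributed_integrable[OF D, of "\<lambda>x. x ^ 1"] distributed_integrable[OF D, of "\<lambda>x. x ^ 2"] by auto
    moreover have "expectation (\<lambda>\<omega>. (incr j a b \<omega>) ^ 1) = 0"
      using distributed_integral[OF D, of "\<lambda>x. x ^ 1"] integral_normal_moment_odd[OF s, of 0 0] by simp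
    moreover have "expectation (\<lambda>\<omega>. (incr j a b \<omega>) ^ 2) = b - a"
      using distributed_integral[OF D, of "\<lambda>x. x ^ 2"] integral_normal_moment_even[OF s, of 0 1] lt
      by (simp add: fact_numeral)
    ultimately show ?thesis by simp
  qed
  then show "integrable M (incr j a b)" "expectation (incr j a b) = 0"
    "integrable M (\<lambda>\<omega>. (incr j a b \<omega>)\<^sup>2)" "expectation (\<lambda>\<omega>. (incr j a b \<omega>)\<^sup>2) = b - a" by auto
qed

lemma borel_measurable_incr [measurable]:
  "0 \<le> a \<Longrightarrow> a \<le> b \<Longrightarrow> b \<le> T \<Longrightarrow> incr j a b \<in> borel_measurable M"
  by (rule borel_measurable_integrable[OF incr_moments(1)])

lemma L2_incr: "0 \<le> a \<Longrightarrow> a \<le> b \<Longrightarrow> b \<le> T \<Longrightarrow> L2 M (incr j a b)"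
  by (rule L2I) (auto simp: incr_moments)

lemma indep_var_incr:
  assumes ab: "0 \<le> a" "a < b" "b \<le> T" and Z: "Z \<in> borel_measurable (indep_alg j a)" "Z \<in> borel_measurable M"
  shows "indep_var borel (incr j a b) borel (Z :: 'w \<Rightarrow> real)"
  unfolding indep_var_eq
proof (intro conjI)
  have "sigma_sets (space M) {Z -` U \<inter> space M | U. U \<in> sets borel} \<subseteq> sets (indep_alg j a)"
    unfolding space_indep_alg[of j a, symmetric]
    by (rule sets.sigma_sets_subset) (use measurable_sets[OF Z(1)] in auto)
  with indep_set_incr[OF ab, of j]
  show "indep_set (sigma_sets (space M) {incr j a b -` U \<inter> space M | U. U \<in> sets borel})
      (sigma_sets (space M) {Z -` U \<inter> space M | U. U \<in> sets borel})"
    unfolding indep_sets2_eq by auto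
qed (use ab Z in auto)

lemma expectation_incr_mult:
  assumes ab: "0 \<le> a" "a \<le> b" "b \<le> T" and Z: "Z \<in> borel_measurable (indep_alg j a)" "integrable M Z"
  shows "expectation (\<lambda>\<omega>. incr j a b \<omega> * Z \<omega>) = 0"
proof (cases "a = b")
  case False
  then have "indep_var borel (incr j a b) borel Z"
    using ab Z by (intro indep_var_incr) auto
  from indep_var_lebesgue_integral[OF this incr_moments(1)[OF ab] Z(2)] show ?thesis
    by (simp add: incr_moments(2)[OF ab])
qed (simp add: incr_def)

lemma expectation_incr_power2_mult:
  assumes ab: "0 \<le> a" "a \<le> b" "b \<le> T" and Z: "Z \<in> borel_measurable (indep_alg j a)" "integrable M Z"
  shows "expectation (\<lambda>\<omega>. (incr j a b \<omega>)\<^sup>2 * Z \<omega>) = (b - a) * expectation Z"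
proof (cases "a = b")
  case False
  then have "indep_var borel (incr j a b) borel Z"
    using ab Z by (intro indep_var_incr) auto
  moreover have "(\<lambda>x::real. x\<^sup>2) \<in> borel_measurable borel" "(\<lambda>x::real. x) \<in> borel_measurable borel"
    by measurable
  ultimately have "indep_var borel ((\<lambda>x. x\<^sup>2) \<circ> incr j a b) borel ((\<lambda>x. x) \<circ> Z)"
    by (rule indep_var_compose)
  then have "indep_var borel (\<lambda>\<omega>. (incr j a b \<omega>)\<^sup>2) borel Z"
    unfolding comp_def .
  from indep_var_lebesgue_integral[OF this incr_moments(3)[OF ab] Z(2)] show ?thesis
    unfolding incr_moments(4)[OF ab] .
qed (simp add: incr_def)

lemma integrable_incr_mult_incr:
  assumes "0 \<le> a" "a \<le> b" "b \<le> T" "0 \<le> p" "p \<le> q" "q \<le> T"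
    and Z: "Z \<in> borel_measurable M" "\<And>\<omega>. \<omega> \<in> space M \<Longrightarrow> \<bar>Z \<omega>\<bar> \<le> B"
  shows "integrable M (\<lambda>\<omega>. incr i a b \<omega> * incr j p q \<omega> * (Z \<omega> :: real))"
proof (rule Bochner_Integration.integrable_bound)
  show "integrable M (\<lambda>\<omega>. B * (incr i a b \<omega> * incr j p q \<omega>))"
    using L2_inner_integrable[OF L2_incr[OF assms(1-3), of i] L2_incr[OF assms(4-6), of j]] by simp
  show "AE \<omega> in M. norm (incr i a b \<omega> * incr j p q \<omega> * Z \<omega>) \<le> norm (B * (incr i a b \<omega> * incr j p q \<omega>))"
  proof (rule AE_I2)
    fix \<omega> assume "\<omega> \<in> space M"
    then have "\<bar>incr i a b \<omega> * incr j p q \<omega>\<bar> * \<bar>Z \<omega>\<bar> \<le> \<bar>incr i a b \<omega> * incr j p q \<omega>\<bar> * \<bar>B\<bar>"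
      using Z(2)[of \<omega>] by (intro mult_left_mono) auto
    then show "norm (incr i a b \<omega> * incr j p q \<omega> * Z \<omega>) \<le> norm (B * (incr i a b \<omega> * incr j p q \<omega>))"
      by (simp add: abs_mult mult_ac)
  qed
qed (intro borel_measurable_times borel_measurable_incr assms)

lemma borel_measurable_incr_F: "0 \<le> p \<Longrightarrow> p \<le> q \<Longrightarrow> q \<le> t \<Longrightarrow> incr i p q \<in> borel_measurable (F t)"
  unfolding incr_def[abs_def] by (intro borel_measurable_diff borel_measurable_\<beta>_F) auto

text \<open>The earlier increment times Z is measurable at time u, and the later increment is
  centred and independent of it.\<close>

lemma expectation_incr_separated:
  assumes t: "0 \<le> p" "p \<le> q" "q \<le> u" "u \<le> v" "v \<le> T"
    and Z: "Z \<in> borel_measurable (F u)" "\<And>\<omega>. \<omega> \<in> space M \<Longrightarrow> \<bar>Z \<omega>\<bar> \<le> B"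
  shows "expectation (\<lambda>\<omega>. incr i p q \<omega> * incr j u v \<omega> * (Z \<omega> :: real)) = 0"
proof -
  have ZM: "Z \<in> borel_measurable M" using measurable_F_M[OF Z(1)] t by simp
  have "(\<lambda>\<omega>. incr i p q \<omega> * Z \<omega>) \<in> borel_measurable (F u)"
    using t Z by (intro borel_measurable_times borel_measurable_incr_F) auto
  moreover have "integrable M (\<lambda>\<omega>. incr i p q \<omega> * Z \<omega>)"
  proof -
    have "L2 M Z" by (rule L2_bounded[OF ZM, of B]) (use Z in auto)
    from L2_inner_integrable[OF L2_incr[of p q i] this] show ?thesis using t by simp
  qed
  ultimately have "expectation (\<lambda>\<omega>. incr j u v \<omega> * (incr i p q \<omega> * Z \<omega>)) = 0"
    using t by (intro expectation_incr_mult measurable_F_indep_alg) auto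
  then show ?thesis by (simp add: mult_ac)
qed

text \<open>For i = j this is the variance of the increment. For different coordinates the increment
  of \<open>\<beta> i\<close> ends after u and is not \<open>F u\<close>-measurable; here it matters
  that \<open>indep_alg j u\<close> contains the whole trajectories of the other
  coordinates.\<close>

lemma expectation_incr_same:
  assumes t: "0 \<le> u" "u \<le> v" "v \<le> T"
    and Z: "Z \<in> borel_measurable (F u)" "\<And>\<omega>. \<omega> \<in> space M \<Longrightarrow> \<bar>Z \<omega>\<bar> \<le> B"
  shows "expectation (\<lambda>\<omega>. incr i u v \<omega> * incr j u v \<omega> * (Z \<omega> :: real)) = (if i = j then (v - u) * expectation Z else 0)"
proof -
  have ZM: "Z \<in> borel_measurable M" using measurable_F_M[OF Z(1)] t by simp
  have ZG: "Z \<in> borel_measurable (indep_alg j u)" using t Z by (intro measurable_F_indep_alg) auto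
  have Z2: "L2 M Z" by (rule L2_bounded[OF ZM, of B]) (use Z in auto)
  have Zi: "integrable M Z" using Z by (intro integrable_const_bound[of _ B] ZM) auto
  show ?thesis
  proof (cases "i = j")
    case True
    then show ?thesis
      using expectation_incr_power2_mult[OF t ZG Zi] by (simp add: power2_eq_square)
  next
    case False
    have "expectation (\<lambda>\<omega>. incr j u v \<omega> * (incr i u v \<omega> * Z \<omega>)) = 0"
    proof (rule expectation_incr_mult[OF t])
      show "(\<lambda>\<omega>. incr i u v \<omega> * Z \<omega>) \<in> borel_measurable (indep_alg j u)"
        unfolding incr_def using False t
        by (intro borel_measurable_times borel_measurable_diff borel_measurable_\<beta>_indep_alg ZG) auto
      show "integrable M (\<lambda>\<omega>. incr i u v \<omega> * Z \<omega>)"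
        using L2_inner_integrable[OF L2_incr[OF t, of i] Z2] by simp
    qed
    then show ?thesis using False by (simp add: mult_ac)
  qed
qed

text \<open>Cutting \<open>{p..q}\<close> at u and at w = min q v writes the product as four terms.
  In three of them the intervals do not overlap or one of them is degenerate, so the expectation is
  0; the fourth has both increments over \<open>{u..w}\<close>.\<close>

lemma expectation_incr_overlap_ordered:
  assumes t: "0 \<le> p" "p \<le> u" "p \<le> q" "q \<le> T" "u \<le> v" "v \<le> T"
    and Z: "Z \<in> borel_measurable (F u)" "\<And>\<omega>. \<omega> \<in> space M \<Longrightarrow> \<bar>Z \<omega>\<bar> \<le> B"
  shows "expectation (\<lambda>\<omega>. incr i p q \<omega> * incr j u v \<omega> * (Z \<omega> :: real))
    = (if i = j then max 0 (min q v - u) * expectation Z else 0)"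
proof (cases "q \<le> u")
  case True
  then show ?thesis using expectation_incr_separated[OF t(1,3) True t(5,6) Z] by simp
next
  case False
  note ZM[measurable] = measurable_F_M[OF Z(1) order_trans[OF t(5,6)]]
  define w where "w = min q v"
  have w: "u \<le> w" "w \<le> q" "w \<le> v" "w \<le> T" using False t by (auto simp: w_def)
  have int: "integrable M (\<lambda>\<omega>. incr i a b \<omega> * incr j c d \<omega> * Z \<omega>)"
    if "0 \<le> a" "a \<le> b" "b \<le> T" "0 \<le> c" "c \<le> d" "d \<le> T" for a b c d
    by (rule integrable_incr_mult_incr[OF that ZM Z(2)])
  have "incr i p q \<omega> * incr j u v \<omega> * Z \<omega> = incr i p u \<omega> * incr j u v \<omega> * Z \<omega>
     + incr i u w \<omega> * incr j u w \<omega> * Z \<omega> + incr i u w \<omega> * incr j w v \<omega> * Z \<omega> + incr i w q \<omega> * incr j u v \<omega> * Z \<omega>" for \<omega>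
    by (simp add: incr_def algebra_simps)
  note eq = this
  have i4: "integrable M (\<lambda>\<omega>. incr i p u \<omega> * incr j u v \<omega> * Z \<omega>)"
      "integrable M (\<lambda>\<omega>. incr i u w \<omega> * incr j u w \<omega> * Z \<omega>)"
      "integrable M (\<lambda>\<omega>. incr i u w \<omega> * incr j w v \<omega> * Z \<omega>)"
      "integrable M (\<lambda>\<omega>. incr i w q \<omega> * incr j u v \<omega> * Z \<omega>)"
    by (rule int; use t w False in linarith)+
  have "expectation (\<lambda>\<omega>. incr i p q \<omega> * incr j u v \<omega> * Z \<omega>)
    = expectation (\<lambda>\<omega>. incr i p u \<omega> * incr j u v \<omega> * Z \<omega>) + expectation (\<lambda>\<omega>. incr i u w \<omega> * incr j u w \<omega> * Z \<omega>)
    + expectation (\<lambda>\<omega>. incr i u w \<omega> * incr j w v \<omega> * Z \<omega>) + expectation (\<lambda>\<omega>. incr i w q \<omega> * incr j u v \<omega> * Z \<omega>)"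
    unfolding eq by (simp add: i4)
  also have "expectation (\<lambda>\<omega>. incr i p u \<omega> * incr j u v \<omega> * Z \<omega>) = 0"
    using t by (intro expectation_incr_separated[OF _ _ _ _ _ Z]) auto
  also have "expectation (\<lambda>\<omega>. incr i u w \<omega> * incr j w v \<omega> * Z \<omega>) = 0"
    using t w by (intro expectation_incr_separated[OF _ _ _ _ _ measurable_F_mono[OF Z(1)] Z(2)]) auto
  also have "expectation (\<lambda>\<omega>. incr i u w \<omega> * incr j u w \<omega> * Z \<omega>) = (if i = j then (w - u) * expectation Z else 0)"
    using t w by (intro expectation_incr_same[OF _ _ _ Z]) auto
  also have "expectation (\<lambda>\<omega>. incr i w q \<omega> * incr j u v \<omega> * Z \<omega>) = 0"
  proof (cases "q \<le> v")
    case True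
    then have "w = q" using w by (simp add: w_def)
    then show ?thesis by (simp add: incr_def)
  next
    case False
    then have "w = v" by (simp add: w_def)
    then have "expectation (\<lambda>\<omega>. incr j u v \<omega> * incr i w q \<omega> * Z \<omega>) = 0"
      using t w by (intro expectation_incr_separated[OF _ _ _ _ _ measurable_F_mono[OF Z(1)] Z(2)]) auto
    then show ?thesis by (simp add: mult_ac)
  qed
  finally show ?thesis using w(1) by (simp add: w_def max_def)
qed

text \<open>By symmetry the interval that starts later may take the second place. The factor is the
  length of the overlap of the two intervals, the form in which it can be compared with a time
  integral of indicators.\<close>

lemma expectation_incr_overlap:
  assumes t: "0 \<le> p" "p \<le> q" "q \<le> T" "0 \<le> u" "u \<le> v" "v \<le> T"
    and Z: "Z \<in> borel_measurable (F (max p u))" "\<And>\<omega>. \<omega> \<in> space M \<Longrightarrow> \<bar>Z \<omega>\<bar> \<le> B"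
  shows "expectation (\<lambda>\<omega>. incr i p q \<omega> * incr j u v \<omega> * (Z \<omega> :: real))
    = (if i = j then max 0 (min q v - max p u) * expectation Z else 0)"
proof (cases "p \<le> u")
  case True
  then show ?thesis
    using expectation_incr_overlap_ordered[of p u q v Z B i j] t Z by (simp add: max_def)
next
  case False
  then have "expectation (\<lambda>\<omega>. incr j u v \<omega> * incr i p q \<omega> * Z \<omega>)
    = (if j = i then max 0 (min v q - p) * expectation Z else 0)"
    using expectation_incr_overlap_ordered[of u p v q Z B j i] t Z by (simp add: max_def)
  moreover have "max p u = p" using False by simp
  ultimately show ?thesis by (simp add: mult_ac min.commute)
qed

end

section \<open>Approximation of progressive processes\<close>


text \<open>An approximate identity in time. \<open>K_mass'\<close>, the mass over the first
  argument, makes smoothing an L1 contraction; unit mass and shrinking support give convergence on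
  half-lines; the bounds \<open>c m\<close> serve integrability at fixed m. Separating these
  properties from the grid leaves a monotone class argument in which no cells occur.\<close>

locale approx_kernel = prob_space M for M :: "'w measure" +
  fixes a b :: real and K :: "nat \<Rightarrow> real \<Rightarrow> real \<Rightarrow> real" and c :: "nat \<Rightarrow> real"
  assumes K_measurable [measurable]: "\<And>m. (\<lambda>z. K m (fst z) (snd z)) \<in> borel_measurable (borel \<Otimes>\<^sub>M borel)"
    and K_nonneg: "\<And>m s r. 0 \<le> K m s r"
    and K_le: "\<And>m s r. K m s r \<le> c m"
    and K_mass: "\<And>m s. (\<integral>\<^sup>+r. ennreal (K m s r) \<partial>restrict_space lborel {a..b}) \<le> 1"
    and K_mass': "\<And>m r. (\<integral>\<^sup>+s. ennreal (K m s r) \<partial>restrict_space lborel {a..b}) \<le> 1"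
    and K_unit: "\<And>s. a < s \<Longrightarrow> s < b \<Longrightarrow>
      \<forall>\<^sub>F m in sequentially. (\<integral>r. K m s r \<partial>restrict_space lborel {a..b}) = 1"
    and K_local: "\<And>s d. a < s \<Longrightarrow> s < b \<Longrightarrow> 0 < d \<Longrightarrow>
      \<forall>\<^sub>F m in sequentially. \<forall>r. K m s r \<noteq> 0 \<longrightarrow> \<bar>r - s\<bar> < d"
begin

abbreviation "L \<equiv> restrict_space lborel {a..b}"

definition smooth :: "nat \<Rightarrow> (real \<times> 'w \<Rightarrow> real) \<Rightarrow> real \<times> 'w \<Rightarrow> real" where
  "smooth m f z = (\<integral>r. K m (fst z) r * f (r, snd z) \<partial>L)"

definition bdd :: "(real \<times> 'w \<Rightarrow> real) \<Rightarrow> bool" where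
  "bdd f \<longleftrightarrow> f \<in> borel_measurable (slab M a b) \<and> (\<exists>B. \<forall>z\<in>space (slab M a b). \<bar>f z\<bar> \<le> B)"

text \<open>Convergence is asked in L1 because \<open>smooth_contraction\<close> then passes it on
  to L1 limits. Boundedness is what upgrades it to L2 in
  \<open>scalar_approximation\<close>.\<close>

definition good :: "(real \<times> 'w \<Rightarrow> real) \<Rightarrow> bool" where
  "good f \<longleftrightarrow> bdd f \<and> (\<lambda>m. \<integral>\<^sup>+z. ennreal \<bar>smooth m f z - f z\<bar> \<partial>slab M a b) \<longlonglongrightarrow> 0"

lemma finite_L: "finite_measure L" by (rule finite_measure_Icc)

lemma sigma_finite_L: "sigma_finite_measure L"
  using finite_L by (simp add: finite_measure_def)

lemma pair_sf: "pair_sigma_finite L M"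
  by (rule pair_sigma_finite_slab) unfold_locales

lemma space_slab [simp]: "space (slab M a b) = {a..b} \<times> space M"
  by (simp add: space_pair_measure space_restrict_space)

lemma K_section [measurable]: "K m s \<in> borel_measurable L"
proof -
  have "(\<lambda>r. K m (fst (s, r)) (snd (s, r))) \<in> borel_measurable borel"
    by (rule measurable_compose[OF measurable_Pair1' K_measurable]) simp
  then show ?thesis by (simp add: measurable_restrict_space1)
qed

lemma K_section' [measurable]: "(\<lambda>s. K m s r) \<in> borel_measurable L"
proof -
  have "(\<lambda>s. K m (fst (s, r)) (snd (s, r))) \<in> borel_measurable borel"
    by (rule measurable_compose[OF measurable_Pair2' K_measurable]) simp
  then show ?thesis by (simp add: measurable_restrict_space1)
qed

lemma integrable_section:
  assumes f: "bdd f" and \<omega>: "\<omega> \<in> space M"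
  shows "integrable L (\<lambda>r. K m s r * f (r, \<omega>))"
proof -
  interpret L: finite_measure L by (rule finite_L)
  obtain B where "\<forall>z\<in>space (slab M a b). \<bar>f z\<bar> \<le> B"
    using f unfolding bdd_def by blast
  then have B: "\<And>r. r \<in> {a..b} \<Longrightarrow> \<bar>f (r, \<omega>)\<bar> \<le> B"
    using \<omega> by auto
  have [measurable]: "(\<lambda>r. f (r, \<omega>)) \<in> borel_measurable L"
    using f \<omega> by (intro measurable_compose[OF measurable_Pair2']) (auto simp: bdd_def)
  show ?thesis
  proof (rule L.integrable_const_bound[of _ "c m * B"])
    show "AE r in L. norm (K m s r * f (r, \<omega>)) \<le> c m * B"
    proof (rule AE_I2)
      fix r assume "r \<in> space L"
      then have "\<bar>f (r, \<omega>)\<bar> \<le> B" using B by (simp add: space_restrict_space)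
      then have "K m s r * \<bar>f (r, \<omega>)\<bar> \<le> c m * B"
        using K_nonneg[of m s r] K_le[of m s r] by (intro mult_mono) auto
      then show "norm (K m s r * f (r, \<omega>)) \<le> c m * B"
        using K_nonneg[of m s r] by (simp add: abs_mult)
    qed
  qed simp
qed

lemma smooth_measurable [measurable]:
  assumes f: "bdd f" shows "smooth m f \<in> borel_measurable (slab M a b)"
proof -
  interpret L: sigma_finite_measure L by (rule sigma_finite_L)
  have 1: "(\<lambda>x. (fst (fst x), snd x)) \<in> slab M a b \<Otimes>\<^sub>M L \<rightarrow>\<^sub>M borel \<Otimes>\<^sub>M borel"
  proof (rule measurable_Pair)
    show "(\<lambda>x. fst (fst x)) \<in> slab M a b \<Otimes>\<^sub>M L \<rightarrow>\<^sub>M borel"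
      by (rule measurable_compose[OF measurable_fst[THEN measurable_compose, OF measurable_fst]])
        (simp add: measurable_restrict_space1)
    show "snd \<in> slab M a b \<Otimes>\<^sub>M L \<rightarrow>\<^sub>M borel"
      using measurable_compose[OF measurable_snd, of "\<lambda>x. x" L borel "slab M a b"]
      by (simp add: measurable_restrict_space1)
  qed
  have 2: "(\<lambda>x. (snd x, snd (fst x))) \<in> slab M a b \<Otimes>\<^sub>M L \<rightarrow>\<^sub>M slab M a b"
    by measurable
  have "(\<lambda>x. K m (fst (fst x)) (snd x) * f (snd x, snd (fst x))) \<in> borel_measurable (slab M a b \<Otimes>\<^sub>M L)"
    using measurable_compose[OF 1 K_measurable[of m]] measurable_compose[OF 2, of f borel] f
    by (auto simp: bdd_def)
  then have "(\<lambda>(z, r). K m (fst z) r * f (r, snd z)) \<in> borel_measurable (slab M a b \<Otimes>\<^sub>M L)"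
    by (simp add: case_prod_unfold)
  from L.borel_measurable_lebesgue_integral[OF this] show ?thesis
    by (simp add: smooth_def[abs_def])
qed

lemma bdd_measurable [measurable_dest]: "bdd f \<Longrightarrow> f \<in> borel_measurable (slab M a b)"
  by (simp add: bdd_def)

lemma bdd_diff: assumes "bdd f" "bdd g" shows "bdd (\<lambda>z. f z - g z)"
proof -
  obtain B B' where "\<forall>z\<in>space (slab M a b). \<bar>f z\<bar> \<le> B" "\<forall>z\<in>space (slab M a b). \<bar>g z\<bar> \<le> B'"
    using assms unfolding bdd_def by blast
  then have "\<forall>z\<in>space (slab M a b). \<bar>f z - g z\<bar> \<le> B + B'" by fastforce
  moreover have "(\<lambda>z. f z - g z) \<in> borel_measurable (slab M a b)"
    using assms by (auto dest: bdd_measurable)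
  ultimately show ?thesis unfolding bdd_def by blast
qed

lemma bdd_scale: assumes "bdd f" shows "bdd (\<lambda>z. k * f z)"
proof -
  obtain B where "\<forall>z\<in>space (slab M a b). \<bar>f z\<bar> \<le> B"
    using assms unfolding bdd_def by blast
  then have "\<forall>z\<in>space (slab M a b). \<bar>k * f z\<bar> \<le> \<bar>k\<bar> * B" by (simp add: abs_mult mult_left_mono)
  moreover have "(\<lambda>z. k * f z) \<in> borel_measurable (slab M a b)"
    using assms by (auto dest: bdd_measurable)
  ultimately show ?thesis unfolding bdd_def by blast
qed

lemma bdd_indicator: "A \<in> sets (slab M a b) \<Longrightarrow> bdd (indicator A)"
  unfolding bdd_def by (auto intro!: exI[of _ 1] simp: indicator_def)

lemma smooth_diff:
  "bdd f \<Longrightarrow> bdd g \<Longrightarrow> z \<in> space (slab M a b) \<Longrightarrow> smooth m (\<lambda>z. f z - g z) z = smooth m f z - smooth m g z"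
  unfolding smooth_def by (subst Bochner_Integration.integral_diff[symmetric])
    (auto intro!: integrable_section simp: right_diff_distrib)

lemma smooth_scale: "smooth m (\<lambda>z. k * f z) z = k * smooth m f z"
  unfolding smooth_def by (simp add: mult.left_commute)

text \<open>After Tonelli the kernel is integrated over its first argument, which gives at most 1
  for every r. The constant is the same for all m, and \<open>good_limit\<close> rests on
  that.\<close>

lemma smooth_contraction:
  assumes f: "bdd f"
  shows "(\<integral>\<^sup>+z. ennreal \<bar>smooth m f z\<bar> \<partial>slab M a b) \<le> (\<integral>\<^sup>+z. ennreal \<bar>f z\<bar> \<partial>slab M a b)"
proof -
  interpret L: sigma_finite_measure L by (rule sigma_finite_L)
  interpret LM: pair_sigma_finite L M by (rule pair_sf)
  interpret LL: pair_sigma_finite L L by unfold_locales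
  note [measurable] = bdd_measurable[OF f] smooth_measurable[OF f]
  have fs: "(\<lambda>r. f (r, \<omega>)) \<in> borel_measurable L" if "\<omega> \<in> space M" for \<omega>
    using f that by (intro measurable_compose[OF measurable_Pair2']) (auto simp: bdd_def)
  have KL: "(\<lambda>(s, r). ennreal (K m s r)) \<in> borel_measurable (L \<Otimes>\<^sub>M L)"
  proof -
    have "(\<lambda>x. (fst x, snd x)) \<in> L \<Otimes>\<^sub>M L \<rightarrow>\<^sub>M borel \<Otimes>\<^sub>M borel"
      by (intro measurable_Pair measurable_compose[OF measurable_fst, of "\<lambda>x. x"]
          measurable_compose[OF measurable_snd, of "\<lambda>x. x"]) (simp_all add: measurable_restrict_space1)
    from measurable_compose[OF this K_measurable[of m]] show ?thesis by (simp add: case_prod_unfold)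
  qed
  have "(\<integral>\<^sup>+z. ennreal \<bar>smooth m f z\<bar> \<partial>slab M a b) = (\<integral>\<^sup>+\<omega>. (\<integral>\<^sup>+s. ennreal \<bar>smooth m f (s, \<omega>)\<bar> \<partial>L) \<partial>M)"
    by (rule LM.nn_integral_snd[of "\<lambda>z. ennreal \<bar>smooth m f z\<bar>", symmetric]) measurable
  also have "\<dots> \<le> (\<integral>\<^sup>+\<omega>. (\<integral>\<^sup>+r. ennreal \<bar>f (r, \<omega>)\<bar> \<partial>L) \<partial>M)"
  proof (rule nn_integral_mono)
    fix \<omega> assume \<omega>: "\<omega> \<in> space M"
    note [measurable] = fs[OF \<omega>]
    have "(\<integral>\<^sup>+s. ennreal \<bar>smooth m f (s, \<omega>)\<bar> \<partial>L) \<le> (\<integral>\<^sup>+s. (\<integral>\<^sup>+r. ennreal (K m s r) * ennreal \<bar>f (r, \<omega>)\<bar> \<partial>L) \<partial>L)"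
    proof (rule nn_integral_mono)
      fix s
      have "ennreal \<bar>smooth m f (s, \<omega>)\<bar> \<le> (\<integral>\<^sup>+r. ennreal (norm (K m s r * f (r, \<omega>))) \<partial>L)"
        using integral_norm_bound_ennreal[OF integrable_section[OF f \<omega>, of m s]] by (simp add: smooth_def)
      also have "\<dots> = (\<integral>\<^sup>+r. ennreal (K m s r) * ennreal \<bar>f (r, \<omega>)\<bar> \<partial>L)"
        using K_nonneg by (simp add: abs_mult ennreal_mult)
      finally show "ennreal \<bar>smooth m f (s, \<omega>)\<bar> \<le> (\<integral>\<^sup>+r. ennreal (K m s r) * ennreal \<bar>f (r, \<omega>)\<bar> \<partial>L)" .
    qed
    also have "\<dots> = (\<integral>\<^sup>+r. (\<integral>\<^sup>+s. ennreal (K m s r) * ennreal \<bar>f (r, \<omega>)\<bar> \<partial>L) \<partial>L)"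
    proof (rule LL.Fubini'[symmetric])
      show "(\<lambda>(s, r). ennreal (K m s r) * ennreal \<bar>f (r, \<omega>)\<bar>) \<in> borel_measurable (L \<Otimes>\<^sub>M L)"
        using KL by (simp add: case_prod_unfold)
    qed
    also have "\<dots> = (\<integral>\<^sup>+r. (\<integral>\<^sup>+s. ennreal (K m s r) \<partial>L) * ennreal \<bar>f (r, \<omega>)\<bar> \<partial>L)"
      by (intro nn_integral_cong nn_integral_multc) measurable
    also have "\<dots> \<le> (\<integral>\<^sup>+r. 1 * ennreal \<bar>f (r, \<omega>)\<bar> \<partial>L)"
      by (intro nn_integral_mono mult_right_mono K_mass') auto
    finally show "(\<integral>\<^sup>+s. ennreal \<bar>smooth m f (s, \<omega>)\<bar> \<partial>L) \<le> (\<integral>\<^sup>+r. ennreal \<bar>f (r, \<omega>)\<bar> \<partial>L)" by simp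
  qed
  also have "\<dots> = (\<integral>\<^sup>+z. ennreal \<bar>f z\<bar> \<partial>slab M a b)"
    by (rule LM.nn_integral_snd[of "\<lambda>z. ennreal \<bar>f z\<bar>"]) measurable
  finally show ?thesis .
qed

lemma good_diff: assumes f: "good f" and g: "good g" shows "good (\<lambda>z. f z - g z)"
  unfolding good_def
proof
  have b: "bdd f" "bdd g" using f g by (auto simp: good_def)
  then show "bdd (\<lambda>z. f z - g z)" by (rule bdd_diff)
  note [measurable] = b[THEN bdd_measurable]
  let ?I = "\<lambda>f m. \<integral>\<^sup>+z. ennreal \<bar>smooth m f z - f z\<bar> \<partial>slab M a b"
  have le: "?I (\<lambda>z. f z - g z) m \<le> ?I f m + ?I g m" for m
  proof -
    have "?I (\<lambda>z. f z - g z) m \<le> (\<integral>\<^sup>+z. ennreal \<bar>smooth m f z - f z\<bar> + ennreal \<bar>smooth m g z - g z\<bar> \<partial>slab M a b)"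
      by (rule nn_integral_mono) (auto simp del: space_slab simp: smooth_diff b simp flip: ennreal_plus intro!: ennreal_leI)
    also have "\<dots> = ?I f m + ?I g m" using b by (intro nn_integral_add) auto
    finally show ?thesis .
  qed
  have "(\<lambda>m. ?I f m + ?I g m) \<longlonglongrightarrow> 0 + 0" using f g by (intro tendsto_add) (auto simp: good_def)
  then have lim0: "(\<lambda>m. ?I f m + ?I g m) \<longlonglongrightarrow> 0" by simp
  show "(\<lambda>m. ?I (\<lambda>z. f z - g z) m) \<longlonglongrightarrow> 0"
    by (intro tendsto_sandwich[OF always_eventually always_eventually tendsto_const lim0] allI le zero_le)
qed

lemma good_scale: assumes f: "good f" shows "good (\<lambda>z. k * f z)"
  unfolding good_def
proof
  have b: "bdd f" using f by (auto simp: good_def)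
  then show "bdd (\<lambda>z. k * f z)" by (rule bdd_scale)
  note [measurable] = b[THEN bdd_measurable]
  have "(\<integral>\<^sup>+z. ennreal \<bar>smooth m (\<lambda>z. k * f z) z - k * f z\<bar> \<partial>slab M a b)
      = ennreal \<bar>k\<bar> * (\<integral>\<^sup>+z. ennreal \<bar>smooth m f z - f z\<bar> \<partial>slab M a b)" for m
    using b by (subst nn_integral_cmult[symmetric])
      (auto simp: smooth_scale abs_mult simp flip: right_diff_distrib ennreal_mult)
  moreover have "(\<lambda>m. ennreal \<bar>k\<bar> * (\<integral>\<^sup>+z. ennreal \<bar>smooth m f z - f z\<bar> \<partial>slab M a b)) \<longlonglongrightarrow> ennreal \<bar>k\<bar> * 0"
    using f by (intro ennreal_tendsto_cmult) (auto simp: good_def)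
  ultimately show "(\<lambda>m. \<integral>\<^sup>+z. ennreal \<bar>smooth m (\<lambda>z. k * f z) z - k * f z\<bar> \<partial>slab M a b) \<longlonglongrightarrow> 0"
    by simp
qed

text \<open>The error for f is compared with the error for \<open>U i\<close>. The contraction
  bounds the smoothed difference uniformly in m, so i can be fixed before m tends to
  infinity.\<close>

lemma good_limit:
  assumes b: "bdd f" and g: "\<And>i. good (U i)"
    and lim: "(\<lambda>i. \<integral>\<^sup>+z. ennreal \<bar>f z - U i z\<bar> \<partial>slab M a b) \<longlonglongrightarrow> 0"
  shows "good f"
  unfolding good_def
proof
  have bU: "bdd (U i)" for i using g by (auto simp: good_def)
  note [measurable] = b[THEN bdd_measurable] bU[THEN bdd_measurable]
  let ?I = "\<lambda>f m. \<integral>\<^sup>+z. ennreal \<bar>smooth m f z - f z\<bar> \<partial>slab M a b"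
  let ?d = "\<lambda>i. \<integral>\<^sup>+z. ennreal \<bar>f z - U i z\<bar> \<partial>slab M a b"
  have le: "?I f m \<le> ?d i + ?I (U i) m + ?d i" for m i
  proof -
    note bd = bdd_diff[OF b bU[of i]]
    have "?I f m \<le> (\<integral>\<^sup>+z. ennreal \<bar>smooth m (\<lambda>z. f z - U i z) z\<bar> + ennreal \<bar>smooth m (U i) z - U i z\<bar>
        + ennreal \<bar>f z - U i z\<bar> \<partial>slab M a b)"
      by (rule nn_integral_mono) (auto simp del: space_slab simp: smooth_diff b bU simp flip: ennreal_plus intro!: ennreal_leI)
    also have "\<dots> = (\<integral>\<^sup>+z. ennreal \<bar>smooth m (\<lambda>z. f z - U i z) z\<bar> \<partial>slab M a b) + ?I (U i) m + ?d i"
      using bd b bU by (subst nn_integral_add; (subst nn_integral_add)?) auto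
    also have "\<dots> \<le> ?d i + ?I (U i) m + ?d i"
      by (intro add_right_mono smooth_contraction bd)
    finally show ?thesis .
  qed
  show "?I f \<longlonglongrightarrow> 0"
  proof (rule order_tendstoI)
    fix \<epsilon> :: ennreal assume \<epsilon>: "0 < \<epsilon>"
    obtain r :: real where r: "0 < r" "ennreal r \<le> \<epsilon>"
    proof (cases \<epsilon>)
      case (real x) then show ?thesis using that \<epsilon> by auto
    next
      case top then show ?thesis using that[of 1] by auto
    qed
    have "\<forall>\<^sub>F i in sequentially. ?d i < ennreal (r / 3)" by (rule order_tendstoD[OF lim]) (use r in simp)
    then obtain i where i: "?d i < ennreal (r / 3)" by (auto simp: eventually_sequentially)
    have "\<forall>\<^sub>F m in sequentially. ?I (U i) m < ennreal (r / 3)"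
      by (rule order_tendstoD) (use r g[of i] in \<open>auto simp: good_def\<close>)
    then show "\<forall>\<^sub>F m in sequentially. ?I f m < \<epsilon>"
    proof eventually_elim
      case (elim m)
      have "?d i + ?I (U i) m + ?d i < ennreal (r / 3) + ennreal (r / 3) + ennreal (r / 3)"
        using i elim by (intro add_strict_mono)
      also have "\<dots> = ennreal r" using r by (simp flip: ennreal_plus)
      also have "\<dots> \<le> \<epsilon>" by (rule r)
      finally show ?case using le[of m i] by (rule_tac le_less_trans)
    qed
  qed simp
qed (rule b)

lemma good_bounded_convergence:
  assumes f: "f \<in> borel_measurable (slab M a b)" and g: "\<And>i. good (U i)"
    and le: "\<And>i z. z \<in> space (slab M a b) \<Longrightarrow> \<bar>U i z\<bar> \<le> B"
    and lim: "\<And>z. z \<in> space (slab M a b) \<Longrightarrow> (\<lambda>i. U i z) \<longlonglongrightarrow> f z"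
  shows "good f"
proof -
  interpret N: finite_measure "slab M a b" by (rule finite_measure_slab) unfold_locales
  have bU: "bdd (U i)" for i using g by (auto simp: good_def)
  note [measurable] = f bU[THEN bdd_measurable]
  have "\<bar>f z\<bar> \<le> B" if "z \<in> space (slab M a b)" for z
    using tendsto_rabs[OF lim[OF that]] by (rule LIMSEQ_le_const2) (use le that in auto)
  then have bf: "bdd f" unfolding bdd_def using f by blast
  have "(\<lambda>i. \<integral>\<^sup>+z. ennreal (norm (f z - U i z)) \<partial>slab M a b) \<longlonglongrightarrow> 0"
  proof (rule nn_integral_dominated_convergence_norm[where w="\<lambda>_. B"])
    show "(\<integral>\<^sup>+z. ennreal B \<partial>slab M a b) < \<infinity>"
      using N.emeasure_finite[of "{a..b} \<times> space M"] by (simp add: ennreal_mult_eq_top_iff less_top[symmetric])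
  qed (use le lim in \<open>auto simp del: space_slab intro!: AE_I2\<close>)
  then show ?thesis by (intro good_limit[OF bf g]) simp
qed

text \<open>Smoothing acts on time only, so the event B is a mere factor. If s differs from a, b and
  p, the kernel at s eventually has mass 1 and lives within distance |p - s| of s, where the
  indicator is constant; smoothing is then exact. The excluded times form a null set.\<close>

lemma good_halfline:
  assumes B: "B \<in> sets M"
  shows "good (indicator (({..p} \<inter> {a..b}) \<times> B))"
  unfolding good_def
proof
  have set: "({..p} \<inter> {a..b}) \<times> B \<in> sets (slab M a b)"
    using B by (intro pair_measureI) (auto simp: sets_restrict_space)
  then show bdd: "bdd (indicator (({..p} \<inter> {a..b}) \<times> B))" by (rule bdd_indicator)
  let ?f = "indicator (({..p} \<inter> {a..b}) \<times> B) :: real \<times> 'w \<Rightarrow> real"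
  let ?k = "\<lambda>m s. \<integral>r. K m s r * indicator {..p} r \<partial>L"
  interpret L: finite_measure L by (rule finite_L)
  have Kint: "integrable L (\<lambda>r. K m s r)" for m s
    by (rule L.integrable_const_bound[of _ "c m"]) (use K_nonneg K_le in auto)
  have [measurable]: "(\<lambda>r. indicator {..p} r :: real) \<in> borel_measurable L"
    by (rule measurable_restrict_space1) simp
  have Kint': "integrable L (\<lambda>r. K m s r * indicator {..p} r)" for m s
    by (rule Bochner_Integration.integrable_bound[OF Kint])
      (measurable, auto simp: indicator_def)
  have K1: "(\<integral>r. K m s r \<partial>L) \<le> 1" for m s
  proof -
    have "ennreal (\<integral>r. K m s r \<partial>L) \<le> 1"
      using K_mass[of m s] nn_integral_eq_integral[OF Kint[of m s]] K_nonneg by simp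
    then show ?thesis by (simp flip: ennreal_1 add: ennreal_le_iff)
  qed
  have k01: "0 \<le> ?k m s" "?k m s \<le> 1" for m s
  proof -
    show "0 \<le> ?k m s" using K_nonneg by (intro integral_nonneg_AE AE_I2) auto
    have "?k m s \<le> (\<integral>r. K m s r \<partial>L)"
      by (rule integral_mono[OF Kint' Kint]) (use K_nonneg in \<open>auto simp: indicator_def\<close>)
    then show "?k m s \<le> 1" using K1[of m s] by linarith
  qed
  have sm: "smooth m ?f (s, \<omega>) = ?k m s * indicator B \<omega>" for m s \<omega>
  proof -
    have "smooth m ?f (s, \<omega>) = (\<integral>r. K m s r * indicator {..p} r * indicator B \<omega> \<partial>L)"
      unfolding smooth_def
      by (intro Bochner_Integration.integral_cong refl) (auto simp: indicator_def space_restrict_space)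
    then show ?thesis by simp
  qed
  have kmeas: "(\<lambda>s. ?k m s) \<in> borel_measurable L" for m
  proof -
    have "({..p} \<inter> {a..b}) \<times> space M \<in> sets (slab M a b)"
      by (intro pair_measureI) (auto simp: sets_restrict_space)
    obtain \<omega> where \<omega>: "\<omega> \<in> space M" using not_empty by auto
    have "(\<lambda>s. smooth m (indicator (({..p} \<inter> {a..b}) \<times> space M)) (s, \<omega>)) \<in> borel_measurable L"
      by (rule measurable_compose[OF measurable_Pair2'[OF \<omega>] smooth_measurable[OF bdd_indicator]]) fact
    moreover have "smooth m (indicator (({..p} \<inter> {a..b}) \<times> space M)) (s, \<omega>) = ?k m s" for s
      unfolding smooth_def using \<omega>
      by (intro Bochner_Integration.integral_cong refl) (auto simp: indicator_def space_restrict_space)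
    ultimately show ?thesis by simp
  qed
  have le: "(\<integral>\<^sup>+z. ennreal \<bar>smooth m ?f z - ?f z\<bar> \<partial>slab M a b) \<le> (\<integral>\<^sup>+s. ennreal (norm (indicator {..p} s - ?k m s)) \<partial>L)" for m
  proof -
    have "(\<integral>\<^sup>+z. ennreal \<bar>smooth m ?f z - ?f z\<bar> \<partial>slab M a b)
        = (\<integral>\<^sup>+s. (\<integral>\<^sup>+\<omega>. ennreal \<bar>smooth m ?f (s, \<omega>) - ?f (s, \<omega>)\<bar> \<partial>M) \<partial>L)"
      using bdd by (intro nn_integral_fst[symmetric]) (auto dest: bdd_measurable)
    also have "\<dots> \<le> (\<integral>\<^sup>+s. (\<integral>\<^sup>+\<omega>. ennreal (norm (indicator {..p} s - ?k m s)) \<partial>M) \<partial>L)"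
    proof (intro nn_integral_mono ennreal_leI)
      fix s \<omega> assume "s \<in> space L" "\<omega> \<in> space M"
      then have "?f (s, \<omega>) = indicator {..p} s * indicator B \<omega>"
        by (auto simp: indicator_def space_restrict_space)
      then have "smooth m ?f (s, \<omega>) - ?f (s, \<omega>) = (?k m s - indicator {..p} s) * indicator B \<omega>"
        unfolding sm by (simp add: left_diff_distrib)
      then have "\<bar>smooth m ?f (s, \<omega>) - ?f (s, \<omega>)\<bar> = \<bar>?k m s - indicator {..p} s\<bar> * indicator B \<omega>"
        by (simp add: abs_mult)
      also have "\<dots> \<le> \<bar>?k m s - indicator {..p} s\<bar> * 1"
        by (intro mult_left_mono) (auto simp: indicator_def)
      finally show "\<bar>smooth m ?f (s, \<omega>) - ?f (s, \<omega>)\<bar> \<le> norm (indicator {..p} s - ?k m s)"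
        by (simp only: mult_1_right real_norm_def abs_minus_commute)
    qed
    finally show ?thesis by (simp add: emeasure_space_1)
  qed
  have "(\<lambda>m. \<integral>\<^sup>+s. ennreal (norm (indicator {..p} s - ?k m s)) \<partial>L) \<longlonglongrightarrow> 0"
  proof (rule nn_integral_dominated_convergence_norm[where w="\<lambda>_. 1"])
    show "AE s in L. (\<lambda>m. ?k m s) \<longlonglongrightarrow> indicator {..p} s"
    proof -
      have "AE s in lborel. s \<noteq> a \<and> s \<noteq> b \<and> s \<noteq> p"
        using AE_lborel_singleton[of a] AE_lborel_singleton[of b] AE_lborel_singleton[of p] by eventually_elim auto
      then have "AE s in L. s \<noteq> a \<and> s \<noteq> b \<and> s \<noteq> p"
        by (subst AE_restrict_space_iff) auto
      then show ?thesis using AE_space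
      proof eventually_elim
        case (elim s)
        then have s: "a < s" "s < b" "s \<noteq> p" by (auto simp: space_restrict_space)
        have loc0: "\<forall>\<^sub>F m in sequentially. \<forall>r. K m s r \<noteq> 0 \<longrightarrow> \<bar>r - s\<bar> < \<bar>p - s\<bar>"
          using s by (intro K_local) auto
        have "\<forall>\<^sub>F m in sequentially. ?k m s = indicator {..p} s"
          using K_unit[OF s(1,2)] loc0
        proof eventually_elim
          case e2: (elim m)
          have loc: "K m s r \<noteq> 0 \<Longrightarrow> \<bar>r - s\<bar> < \<bar>p - s\<bar>" for r using e2(2) s(3) by auto
          have "?k m s = (\<integral>r. indicator {..p} s * K m s r \<partial>L)"
          proof (intro Bochner_Integration.integral_cong refl)
            fix r
            show "K m s r * indicator {..p} r = indicator {..p} s * K m s r"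
              using loc[of r] by (cases "K m s r = 0") (auto simp: indicator_def)
          qed
          also have "\<dots> = indicator {..p} s" using e2(1) by simp
          finally show ?case .
        qed
        then show ?case by (rule tendsto_eventually)
      qed
    qed
    show "(\<integral>\<^sup>+s. ennreal 1 \<partial>L) < \<infinity>"
      using L.emeasure_finite by (simp add: less_top[symmetric])
  qed (use k01 kmeas in \<open>auto intro!: AE_I2 measurable_restrict_space1\<close>)
  then show "(\<lambda>m. \<integral>\<^sup>+z. ennreal \<bar>smooth m ?f z - ?f z\<bar> \<partial>slab M a b) \<longlonglongrightarrow> 0"
    by (rule tendsto_sandwich[OF always_eventually always_eventually tendsto_const, rotated 2])
      (intro allI le zero_le)+
qed

text \<open>Disjointness makes the finite partial sums indicators again, so they stay bounded by 1
  and bounded convergence applies.\<close>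

lemma good_UNION:
  fixes A :: "nat \<Rightarrow> (real \<times> 'w) set"
  assumes d: "disjoint_family A" and g: "\<And>i. good (indicator (A i))" and A: "\<And>i. A i \<in> sets (slab M a b)"
  shows "good (indicator (\<Union>i. A i))"
proof (rule good_bounded_convergence)
  show "indicator (\<Union>i. A i) \<in> borel_measurable (slab M a b)" using A by auto
  have gz: "good (\<lambda>z. 0)" using good_scale[OF g, of 0 0] by simp
  show "good (\<lambda>z. \<Sum>j<i. indicator (A j) z)" for i
  proof (induction i)
    case (Suc i)
    have "good (\<lambda>z. (\<Sum>j<i. indicator (A j) z) - (-1) * indicator (A i) z)"
      by (intro good_diff Suc good_scale g)
    then show ?case by simp
  qed (simp add: gz)
  have eq: "(\<Sum>j<i. indicator (A j) z) = (indicator (\<Union>j<i. A j) z :: real)" for i z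
    by (rule indicator_UN_disjoint[symmetric]) (use d in \<open>auto simp: disjoint_family_on_def\<close>)
  show "\<bar>\<Sum>j<i. indicator (A j) z\<bar> \<le> (1::real)" for i z
    unfolding eq by (simp add: indicator_def)
  show "(\<lambda>i. \<Sum>j<i. indicator (A j) z) \<longlonglongrightarrow> (indicator (\<Union>i. A i) z :: real)" for z
    unfolding eq by (rule LIMSEQ_indicator_UN)
qed

text \<open>Two Dynkin arguments: half-lines generate the Borel sets of the time axis, and
  rectangles generate the product sigma-algebra. Complements and disjoint unions are covered by
  \<open>good_diff\<close> and \<open>good_UNION\<close>.\<close>

lemma good_set:
  assumes "A \<in> sets (slab M a b)" shows "good (indicator A)"
proof -
  have rect: "good (indicator ((E \<inter> {a..b}) \<times> B))" if E: "E \<in> sets borel" and B: "B \<in> sets M" for E B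
  proof -
    have sE: "(X \<inter> {a..b}) \<times> B \<in> sets (slab M a b)" if "X \<in> sets borel" for X
      using B that by (intro pair_measureI) (auto simp: sets_restrict_space)
    have bo: "sets (borel :: real measure) = sigma_sets UNIV (range (\<lambda>p. {..p}))"
      by (subst borel_eq_atMost) (simp add: sets_measure_of)
    have E': "E \<in> sigma_sets UNIV (range (\<lambda>p. {..p}))" using E bo by simp
    have stab: "Int_stable (range (\<lambda>p::real. {..p}))"
    proof (rule Int_stableI)
      fix x y :: "real set" assume "x \<in> range (\<lambda>p. {..p})" "y \<in> range (\<lambda>p. {..p})"
      then obtain p q where "x = {..p}" "y = {..q}" by auto
      then have "x \<inter> y = {..min p q}" by auto
      then show "x \<inter> y \<in> range (\<lambda>p. {..p})" by blast
    qed
    have full: "good (indicator ((UNIV \<inter> {a..b}) \<times> B))"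
    proof -
      have "({..b} \<inter> {a..b}) = (UNIV \<inter> {a..b})" by auto
      then show ?thesis using good_halfline[OF B, of b] by simp
    qed
    have sub: "range (\<lambda>p::real. {..p}) \<subseteq> Pow UNIV" by simp
    from stab sub E' show ?thesis
    proof (induction rule: sigma_sets_induct_disjoint)
      case (basic X) then show ?case using good_halfline[OF B] by auto
    next
      case empty
      show ?case using good_scale[OF full, of 0] by (simp add: indicator_def)
    next
      case (compl X)
      have "indicator (((UNIV - X) \<inter> {a..b}) \<times> B)
          = (\<lambda>z. indicator ((UNIV \<inter> {a..b}) \<times> B) z - (indicator ((X \<inter> {a..b}) \<times> B) z :: real))"
        by (auto simp: indicator_def fun_eq_iff)
      then show ?case using good_diff[OF full compl(2)] by simp
    next
      case (union X)
      have "((\<Union>i. X i) \<inter> {a..b}) \<times> B = (\<Union>i. (X i \<inter> {a..b}) \<times> B)" by auto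
      moreover have "good (indicator (\<Union>i. (X i \<inter> {a..b}) \<times> B))"
        using union by (intro good_UNION sE) (auto simp: disjoint_family_on_def bo)
      ultimately show ?case by simp
    qed
  qed
  have full: "good (indicator ({a..b} \<times> space M))" using rect[of UNIV "space M"] by simp
  have "A \<in> sigma_sets (space L \<times> space M) {x \<times> y | x y. x \<in> sets L \<and> y \<in> sets M}"
    using assms by (simp add: sets_pair_measure)
  from Int_stable_pair_measure_generator pair_measure_closed this show ?thesis
  proof (induction rule: sigma_sets_induct_disjoint)
    case (basic X)
    then obtain x y where X: "X = x \<times> y" "x \<in> sets L" "y \<in> sets M" by auto
    then obtain E where "x = E \<inter> {a..b}" "E \<in> sets borel" by (auto simp: sets_restrict_space)
    then show ?case using rect X by simp
  next
    case empty
    show ?case using good_scale[OF full, of 0] by (simp add: indicator_def)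
  next
    case (compl X)
    have "X \<subseteq> {a..b} \<times> space M"
      using sigma_sets_into_sp[OF _ compl(1)] sets.sets_into_space[of _ L] sets.sets_into_space[of _ M]
      by (fastforce simp: space_restrict_space)
    then have "indicator (space L \<times> space M - X) = (\<lambda>z. indicator ({a..b} \<times> space M) z - (indicator X z :: real))"
      by (auto simp: indicator_def fun_eq_iff space_restrict_space)
    then show ?case using good_diff[OF full compl(2)] by simp
  next
    case (union X)
    then show ?case by (intro good_UNION) (auto simp: sets_pair_measure)
  qed
qed

lemma good_bdd:
  assumes f: "bdd f" shows "good f"
proof -
  have nonneg: "good g" if "bdd g" "\<And>z. 0 \<le> g z" for g
  proof -
    have "g \<in> borel_measurable (slab M a b)" using that by (simp add: bdd_def)
    \<comment> \<open>Boundedness travels as a premise through the induction: all pieces are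
      nonnegative, so a bound for a sum or for an increasing limit also bounds its
      constituents.\<close>
    then have "bdd g \<longrightarrow> good g"
      using that(2)
    proof (induction rule: borel_measurable_induct_real)
      case (set A) then show ?case using good_set by blast
    next
      case (mult u c)
      show ?case
      proof
        assume b: "bdd (\<lambda>z. c * u z)"
        show "good (\<lambda>z. c * u z)"
        proof (cases "c = 0")
          case True
          then show ?thesis using good_scale[OF good_set[OF sets.empty_sets], of 0] by simp
        next
          case False
          then have "bdd u" using bdd_scale[OF b, of "1 / c"] by simp
          then show ?thesis using mult by (intro good_scale) auto
        qed
      qed
    next
      case (add u v)
      show ?case
      proof
        assume "bdd (\<lambda>z. v z + u z)"
        then obtain B where B: "\<And>z. z \<in> space (slab M a b) \<Longrightarrow> \<bar>v z + u z\<bar> \<le> B" unfolding bdd_def by blast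
        have uv: "u \<in> borel_measurable (slab M a b)" "v \<in> borel_measurable (slab M a b)"
          "0 \<le> u z" "0 \<le> v z" for z
          using add by auto
        have "\<bar>u z\<bar> \<le> B" "\<bar>v z\<bar> \<le> B" if "z \<in> space (slab M a b)" for z
          using B[OF that] uv(3,4)[of z] by linarith+
        then have "bdd u" "bdd v" unfolding bdd_def using uv(1,2) by blast+
        then have "good (\<lambda>z. v z - (-1) * u z)" using add by (intro good_diff good_scale) auto
        then show "good (\<lambda>z. v z + u z)" by simp
      qed
    next
      case (seq U)
      show ?case
      proof
        assume b: "bdd g"
        then obtain B where B: "\<And>z. z \<in> space (slab M a b) \<Longrightarrow> \<bar>g z\<bar> \<le> B" unfolding bdd_def by blast
        have le: "\<bar>U i z\<bar> \<le> B" if "z \<in> space (slab M a b)" for i z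
        proof -
          have "incseq U" "(\<lambda>i. U i z) \<longlonglongrightarrow> g z" using seq that by blast+
          then have "U i z \<le> g z"
            by (intro incseq_le[of "\<lambda>i. U i z"]) (auto dest: incseqD le_funD simp: mono_def)
          moreover have "0 \<le> U i z" using seq by blast
          ultimately show ?thesis using B[OF that] by simp
        qed
        have "U i \<in> borel_measurable (slab M a b)" for i using seq by blast
        then have "bdd (U i)" for i unfolding bdd_def using le by blast
        then have "good (U i)" for i using seq by blast
        moreover have "(\<lambda>i. U i z) \<longlonglongrightarrow> g z" if "z \<in> space (slab M a b)" for z using seq that by blast
        ultimately show "good g"
          using le b by (intro good_bounded_convergence[of g U B]) (auto dest: bdd_measurable)
      qed
    qed
    then show ?thesis using that by blast
  qed
  obtain B where B: "\<And>z. z \<in> space (slab M a b) \<Longrightarrow> \<bar>f z\<bar> \<le> B" using f unfolding bdd_def by blast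
  have [measurable]: "f \<in> borel_measurable (slab M a b)" by (rule bdd_measurable[OF f])
  have "bdd (\<lambda>z. max 0 (f z))" "bdd (\<lambda>z. max 0 (- f z))"
  proof -
    have "\<bar>max 0 (f z)\<bar> \<le> B" "\<bar>max 0 (- f z)\<bar> \<le> B" if "z \<in> space (slab M a b)" for z
      using B[OF that] by linarith+
    moreover have "(\<lambda>z. max 0 (f z)) \<in> borel_measurable (slab M a b)" "(\<lambda>z. max 0 (- f z)) \<in> borel_measurable (slab M a b)"
      by measurable
    ultimately show "bdd (\<lambda>z. max 0 (f z))" "bdd (\<lambda>z. max 0 (- f z))"
      unfolding bdd_def by blast+
  qed
  then have "good (\<lambda>z. max 0 (f z) - max 0 (- f z))" by (intro good_diff nonneg) auto
  moreover have "(\<lambda>z. max 0 (f z) - max 0 (- f z)) = f" by (auto simp: max_def)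
  ultimately show ?thesis by simp
qed

end


section \<open>Time grids and averaging over the preceding cell\<close>

definition grid :: "real \<Rightarrow> real \<Rightarrow> nat \<Rightarrow> nat \<Rightarrow> real" where
  "grid a b m k = a + real k * ((b - a) / real m)"

text \<open>Half-open cells partition \<open>{a..<b}\<close> for a < b and m > 0; the end point b
  lies in none of them and is discarded as a null time by \<open>AE_slab_fst_neq\<close>. For m = 0
  division by zero collapses the grid to the point a.\<close>

definition cell :: "real \<Rightarrow> real \<Rightarrow> nat \<Rightarrow> nat \<Rightarrow> real set" where
  "cell a b m k = {grid a b m k..<grid a b m (Suc k)}"

lemma grid_0 [simp]: "grid a b m 0 = a"
  by (simp add: grid_def)

lemma grid_end: "m > 0 \<Longrightarrow> grid a b m m = b"
  by (simp add: grid_def)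

lemma grid_mono: "a \<le> b \<Longrightarrow> j \<le> k \<Longrightarrow> grid a b m j \<le> grid a b m k"
  by (simp add: grid_def mult_right_mono divide_right_mono)

lemma grid_bounds: "a \<le> b \<Longrightarrow> k \<le> m \<Longrightarrow> m > 0 \<Longrightarrow> a \<le> grid a b m k \<and> grid a b m k \<le> b"
  using grid_mono[of a b 0 k m] grid_mono[of a b k m m] by (simp add: grid_end)

lemma grid_Suc: "grid a b m (Suc k) = grid a b m k + (b - a) / real m"
  by (simp add: grid_def distrib_right add_divide_distrib)

lemma cell_subset: "a \<le> b \<Longrightarrow> k < m \<Longrightarrow> cell a b m k \<subseteq> {a..<b}"
  using grid_bounds[of a b k m] grid_bounds[of a b "Suc k" m] by (auto simp: cell_def)

lemma cell_in_borel [measurable]: "cell a b m k \<in> sets borel"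
  by (simp add: cell_def)

lemma sum_indicator_cell:
  "a \<le> b \<Longrightarrow> (\<Sum>k<n. indicator (cell a b m k) s) = (indicator {a..<grid a b m n} s :: real)"
proof (induction n)
  case (Suc n)
  then show ?case
    using grid_mono[of a b 0 n m] grid_mono[of a b n "Suc n" m]
    by (auto simp: cell_def indicator_def)
qed simp

lemma cell_unique:
  assumes ab: "a \<le> b" and s: "s \<in> cell a b m j" "s \<in> cell a b m k"
  shows "j = k"
proof (rule ccontr)
  assume "j \<noteq> k"
  then have "Suc j \<le> k \<or> Suc k \<le> j" by auto
  then show False
    using s grid_mono[OF ab, of "Suc j" k m] grid_mono[OF ab, of "Suc k" j m] by (auto simp: cell_def)
qed

lemma cell_exists:
  assumes ab: "a < b" and m: "m > 0" and s: "s \<in> {a..<b}"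
  obtains k where "k < m" "s \<in> cell a b m k"
proof -
  have "(\<Sum>k<m. indicator (cell a b m k) s) = (1::real)"
    using sum_indicator_cell[of a b m s m] ab s m by (simp add: grid_end)
  then have "\<exists>k\<in>{..<m}. indicator (cell a b m k) s \<noteq> (0::real)"
    by (metis sum.neutral zero_neq_one)
  then show ?thesis using that by (auto simp: indicator_def split: if_splits)
qed

lemma sum_cell_collapse:
  assumes ab: "a \<le> b" and k: "k < m" "s \<in> cell a b m k"
  shows "(\<Sum>j<m. indicator (cell a b m j) s *\<^sub>R (G j :: 'b::real_vector)) = G k"
proof -
  have "(\<Sum>j<m. indicator (cell a b m j) s *\<^sub>R G j) = (\<Sum>j<m. if j = k then G k else 0)"
  proof (rule sum.cong[OF refl])
    fix j
    show "indicator (cell a b m j) s *\<^sub>R G j = (if j = k then G k else 0)"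
      using cell_unique[OF ab _ k(2), of j] k(2) by (cases "s \<in> cell a b m j") auto
  qed
  then show ?thesis using k(1) by simp
qed

lemma integrable_indicator_cell:
  "integrable (restrict_space lborel {a..b}) (\<lambda>r. indicator (cell a' b' m k) r :: real)"
proof -
  interpret L: finite_measure "restrict_space lborel {a..b}" by (rule finite_measure_Icc)
  show ?thesis
  proof (rule L.integrable_const_bound[of _ 1])
    show "AE r in restrict_space lborel {a..b}. norm (indicator (cell a' b' m k) r :: real) \<le> 1"
      by (rule AE_I2) (simp add: indicator_def)
  qed (rule measurable_restrict_space1, simp)
qed

lemma integral_indicator_cell:
  assumes ab: "a < b" and k: "k < m"
  shows "(\<integral>r. indicator (cell a b m k) r \<partial>restrict_space lborel {a..b}) = (b - a) / real m"
proof -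
  have sub: "cell a b m k \<subseteq> {a..b}" using cell_subset[of a b k m] ab k by force
  have "(\<integral>r. indicator (cell a b m k) r \<partial>restrict_space lborel {a..b}) = measure (restrict_space lborel {a..b}) (cell a b m k)"
    using sub by (simp add: space_restrict_space Int_absorb2)
  also have "\<dots> = measure lborel (cell a b m k)"
    by (rule measure_restrict_space) (use sub in auto)
  also have "\<dots> = grid a b m (Suc k) - grid a b m k"
    unfolding cell_def using grid_mono[of a b k "Suc k" m] ab by simp
  finally show ?thesis by (simp add: grid_Suc)
qed

text \<open>Averages the argument over the cell before the one containing \<open>s\<close>, which keeps the result
  adapted.\<close>

definition grid_kernel :: "real \<Rightarrow> real \<Rightarrow> nat \<Rightarrow> real \<Rightarrow> real \<Rightarrow> real" where
  "grid_kernel a b m s r =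
     (\<Sum>k<m - 1. indicator (cell a b m (Suc k)) s * indicator (cell a b m k) r * (real m / (b - a)))"

text \<open>The first cell has no predecessor, so the averaging kernel has mass 1 only from the
  second grid point on. For a fixed s > a this is reached as soon as the mesh is below s -
  a.\<close>

lemma sum_indicator_cell_Suc:
  assumes "a \<le> b" "m > 0"
  shows "(\<Sum>k<m - 1. indicator (cell a b m (Suc k)) s) = (indicator {grid a b m 1..<b} s :: real)"
proof -
  obtain n where m: "m = Suc n" using assms by (cases m) auto
  have "(\<Sum>k<Suc n. indicator (cell a b m k) s) = (indicator {a..<b} s :: real)"
    using sum_indicator_cell[of a b m s m] assms by (simp add: grid_end flip: m)
  then have "(\<Sum>k<n. indicator (cell a b m (Suc k)) s) = (indicator {a..<b} s - indicator (cell a b m 0) s :: real)"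
    unfolding sum.lessThan_Suc_shift by simp
  then show ?thesis
    using assms grid_bounds[of a b 1 m] by (auto simp: m cell_def indicator_def)
qed

text \<open>The factor m / (b - a) is the inverse cell length, so integrating out either variable
  leaves a sum of indicators of disjoint cells, hence at most 1. The pointwise bound simply counts
  the m - 1 summands.\<close>

lemma approx_kernel_grid:
  assumes M: "prob_space M" and ab: "a < b"
  shows "approx_kernel M a b (grid_kernel a b) (\<lambda>m. real (m - 1) * (real m / (b - a)))"
proof (intro approx_kernel.intro approx_kernel_axioms.intro M)
  interpret L: finite_measure "restrict_space lborel {a..b}" by (rule finite_measure_Icc)
  have [measurable]: "(\<lambda>r. indicator (cell a b m k) r :: real) \<in> borel_measurable (restrict_space lborel {a..b})" for m k
    by (rule measurable_restrict_space1) simp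
  note int = integrable_indicator_cell
  have I1: "integrable (restrict_space lborel {a..b}) (\<lambda>r. grid_kernel a b m s r)"
    and I2: "integrable (restrict_space lborel {a..b}) (\<lambda>s. grid_kernel a b m s r)" for m s r
    unfolding grid_kernel_def using int by auto
  have E1: "(\<integral>r. grid_kernel a b m s r \<partial>restrict_space lborel {a..b}) = (\<Sum>k<m - 1. indicator (cell a b m (Suc k)) s)" for m s
  proof -
    have "(\<integral>r. grid_kernel a b m s r \<partial>restrict_space lborel {a..b}) = (\<Sum>k<m - 1. \<integral>r. indicator (cell a b m (Suc k)) s *
        indicator (cell a b m k) r * (real m / (b - a)) \<partial>restrict_space lborel {a..b})"
      unfolding grid_kernel_def
      by (rule Bochner_Integration.integral_sum) (intro integrable_mult_left integrable_mult_right int)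
    also have "\<dots> = (\<Sum>k<m - 1. indicator (cell a b m (Suc k)) s * ((b - a) / real m) * (real m / (b - a)))"
      by (intro sum.cong refl) (simp only: integral_mult_left_zero integral_mult_right_zero integral_indicator_cell[OF ab] lessThan_iff less_diff_conv)
    also have "\<dots> = (\<Sum>k<m - 1. indicator (cell a b m (Suc k)) s)"
      using ab by (intro sum.cong refl) auto
    finally show ?thesis .
  qed
  have E2: "(\<integral>s. grid_kernel a b m s r \<partial>restrict_space lborel {a..b}) = (\<Sum>k<m - 1. indicator (cell a b m k) r)" for m r
  proof -
    have "(\<integral>s. grid_kernel a b m s r \<partial>restrict_space lborel {a..b}) = (\<Sum>k<m - 1. \<integral>s. indicator (cell a b m (Suc k)) s *
        indicator (cell a b m k) r * (real m / (b - a)) \<partial>restrict_space lborel {a..b})"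
      unfolding grid_kernel_def
      by (rule Bochner_Integration.integral_sum) (intro integrable_mult_left integrable_mult_right int)
    also have "\<dots> = (\<Sum>k<m - 1. ((b - a) / real m) * indicator (cell a b m k) r * (real m / (b - a)))"
      by (intro sum.cong refl) (simp only: integral_mult_left_zero integral_mult_right_zero integral_indicator_cell[OF ab] lessThan_iff less_diff_conv Suc_eq_plus1)
    also have "\<dots> = (\<Sum>k<m - 1. indicator (cell a b m k) r)"
      using ab by (intro sum.cong refl) auto
    finally show ?thesis .
  qed
  show nn: "0 \<le> grid_kernel a b m s r" for m s r
    unfolding grid_kernel_def using ab by (intro sum_nonneg) auto
  show "(\<lambda>z. grid_kernel a b m (fst z) (snd z)) \<in> borel_measurable (borel \<Otimes>\<^sub>M borel)" for m
    unfolding grid_kernel_def by measurable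
  show "grid_kernel a b m s r \<le> real (m - 1) * (real m / (b - a))" for m s r
  proof -
    have "grid_kernel a b m s r \<le> (\<Sum>k<m - 1. real m / (b - a))"
      unfolding grid_kernel_def using ab by (intro sum_mono) (auto simp: indicator_def)
    then show ?thesis by simp
  qed
  show "(\<integral>\<^sup>+r. ennreal (grid_kernel a b m s r) \<partial>restrict_space lborel {a..b}) \<le> 1" for m s
  proof (cases "m = 0")
    case False
    show ?thesis
    proof -
      have "(\<Sum>k<m - 1. indicator (cell a b m (Suc k)) s) \<le> (1::real)"
        using sum_indicator_cell_Suc[of a b m s] ab False by (simp only: indicator_le_1)
      then show ?thesis
        using nn by (simp only: nn_integral_eq_integral[OF I1] E1 ennreal_le_1 AE_I2 simp_thms)
    qed
  qed (simp add: grid_kernel_def)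
  show "(\<integral>\<^sup>+s. ennreal (grid_kernel a b m s r) \<partial>restrict_space lborel {a..b}) \<le> 1" for m r
  proof -
    have "(\<Sum>k<m - 1. indicator (cell a b m k) r) \<le> (1::real)"
      using sum_indicator_cell[of a b m r "m - 1"] ab by (simp only: indicator_le_1)
    then show ?thesis
      using nn by (simp only: nn_integral_eq_integral[OF I2] E2 ennreal_le_1 AE_I2 simp_thms)
  qed
  fix s assume s: "a < s" "s < b"
  have small: "\<forall>\<^sub>F m in sequentially. 0 < m \<and> (b - a) / real m < d" if "d > 0" for d
  proof -
    have "(\<lambda>m. (b - a) / real m) \<longlonglongrightarrow> 0" by (rule lim_const_over_n)
    from order_tendstoD(2)[OF this that] eventually_gt_at_top[of 0] show ?thesis by eventually_elim simp
  qed
  show "\<forall>\<^sub>F m in sequentially. (\<integral>r. grid_kernel a b m s r \<partial>restrict_space lborel {a..b}) = 1"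
  proof -
    have "\<forall>\<^sub>F m in sequentially. 0 < m \<and> (b - a) / real m < s - a" using small[of "s - a"] s by simp
    then show ?thesis
    proof eventually_elim
      case (elim m)
      then have "s \<in> {grid a b m 1..<b}" using s by (simp add: grid_def)
      then show ?case using elim ab unfolding E1 by (subst sum_indicator_cell_Suc) auto
    qed
  qed
  show "\<forall>\<^sub>F m in sequentially. \<forall>r. grid_kernel a b m s r \<noteq> 0 \<longrightarrow> \<bar>r - s\<bar> < d" if d: "0 < d" for d
  proof -
    have "\<forall>\<^sub>F m in sequentially. 0 < m \<and> (b - a) / real m < d / 2" using small[of "d / 2"] d by simp
    then show ?thesis
    proof (rule eventually_mono, intro allI impI)
      \<comment> \<open>A nonzero kernel value places r and s in adjacent cells, less than two mesh
        sizes apart; this explains d / 2.\<close>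
      fix m r assume m: "0 < m \<and> (b - a) / real m < d / 2" and "grid_kernel a b m s r \<noteq> 0"
      then obtain k where "indicator (cell a b m (Suc k)) s * indicator (cell a b m k) r * (real m / (b - a)) \<noteq> 0"
        unfolding grid_kernel_def by (meson sum.neutral)
      then have "s \<in> cell a b m (Suc k)" "r \<in> cell a b m k" by (auto simp: indicator_def split: if_splits)
      then show "\<bar>r - s\<bar> < d"
        using m unfolding cell_def grid_Suc atLeastLessThan_iff by linarith
    qed
  qed
qed

text \<open>The value of the smoothed process on cell k, namely the mean of X over cell k - 1.
  Looking back by one cell makes it measurable at the left end of cell k; the value 0 for k = 0
  stands for the summand absent from \<open>grid_kernel\<close>.\<close>

definition prev_avg :: "real \<Rightarrow> real \<Rightarrow> nat \<Rightarrow> nat \<Rightarrow> (real \<Rightarrow> 'w \<Rightarrow> real) \<Rightarrow> 'w \<Rightarrow> real" where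
  "prev_avg a b m k X \<omega> = (if k = 0 then 0 else
     real m / (b - a) * (\<integral>r. indicator (cell a b m (k - 1)) r * X r \<omega> \<partial>restrict_space lborel {a..b}))"

lemma AE_slab_fst_neq: "prob_space M \<Longrightarrow> AE z in slab M a b. fst z \<noteq> (p::real)"
proof (rule AE_I')
  assume M: "prob_space M"
  interpret prob_space M by fact
  let ?N = "({p} \<inter> {a..b}) \<times> space M"
  have s: "{p} \<inter> {a..b} \<in> sets (restrict_space lborel {a..b})"
    by (rule sets_restrict_space_iff[THEN iffD2]) auto
  have "emeasure (restrict_space lborel {a..b}) ({p} \<inter> {a..b}) = emeasure lborel ({p} \<inter> {a..b})"
    by (rule emeasure_restrict_space) auto
  also have "\<dots> \<le> emeasure lborel {p}" by (rule emeasure_mono) auto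
  finally have "emeasure (restrict_space lborel {a..b}) ({p} \<inter> {a..b}) = 0" by simp
  then show "?N \<in> null_sets (slab M a b)"
    using s by (auto simp: null_sets_def emeasure_pair_measure_Times)
  show "{z \<in> space (slab M a b). \<not> fst z \<noteq> p} \<subseteq> ?N"
    by (auto simp: space_pair_measure space_restrict_space)
qed

context cyl_wiener_space begin

lemma progressive_measurable:
  assumes X: "progressive M F T X" and ab: "0 \<le> a" "b \<le> T" "0 \<le> T"
  shows "(\<lambda>z. X (fst z) (snd z)) \<in> borel_measurable (slab M a b)"
proof (rule measurable_slab_mono)
  have "(\<lambda>z. X (fst z) (snd z)) \<in> borel_measurable (slab (F T) 0 T)"
    using X ab by (simp add: progressive_def)
  moreover have "(\<lambda>z. (fst z, snd z)) \<in> slab M 0 T \<rightarrow>\<^sub>M slab (F T) 0 T"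
  proof (intro measurable_Pair measurable_fst)
    have "(\<lambda>\<omega>. \<omega>) \<in> measurable M (F T)" by (rule measurable_F_M[of _ T]) auto
    then show "snd \<in> slab M 0 T \<rightarrow>\<^sub>M F T"
      using measurable_compose[OF measurable_snd, of "\<lambda>\<omega>. \<omega>" M "F T"] by simp
  qed
  ultimately show "(\<lambda>z. X (fst z) (snd z)) \<in> borel_measurable (slab M 0 T)"
    using measurable_compose by fastforce
  show "{a..b} \<subseteq> {0..T}" using ab by auto
qed

lemma progressive_section:
  assumes X: "progressive M F T X" and t: "t \<in> {0..T}"
  shows "X t \<in> borel_measurable (F t)"
proof -
  have "(\<lambda>\<omega>. (t, \<omega>)) \<in> F t \<rightarrow>\<^sub>M slab (F t) 0 t"
    by (rule measurable_Pair1') (use t in \<open>simp add: space_restrict_space\<close>)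
  from measurable_compose[OF this, of "\<lambda>z. X (fst z) (snd z)" borel] show ?thesis
    using X t by (simp add: progressive_def)
qed

text \<open>The averaging cell lies in \<open>{0..u}\<close> with u the k-th grid point, so the
  integral may be taken over that interval. There progressive measurability at time u gives joint
  measurability, and integrating out time leaves an \<open>F u\<close>-measurable variable.\<close>

lemma prev_avg_measurable:
  assumes X: "progressive M F T X" and ab: "0 \<le> a" "a < b" "b \<le> T" and k: "k < m"
  shows "prev_avg a b m k X \<in> borel_measurable (F (grid a b m k))"
proof (cases "k = 0")
  case True
  then show ?thesis by (simp add: prev_avg_def[abs_def])
next
  case False
  let ?u = "grid a b m k"
  have u: "a \<le> ?u" "?u \<le> b" using grid_bounds[of a b k m] ab k by auto
  have c: "cell a b m (k - 1) \<subseteq> {0..?u}" "cell a b m (k - 1) \<subseteq> {a..b}"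
    using cell_subset[of a b "k - 1" m] ab k False grid_bounds[of a b "k - 1" m] by (force simp: cell_def)+
  let ?h = "\<lambda>\<omega> r. indicator (cell a b m (k - 1)) r * X r \<omega>"
  have eq: "(\<integral>r. ?h \<omega> r \<partial>restrict_space lborel {a..b}) = (\<integral>r. ?h \<omega> r \<partial>restrict_space lborel {0..?u})" for \<omega>
  proof -
    have "(\<integral>r. ?h \<omega> r \<partial>restrict_space lborel I) = (\<integral>r. ?h \<omega> r \<partial>lborel)" if "cell a b m (k - 1) \<subseteq> I" "I \<in> sets borel" for I
      using that by (subst integral_restrict_space) (auto simp: indicator_def intro!: Bochner_Integration.integral_cong)
    with c show ?thesis by simp
  qed
  interpret L: finite_measure "restrict_space lborel {0..?u}" by (rule finite_measure_Icc)
  have "(\<lambda>z. X (fst z) (snd z)) \<in> borel_measurable (slab (F ?u) 0 ?u)"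
    using X u ab by (simp add: progressive_def)
  moreover have "(\<lambda>z. indicator (cell a b m (k - 1)) (fst z) :: real) \<in> borel_measurable (slab (F ?u) 0 ?u)"
    by (rule measurable_compose[OF measurable_fst measurable_restrict_space1]) simp
  ultimately have "(\<lambda>z. indicator (cell a b m (k - 1)) (fst z) * X (fst z) (snd z)) \<in> borel_measurable (slab (F ?u) 0 ?u)"
    by (intro borel_measurable_times)
  from measurable_compose[OF measurable_pair_swap' this]
  have "(\<lambda>(\<omega>, r). ?h \<omega> r) \<in> borel_measurable (F ?u \<Otimes>\<^sub>M restrict_space lborel {0..?u})"
    by (simp add: case_prod_unfold)
  from L.borel_measurable_lebesgue_integral[OF this] show ?thesis
    unfolding prev_avg_def[abs_def] eq using False by simp
qed

text \<open>Smoothing by \<open>grid_kernel\<close> produces exactly the step process of the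
  averages, so it converges in L1. Averages inherit the bound B; the squared error is therefore at
  most 2 B times the error, and the convergence holds in L2.\<close>

lemma scalar_approximation:
  assumes X: "progressive M F T X" and ab: "0 \<le> a" "a < b" "b \<le> T"
    and B: "\<And>s \<omega>. s \<in> {0..T} \<Longrightarrow> \<omega> \<in> space M \<Longrightarrow> \<bar>X s \<omega>\<bar> \<le> B"
  shows "\<And>m k \<omega>. k < m \<Longrightarrow> \<omega> \<in> space M \<Longrightarrow> \<bar>prev_avg a b m k X \<omega>\<bar> \<le> B"
    and "(\<lambda>m. \<integral>\<^sup>+z. ennreal (((\<Sum>k<m. indicator (cell a b m k) (fst z) * prev_avg a b m k X (snd z))
        - X (fst z) (snd z))\<^sup>2) \<partial>slab M a b) \<longlonglongrightarrow> 0"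
proof -
  interpret A: approx_kernel M a b "grid_kernel a b" "\<lambda>m. real (m - 1) * (real m / (b - a))"
    by (rule approx_kernel_grid) (use ab in \<open>auto intro: prob_space_axioms\<close>)
  let ?L = "restrict_space lborel {a..b}"
  interpret L: finite_measure ?L by (rule finite_measure_Icc)
  have [measurable]: "(\<lambda>r. indicator (cell a b m k) r :: real) \<in> borel_measurable ?L" for m k
    by (rule measurable_restrict_space1) simp
  note ind = integrable_indicator_cell
  let ?f = "\<lambda>z. X (fst z) (snd z)"
  have fm[measurable]: "?f \<in> borel_measurable (slab M a b)" using progressive_measurable[OF X] ab by simp
  have Bf: "\<bar>?f z\<bar> \<le> B" if "z \<in> space (slab M a b)" for z using B that ab by auto
  have bdd: "A.bdd ?f" unfolding A.bdd_def using Bf fm by blast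
  obtain \<omega>0 where \<omega>0: "\<omega>0 \<in> space M" using not_empty by auto
  have B0: "0 \<le> B" using B[of a \<omega>0] \<omega>0 ab by auto
  have Xm: "(\<lambda>r. X r \<omega>) \<in> borel_measurable ?L" if "\<omega> \<in> space M" for \<omega>
    using measurable_compose[OF measurable_Pair2'[OF that] fm] by simp
  have iX: "integrable ?L (\<lambda>r. indicator (cell a b m k) r * X r \<omega>)" if "\<omega> \<in> space M" for m k \<omega>
  proof (rule L.integrable_const_bound[of _ B])
    note [measurable] = Xm[OF that]
    show "(\<lambda>r. indicator (cell a b m k) r * X r \<omega>) \<in> borel_measurable ?L" by measurable
    show "AE r in ?L. norm (indicator (cell a b m k) r * X r \<omega>) \<le> B"
      using B that ab B0 by (intro AE_I2) (auto simp: indicator_def space_restrict_space)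
  qed
  show pb: "\<bar>prev_avg a b m k X \<omega>\<bar> \<le> B" if k: "k < m" and \<omega>: "\<omega> \<in> space M" for m k \<omega>
  proof (cases "k = 0")
    case False
    have "\<bar>\<integral>r. indicator (cell a b m (k - 1)) r * X r \<omega> \<partial>?L\<bar> \<le> (\<integral>r. \<bar>indicator (cell a b m (k - 1)) r * X r \<omega>\<bar> \<partial>?L)"
      by (rule integral_abs_bound)
    also have "\<dots> \<le> (\<integral>r. indicator (cell a b m (k - 1)) r * B \<partial>?L)"
      using B ab \<omega> by (intro integral_mono integrable_abs iX integrable_mult_left ind)
        (auto simp: indicator_def space_restrict_space)
    also have "\<dots> = (b - a) / real m * B" using integral_indicator_cell[of a b "k - 1" m] ab k by simp
    finally have "real m / (b - a) * \<bar>\<integral>r. indicator (cell a b m (k - 1)) r * X r \<omega> \<partial>?L\<bar> \<le> real m / (b - a) * ((b - a) / real m * B)"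
      using ab by (intro mult_left_mono) auto
    also have "\<dots> = B" using ab k by (simp add: field_simps)
    finally show ?thesis using False ab by (simp add: prev_avg_def abs_mult)
  qed (use B0 in \<open>simp add: prev_avg_def\<close>)
  let ?A = "\<lambda>m z. \<Sum>k<m. indicator (cell a b m k) (fst z) * prev_avg a b m k X (snd z)"
  \<comment> \<open>Summand k of the kernel lives on cell k + 1; the shift of the sum adds the term
    for cell 0, where the average is 0 by definition.\<close>
  have sm: "A.smooth m ?f z = ?A m z" if "z \<in> space (slab M a b)" for m z
  proof (cases m)
    case 0 then show ?thesis by (simp add: A.smooth_def grid_kernel_def)
  next
    case (Suc n)
    have \<omega>: "snd z \<in> space M" using that by auto
    have "A.smooth m ?f z = (\<integral>r. (\<Sum>k<n. (indicator (cell a b m (Suc k)) (fst z) * (real m / (b - a))) *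
        (indicator (cell a b m k) r * X r (snd z))) \<partial>?L)"
      unfolding A.smooth_def grid_kernel_def
      by (intro Bochner_Integration.integral_cong refl) (simp add: Suc sum_distrib_left sum_distrib_right mult_ac)
    also have "\<dots> = (\<Sum>k<n. (indicator (cell a b m (Suc k)) (fst z) * (real m / (b - a))) *
        (\<integral>r. indicator (cell a b m k) r * X r (snd z) \<partial>?L))"
      using iX[OF \<omega>] by simp
    also have "\<dots> = ?A m z"
      unfolding Suc sum.lessThan_Suc_shift by (simp add: prev_avg_def mult_ac)
    finally show ?thesis .
  qed
  have Abd: "\<bar>?A m z\<bar> \<le> B" if "z \<in> space (slab M a b)" for m z
  proof -
    have "\<bar>?A m z\<bar> \<le> (\<Sum>k<m. \<bar>indicator (cell a b m k) (fst z) * prev_avg a b m k X (snd z)\<bar>)"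
      by (rule sum_abs)
    also have "\<dots> \<le> (\<Sum>k<m. indicator (cell a b m k) (fst z) * B)"
      using pb that by (intro sum_mono) (auto simp: indicator_def)
    also have "\<dots> = indicator {a..<grid a b m m} (fst z) * B"
      using ab by (simp add: sum_indicator_cell flip: sum_distrib_right)
    also have "\<dots> \<le> B" using B0 by (simp add: indicator_def)
    finally show ?thesis .
  qed
  have lim: "(\<lambda>m. ennreal (2 * B) * (\<integral>\<^sup>+z. ennreal \<bar>A.smooth m ?f z - ?f z\<bar> \<partial>slab M a b)) \<longlonglongrightarrow> ennreal (2 * B) * 0"
    using A.good_bdd[OF bdd] by (intro ennreal_tendsto_cmult) (auto simp: A.good_def)
  have le: "(\<integral>\<^sup>+z. ennreal ((?A m z - ?f z)\<^sup>2) \<partial>slab M a b)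
      \<le> ennreal (2 * B) * (\<integral>\<^sup>+z. ennreal \<bar>A.smooth m ?f z - ?f z\<bar> \<partial>slab M a b)" for m
  proof -
    have "(\<integral>\<^sup>+z. ennreal ((?A m z - ?f z)\<^sup>2) \<partial>slab M a b) \<le> (\<integral>\<^sup>+z. ennreal (2 * B) * ennreal \<bar>A.smooth m ?f z - ?f z\<bar> \<partial>slab M a b)"
    proof (rule nn_integral_mono)
      fix z assume z: "z \<in> space (slab M a b)"
      have "\<bar>?A m z - ?f z\<bar> \<le> 2 * B" using Abd[OF z, of m] Bf[OF z] by linarith
      then have "\<bar>?A m z - ?f z\<bar> * \<bar>?A m z - ?f z\<bar> \<le> 2 * B * \<bar>?A m z - ?f z\<bar>"
        by (rule mult_right_mono) simp
      then have "(?A m z - ?f z)\<^sup>2 \<le> 2 * B * \<bar>?A m z - ?f z\<bar>" by (simp add: power2_eq_square)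
      then show "ennreal ((?A m z - ?f z)\<^sup>2) \<le> ennreal (2 * B) * ennreal \<bar>A.smooth m ?f z - ?f z\<bar>"
        unfolding sm[OF z] using B0 by (simp add: ennreal_leI flip: ennreal_mult)
    qed
    also have "\<dots> = ennreal (2 * B) * (\<integral>\<^sup>+z. ennreal \<bar>A.smooth m ?f z - ?f z\<bar> \<partial>slab M a b)"
      using A.smooth_measurable[OF bdd] by (intro nn_integral_cmult) auto
    finally show ?thesis .
  qed
  have lim0: "(\<lambda>m. ennreal (2 * B) * (\<integral>\<^sup>+z. ennreal \<bar>A.smooth m ?f z - ?f z\<bar> \<partial>slab M a b)) \<longlonglongrightarrow> 0"
    using lim by simp
  show "(\<lambda>m. \<integral>\<^sup>+z. ennreal ((?A m z - ?f z)\<^sup>2) \<partial>slab M a b) \<longlonglongrightarrow> 0"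
    by (rule tendsto_sandwich[OF always_eventually always_eventually tendsto_const lim0]) (intro allI le zero_le)+
qed

end


section \<open>Hilbert-valued step processes carried along by the semigroup\<close>

lemma nn_integral_lincomb:
  fixes c d :: ennreal
  assumes [measurable]: "f \<in> borel_measurable \<mu>" "g \<in> borel_measurable \<mu>"
  shows "(\<integral>\<^sup>+z. c * f z + d * g z \<partial>\<mu>) = c * (\<integral>\<^sup>+z. f z \<partial>\<mu>) + d * (\<integral>\<^sup>+z. g z \<partial>\<mu>)"
  by (simp add: nn_integral_add nn_integral_cmult)

locale mild_setup = cyl_wiener_space M T \<beta> for M :: "'w measure" and T \<beta> +
  fixes e :: "nat \<Rightarrow> 'h::{real_inner,complete_space,second_countable_topology}"
    and S :: "real \<Rightarrow> 'h \<Rightarrow> 'h" and K :: real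
  assumes basis: "orthonormal_basis e"
    and semigroup: "c0_semigroup S"
    and K_ge_1: "K \<ge> 1"
    and S_le: "\<And>t x. t \<in> {0..T} \<Longrightarrow> norm (S t x) \<le> K * norm x"
begin

lemma S_linear: "0 \<le> t \<Longrightarrow> bounded_linear (S t)"
  using semigroup by (simp add: c0_semigroup_def)

lemma S_0: "S 0 x = x"
  using semigroup by (simp add: c0_semigroup_def)

lemma S_add: "0 \<le> t \<Longrightarrow> 0 \<le> s \<Longrightarrow> S (t + s) x = S t (S s x)"
  using semigroup by (simp add: c0_semigroup_def)

lemma basis_expansion: "(\<lambda>n. \<Sum>i<n. inner x (e i) *\<^sub>R e i) \<longlonglongrightarrow> x"
  using basis by (simp add: orthonormal_basis_def)

lemma norm_basis: "norm (e i) = 1"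
  using basis by (simp add: orthonormal_basis_def norm_eq_sqrt_inner)

text \<open>For a fixed basis vector the orbit is continuous in time; the basis expansion of the
  argument extends measurability to random vectors. Clipping by \<open>max 0\<close> keeps the
  operator bounded and linear for every value of g.\<close>

lemma borel_measurable_semigroup:
  assumes "X \<in> borel_measurable \<mu>" "g \<in> borel_measurable \<mu>"
  shows "(\<lambda>z. S (max 0 (g z)) (X z)) \<in> borel_measurable \<mu>"
proof (rule borel_measurable_apply_operator[OF basis, where K="\<lambda>z. S (max 0 (g z))" and X=X])
  show "(\<lambda>z. S (max 0 (g z)) (e k)) \<in> borel_measurable \<mu>" for k
    using measurable_compose[OF assms(2) borel_measurable_continuous_onI[OF c0_semigroup_continuous[OF semigroup, of "e k"]]] .
qed (use assms in \<open>auto intro: S_linear\<close>)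

lemma progressive_inner:
  "progressive M F T \<Gamma> \<Longrightarrow> progressive M F T (\<lambda>s \<omega>. inner (\<Gamma> s \<omega>) (y :: 'h))"
  by (simp add: progressive_def borel_measurable_inner)

lemma borel_measurable_snd_F:
  "\<zeta> \<in> borel_measurable (F t) \<Longrightarrow> t \<le> T \<Longrightarrow> (\<lambda>z. \<zeta> (snd z)) \<in> borel_measurable (slab M a b)"
  by (rule measurable_compose[OF measurable_snd measurable_F_M])

lemma borel_measurable_indicator_cell [measurable]:
  "(\<lambda>z. indicator (cell a b m k) (fst z) :: real) \<in> borel_measurable (slab M a' b')"
  by (rule measurable_compose[OF measurable_fst measurable_restrict_space1]) simp

text \<open>The process is projected to finitely many coordinates, their number n being fixed by the
  tolerance, and is averaged coordinate by coordinate. As n does not depend on m, the bound n B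
  serves all grids. Quarters of \<epsilon> appear because |u + v|^2 <= 2 |u|^2 + 2 |v|^2.\<close>

lemma vector_approximation:
  assumes \<Gamma>: "progressive M F T \<Gamma>" and ab: "0 \<le> a" "a < b" "b \<le> T"
    and B: "\<And>s \<omega>. s \<in> {0..T} \<Longrightarrow> \<omega> \<in> space M \<Longrightarrow> norm (\<Gamma> s \<omega> :: 'h) \<le> B"
    and \<epsilon>: "\<epsilon> > 0"
  obtains B' \<zeta> where "\<And>m k. k < m \<Longrightarrow> \<zeta> m k \<in> borel_measurable (F (grid a b m k))"
    "\<And>m k \<omega>. k < m \<Longrightarrow> \<omega> \<in> space M \<Longrightarrow> norm (\<zeta> m k \<omega>) \<le> B'"
    "\<forall>\<^sub>F m in sequentially. (\<integral>\<^sup>+z. ennreal ((norm ((\<Sum>k<m. indicator (cell a b m k) (fst z) *\<^sub>R \<zeta> m k (snd z))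
        - \<Gamma> (fst z) (snd z)))\<^sup>2) \<partial>slab M a b) < ennreal \<epsilon>"
proof -
  interpret N: finite_measure "slab M a b" by (rule finite_measure_slab) unfold_locales
  let ?G = "\<lambda>z. \<Gamma> (fst z) (snd z)"
  have Gm[measurable]: "?G \<in> borel_measurable (slab M a b)" using progressive_measurable[OF \<Gamma>] ab by simp
  have BG: "norm (?G z) \<le> B" if "z \<in> space (slab M a b)" for z
    using B that ab by (auto simp: space_pair_measure space_restrict_space)
  define G' where "G' n z = (\<Sum>l<n. inner (?G z) (e l) *\<^sub>R e l)" for n z
  have G'm[measurable]: "G' n \<in> borel_measurable (slab M a b)" for n unfolding G'_def by measurable
  have "(\<lambda>n. \<integral>\<^sup>+z. ennreal ((norm (G' n z - ?G z))\<^sup>2) \<partial>slab M a b) \<longlonglongrightarrow> (\<integral>\<^sup>+z. 0 \<partial>slab M a b)"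
  proof (rule nn_integral_dominated_convergence[where w="\<lambda>_. ennreal ((2 * B)\<^sup>2)"])
    show "AE z in slab M a b. ennreal ((norm (G' n z - ?G z))\<^sup>2) \<le> ennreal ((2 * B)\<^sup>2)" for n
    proof (rule AE_I2)
      fix z assume z: "z \<in> space (slab M a b)"
      have "norm (G' n z - ?G z) \<le> norm (G' n z) + norm (?G z)" by (rule norm_triangle_ineq4)
      also have "\<dots> \<le> 2 * B" using bessel_inequality[OF basis, of "?G z" n] BG[OF z] by (simp add: G'_def)
      finally show "ennreal ((norm (G' n z - ?G z))\<^sup>2) \<le> ennreal ((2 * B)\<^sup>2)"
        by (intro ennreal_leI power_mono) auto
    qed
    show "(\<integral>\<^sup>+z. ennreal ((2 * B)\<^sup>2) \<partial>slab M a b) < \<infinity>"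
      using N.emeasure_finite[of "space (slab M a b)"] by (simp add: ennreal_mult_eq_top_iff less_top[symmetric])
    show "AE z in slab M a b. (\<lambda>n. ennreal ((norm (G' n z - ?G z))\<^sup>2)) \<longlonglongrightarrow> 0"
    proof (rule AE_I2)
      fix z
      have "(\<lambda>n. (norm (G' n z - ?G z))\<^sup>2) \<longlonglongrightarrow> (norm (?G z - ?G z))\<^sup>2"
        unfolding G'_def by (intro tendsto_intros basis_expansion)
      then show "(\<lambda>n. ennreal ((norm (G' n z - ?G z))\<^sup>2)) \<longlonglongrightarrow> 0"
        using tendsto_ennrealI by fastforce
    qed
  qed measurable
  then have "(\<lambda>n. \<integral>\<^sup>+z. ennreal ((norm (G' n z - ?G z))\<^sup>2) \<partial>slab M a b) \<longlonglongrightarrow> 0" by simp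
  then have "\<forall>\<^sub>F n in sequentially. (\<integral>\<^sup>+z. ennreal ((norm (G' n z - ?G z))\<^sup>2) \<partial>slab M a b) < ennreal (\<epsilon> / 4)"
    by (rule order_tendstoD) (use \<epsilon> in simp)
  then obtain n where n: "(\<integral>\<^sup>+z. ennreal ((norm (G' n z - ?G z))\<^sup>2) \<partial>slab M a b) < ennreal (\<epsilon> / 4)"
    by (auto simp: eventually_sequentially)
  define X where "X l s \<omega> = inner (\<Gamma> s \<omega>) (e l)" for l s \<omega>
  have Xp: "progressive M F T (X l)" for l unfolding X_def by (rule progressive_inner[OF \<Gamma>])
  have XB: "\<bar>X l s \<omega>\<bar> \<le> B" if "s \<in> {0..T}" "\<omega> \<in> space M" for l s \<omega>
    using Cauchy_Schwarz_ineq2[of "\<Gamma> s \<omega>" "e l"] B[OF that] by (simp add: X_def norm_basis)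
  define \<zeta> where "\<zeta> m k \<omega> = (\<Sum>l<n. prev_avg a b m k (X l) \<omega> *\<^sub>R e l)" for m k \<omega>
  note pm = prev_avg_measurable[OF Xp ab]
  have pB: "\<bar>prev_avg a b m k (X l) \<omega>\<bar> \<le> B" if "k < m" "\<omega> \<in> space M" for m k l \<omega>
    by (rule scalar_approximation(1)[OF Xp ab _ that]) (rule XB)
  have pl: "(\<lambda>m. \<integral>\<^sup>+z. ennreal (((\<Sum>k<m. indicator (cell a b m k) (fst z) * prev_avg a b m k (X l) (snd z))
        - X l (fst z) (snd z))\<^sup>2) \<partial>slab M a b) \<longlonglongrightarrow> 0" for l
    by (rule scalar_approximation(2)[OF Xp ab]) (rule XB)
  show thesis
  proof (rule that)
    show \<zeta>m: "\<zeta> m k \<in> borel_measurable (F (grid a b m k))" if "k < m" for m k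
      unfolding \<zeta>_def[abs_def] using pm[OF that] by (intro borel_measurable_sum borel_measurable_scaleR) auto
    show "norm (\<zeta> m k \<omega>) \<le> real n * B" if "k < m" "\<omega> \<in> space M" for m k \<omega>
    proof -
      have "norm (\<zeta> m k \<omega>) \<le> (\<Sum>l<n. norm (prev_avg a b m k (X l) \<omega> *\<^sub>R e l))"
        unfolding \<zeta>_def by (rule norm_sum)
      also have "\<dots> \<le> (\<Sum>l<n. B)" using pB[OF that] by (intro sum_mono) (simp add: norm_basis)
      finally show ?thesis by simp
    qed
    let ?A = "\<lambda>m l z. \<Sum>k<m. indicator (cell a b m k) (fst z) * prev_avg a b m k (X l) (snd z)"
    let ?Z = "\<lambda>m z. \<Sum>k<m. indicator (cell a b m k) (fst z) *\<^sub>R \<zeta> m k (snd z)"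
    have Am[measurable]: "?A m l \<in> borel_measurable (slab M a b)" for m l
    proof (intro borel_measurable_sum borel_measurable_times borel_measurable_indicator_cell)
      fix k assume "k \<in> {..<m}"
      then have k: "k < m" by simp
      show "(\<lambda>z. prev_avg a b m k (X l) (snd z)) \<in> borel_measurable (slab M a b)"
        by (rule borel_measurable_snd_F[OF pm[OF k]]) (use grid_bounds[of a b k m] ab k in auto)
    qed
    have ZA: "?Z m z = (\<Sum>l<n. ?A m l z *\<^sub>R e l)" for m z
    proof -
      have "?Z m z = (\<Sum>k<m. \<Sum>l<n. (indicator (cell a b m k) (fst z) * prev_avg a b m k (X l) (snd z)) *\<^sub>R e l)"
        unfolding \<zeta>_def by (simp add: scaleR_sum_right)
      also have "\<dots> = (\<Sum>l<n. \<Sum>k<m. (indicator (cell a b m k) (fst z) * prev_avg a b m k (X l) (snd z)) *\<^sub>R e l)"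
        by (rule sum.swap)
      finally show ?thesis by (simp only: scaleR_sum_left)
    qed
    have Zm[measurable]: "?Z m \<in> borel_measurable (slab M a b)" for m
      unfolding ZA by measurable
    \<comment> \<open>By orthonormality the squared error is the sum of the n scalar errors, so
      scalar convergence is enough.\<close>
    have sq: "(norm (?Z m z - G' n z))\<^sup>2 = (\<Sum>l<n. (?A m l z - X l (fst z) (snd z))\<^sup>2)" for m z
    proof -
      have "?Z m z - G' n z = (\<Sum>l<n. (?A m l z - X l (fst z) (snd z)) *\<^sub>R e l)"
        unfolding ZA G'_def X_def by (simp add: sum_subtractf scaleR_diff_left)
      then show ?thesis using norm_sum_orthonormal[OF basis finite_lessThan] by simp
    qed
    have Xm[measurable]: "(\<lambda>z. X l (fst z) (snd z)) \<in> borel_measurable (slab M a b)" for l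
      unfolding X_def by measurable
    have "(\<lambda>m. \<Sum>l<n. \<integral>\<^sup>+z. ennreal ((?A m l z - X l (fst z) (snd z))\<^sup>2) \<partial>slab M a b) \<longlonglongrightarrow> (\<Sum>l<n. 0)"
      by (intro tendsto_sum pl)
    moreover have "(\<integral>\<^sup>+z. ennreal ((norm (?Z m z - G' n z))\<^sup>2) \<partial>slab M a b)
        = (\<Sum>l<n. \<integral>\<^sup>+z. ennreal ((?A m l z - X l (fst z) (snd z))\<^sup>2) \<partial>slab M a b)" for m
    proof -
      have "(\<integral>\<^sup>+z. ennreal ((norm (?Z m z - G' n z))\<^sup>2) \<partial>slab M a b)
          = (\<integral>\<^sup>+z. (\<Sum>l<n. ennreal ((?A m l z - X l (fst z) (snd z))\<^sup>2)) \<partial>slab M a b)"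
        unfolding sq by (intro nn_integral_cong sum_ennreal[symmetric] zero_le_power2)
      also have "\<dots> = (\<Sum>l<n. \<integral>\<^sup>+z. ennreal ((?A m l z - X l (fst z) (snd z))\<^sup>2) \<partial>slab M a b)"
        by (rule nn_integral_sum) measurable
      finally show ?thesis .
    qed
    ultimately have "(\<lambda>m. \<integral>\<^sup>+z. ennreal ((norm (?Z m z - G' n z))\<^sup>2) \<partial>slab M a b) \<longlonglongrightarrow> 0" by simp
    then have "\<forall>\<^sub>F m in sequentially. (\<integral>\<^sup>+z. ennreal ((norm (?Z m z - G' n z))\<^sup>2) \<partial>slab M a b) < ennreal (\<epsilon> / 4)"
      by (rule order_tendstoD) (use \<epsilon> in simp)
    then show "\<forall>\<^sub>F m in sequentially. (\<integral>\<^sup>+z. ennreal ((norm (?Z m z - ?G z))\<^sup>2) \<partial>slab M a b) < ennreal \<epsilon>"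
    proof eventually_elim
      case (elim m)
      have "(\<integral>\<^sup>+z. ennreal ((norm (?Z m z - ?G z))\<^sup>2) \<partial>slab M a b)
          \<le> (\<integral>\<^sup>+z. 2 * ennreal ((norm (?Z m z - G' n z))\<^sup>2) + 2 * ennreal ((norm (G' n z - ?G z))\<^sup>2) \<partial>slab M a b)"
      proof (rule nn_integral_mono)
        fix z
        show "ennreal ((norm (?Z m z - ?G z))\<^sup>2) \<le> 2 * ennreal ((norm (?Z m z - G' n z))\<^sup>2) + 2 * ennreal ((norm (G' n z - ?G z))\<^sup>2)"
          using norm_add_power2_le[of "?Z m z - G' n z" "G' n z - ?G z"]
          by (simp add: ennreal_leI flip: ennreal_numeral ennreal_mult ennreal_plus)
      qed
      also have "\<dots> = 2 * (\<integral>\<^sup>+z. ennreal ((norm (?Z m z - G' n z))\<^sup>2) \<partial>slab M a b)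
          + 2 * (\<integral>\<^sup>+z. ennreal ((norm (G' n z - ?G z))\<^sup>2) \<partial>slab M a b)"
        by (rule nn_integral_lincomb) measurable
      also have "\<dots> < ennreal (\<epsilon> / 2) + ennreal (\<epsilon> / 2)"
      proof (rule add_strict_mono)
        have *: "2 * x < ennreal (\<epsilon> / 2)" if "x < ennreal (\<epsilon> / 4)" for x
        proof -
          have "2 * x < 2 * ennreal (\<epsilon> / 4)"
            using that by (intro ennreal_mult_strict_left_mono) auto
          also have "\<dots> = ennreal (\<epsilon> / 2)"
            using \<epsilon> by (simp flip: ennreal_numeral ennreal_mult)
          finally show ?thesis .
        qed
        show "2 * (\<integral>\<^sup>+z. ennreal ((norm (?Z m z - G' n z))\<^sup>2) \<partial>slab M a b) < ennreal (\<epsilon> / 2)" by (rule *[OF elim])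
        show "2 * (\<integral>\<^sup>+z. ennreal ((norm (G' n z - ?G z))\<^sup>2) \<partial>slab M a b) < ennreal (\<epsilon> / 2)" by (rule *[OF n])
      qed
      also have "\<dots> = ennreal \<epsilon>" using \<epsilon> by (simp flip: ennreal_plus)
      finally show ?case .
    qed
  qed
qed

text \<open>Before b exactly one cell is active, and the sum reduces to \<open>S h\<close> with h at
  most the mesh. Strong continuity at 0 gives pointwise convergence, and the bound K gives the
  dominating constant.\<close>

lemma semigroup_step_tendsto:
  assumes \<Gamma>: "progressive M F T \<Gamma>" and ab: "0 \<le> a" "a < b" "b \<le> T"
    and B: "\<And>s \<omega>. s \<in> {0..T} \<Longrightarrow> \<omega> \<in> space M \<Longrightarrow> norm (\<Gamma> s \<omega> :: 'h) \<le> B"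
  shows "(\<lambda>m. \<integral>\<^sup>+z. ennreal ((norm ((\<Sum>k<m. indicator (cell a b m k) (fst z) *\<^sub>R S (max 0 (fst z - grid a b m k)) (\<Gamma> (fst z) (snd z)))
        - \<Gamma> (fst z) (snd z)))\<^sup>2) \<partial>slab M a b) \<longlonglongrightarrow> 0"
proof -
  interpret N: finite_measure "slab M a b" by (rule finite_measure_slab) unfold_locales
  let ?G = "\<lambda>z. \<Gamma> (fst z) (snd z)"
  let ?V = "\<lambda>m z. \<Sum>k<m. indicator (cell a b m k) (fst z) *\<^sub>R S (max 0 (fst z - grid a b m k)) (?G z)"
  have Gm[measurable]: "?G \<in> borel_measurable (slab M a b)" using progressive_measurable[OF \<Gamma>] ab by simp
  have fst_m: "(\<lambda>z. fst z - u) \<in> borel_measurable (slab M a b)" for u :: real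
    by (rule measurable_compose[OF measurable_fst measurable_restrict_space1]) simp
  have Vm[measurable]: "?V m \<in> borel_measurable (slab M a b)" for m
    by (intro borel_measurable_sum borel_measurable_scaleR borel_measurable_indicator_cell borel_measurable_semigroup Gm fst_m)
  have "(\<lambda>m. \<integral>\<^sup>+z. ennreal ((norm (?V m z - ?G z))\<^sup>2) \<partial>slab M a b) \<longlonglongrightarrow> (\<integral>\<^sup>+z. 0 \<partial>slab M a b)"
  proof (rule nn_integral_dominated_convergence[where w="\<lambda>_. ennreal ((K * B + B)\<^sup>2)"])
    have V: "\<exists>h. 0 \<le> h \<and> h \<le> (b - a) / real m \<and> ?V m z = S h (?G z)"
      if z: "z \<in> space (slab M a b)" "fst z \<noteq> b" and m: "m > 0" for m z
    proof -
      have "fst z \<in> {a..<b}" using z by (auto simp: space_pair_measure space_restrict_space)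
      then obtain k where k: "k < m" "fst z \<in> cell a b m k" using cell_exists[of a b m "fst z"] ab m by auto
      have "?V m z = S (max 0 (fst z - grid a b m k)) (?G z)"
        using ab k by (intro sum_cell_collapse) auto
      moreover have "fst z - grid a b m k \<le> (b - a) / real m" "0 \<le> fst z - grid a b m k"
        using k(2) by (auto simp: cell_def grid_Suc)
      ultimately show ?thesis by (intro exI[of _ "fst z - grid a b m k"]) (simp add: max_def)
    qed
    show "AE z in slab M a b. ennreal ((norm (?V m z - ?G z))\<^sup>2) \<le> ennreal ((K * B + B)\<^sup>2)" for m
      using AE_slab_fst_neq[OF prob_space_axioms, of b a b] AE_space
    proof eventually_elim
      case (elim z)
      have GB: "norm (?G z) \<le> B" using B[of "fst z" "snd z"] elim ab by (auto simp: space_pair_measure space_restrict_space)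
      then have B0: "0 \<le> B" using norm_ge_zero order_trans by blast
      have KB: "0 \<le> K * B" using K_ge_1 B0 by simp
      have "norm (?V m z) \<le> K * B"
      proof (cases "m = 0")
        case False
        then obtain h where h: "0 \<le> h" "h \<le> (b - a) / real m" "?V m z = S h (?G z)" using V[OF elim(2,1), of m] by auto
        have "(b - a) / real m \<le> (b - a) / 1" by (rule divide_left_mono) (use ab False in auto)
        then have "norm (?V m z) \<le> K * norm (?G z)" using h S_le[of h] ab by simp
        also have "\<dots> \<le> K * B" using GB K_ge_1 by (intro mult_left_mono) auto
        finally show ?thesis .
      qed (use KB in simp)
      then have "norm (?V m z - ?G z) \<le> K * B + B" using GB norm_triangle_ineq4[of "?V m z" "?G z"] by linarith
      then show ?case by (intro ennreal_leI power_mono) auto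
    qed
    show "AE z in slab M a b. (\<lambda>m. ennreal ((norm (?V m z - ?G z))\<^sup>2)) \<longlonglongrightarrow> 0"
      using AE_slab_fst_neq[OF prob_space_axioms, of b a b] AE_space
    proof eventually_elim
      case (elim z)
      have "(\<lambda>m. ?V m z) \<longlonglongrightarrow> ?G z"
      proof (rule metric_LIMSEQ_I)
        fix r :: real assume r: "r > 0"
        have "isCont (\<lambda>t. S (max 0 t) (?G z)) 0"
          using c0_semigroup_continuous[OF semigroup, of "?G z"] by (simp add: continuous_on_eq_continuous_at)
        then obtain d where d: "d > 0" "\<And>t. dist t 0 < d \<Longrightarrow> dist (S (max 0 t) (?G z)) (S (max 0 0) (?G z)) < r"
          using r unfolding continuous_at_eps_delta by metis
        have "(\<lambda>m. (b - a) / real m) \<longlonglongrightarrow> 0" by (rule lim_const_over_n)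
        then have "\<forall>\<^sub>F m in sequentially. (b - a) / real m < d" by (rule order_tendstoD) (rule d)
        then obtain m0 where m0: "\<And>m. m \<ge> m0 \<Longrightarrow> (b - a) / real m < d" by (auto simp: eventually_sequentially)
        have "dist (?V m z) (?G z) < r" if m: "m \<ge> max 1 m0" for m
        proof -
          obtain h where h: "0 \<le> h" "h \<le> (b - a) / real m" "?V m z = S h (?G z)" using V[OF elim(2,1), of m] m by auto
          have "dist h 0 < d" using h m0[of m] m by (simp add: dist_real_def)
          from d(2)[OF this] show ?thesis using h by (simp add: S_0 max_def)
        qed
        then show "\<exists>no. \<forall>m\<ge>no. dist (?V m z) (?G z) < r" by blast
      qed
      then have "(\<lambda>m. (norm (?V m z - ?G z))\<^sup>2) \<longlonglongrightarrow> (norm (?G z - ?G z))\<^sup>2" by (intro tendsto_intros)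
      from tendsto_ennrealI[OF this] show ?case by simp
    qed
    show "(\<integral>\<^sup>+z. ennreal ((K * B + B)\<^sup>2) \<partial>slab M a b) < \<infinity>"
      using N.emeasure_finite[of "space (slab M a b)"] by (simp add: ennreal_mult_eq_top_iff less_top[symmetric])
  qed measurable
  then show ?thesis by simp
qed

text \<open>The dual identity pairs with processes of the form S (s - u) \<zeta> after time u, not
  with \<zeta> itself, so these must be dense. Applying S to the coefficients costs a factor K^2 on
  the error of \<open>vector_approximation\<close>, in addition to the error of
  \<open>semigroup_step_tendsto\<close>.\<close>

lemma semigroup_approximation:
  assumes \<Gamma>: "progressive M F T \<Gamma>" and ab: "0 \<le> a" "a < b" "b \<le> T"
    and B: "\<And>s \<omega>. s \<in> {0..T} \<Longrightarrow> \<omega> \<in> space M \<Longrightarrow> norm (\<Gamma> s \<omega> :: 'h) \<le> B"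
    and \<epsilon>: "\<epsilon> > 0"
  obtains B' \<zeta> where "\<And>m k. k < m \<Longrightarrow> \<zeta> m k \<in> borel_measurable (F (grid a b m k))"
    "\<And>m k \<omega>. k < m \<Longrightarrow> \<omega> \<in> space M \<Longrightarrow> norm (\<zeta> m k \<omega>) \<le> B'"
    "\<forall>\<^sub>F m in sequentially. (\<integral>\<^sup>+z. ennreal ((norm ((\<Sum>k<m. indicator (cell a b m k) (fst z) *\<^sub>R
        S (max 0 (fst z - grid a b m k)) (\<zeta> m k (snd z))) - \<Gamma> (fst z) (snd z)))\<^sup>2) \<partial>slab M a b) < ennreal \<epsilon>"
proof -
  let ?G = "\<lambda>z. \<Gamma> (fst z) (snd z)"
  let ?V = "\<lambda>m z. \<Sum>k<m. indicator (cell a b m k) (fst z) *\<^sub>R S (max 0 (fst z - grid a b m k)) (?G z)"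
  \<comment> \<open>The factor K^2 is lost when S acts on a difference, and 2 when a sum is squared;
    each of the two errors then stays below \<epsilon> / 2.\<close>
  define \<delta> where "\<delta> = \<epsilon> / (4 * K\<^sup>2)"
  have \<delta>: "\<delta> > 0" using \<epsilon> K_ge_1 by (simp add: \<delta>_def)
  obtain B' \<zeta> where \<zeta>m: "\<And>m k. k < m \<Longrightarrow> \<zeta> m k \<in> borel_measurable (F (grid a b m k))"
    and \<zeta>B: "\<And>m k \<omega>. k < m \<Longrightarrow> \<omega> \<in> space M \<Longrightarrow> norm (\<zeta> m k \<omega>) \<le> B'"
    and ev: "\<forall>\<^sub>F m in sequentially. (\<integral>\<^sup>+z. ennreal ((norm ((\<Sum>k<m. indicator (cell a b m k) (fst z) *\<^sub>R \<zeta> m k (snd z))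
        - ?G z))\<^sup>2) \<partial>slab M a b) < ennreal \<delta>"
    by (rule vector_approximation[OF \<Gamma> ab _ \<delta>, of B]) (rule B, assumption, assumption, rule that, assumption+)
  let ?Z = "\<lambda>m z. \<Sum>k<m. indicator (cell a b m k) (fst z) *\<^sub>R \<zeta> m k (snd z)"
  let ?Y = "\<lambda>m z. \<Sum>k<m. indicator (cell a b m k) (fst z) *\<^sub>R S (max 0 (fst z - grid a b m k)) (\<zeta> m k (snd z))"
  have Gm[measurable]: "?G \<in> borel_measurable (slab M a b)" using progressive_measurable[OF \<Gamma>] ab by simp
  have fst_m: "(\<lambda>z. fst z - u) \<in> borel_measurable (slab M a b)" for u :: real
    by (rule measurable_compose[OF measurable_fst measurable_restrict_space1]) simp
  have Vm[measurable]: "?V m \<in> borel_measurable (slab M a b)" for m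
    by (intro borel_measurable_sum borel_measurable_scaleR borel_measurable_indicator_cell borel_measurable_semigroup Gm fst_m)
  have \<zeta>s: "(\<lambda>z. \<zeta> m k (snd z)) \<in> borel_measurable (slab M a b)" if "k < m" for m k
    by (rule borel_measurable_snd_F[OF \<zeta>m[OF that]]) (use grid_bounds[of a b k m] ab that in auto)
  have Zm[measurable]: "?Z m \<in> borel_measurable (slab M a b)" for m
    by (intro borel_measurable_sum borel_measurable_scaleR borel_measurable_indicator_cell \<zeta>s) auto
  have Ym[measurable]: "?Y m \<in> borel_measurable (slab M a b)" for m
    by (intro borel_measurable_sum borel_measurable_scaleR borel_measurable_indicator_cell borel_measurable_semigroup \<zeta>s fst_m) auto
  have evV: "\<forall>\<^sub>F m in sequentially. (\<integral>\<^sup>+z. ennreal ((norm (?V m z - ?G z))\<^sup>2) \<partial>slab M a b) < ennreal (\<epsilon> / 4)"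
    by (rule order_tendstoD[OF semigroup_step_tendsto[OF \<Gamma> ab B]]) (use \<epsilon> in simp_all)
  have "\<forall>\<^sub>F m in sequentially. (\<integral>\<^sup>+z. ennreal ((norm (?Y m z - ?G z))\<^sup>2) \<partial>slab M a b) < ennreal \<epsilon>"
    using ev evV eventually_gt_at_top[of 0]
  proof eventually_elim
    case (elim m)
    have "(\<integral>\<^sup>+z. ennreal ((norm (?Y m z - ?G z))\<^sup>2) \<partial>slab M a b)
        \<le> (\<integral>\<^sup>+z. ennreal (2 * K\<^sup>2) * ennreal ((norm (?Z m z - ?G z))\<^sup>2) + 2 * ennreal ((norm (?V m z - ?G z))\<^sup>2) \<partial>slab M a b)"
    proof (rule nn_integral_mono_AE)
      show "AE z in slab M a b. ennreal ((norm (?Y m z - ?G z))\<^sup>2)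
          \<le> ennreal (2 * K\<^sup>2) * ennreal ((norm (?Z m z - ?G z))\<^sup>2) + 2 * ennreal ((norm (?V m z - ?G z))\<^sup>2)"
        using AE_slab_fst_neq[OF prob_space_axioms, of b a b] AE_space
      proof eventually_elim
        case (elim z)
        have "fst z \<in> {a..<b}" using elim by (auto simp: space_pair_measure space_restrict_space)
        then obtain k where k: "k < m" "fst z \<in> cell a b m k"
          using cell_exists[of a b m "fst z"] ab \<open>0 < m\<close> by auto
        define h where "h = fst z - grid a b m k"
        have h: "0 \<le> h" "h \<le> T"
          using k(2) grid_bounds[of a b k m] grid_bounds[of a b "Suc k" m] ab k(1) by (auto simp: cell_def h_def)
        interpret Sh: bounded_linear "S h" by (rule S_linear[OF h(1)])
        have Y: "?Y m z = S h (\<zeta> m k (snd z))" and V: "?V m z = S h (?G z)" and Z: "?Z m z = \<zeta> m k (snd z)"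
        proof -
          have "max 0 (fst z - grid a b m k) = h" using h by (simp add: h_def)
          then show "?Y m z = S h (\<zeta> m k (snd z))" "?V m z = S h (?G z)" "?Z m z = \<zeta> m k (snd z)"
            by (simp_all only: sum_cell_collapse[OF less_imp_le[OF ab(2)] k])
        qed
        have "norm (S h (\<zeta> m k (snd z)) - S h (?G z)) \<le> K * norm (?Z m z - ?G z)"
          using S_le[of h "\<zeta> m k (snd z) - ?G z"] h by (simp add: Sh.diff Z)
        from power_mono[OF this norm_ge_zero, of 2]
        have "(norm (?Y m z - ?V m z))\<^sup>2 \<le> K\<^sup>2 * (norm (?Z m z - ?G z))\<^sup>2"
          unfolding Y V by (simp add: power_mult_distrib)
        with norm_add_power2_le[of "?Y m z - ?V m z" "?V m z - ?G z"]
        have "(norm (?Y m z - ?G z))\<^sup>2 \<le> 2 * K\<^sup>2 * (norm (?Z m z - ?G z))\<^sup>2 + 2 * (norm (?V m z - ?G z))\<^sup>2"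
          by simp
        from ennreal_leI[OF this] show ?case
          by (simp add: ennreal_mult)
      qed
    qed
    also have "\<dots> = ennreal (2 * K\<^sup>2) * (\<integral>\<^sup>+z. ennreal ((norm (?Z m z - ?G z))\<^sup>2) \<partial>slab M a b)
        + 2 * (\<integral>\<^sup>+z. ennreal ((norm (?V m z - ?G z))\<^sup>2) \<partial>slab M a b)"
      by (rule nn_integral_lincomb) measurable
    also have "\<dots> < ennreal (\<epsilon> / 2) + ennreal (\<epsilon> / 2)"
    proof (rule add_strict_mono)
      have "ennreal (2 * K\<^sup>2) * (\<integral>\<^sup>+z. ennreal ((norm (?Z m z - ?G z))\<^sup>2) \<partial>slab M a b) < ennreal (2 * K\<^sup>2) * ennreal \<delta>"
        using elim(1) K_ge_1 by (intro ennreal_mult_strict_left_mono) auto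
      also have "\<dots> = ennreal (\<epsilon> / 2)"
        using K_ge_1 \<delta> by (simp add: \<delta>_def field_simps flip: ennreal_mult)
      finally show "ennreal (2 * K\<^sup>2) * (\<integral>\<^sup>+z. ennreal ((norm (?Z m z - ?G z))\<^sup>2) \<partial>slab M a b) < ennreal (\<epsilon> / 2)" .
      have "2 * (\<integral>\<^sup>+z. ennreal ((norm (?V m z - ?G z))\<^sup>2) \<partial>slab M a b) < 2 * ennreal (\<epsilon> / 4)"
        using elim(2) by (intro ennreal_mult_strict_left_mono) auto
      also have "\<dots> = ennreal (\<epsilon> / 2)" using \<epsilon> by (simp flip: ennreal_numeral ennreal_mult)
      finally show "2 * (\<integral>\<^sup>+z. ennreal ((norm (?V m z - ?G z))\<^sup>2) \<partial>slab M a b) < ennreal (\<epsilon> / 2)" .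
    qed
    also have "\<dots> = ennreal \<epsilon>" using \<epsilon> by (simp flip: ennreal_plus)
    finally show ?case .
  qed
  with \<zeta>m \<zeta>B show thesis by (rule that)
qed

end

section \<open>Pairings with stochastic and time integrals\<close>


lemma integral_slab_product:
  assumes M: "prob_space M" and Z: "Z \<in> borel_measurable M" "\<And>\<omega>. \<omega> \<in> space M \<Longrightarrow> \<bar>Z \<omega>\<bar> \<le> B"
    and I: "I \<in> sets borel"
  shows "integrable (slab M a b) (\<lambda>z. indicator I (fst z) * (Z (snd z) :: real))"
    and "(\<integral>z. indicator I (fst z) * Z (snd z) \<partial>slab M a b) = measure lborel (I \<inter> {a..b}) * (\<integral>\<omega>. Z \<omega> \<partial>M)"
proof -
  interpret M: prob_space M by fact
  interpret LM: pair_sigma_finite "restrict_space lborel {a..b}" M by (rule pair_sigma_finite_slab[OF M])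
  interpret N: finite_measure "slab M a b" by (rule finite_measure_slab[OF M])
  have [measurable]: "(\<lambda>z. indicator I (fst z) :: real) \<in> borel_measurable (slab M a b)"
    by (rule measurable_compose[OF measurable_fst measurable_restrict_space1]) (use I in simp)
  have [measurable]: "(\<lambda>z. Z (snd z)) \<in> borel_measurable (slab M a b)"
    by (rule measurable_compose[OF measurable_snd Z(1)])
  obtain \<omega>0 where "\<omega>0 \<in> space M" using M.not_empty by auto
  then have B: "0 \<le> B" using Z(2)[of \<omega>0] by linarith
  show int: "integrable (slab M a b) (\<lambda>z. indicator I (fst z) * Z (snd z))"
  proof (rule N.integrable_const_bound[of _ B])
    show "AE z in slab M a b. norm (indicator I (fst z) * Z (snd z)) \<le> B"
      using Z(2) B by (intro AE_I2) (auto simp: indicator_def space_pair_measure)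
  qed measurable
  have "(\<integral>z. indicator I (fst z) * Z (snd z) \<partial>slab M a b)
      = (\<integral>s. (\<integral>\<omega>. indicator I s * Z \<omega> \<partial>M) \<partial>restrict_space lborel {a..b})"
    using LM.integral_fst'[OF int] by simp
  also have "\<dots> = (\<integral>s. indicator I s \<partial>restrict_space lborel {a..b}) * (\<integral>\<omega>. Z \<omega> \<partial>M)" by simp
  also have "(\<integral>s. indicator I s \<partial>restrict_space lborel {a..b}) = (\<integral>s. indicator {a..b} s *\<^sub>R (indicator I s :: real) \<partial>lborel)"
    by (rule integral_restrict_space) simp
  also have "\<dots> = (\<integral>s. indicator (I \<inter> {a..b}) s \<partial>lborel)"
    by (intro Bochner_Integration.integral_cong refl) (auto simp: indicator_def)
  also have "\<dots> = measure lborel (I \<inter> {a..b})" by simp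
  finally show "(\<integral>z. indicator I (fst z) * Z (snd z) \<partial>slab M a b) = measure lborel (I \<inter> {a..b}) * (\<integral>\<omega>. Z \<omega> \<partial>M)" .
qed

lemma measure_Ico_Int_Ico: "measure lborel ({p..<q} \<inter> {u..<v}) = max 0 (min q v - max p (u::real))"
proof -
  have eq: "{p..<q} \<inter> {u..<v} = {max p u..<min q v}" by auto
  show ?thesis unfolding eq
    by (cases "max p u \<le> min q v") auto
qed

lemma L2_snd:
  assumes M: "prob_space M" and Y: "L2 M Y"
  shows "L2 (slab M a b) (\<lambda>z. Y (snd z))"
proof -
  interpret M: prob_space M by fact
  interpret L: finite_measure "restrict_space lborel {a..b}" by (rule finite_measure_Icc)
  note [measurable] = L2_measurable[OF Y]
  have m: "(\<lambda>z. Y (snd z)) \<in> borel_measurable (slab M a b)"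
    by (rule measurable_compose[OF measurable_snd]) measurable
  have "(\<integral>\<^sup>+z. ennreal ((norm (Y (snd z)))\<^sup>2) \<partial>slab M a b)
      = (\<integral>\<^sup>+s. (\<integral>\<^sup>+\<omega>. ennreal ((norm (Y \<omega>))\<^sup>2) \<partial>M) \<partial>restrict_space lborel {a..b})"
    using m by (subst M.nn_integral_fst[symmetric]) auto
  also have "\<dots> = (\<integral>\<^sup>+\<omega>. ennreal ((norm (Y \<omega>))\<^sup>2) \<partial>M) * emeasure (restrict_space lborel {a..b}) (space (restrict_space lborel {a..b}))"
    by simp
  also have "\<dots> < \<infinity>"
    using Y L.emeasure_finite[of "space (restrict_space lborel {a..b})"]
    by (simp add: L2_def ennreal_mult_eq_top_iff less_top[symmetric])
  finally show ?thesis using m by (simp add: L2_def)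
qed

lemma simple_proc_indicator:
  "simple_proc ts n \<xi> s \<omega> = (\<Sum>k<n. indicator {ts k..<ts (Suc k)} s *\<^sub>R \<xi> k \<omega>)"
  unfolding simple_proc_def by (intro sum.cong refl) (simp add: indicator_def)

lemma simple_adapted_mono:
  assumes "simple_adapted M F a c ts n \<xi>" "j \<le> k" "k \<le> n"
  shows "ts j \<le> ts k"
  using assms(2,3)
proof (induction k)
  case (Suc k)
  show ?case
  proof (cases "j = Suc k")
    case False
    then have "ts j \<le> ts k" using Suc by simp
    also have "ts k \<le> ts (Suc k)" using assms(1) Suc by (simp add: simple_adapted_def less_imp_le)
    finally show ?thesis .
  qed simp
qed simp

lemma simple_adapted_bounds:
  assumes "simple_adapted M F a c ts n \<xi>" "k \<le> n"
  shows "a \<le> ts k" "ts k \<le> c"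
  using simple_adapted_mono[OF assms(1), of 0 k] simple_adapted_mono[OF assms(1), of k n] assms
  by (auto simp: simple_adapted_def)

context cyl_wiener_space begin

lemma L2_incr_scaleR:
  assumes t: "0 \<le> a" "a \<le> b" "b \<le> T"
    and Z: "Z \<in> borel_measurable M" "\<And>\<omega>. \<omega> \<in> space M \<Longrightarrow> norm (Z \<omega> :: 'b::{real_inner,second_countable_topology}) \<le> B"
  shows "L2 M (\<lambda>\<omega>. incr i a b \<omega> *\<^sub>R Z \<omega>)"
proof (rule L2_mono[OF L2_incr[OF t, of i], where K=B])
  show "(\<lambda>\<omega>. incr i a b \<omega> *\<^sub>R Z \<omega>) \<in> borel_measurable M"
    using t Z(1) by (intro borel_measurable_scaleR borel_measurable_incr)
  fix \<omega> assume "\<omega> \<in> space M"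
  then show "norm (incr i a b \<omega> *\<^sub>R Z \<omega>) \<le> B * norm (incr i a b \<omega>)"
    using mult_right_mono[OF Z(2), of \<omega> "\<bar>incr i a b \<omega>\<bar>"] by (simp add: mult.commute)
qed

context
  fixes i j :: nat and t :: real and ts :: "nat \<Rightarrow> real" and n :: nat and \<xi> :: "nat \<Rightarrow> 'w \<Rightarrow> 'b::{real_inner,second_countable_topology}"
  assumes sa: "simple_adapted M F t T ts n \<xi>" and t0: "0 \<le> t"
begin

lemma simple_coeff:
  assumes "k < n"
  shows "\<xi> k \<in> borel_measurable (F (ts k))" "\<xi> k \<in> borel_measurable M"
    "0 \<le> ts k" "ts k \<le> ts (Suc k)" "ts (Suc k) \<le> T" "t \<le> ts k"
proof -
  show 1: "\<xi> k \<in> borel_measurable (F (ts k))" "ts k \<le> ts (Suc k)" using sa assms by (auto simp: simple_adapted_def less_imp_le)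
  show 2: "0 \<le> ts k" "ts (Suc k) \<le> T" "t \<le> ts k"
    using simple_adapted_bounds[OF sa, of k] simple_adapted_bounds[OF sa, of "Suc k"] assms t0 by auto
  show "\<xi> k \<in> borel_measurable M" by (rule measurable_F_M[OF 1(1)]) (use 1 2 in linarith)
qed

lemma simple_coeff_bounded:
  assumes "k < n" shows "\<exists>B. \<forall>\<omega>\<in>space M. norm (\<xi> k \<omega>) \<le> B"
  using sa assms by (auto simp: simple_adapted_def)

lemma L2_simple_int: "L2 M (simple_int (\<beta> i) ts n \<xi>)"
proof -
  have "L2 M (\<lambda>\<omega>. \<Sum>k<n. incr i (ts k) (ts (Suc k)) \<omega> *\<^sub>R \<xi> k \<omega>)"
  proof (rule L2_sum)
    fix k assume "k \<in> {..<n}"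
    then have k: "k < n" by simp
    obtain B where "\<forall>\<omega>\<in>space M. norm (\<xi> k \<omega>) \<le> B" using simple_coeff_bounded[OF k] by blast
    then show "L2 M (\<lambda>\<omega>. incr i (ts k) (ts (Suc k)) \<omega> *\<^sub>R \<xi> k \<omega>)"
      using simple_coeff[OF k] by (intro L2_incr_scaleR[where B=B]) auto
  qed
  then show ?thesis by (simp add: simple_int_def[abs_def] incr_def)
qed

lemma simple_proc_measurable:
  "(\<lambda>z. simple_proc ts n \<xi> (fst z) (snd z)) \<in> borel_measurable (slab M t T)"
proof -
  have "(\<lambda>z. indicator {ts k..<ts (Suc k)} (fst z) *\<^sub>R \<xi> k (snd z)) \<in> borel_measurable (slab M t T)" if "k < n" for k
  proof (rule borel_measurable_scaleR)
    show "(\<lambda>z. indicator {ts k..<ts (Suc k)} (fst z) :: real) \<in> borel_measurable (slab M t T)"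
      by (rule measurable_compose[OF measurable_fst measurable_restrict_space1]) simp
    show "(\<lambda>z. \<xi> k (snd z)) \<in> borel_measurable (slab M t T)"
      by (rule measurable_compose[OF measurable_snd simple_coeff(2)[OF that]])
  qed
  then have "(\<lambda>z. \<Sum>k<n. indicator {ts k..<ts (Suc k)} (fst z) *\<^sub>R \<xi> k (snd z)) \<in> borel_measurable (slab M t T)"
    by (intro borel_measurable_sum) auto
  then show ?thesis by (simp add: simple_proc_indicator)
qed

lemma L2_simple_proc: "L2 (slab M t T) (\<lambda>z. simple_proc ts n \<xi> (fst z) (snd z))"
proof -
  interpret N: finite_measure "slab M t T" by (rule finite_measure_slab) unfold_locales
  have "\<forall>k. \<exists>B. k < n \<longrightarrow> (\<forall>\<omega>\<in>space M. norm (\<xi> k \<omega>) \<le> B)" using simple_coeff_bounded by blast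
  then obtain B where B: "\<And>k \<omega>. k < n \<Longrightarrow> \<omega> \<in> space M \<Longrightarrow> norm (\<xi> k \<omega>) \<le> B k" by metis
  show ?thesis
  proof (rule N.L2_bounded[OF simple_proc_measurable, of "\<Sum>k<n. \<bar>B k\<bar>"])
    fix z assume "z \<in> space (slab M t T)"
    then have \<omega>: "snd z \<in> space M" by (auto simp: space_pair_measure)
    have "norm (simple_proc ts n \<xi> (fst z) (snd z)) \<le> (\<Sum>k<n. norm (if ts k \<le> fst z \<and> fst z < ts (Suc k) then \<xi> k (snd z) else 0))"
      unfolding simple_proc_def by (rule norm_sum)
    also have "\<dots> \<le> (\<Sum>k<n. \<bar>B k\<bar>)"
      using order_trans[OF B[OF _ \<omega>] abs_ge_self] by (intro sum_mono) auto
    finally show "norm (simple_proc ts n \<xi> (fst z) (snd z)) \<le> (\<Sum>k<n. \<bar>B k\<bar>)" .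
  qed
qed

text \<open>The k-th increment times the test increment contributes 0 if i and j differ, and
  otherwise the overlap length times the expectation of <\<xi> k, \<zeta>>. Integrating the
  indicators of the two intervals over time gives the same numbers. It is the Ito isometry,
  polarised against a single increment.\<close>

lemma simple_int_pairing:
  assumes uv: "t \<le> u" "u \<le> v" "v \<le> T"
    and \<zeta>: "\<zeta> \<in> borel_measurable (F u)" "\<And>\<omega>. \<omega> \<in> space M \<Longrightarrow> norm (\<zeta> \<omega>) \<le> B"
  shows "expectation (\<lambda>\<omega>. inner (simple_int (\<beta> i) ts n \<xi> \<omega>) (incr j u v \<omega> *\<^sub>R \<zeta> \<omega>))
    = (if i = j then \<integral>z. inner (simple_proc ts n \<xi> (fst z) (snd z)) (indicator {u..<v} (fst z) *\<^sub>R \<zeta> (snd z)) \<partial>slab M t T else 0)"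
proof -
  define Z where "Z k \<omega> = inner (\<xi> k \<omega>) (\<zeta> \<omega>)" for k \<omega>
  have \<zeta>M: "\<zeta> \<in> borel_measurable M" using measurable_F_M[OF \<zeta>(1)] uv by simp
  have ZF: "Z k \<in> borel_measurable (F (max (ts k) u))" if "k < n" for k
    unfolding Z_def[abs_def]
    by (intro borel_measurable_inner measurable_F_mono[OF \<zeta>(1)] measurable_F_mono[OF simple_coeff(1)[OF that]]) auto
  have ZM: "Z k \<in> borel_measurable M" if "k < n" for k
    unfolding Z_def[abs_def] by (intro borel_measurable_inner \<zeta>M simple_coeff(2)[OF that])
  have "\<exists>b. \<forall>\<omega>\<in>space M. \<bar>Z k \<omega>\<bar> \<le> b" if k: "k < n" for k
  proof -
    obtain b where b: "\<forall>\<omega>\<in>space M. norm (\<xi> k \<omega>) \<le> b" using simple_coeff_bounded[OF k] by blast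
    have "\<bar>Z k \<omega>\<bar> \<le> b * B" if "\<omega> \<in> space M" for \<omega>
    proof -
      have "\<bar>Z k \<omega>\<bar> \<le> norm (\<xi> k \<omega>) * norm (\<zeta> \<omega>)" unfolding Z_def by (rule Cauchy_Schwarz_ineq2)
      also have "\<dots> \<le> b * B"
        using b \<zeta>(2) that by (intro mult_mono) (auto intro: order_trans[OF norm_ge_zero])
      finally show ?thesis .
    qed
    then show ?thesis by blast
  qed
  then have "\<forall>k. \<exists>b. k < n \<longrightarrow> (\<forall>\<omega>\<in>space M. \<bar>Z k \<omega>\<bar> \<le> b)" by blast
  then obtain b where b: "\<And>k \<omega>. k < n \<Longrightarrow> \<omega> \<in> space M \<Longrightarrow> \<bar>Z k \<omega>\<bar> \<le> b k" by metis
  have "expectation (\<lambda>\<omega>. inner (simple_int (\<beta> i) ts n \<xi> \<omega>) (incr j u v \<omega> *\<^sub>R \<zeta> \<omega>))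
      = expectation (\<lambda>\<omega>. \<Sum>k<n. incr i (ts k) (ts (Suc k)) \<omega> * incr j u v \<omega> * Z k \<omega>)"
    by (intro Bochner_Integration.integral_cong refl)
      (simp add: simple_int_def incr_def inner_sum_left Z_def sum_distrib_left mult_ac)
  also have "\<dots> = (\<Sum>k<n. expectation (\<lambda>\<omega>. incr i (ts k) (ts (Suc k)) \<omega> * incr j u v \<omega> * Z k \<omega>))"
  proof (rule Bochner_Integration.integral_sum)
    fix k assume "k \<in> {..<n}"
    then have k: "k < n" by simp
    show "integrable M (\<lambda>\<omega>. incr i (ts k) (ts (Suc k)) \<omega> * incr j u v \<omega> * Z k \<omega>)"
      by (rule integrable_incr_mult_incr[where B="b k", OF _ _ _ _ _ _ ZM[OF k] b[OF k]])
        (use simple_coeff[OF k] uv t0 in auto)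
  qed
  also have "\<dots> = (\<Sum>k<n. if i = j then max 0 (min (ts (Suc k)) v - max (ts k) u) * expectation (Z k) else 0)"
  proof (intro sum.cong refl)
    fix k assume "k \<in> {..<n}"
    then have k: "k < n" by simp
    show "expectation (\<lambda>\<omega>. incr i (ts k) (ts (Suc k)) \<omega> * incr j u v \<omega> * Z k \<omega>)
        = (if i = j then max 0 (min (ts (Suc k)) v - max (ts k) u) * expectation (Z k) else 0)"
      by (rule expectation_incr_overlap[OF _ _ _ _ _ _ ZF[OF k] b[OF k]])
        (use simple_coeff[OF k] uv t0 in auto)
  qed
  also have "\<dots> = (if i = j then \<integral>z. inner (simple_proc ts n \<xi> (fst z) (snd z)) (indicator {u..<v} (fst z) *\<^sub>R \<zeta> (snd z)) \<partial>slab M t T else 0)"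
  proof (cases "i = j")
    case True
    have "(\<integral>z. inner (simple_proc ts n \<xi> (fst z) (snd z)) (indicator {u..<v} (fst z) *\<^sub>R \<zeta> (snd z)) \<partial>slab M t T)
        = (\<integral>z. (\<Sum>k<n. indicator ({ts k..<ts (Suc k)} \<inter> {u..<v}) (fst z) * Z k (snd z)) \<partial>slab M t T)"
      by (intro Bochner_Integration.integral_cong refl,
          simp only: simple_proc_indicator inner_sum_left inner_scaleR_left inner_scaleR_right sum_distrib_left Z_def indicator_inter_arith)
        (intro sum.cong refl, simp only: mult_ac)
    also have "\<dots> = (\<Sum>k<n. \<integral>z. indicator ({ts k..<ts (Suc k)} \<inter> {u..<v}) (fst z) * Z k (snd z) \<partial>slab M t T)"
      by (rule Bochner_Integration.integral_sum)
        (rule integral_slab_product(1)[OF prob_space_axioms ZM b], auto)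
    also have "\<dots> = (\<Sum>k<n. max 0 (min (ts (Suc k)) v - max (ts k) u) * expectation (Z k))"
    proof (intro sum.cong refl)
      fix k assume "k \<in> {..<n}"
      then have k: "k < n" by simp
      have sub: "({ts k..<ts (Suc k)} \<inter> {u..<v}) \<inter> {t..T} = {ts k..<ts (Suc k)} \<inter> {u..<v}" using uv by auto
      show "(\<integral>z. indicator ({ts k..<ts (Suc k)} \<inter> {u..<v}) (fst z) * Z k (snd z) \<partial>slab M t T)
          = max 0 (min (ts (Suc k)) v - max (ts k) u) * expectation (Z k)"
        by (subst integral_slab_product(2)[OF prob_space_axioms ZM[OF k] b[OF k]])
          (simp_all only: sub measure_Ico_Int_Ico, simp)
    qed
    finally show ?thesis using True by simp
  qed simp
  finally show ?thesis .
qed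

text \<open>The martingale property: each summand is an increment times a variable measurable at its
  left end \<open>ts k\<close>.\<close>

lemma simple_int_pairing_past:
  assumes \<zeta>: "\<zeta> \<in> borel_measurable (F t)" "\<And>\<omega>. \<omega> \<in> space M \<Longrightarrow> norm (\<zeta> \<omega>) \<le> B" and tT: "t \<le> T"
  shows "expectation (\<lambda>\<omega>. inner (simple_int (\<beta> i) ts n \<xi> \<omega>) (\<zeta> \<omega>)) = 0"
proof -
  have \<zeta>M: "\<zeta> \<in> borel_measurable M" using measurable_F_M[OF \<zeta>(1) tT] .
  have \<zeta>2: "L2 M \<zeta>" by (rule L2_bounded[OF \<zeta>M \<zeta>(2)])
  have "expectation (\<lambda>\<omega>. inner (simple_int (\<beta> i) ts n \<xi> \<omega>) (\<zeta> \<omega>))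
      = expectation (\<lambda>\<omega>. \<Sum>k<n. incr i (ts k) (ts (Suc k)) \<omega> * inner (\<xi> k \<omega>) (\<zeta> \<omega>))"
    by (intro Bochner_Integration.integral_cong refl) (simp add: simple_int_def incr_def inner_sum_left)
  also have "\<dots> = (\<Sum>k<n. expectation (\<lambda>\<omega>. incr i (ts k) (ts (Suc k)) \<omega> * inner (\<xi> k \<omega>) (\<zeta> \<omega>)))"
  proof (rule Bochner_Integration.integral_sum)
    fix k assume "k \<in> {..<n}"
    then have k: "k < n" by simp
    obtain b where "\<forall>\<omega>\<in>space M. norm (\<xi> k \<omega>) \<le> b" using simple_coeff_bounded[OF k] by blast
    then have "L2 M (\<lambda>\<omega>. incr i (ts k) (ts (Suc k)) \<omega> *\<^sub>R \<xi> k \<omega>)"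
      using simple_coeff[OF k] by (intro L2_incr_scaleR[where B=b]) auto
    from L2_inner_integrable[OF this \<zeta>2]
    show "integrable M (\<lambda>\<omega>. incr i (ts k) (ts (Suc k)) \<omega> * inner (\<xi> k \<omega>) (\<zeta> \<omega>))" by simp
  qed
  also have "\<dots> = 0"
  proof (rule sum.neutral, rule ballI)
    fix k assume "k \<in> {..<n}"
    then have k: "k < n" by simp
    obtain b where b: "\<forall>\<omega>\<in>space M. norm (\<xi> k \<omega>) \<le> b" using simple_coeff_bounded[OF k] by blast
    have "(\<lambda>\<omega>. inner (\<xi> k \<omega>) (\<zeta> \<omega>)) \<in> borel_measurable (F (ts k))"
      using simple_coeff[OF k] by (intro borel_measurable_inner measurable_F_mono[OF \<zeta>(1)]) auto
    moreover have "integrable M (\<lambda>\<omega>. inner (\<xi> k \<omega>) (\<zeta> \<omega>))"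
      by (rule L2_inner_integrable[OF L2_bounded[OF simple_coeff(2)[OF k], of b] \<zeta>2]) (use b in auto)
    ultimately show "expectation (\<lambda>\<omega>. incr i (ts k) (ts (Suc k)) \<omega> * inner (\<xi> k \<omega>) (\<zeta> \<omega>)) = 0"
      using simple_coeff[OF k] by (intro expectation_incr_mult measurable_F_indep_alg) auto
  qed
  finally show ?thesis .
qed

end

text \<open>Both sides are continuous along the simple processes supplied by \<open>ito_int\<close>,
  so the formulas for simple processes pass to the limit. Square integrability and these two
  pairings are all that is used of the Ito integral afterwards.\<close>

lemma ito_int_pairing:
  fixes X :: "'w \<Rightarrow> 'b::{real_inner,second_countable_topology}"
  assumes ito: "ito_int M F (\<beta> i) t T \<Phi> X" and t: "0 \<le> t" "t \<le> T"
    and \<Phi>: "(\<lambda>z. \<Phi> (fst z) (snd z)) \<in> borel_measurable (slab M t T)"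
  shows ito_int_L2: "L2 M X"
    and "\<And>\<zeta> B u v. t \<le> u \<Longrightarrow> u \<le> v \<Longrightarrow> v \<le> T \<Longrightarrow> \<zeta> \<in> borel_measurable (F u) \<Longrightarrow>
      (\<And>\<omega>. \<omega> \<in> space M \<Longrightarrow> norm (\<zeta> \<omega>) \<le> B) \<Longrightarrow>
      expectation (\<lambda>\<omega>. inner (X \<omega>) (incr j u v \<omega> *\<^sub>R \<zeta> \<omega>))
      = (if i = j then \<integral>z. inner (\<Phi> (fst z) (snd z)) (indicator {u..<v} (fst z) *\<^sub>R \<zeta> (snd z)) \<partial>slab M t T else 0)"
    and ito_int_pairing_past: "\<And>\<zeta> B. \<zeta> \<in> borel_measurable (F t) \<Longrightarrow>
      (\<And>\<omega>. \<omega> \<in> space M \<Longrightarrow> norm (\<zeta> \<omega>) \<le> B) \<Longrightarrow> expectation (\<lambda>\<omega>. inner (X \<omega>) (\<zeta> \<omega>)) = 0"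
proof -
  interpret N: finite_measure "slab M t T" by (rule finite_measure_slab) unfold_locales
  obtain ts n \<xi> where sa: "\<And>m. simple_adapted M F t T (ts m) (n m) (\<xi> m)"
    and lim1: "(\<lambda>m. \<integral>\<^sup>+z. ennreal ((norm (\<Phi> (fst z) (snd z) - simple_proc (ts m) (n m) (\<xi> m) (fst z) (snd z)))\<^sup>2) \<partial>slab M t T) \<longlonglongrightarrow> 0"
    and lim2: "(\<lambda>m. \<integral>\<^sup>+\<omega>. ennreal ((norm (X \<omega> - simple_int (\<beta> i) (ts m) (n m) (\<xi> m) \<omega>))\<^sup>2) \<partial>M) \<longlonglongrightarrow> 0"
    and X: "X \<in> borel_measurable M"
    using ito unfolding ito_int_def by blast
  note l2 = L2_limit[OF X L2_simple_int[OF sa t(1)] lim2]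
  show "L2 M X" by (rule l2)
  {
    fix \<zeta> B u v assume uv: "t \<le> u" "u \<le> v" "v \<le> T" and \<zeta>: "\<zeta> \<in> borel_measurable (F u)"
      "\<And>\<omega>. \<omega> \<in> space M \<Longrightarrow> norm (\<zeta> \<omega> :: 'b) \<le> B"
    have \<zeta>M: "\<zeta> \<in> borel_measurable M" using measurable_F_M[OF \<zeta>(1)] uv by simp
    have Y: "L2 M (\<lambda>\<omega>. incr j u v \<omega> *\<^sub>R \<zeta> \<omega>)"
      by (rule L2_incr_scaleR[OF _ _ _ \<zeta>M \<zeta>(2)]) (use uv t in auto)
    have Y': "L2 (slab M t T) (\<lambda>z. indicator {u..<v} (fst z) *\<^sub>R \<zeta> (snd z))"
    proof (rule L2_mono[OF L2_snd[OF prob_space_axioms L2_bounded[OF \<zeta>M \<zeta>(2)]], where K=1])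
      have "(\<lambda>z. indicator {u..<v} (fst z) :: real) \<in> borel_measurable (slab M t T)"
        by (rule measurable_compose[OF measurable_fst measurable_restrict_space1]) simp
      then show "(\<lambda>z. indicator {u..<v} (fst z) *\<^sub>R \<zeta> (snd z)) \<in> borel_measurable (slab M t T)"
        by (intro borel_measurable_scaleR measurable_compose[OF measurable_snd \<zeta>M])
    qed (auto simp: indicator_def)
    have "(\<lambda>m. expectation (\<lambda>\<omega>. inner (simple_int (\<beta> i) (ts m) (n m) (\<xi> m) \<omega>) (incr j u v \<omega> *\<^sub>R \<zeta> \<omega>)))
        \<longlonglongrightarrow> expectation (\<lambda>\<omega>. inner (X \<omega>) (incr j u v \<omega> *\<^sub>R \<zeta> \<omega>))"
      by (rule l2(2)[OF Y])
    moreover have "(\<lambda>m. expectation (\<lambda>\<omega>. inner (simple_int (\<beta> i) (ts m) (n m) (\<xi> m) \<omega>) (incr j u v \<omega> *\<^sub>R \<zeta> \<omega>)))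
      \<longlonglongrightarrow> (if i = j then \<integral>z. inner (\<Phi> (fst z) (snd z)) (indicator {u..<v} (fst z) *\<^sub>R \<zeta> (snd z)) \<partial>slab M t T else 0)"
    proof (cases "i = j")
      case True
      with L2_limit(2)[OF \<Phi> L2_simple_proc[OF sa t(1)] lim1 Y'] show ?thesis
        by (simp add: simple_int_pairing[OF sa t(1) uv \<zeta>] del: inner_scaleR_right inner_scaleR_left)
    qed (simp add: simple_int_pairing[OF sa t(1) uv \<zeta>] del: inner_scaleR_right inner_scaleR_left)
    ultimately show "expectation (\<lambda>\<omega>. inner (X \<omega>) (incr j u v \<omega> *\<^sub>R \<zeta> \<omega>))
      = (if i = j then \<integral>z. inner (\<Phi> (fst z) (snd z)) (indicator {u..<v} (fst z) *\<^sub>R \<zeta> (snd z)) \<partial>slab M t T else 0)"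
      by (rule LIMSEQ_unique)
  next
    fix \<zeta> B assume \<zeta>: "\<zeta> \<in> borel_measurable (F t)" "\<And>\<omega>. \<omega> \<in> space M \<Longrightarrow> norm (\<zeta> \<omega> :: 'b) \<le> B"
    have \<zeta>2: "L2 M \<zeta>" by (rule L2_bounded[OF measurable_F_M[OF \<zeta>(1) t(2)] \<zeta>(2)])
    from l2(2)[OF this] show "expectation (\<lambda>\<omega>. inner (X \<omega>) (\<zeta> \<omega>)) = 0"
      using simple_int_pairing_past[OF sa t(1) \<zeta> t(2)] by (simp add: LIMSEQ_const_iff)
  }
qed

end


section \<open>Power weights and Bochner integrals in time\<close>

text \<open>A translation and a reflection of the line move the singular end point to 0.\<close>

lemma nn_integral_powr:
  fixes p :: real
  assumes p: "p < 1" and ab: "a \<le> b"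
  shows nn_integral_powr_left: "(\<integral>\<^sup>+r. ennreal ((r - a) powr (- p)) * indicator {a..b} r \<partial>lborel) = ennreal ((b - a) powr (1 - p) / (1 - p))"
    and nn_integral_powr_right: "(\<integral>\<^sup>+r. ennreal ((b - r) powr (- p)) * indicator {a..b} r \<partial>lborel) = ennreal ((b - a) powr (1 - p) / (1 - p))"
proof -
  define f where "f x = (if x \<in> {0..b - a} then x powr (- p) else 0)" for x
  have [measurable]: "f \<in> borel_measurable borel" unfolding f_def[abs_def] by measurable
  have "((\<lambda>x. x powr (- p)) has_integral ((b - a) powr (1 - p) / (1 - p))) {0..b - a}"
    using has_integral_powr_from_0[of "- p" "b - a"] p ab by simp
  then have "(f has_integral ((b - a) powr (1 - p) / (1 - p))) UNIV"
    unfolding f_def[abs_def] by (subst has_integral_restrict_UNIV)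
  then have I: "(\<integral>\<^sup>+x. ennreal (f x) \<partial>lborel) = ennreal ((b - a) powr (1 - p) / (1 - p))"
    by (intro nn_integral_has_integral_lborel) (measurable, simp add: f_def)
  have "(\<integral>\<^sup>+x. ennreal (f x) \<partial>lborel) = (\<integral>\<^sup>+r. ennreal (f (- a + 1 * r)) \<partial>lborel)"
    using nn_integral_real_affine[of "\<lambda>x. ennreal (f x)" 1 "- a"] by simp
  also have "\<dots> = (\<integral>\<^sup>+r. ennreal ((r - a) powr (- p)) * indicator {a..b} r \<partial>lborel)"
    by (intro nn_integral_cong) (auto simp: f_def indicator_def)
  finally show "(\<integral>\<^sup>+r. ennreal ((r - a) powr (- p)) * indicator {a..b} r \<partial>lborel) = ennreal ((b - a) powr (1 - p) / (1 - p))"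
    using I by simp
  have "(\<integral>\<^sup>+x. ennreal (f x) \<partial>lborel) = (\<integral>\<^sup>+r. ennreal (f (b + (- 1) * r)) \<partial>lborel)"
    using nn_integral_real_affine[of "\<lambda>x. ennreal (f x)" "- 1" b] by simp
  also have "\<dots> = (\<integral>\<^sup>+r. ennreal ((b - r) powr (- p)) * indicator {a..b} r \<partial>lborel)"
    by (intro nn_integral_cong) (auto simp: f_def indicator_def)
  finally show "(\<integral>\<^sup>+r. ennreal ((b - r) powr (- p)) * indicator {a..b} r \<partial>lborel) = ennreal ((b - a) powr (1 - p) / (1 - p))"
    using I by simp
qed

lemma nn_integral_Cauchy_Schwarz:
  fixes f g :: "'a \<Rightarrow> real"
  assumes f: "f \<in> borel_measurable \<mu>" "(\<integral>\<^sup>+x. ennreal ((f x)\<^sup>2) \<partial>\<mu>) < \<infinity>" "\<And>x. 0 \<le> f x"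
    and g: "g \<in> borel_measurable \<mu>" "(\<integral>\<^sup>+x. ennreal ((g x)\<^sup>2) \<partial>\<mu>) < \<infinity>" "\<And>x. 0 \<le> g x"
  shows "(\<integral>\<^sup>+x. ennreal (f x * g x) \<partial>\<mu>)\<^sup>2 \<le> (\<integral>\<^sup>+x. ennreal ((f x)\<^sup>2) \<partial>\<mu>) * (\<integral>\<^sup>+x. ennreal ((g x)\<^sup>2) \<partial>\<mu>)"
proof -
  have L: "L2 \<mu> f" "L2 \<mu> g" using f g by (simp_all add: L2_def)
  have i: "integrable \<mu> (\<lambda>x. f x * g x)" using L2_inner_integrable[OF L] by simp
  have "(\<integral>\<^sup>+x. ennreal (f x * g x) \<partial>\<mu>) = ennreal (\<integral>x. f x * g x \<partial>\<mu>)"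
    using f g by (intro nn_integral_eq_integral[OF i]) auto
  moreover have "(\<integral>x. f x * g x \<partial>\<mu>)\<^sup>2 \<le> (\<integral>x. (f x)\<^sup>2 \<partial>\<mu>) * (\<integral>x. (g x)\<^sup>2 \<partial>\<mu>)"
    using L2_Cauchy_Schwarz[OF L] by simp
  moreover have "0 \<le> (\<integral>x. f x * g x \<partial>\<mu>)" using f g by (intro integral_nonneg_AE AE_I2) auto
  moreover have "(\<integral>\<^sup>+x. ennreal ((f x)\<^sup>2) \<partial>\<mu>) = ennreal (\<integral>x. (f x)\<^sup>2 \<partial>\<mu>)"
    "(\<integral>\<^sup>+x. ennreal ((g x)\<^sup>2) \<partial>\<mu>) = ennreal (\<integral>x. (g x)\<^sup>2 \<partial>\<mu>)"
    using L2_nn_integral[OF L(1)] L2_nn_integral[OF L(2)] by simp_all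
  ultimately show ?thesis
    by (simp add: ennreal_power ennreal_leI flip: ennreal_mult)
qed

definition time_integral :: "real \<Rightarrow> real \<Rightarrow> (real \<times> 'w \<Rightarrow> 'h::{real_inner,second_countable_topology}) \<Rightarrow> 'w \<Rightarrow> 'h" where
  "time_integral t t' W \<omega> = (\<integral>s. W (s, \<omega>) \<partial>restrict_space lborel {t..t'})"

context
  fixes M :: "'w measure" and e :: "nat \<Rightarrow> 'h::{real_inner,complete_space,second_countable_topology}"
    and t t' :: real and W :: "real \<times> 'w \<Rightarrow> 'h"
  assumes M: "prob_space M" and e: "orthonormal_basis e" and W: "L2 (slab M t t') W"
begin

private abbreviation "L \<equiv> restrict_space lborel {t..t'}"

lemma W_section: "\<omega> \<in> space M \<Longrightarrow> (\<lambda>s. W (s, \<omega>)) \<in> borel_measurable L"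
  by (rule measurable_compose[OF measurable_Pair2' L2_measurable[OF W]])

text \<open>On a finite measure space square integrability implies integrability, and Tonelli leaves
  almost every path integrable in time.\<close>

lemma AE_time_integrable: "AE \<omega> in M. integrable L (\<lambda>s. W (s, \<omega>))"
proof -
  interpret M: prob_space M by (rule M)
  interpret LM: pair_sigma_finite L M by (rule pair_sigma_finite_slab[OF M])
  interpret N: finite_measure "slab M t t'" by (rule finite_measure_slab[OF M])
  note [measurable] = L2_measurable[OF W]
  have "integrable (slab M t t') (\<lambda>z. (norm (W z)) * 1)"
  proof -
    have "L2 (slab M t t') (\<lambda>z. norm (W z))" by (rule L2_mono[OF W, where K=1]) simp_all
    moreover have "L2 (slab M t t') (\<lambda>z. 1::real)" by (rule N.L2_bounded[where B=1]) simp_all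
    ultimately show ?thesis using L2_inner_integrable by fastforce
  qed
  then have "(\<integral>\<^sup>+z. ennreal (norm (W z)) \<partial>slab M t t') < \<infinity>"
    by (simp add: integrable_iff_bounded)
  also have "(\<integral>\<^sup>+z. ennreal (norm (W z)) \<partial>slab M t t') = (\<integral>\<^sup>+\<omega>. (\<integral>\<^sup>+s. ennreal (norm (W (s, \<omega>))) \<partial>L) \<partial>M)"
    by (rule LM.nn_integral_snd[of "\<lambda>z. ennreal (norm (W z))", symmetric]) measurable
  finally have "(\<integral>\<^sup>+\<omega>. (\<integral>\<^sup>+s. ennreal (norm (W (s, \<omega>))) \<partial>L) \<partial>M) \<noteq> \<infinity>" by simp
  then have "AE \<omega> in M. (\<integral>\<^sup>+s. ennreal (norm (W (s, \<omega>))) \<partial>L) \<noteq> \<infinity>"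
    by (intro nn_integral_PInf_AE) measurable
  then show ?thesis
    using AE_space
    by eventually_elim (simp add: integrable_iff_bounded_complete W_section less_top[symmetric])
qed

text \<open>A Bochner integral is 0 by default where the path is not integrable, although single
  coordinates may still be integrable there. The indicator of the measurable set of integrable paths
  reconciles the two.\<close>

lemma time_integral_measurable: "time_integral t t' W \<in> borel_measurable M"
proof (rule borel_measurable_coordinates[OF e])
  interpret M: prob_space M by (rule M)
  interpret L: finite_measure L by (rule finite_measure_Icc)
  note [measurable] = L2_measurable[OF W]
  fix k
  let ?G = "{\<omega> \<in> space M. (\<integral>\<^sup>+s. ennreal (norm (W (s, \<omega>))) \<partial>L) < \<infinity>}"
  have sw: "(\<lambda>z. W (snd z, fst z)) \<in> borel_measurable (M \<Otimes>\<^sub>M L)"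
    using measurable_compose[OF measurable_pair_swap' L2_measurable[OF W]] by (simp add: case_prod_unfold)
  have [measurable]: "(\<lambda>\<omega>. \<integral>\<^sup>+s. ennreal (norm (W (s, \<omega>))) \<partial>L) \<in> borel_measurable M"
    by (rule L.borel_measurable_nn_integral) (use sw in \<open>simp add: case_prod_unfold\<close>)
  have 1: "(\<lambda>\<omega>. \<integral>s. inner (W (s, \<omega>)) (e k) \<partial>L) \<in> borel_measurable M"
    by (rule L.borel_measurable_lebesgue_integral) (use sw in \<open>simp add: case_prod_unfold\<close>)
  have "(\<lambda>\<omega>. indicator ?G \<omega> * (\<integral>s. inner (W (s, \<omega>)) (e k) \<partial>L)) \<in> borel_measurable M"
    using 1 by (intro borel_measurable_times borel_measurable_indicator) measurable
  moreover have "inner (time_integral t t' W \<omega>) (e k) = indicator ?G \<omega> * (\<integral>s. inner (W (s, \<omega>)) (e k) \<partial>L)"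
    if \<omega>: "\<omega> \<in> space M" for \<omega>
  proof (cases "integrable L (\<lambda>s. W (s, \<omega>))")
    case True
    then have "\<omega> \<in> ?G" using \<omega> by (simp add: integrable_iff_bounded_complete)
    then show ?thesis using True by (simp add: time_integral_def)
  next
    case False
    then have "\<omega> \<notin> ?G" using \<omega> by (simp add: integrable_iff_bounded_complete W_section)
    then show ?thesis using False by (simp add: time_integral_def not_integrable_integral_eq)
  qed
  ultimately show "(\<lambda>\<omega>. inner (time_integral t t' W \<omega>) (e k)) \<in> borel_measurable M"
    by (subst measurable_cong) auto
qed

text \<open>Cauchy-Schwarz in time for almost every \<omega>, with the singularity carried by the
  deterministic factor h. One time p is exempt from the pointwise bound, so that the weights may
  degenerate there.\<close>

lemma time_integral_bound:
  assumes h: "h \<in> borel_measurable borel" "\<And>s. 0 \<le> h s" "(\<integral>\<^sup>+s. ennreal ((h s)\<^sup>2) \<partial>L) = ennreal \<kappa>"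
    and G: "G \<in> borel_measurable (slab M t t')" "\<And>z. 0 \<le> G z" "(\<integral>\<^sup>+z. ennreal ((G z)\<^sup>2) \<partial>slab M t t') < \<infinity>"
    and le: "\<And>z. z \<in> space (slab M t t') \<Longrightarrow> fst z \<noteq> p \<Longrightarrow> norm (W z) \<le> h (fst z) * G z"
  shows "(\<integral>\<^sup>+\<omega>. ennreal ((norm (time_integral t t' W \<omega>))\<^sup>2) \<partial>M) \<le> ennreal \<kappa> * (\<integral>\<^sup>+z. ennreal ((G z)\<^sup>2) \<partial>slab M t t')"
proof -
  interpret M: prob_space M by (rule M)
  interpret L: finite_measure L by (rule finite_measure_Icc)
  interpret LM: pair_sigma_finite L M by (rule pair_sigma_finite_slab[OF M])
  note [measurable] = G(1)
  have hL: "h \<in> borel_measurable L" by (rule measurable_restrict_space1) (use h in simp)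
  have eq: "(\<integral>\<^sup>+z. ennreal ((G z)\<^sup>2) \<partial>slab M t t') = (\<integral>\<^sup>+\<omega>. (\<integral>\<^sup>+s. ennreal ((G (s, \<omega>))\<^sup>2) \<partial>L) \<partial>M)"
    by (rule LM.nn_integral_snd[of "\<lambda>z. ennreal ((G z)\<^sup>2)", symmetric]) measurable
  have sw: "(\<lambda>z. G (snd z, fst z)) \<in> borel_measurable (M \<Otimes>\<^sub>M L)"
    using measurable_compose[OF measurable_pair_swap' G(1)] by (simp add: case_prod_unfold)
  have mG[measurable]: "(\<lambda>\<omega>. \<integral>\<^sup>+s. ennreal ((G (s, \<omega>))\<^sup>2) \<partial>L) \<in> borel_measurable M"
    by (rule L.borel_measurable_nn_integral) (use sw in \<open>simp add: case_prod_unfold\<close>)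
  have fin: "AE \<omega> in M. (\<integral>\<^sup>+s. ennreal ((G (s, \<omega>))\<^sup>2) \<partial>L) \<noteq> \<infinity>"
    using G(3) unfolding eq by (intro nn_integral_PInf_AE mG) auto
  have "(\<integral>\<^sup>+\<omega>. ennreal ((norm (time_integral t t' W \<omega>))\<^sup>2) \<partial>M) \<le> (\<integral>\<^sup>+\<omega>. ennreal \<kappa> * (\<integral>\<^sup>+s. ennreal ((G (s, \<omega>))\<^sup>2) \<partial>L) \<partial>M)"
  proof (rule nn_integral_mono_AE)
    show "AE \<omega> in M. ennreal ((norm (time_integral t t' W \<omega>))\<^sup>2) \<le> ennreal \<kappa> * (\<integral>\<^sup>+s. ennreal ((G (s, \<omega>))\<^sup>2) \<partial>L)"
      using fin AE_time_integrable AE_space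
    proof eventually_elim
      case (elim \<omega>)
      have Gs: "(\<lambda>s. G (s, \<omega>)) \<in> borel_measurable L"
        by (rule measurable_compose[OF measurable_Pair2' G(1)]) (rule elim)
      have p: "AE s in L. s \<noteq> p"
      proof (subst AE_restrict_space_iff)
        show "AE s in lborel. s \<in> {t..t'} \<longrightarrow> s \<noteq> p"
          using AE_lborel_singleton[of p] by eventually_elim simp
      qed simp
      have "ennreal (norm (time_integral t t' W \<omega>)) \<le> (\<integral>\<^sup>+s. ennreal (norm (W (s, \<omega>))) \<partial>L)"
        unfolding time_integral_def by (rule integral_norm_bound_ennreal[OF elim(2)])
      also have "\<dots> \<le> (\<integral>\<^sup>+s. ennreal (h s * G (s, \<omega>)) \<partial>L)"
      proof (rule nn_integral_mono_AE)
        show "AE s in L. ennreal (norm (W (s, \<omega>))) \<le> ennreal (h s * G (s, \<omega>))"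
          using p AE_space
        proof eventually_elim
          case s: (elim s)
          have "norm (W (s, \<omega>)) \<le> h (fst (s, \<omega>)) * G (s, \<omega>)"
            using s elim(3) by (intro le) (auto simp: space_pair_measure)
          then show ?case by (simp add: ennreal_leI)
        qed
      qed
      finally have "(ennreal (norm (time_integral t t' W \<omega>)))\<^sup>2 \<le> (\<integral>\<^sup>+s. ennreal (h s * G (s, \<omega>)) \<partial>L)\<^sup>2"
        by (rule power_mono) simp
      also have "\<dots> \<le> (\<integral>\<^sup>+s. ennreal ((h s)\<^sup>2) \<partial>L) * (\<integral>\<^sup>+s. ennreal ((G (s, \<omega>))\<^sup>2) \<partial>L)"
        using h G(2) elim(1) hL Gs by (intro nn_integral_Cauchy_Schwarz) (auto simp: less_top[symmetric])
      finally show ?case by (simp add: h(3) ennreal_power)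
    qed
  qed
  also have "\<dots> = ennreal \<kappa> * (\<integral>\<^sup>+\<omega>. (\<integral>\<^sup>+s. ennreal ((G (s, \<omega>))\<^sup>2) \<partial>L) \<partial>M)"
    by (rule nn_integral_cmult) (rule mG)
  finally show ?thesis unfolding eq .
qed

lemma time_integral_pairing:
  assumes Y: "L2 M Y"
  shows "(\<integral>\<omega>. inner (time_integral t t' W \<omega>) (Y \<omega>) \<partial>M) = (\<integral>z. inner (W z) (Y (snd z)) \<partial>slab M t t')"
proof -
  interpret M: prob_space M by (rule M)
  interpret L: finite_measure L by (rule finite_measure_Icc)
  interpret LM: pair_sigma_finite L M by (rule pair_sigma_finite_slab[OF M])
  have i: "integrable (slab M t t') (\<lambda>z. inner (W z) (Y (snd z)))"
    by (rule L2_inner_integrable[OF W L2_snd[OF M Y]])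
  have "(\<integral>z. inner (W z) (Y (snd z)) \<partial>slab M t t') = (\<integral>\<omega>. (\<integral>s. inner (W (s, \<omega>)) (Y \<omega>) \<partial>L) \<partial>M)"
    using LM.integral_snd[of "\<lambda>s \<omega>. inner (W (s, \<omega>)) (Y \<omega>)"] i by (simp add: case_prod_unfold)
  also have "\<dots> = (\<integral>\<omega>. inner (time_integral t t' W \<omega>) (Y \<omega>) \<partial>M)"
  proof (rule integral_cong_AE)
    show "AE \<omega> in M. (\<integral>s. inner (W (s, \<omega>)) (Y \<omega>) \<partial>L) = inner (time_integral t t' W \<omega>) (Y \<omega>)"
      using AE_time_integrable by eventually_elim (simp add: time_integral_def)
    show "(\<lambda>\<omega>. \<integral>s. inner (W (s, \<omega>)) (Y \<omega>) \<partial>L) \<in> borel_measurable M"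
      using LM.integrable_snd[of "\<lambda>s \<omega>. inner (W (s, \<omega>)) (Y \<omega>)"] i by (simp add: case_prod_unfold)
    show "(\<lambda>\<omega>. inner (time_integral t t' W \<omega>) (Y \<omega>)) \<in> borel_measurable M"
      using time_integral_measurable L2_measurable[OF Y] by (rule borel_measurable_inner)
  qed
  finally show ?thesis by simp
qed

end

section \<open>The dual identity\<close>


locale bsde_setup = mild_setup M T \<beta> e S K
  for M :: "'w measure" and T \<beta> and e :: "nat \<Rightarrow> 'h::{real_inner,complete_space,second_countable_topology}"
    and S :: "real \<Rightarrow> 'h \<Rightarrow> 'h" and K +
  fixes C :: "nat \<Rightarrow> real \<Rightarrow> 'w \<Rightarrow> 'h \<Rightarrow> 'h" and c \<alpha> :: real
  assumes T_pos: "0 < T" and alpha: "0 \<le> \<alpha>" "\<alpha> < 1/2" and c_nonneg: "0 \<le> c"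
    and C_linear: "\<And>i s \<omega>. s \<in> {0..T} \<Longrightarrow> \<omega> \<in> space M \<Longrightarrow> bounded_linear (C i s \<omega>)"
    and C_le: "\<And>i s \<omega> y. s \<in> {0..T} \<Longrightarrow> \<omega> \<in> space M \<Longrightarrow> norm (C i s \<omega> y) \<le> c * norm y"
    and C_prog: "\<And>i y. progressive M F T (\<lambda>s \<omega>. C i s \<omega> y)"
begin

text \<open>For the column differences these are the sums g_n of the overview. Only partial sums are
  formed: condition (3) bounds them uniformly without providing a limit.\<close>

definition drift :: "(nat \<Rightarrow> real \<times> 'w \<Rightarrow> 'h) \<Rightarrow> nat \<Rightarrow> real \<times> 'w \<Rightarrow> 'h" where
  "drift x n z = (\<Sum>i<n. hadj (C i (fst z) (snd z)) (x i z))"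

definition weighted :: "(real \<times> 'w \<Rightarrow> 'h) \<Rightarrow> ennreal" where
  "weighted g = (\<integral>\<^sup>+z. ennreal ((T - fst z) powr (2 * \<alpha>) * (norm (g z))\<^sup>2) \<partial>slab M 0 T)"

lemma hadj_C_measurable:
  assumes "space \<mu> \<subseteq> {0..T} \<times> space M" "\<And>k. (\<lambda>z. C i (fst z) (snd z) (e k)) \<in> borel_measurable \<mu>"
    and x: "x \<in> borel_measurable \<mu>"
  shows "(\<lambda>z. hadj (C i (fst z) (snd z)) (x z)) \<in> borel_measurable \<mu>"
proof (rule borel_measurable_coordinates[OF basis])
  fix k
  have "(\<lambda>z. inner (x z) (C i (fst z) (snd z) (e k))) \<in> borel_measurable \<mu>"
    using assms by (intro borel_measurable_inner)
  moreover have "inner (hadj (C i (fst z) (snd z)) (x z)) (e k) = inner (x z) (C i (fst z) (snd z) (e k))"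
    if "z \<in> space \<mu>" for z
    by (rule hadj_inner[OF basis C_linear]) (use that assms(1) in auto)
  ultimately show "(\<lambda>z. inner (hadj (C i (fst z) (snd z)) (x z)) (e k)) \<in> borel_measurable \<mu>"
    by (subst measurable_cong) auto
qed

lemma space_slab_subset: "0 \<le> a \<Longrightarrow> b \<le> T \<Longrightarrow> space (slab M a b) \<subseteq> {0..T} \<times> space M"
  by (auto simp: space_pair_measure space_restrict_space)

lemma norm_hadj_C_le: "z \<in> space (slab M 0 T) \<Longrightarrow> norm (hadj (C i (fst z) (snd z)) y) \<le> c * norm y"
  by (rule norm_hadj_le[OF basis]) (auto simp: space_pair_measure space_restrict_space intro: C_linear C_le)

lemma L2_hadj_C:
  assumes x: "L2 (slab M 0 T) x" shows "L2 (slab M 0 T) (\<lambda>z. hadj (C i (fst z) (snd z)) (x z))"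
proof (rule L2_mono[OF x, where K=c])
  show "(\<lambda>z. hadj (C i (fst z) (snd z)) (x z)) \<in> borel_measurable (slab M 0 T)"
    using T_pos by (intro hadj_C_measurable space_slab_subset progressive_measurable[OF C_prog] L2_measurable[OF x]) auto
qed (rule norm_hadj_C_le)

lemma L2_drift: "(\<And>i. L2 (slab M 0 T) (x i)) \<Longrightarrow> L2 (slab M 0 T) (drift x n)"
  unfolding drift_def[abs_def] by (intro L2_sum L2_hadj_C)

lemma slab_time:
  "z \<in> space (slab M t T) \<Longrightarrow> 0 \<le> t \<Longrightarrow> fst z - t \<in> {0..T} \<and> max 0 (fst z - t) = fst z - t"
  by (auto simp: space_pair_measure space_restrict_space)

lemma hadj_S_inner:
  assumes "z \<in> space (slab M t T)" "0 \<le> t"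
  shows "inner (hadj (S (fst z - t)) x) y = inner x (S (max 0 (fst z - t)) y)"
  using slab_time[OF assms] hadj_inner[OF basis S_linear] by simp

lemma hadj_S_measurable:
  assumes x: "x \<in> borel_measurable (slab M t T)" and t: "0 \<le> t"
  shows "(\<lambda>z. hadj (S (fst z - t)) (x z)) \<in> borel_measurable (slab M t T)"
proof (rule borel_measurable_coordinates[OF basis])
  fix k
  have "(\<lambda>z. fst z - t) \<in> borel_measurable (slab M t T)"
    by (rule measurable_compose[OF measurable_fst measurable_restrict_space1]) simp
  then have "(\<lambda>z. inner (x z) (S (max 0 (fst z - t)) (e k))) \<in> borel_measurable (slab M t T)"
    using x by (intro borel_measurable_inner borel_measurable_semigroup) auto
  then show "(\<lambda>z. inner (hadj (S (fst z - t)) (x z)) (e k)) \<in> borel_measurable (slab M t T)"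
    using hadj_S_inner[OF _ t] by (subst measurable_cong) auto
qed

lemma norm_hadj_S_le: "z \<in> space (slab M t T) \<Longrightarrow> 0 \<le> t \<Longrightarrow> norm (hadj (S (fst z - t)) y) \<le> K * norm y"
  using slab_time[of z t] by (intro norm_hadj_le[OF basis] S_linear S_le) auto

lemma L2_hadj_S:
  assumes x: "L2 (slab M t T) x" and t: "0 \<le> t" shows "L2 (slab M t T) (\<lambda>z. hadj (S (fst z - t)) (x z))"
  by (rule L2_mono[OF x hadj_S_measurable[OF L2_measurable[OF x] t], where K=K]) (rule norm_hadj_S_le[OF _ t])

definition drift_integral :: "(nat \<Rightarrow> real \<times> 'w \<Rightarrow> 'h) \<Rightarrow> real \<Rightarrow> nat \<Rightarrow> 'w \<Rightarrow> 'h" where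
  "drift_integral x t n \<omega> = (\<Sum>i<n. time_integral t T (\<lambda>z. hadj (S (fst z - t)) (hadj (C i (fst z) (snd z)) (x i z))) \<omega>)"

context
  fixes x :: "nat \<Rightarrow> real \<times> 'w \<Rightarrow> 'h" and t :: real
  assumes x: "\<And>i. L2 (slab M 0 T) (x i)" and t: "0 \<le> t" "t \<le> T"
begin

private abbreviation "W i \<equiv> (\<lambda>z. hadj (S (fst z - t)) (hadj (C i (fst z) (snd z)) (x i z)))"
private abbreviation "WS n \<equiv> (\<lambda>z. hadj (S (fst z - t)) (drift x n z))"

private lemma W_L2: "L2 (slab M t T) (W i)"
  by (rule L2_hadj_S[OF L2_slab_mono[OF prob_space_axioms _ L2_hadj_C[OF x]]]) (use t in auto)

private lemma WS_L2: "L2 (slab M t T) (WS n)"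
  by (rule L2_hadj_S[OF L2_slab_mono[OF prob_space_axioms _ L2_drift[OF x]]]) (use t in auto)

lemma drift_integral_measurable: "drift_integral x t n \<in> borel_measurable M"
  unfolding drift_integral_def[abs_def]
  by (intro borel_measurable_sum time_integral_measurable[OF prob_space_axioms basis W_L2])

text \<open>The mild equation contains a sum of separate Bochner integrals, while condition (3)
  bounds the sum of the integrands. They agree wherever all of the countably many integrands are
  integrable in time.\<close>

lemma AE_drift_integral: "AE \<omega> in M. drift_integral x t n \<omega> = time_integral t T (WS n) \<omega>"
proof -
  have "AE \<omega> in M. \<forall>i. integrable (restrict_space lborel {t..T}) (\<lambda>s. W i (s, \<omega>))"
    unfolding AE_all_countable using AE_time_integrable[OF prob_space_axioms basis W_L2] by simp
  then show ?thesis
  proof eventually_elim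
    case (elim \<omega>)
    have "drift_integral x t n \<omega> = (\<integral>s. (\<Sum>i<n. W i (s, \<omega>)) \<partial>restrict_space lborel {t..T})"
      unfolding drift_integral_def time_integral_def
      by (rule Bochner_Integration.integral_sum[symmetric]) (use elim in blast)
    also have "\<dots> = time_integral t T (WS n) \<omega>"
      unfolding time_integral_def drift_def
    proof (rule Bochner_Integration.integral_cong[OF refl])
      fix s assume "s \<in> space (restrict_space lborel {t..T})"
      then have "0 \<le> s - t" by (simp add: space_restrict_space)
      then show "(\<Sum>i<n. W i (s, \<omega>)) = hadj (S (fst (s, \<omega>) - t)) (\<Sum>i<n. hadj (C i (fst (s, \<omega>)) (snd (s, \<omega>))) (x i (s, \<omega>)))"
        by (simp add: hadj_sum[OF basis S_linear])
    qed
    finally show ?case .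
  qed
qed

text \<open>Fubini pulls the time integral out, and the adjoint moves the semigroup to Y. The drift
  itself then enters the pairing undisturbed.\<close>

lemma drift_integral_pairing:
  assumes Y: "L2 M Y"
  shows "expectation (\<lambda>\<omega>. inner (drift_integral x t n \<omega>) (Y \<omega>))
    = (\<integral>z. inner (drift x n z) (S (max 0 (fst z - t)) (Y (snd z))) \<partial>slab M t T)"
proof -
  have "expectation (\<lambda>\<omega>. inner (drift_integral x t n \<omega>) (Y \<omega>)) = expectation (\<lambda>\<omega>. inner (time_integral t T (WS n) \<omega>) (Y \<omega>))"
  proof (rule integral_cong_AE)
    show "AE \<omega> in M. inner (drift_integral x t n \<omega>) (Y \<omega>) = inner (time_integral t T (WS n) \<omega>) (Y \<omega>)"
      using AE_drift_integral[of n] by eventually_elim simp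
  qed (intro borel_measurable_inner drift_integral_measurable L2_measurable[OF Y]
      time_integral_measurable[OF prob_space_axioms basis WS_L2])+
  also have "\<dots> = (\<integral>z. inner (WS n z) (Y (snd z)) \<partial>slab M t T)"
    by (rule time_integral_pairing[OF prob_space_axioms basis WS_L2 Y])
  also have "\<dots> = (\<integral>z. inner (drift x n z) (S (max 0 (fst z - t)) (Y (snd z))) \<partial>slab M t T)"
    by (intro Bochner_Integration.integral_cong refl hadj_S_inner t)
  finally show ?thesis .
qed

text \<open>Insert (T - s)^(-\<alpha>) (T - s)^\<alpha> = 1 and apply Cauchy-Schwarz in time: the
  first weight has a finite square integral because \<alpha> < 1/2, the second yields the weighted
  norm.\<close>

lemma drift_integral_bound:
  assumes fin: "weighted (drift x n) < \<infinity>"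
  shows "(\<integral>\<^sup>+\<omega>. ennreal ((norm (drift_integral x t n \<omega>))\<^sup>2) \<partial>M)
    \<le> ennreal (K\<^sup>2 * ((T - t) powr (1 - 2 * \<alpha>) / (1 - 2 * \<alpha>))) * weighted (drift x n)"
proof -
  let ?L = "restrict_space lborel {t..T}"
  define h where "h s = K * (T - s) powr (- \<alpha>)" for s
  define G where "G z = (T - fst z) powr \<alpha> * norm (drift x n z)" for z
  have sq: "(y powr a)\<^sup>2 = y powr (2 * a)" for y a :: real
    by (simp add: power2_eq_square flip: powr_add)
  have G2: "(G z)\<^sup>2 = (T - fst z) powr (2 * \<alpha>) * (norm (drift x n z))\<^sup>2" for z
    by (simp add: G_def power_mult_distrib sq)
  have dm: "drift x n \<in> borel_measurable (slab M 0 T)" by (rule L2_measurable[OF L2_drift[OF x]])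
  have wm: "(\<lambda>z. (T - fst z) powr \<alpha>) \<in> borel_measurable (slab M 0 T)"
    by (rule measurable_compose[OF measurable_fst measurable_restrict_space1]) simp
  have Gm0[measurable]: "G \<in> borel_measurable (slab M 0 T)"
    unfolding G_def[abs_def] using dm wm by measurable
  have Gm: "G \<in> borel_measurable (slab M t T)" by (rule measurable_slab_mono[OF _ Gm0]) (use t in auto)
  have GW: "(\<integral>\<^sup>+z. ennreal ((G z)\<^sup>2) \<partial>slab M t T) \<le> weighted (drift x n)"
    unfolding weighted_def G2[symmetric]
    by (subst nn_integral_slab_restrict[OF prob_space_axioms, of t T 0 T])
      (use t Gm0 in \<open>auto simp: indicator_def intro!: nn_integral_mono\<close>)
  have hk: "(\<integral>\<^sup>+s. ennreal ((h s)\<^sup>2) \<partial>?L) = ennreal (K\<^sup>2 * ((T - t) powr (1 - 2 * \<alpha>) / (1 - 2 * \<alpha>)))"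
  proof -
    have "(\<integral>\<^sup>+s. ennreal ((h s)\<^sup>2) \<partial>?L) = (\<integral>\<^sup>+s. ennreal ((h s)\<^sup>2) * indicator {t..T} s \<partial>lborel)"
      by (rule nn_integral_restrict_space) simp
    also have "\<dots> = (\<integral>\<^sup>+s. ennreal (K\<^sup>2) * (ennreal ((T - s) powr (- (2 * \<alpha>))) * indicator {t..T} s) \<partial>lborel)"
      by (intro nn_integral_cong) (simp add: h_def power_mult_distrib sq ennreal_mult mult.assoc)
    also have "\<dots> = ennreal (K\<^sup>2) * (\<integral>\<^sup>+s. ennreal ((T - s) powr (- (2 * \<alpha>))) * indicator {t..T} s \<partial>lborel)"
      by (rule nn_integral_cmult) measurable
    also have "\<dots> = ennreal (K\<^sup>2) * ennreal ((T - t) powr (1 - 2 * \<alpha>) / (1 - 2 * \<alpha>))"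
      using alpha t by (subst nn_integral_powr_right) auto
    also have "\<dots> = ennreal (K\<^sup>2 * ((T - t) powr (1 - 2 * \<alpha>) / (1 - 2 * \<alpha>)))"
      using alpha by (intro ennreal_mult[symmetric]) auto
    finally show ?thesis .
  qed
  \<comment> \<open>At time T both powers are 0, as \<open>0 powr a = 0\<close>, and do not cancel;
    T is the exempt time in \<open>time_integral_bound\<close>.\<close>
  have le: "norm (WS n z) \<le> h (fst z) * G z" if z: "z \<in> space (slab M t T)" "fst z \<noteq> T" for z
  proof -
    have "fst z < T" using z by (auto simp: space_pair_measure space_restrict_space)
    then have "(T - fst z) powr (- \<alpha>) * (T - fst z) powr \<alpha> = 1" by (simp flip: powr_add)
    then have "h (fst z) * G z = K * norm (drift x n z)" by (simp add: h_def G_def mult_ac)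
    then show ?thesis using norm_hadj_S_le[OF z(1) t(1)] by simp
  qed
  have "(\<integral>\<^sup>+\<omega>. ennreal ((norm (drift_integral x t n \<omega>))\<^sup>2) \<partial>M) = (\<integral>\<^sup>+\<omega>. ennreal ((norm (time_integral t T (WS n) \<omega>))\<^sup>2) \<partial>M)"
    using AE_drift_integral[of n] by (intro nn_integral_cong_AE) (auto elim: eventually_mono)
  also have "\<dots> \<le> ennreal (K\<^sup>2 * ((T - t) powr (1 - 2 * \<alpha>) / (1 - 2 * \<alpha>))) * (\<integral>\<^sup>+z. ennreal ((G z)\<^sup>2) \<partial>slab M t T)"
  proof (rule time_integral_bound[OF prob_space_axioms basis WS_L2 _ _ hk Gm _ _ le])
    show "h \<in> borel_measurable borel" unfolding h_def[abs_def] by measurable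
    show "0 \<le> h s" for s using K_ge_1 by (simp add: h_def)
    show "0 \<le> G z" for z by (simp add: G_def)
    show "(\<integral>\<^sup>+z. ennreal ((G z)\<^sup>2) \<partial>slab M t T) < \<infinity>" using GW fin by (rule le_less_trans)
  qed
  also have "\<dots> \<le> ennreal (K\<^sup>2 * ((T - t) powr (1 - 2 * \<alpha>) / (1 - 2 * \<alpha>))) * weighted (drift x n)"
    by (intro mult_left_mono GW) simp
  finally show ?thesis .
qed

text \<open>Condition (3) bounds the drift integrals in L2 uniformly in n, so their L1 limit D is
  also their weak L2 limit.\<close>

lemma drift_integral_limit:
  assumes bd: "\<And>n. weighted (drift x n) \<le> B" "B < \<infinity>" and D: "D \<in> borel_measurable M"
    and lim: "(\<lambda>n. \<integral>\<^sup>+\<omega>. ennreal (norm (drift_integral x t n \<omega> - D \<omega>)) \<partial>M) \<longlonglongrightarrow> 0"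
  shows "L2 M D"
    and "L2 M Y \<Longrightarrow> (\<lambda>n. \<integral>z. inner (drift x n z) (S (max 0 (fst z - t)) (Y (snd z))) \<partial>slab M t T)
      \<longlonglongrightarrow> expectation (\<lambda>\<omega>. inner (D \<omega>) (Y \<omega>))"
proof -
  let ?k = "ennreal (K\<^sup>2 * ((T - t) powr (1 - 2 * \<alpha>) / (1 - 2 * \<alpha>)))"
  have fin: "?k * B < \<infinity>" using bd(2) by (simp add: ennreal_mult_less_top)
  then obtain b where b: "?k * B = ennreal b" "0 \<le> b" by (cases "?k * B") auto
  have le: "(\<integral>\<^sup>+\<omega>. ennreal ((norm (drift_integral x t n \<omega>))\<^sup>2) \<partial>M) \<le> ennreal b" for n
  proof -
    have "(\<integral>\<^sup>+\<omega>. ennreal ((norm (drift_integral x t n \<omega>))\<^sup>2) \<partial>M) \<le> ?k * weighted (drift x n)"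
      by (rule drift_integral_bound) (use bd in \<open>auto intro: le_less_trans\<close>)
    also have "\<dots> \<le> ?k * B" by (intro mult_left_mono bd) simp
    finally show ?thesis by (simp only: b)
  qed
  have l2: "L2 M (drift_integral x t n)" for n
    using le[of n] by (simp add: L2_def drift_integral_measurable le_less_trans)
  have bd': "expectation (\<lambda>\<omega>. (norm (drift_integral x t n \<omega>))\<^sup>2) \<le> b" for n
    using le[of n] b(2) by (simp add: L2_nn_integral[OF l2])
  note lims = L2_bounded_L1_limit[OF D l2 bd' lim]
  show "L2 M D" by (rule lims)
  assume "L2 M Y"
  from lims(2)[OF this] drift_integral_pairing[OF this]
  show "(\<lambda>n. \<integral>z. inner (drift x n z) (S (max 0 (fst z - t)) (Y (snd z))) \<partial>slab M t T)
      \<longlonglongrightarrow> expectation (\<lambda>\<omega>. inner (D \<omega>) (Y \<omega>))" by simp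
qed

end

end


section \<open>Pairings of the two mild equations\<close>

text \<open>The pairing of p with its own truncation is the integral of |p|^2 over the set |p| <= n.
  A truncation is bounded and as measurable as p, so p can act as its own test without being known
  to be square integrable.\<close>

lemma AE_zero_of_truncated_orthogonal:
  fixes p :: "'a \<Rightarrow> 'b::{real_inner,second_countable_topology}"
  assumes p: "p \<in> borel_measurable \<mu>" and fin: "finite_measure \<mu>"
    and orth: "\<And>n. (\<integral>z. inner (p z) (if norm (p z) \<le> real n then p z else 0) \<partial>\<mu>) = 0"
  shows "AE z in \<mu>. p z = 0"
proof -
  interpret finite_measure \<mu> by fact
  have "AE z in \<mu>. norm (p z) \<le> real n \<longrightarrow> p z = 0" for n
  proof -
    let ?f = "\<lambda>z. inner (p z) (if norm (p z) \<le> real n then p z else 0)"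
    have eq: "?f z = (if norm (p z) \<le> real n then (norm (p z))\<^sup>2 else 0)" for z
      by (simp add: power2_norm_eq_inner)
    have "integrable \<mu> ?f"
    proof (rule integrable_const_bound[of _ "(real n)\<^sup>2"])
      show "AE z in \<mu>. norm (?f z) \<le> (real n)\<^sup>2"
        unfolding eq by (intro AE_I2) (auto intro: power_mono)
    qed (use p in measurable)
    moreover have "AE z in \<mu>. 0 \<le> ?f z" unfolding eq by simp
    ultimately have "AE z in \<mu>. ?f z = 0"
      using orth[of n] by (subst integral_nonneg_eq_0_iff_AE[symmetric])
    then show ?thesis unfolding eq by eventually_elim (auto split: if_splits)
  qed
  then have "AE z in \<mu>. \<forall>n. norm (p z) \<le> real n \<longrightarrow> p z = 0" by (subst AE_all_countable) blast
  then show ?thesis by eventually_elim (use real_arch_simple in blast)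
qed

lemma AE_slab_mono:
  assumes M: "prob_space M" and sub: "{a..b} \<subseteq> {a'..b'}"
    and g: "(g :: _ \<Rightarrow> 'b::real_normed_vector) \<in> borel_measurable (slab M a' b')" and zero: "AE z in slab M a' b'. g z = 0"
  shows "AE z in slab M a b. g z = 0"
proof -
  have "(\<integral>\<^sup>+z. ennreal (norm (g z)) \<partial>slab M a b) = (\<integral>\<^sup>+z. ennreal (norm (g z)) * indicator {a..b} (fst z) \<partial>slab M a' b')"
    by (rule nn_integral_slab_restrict[OF M sub]) (use g in measurable)
  also have "\<dots> = (\<integral>\<^sup>+z. 0 \<partial>slab M a' b')"
    using zero by (intro nn_integral_cong_AE) (auto elim: eventually_mono)
  finally have "(\<integral>\<^sup>+z. ennreal (norm (g z)) \<partial>slab M a b) = 0" by simp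
  then have "AE z in slab M a b. ennreal (norm (g z)) = 0"
    using measurable_slab_mono[OF sub g] by (subst (asm) nn_integral_0_iff_AE) auto
  then show ?thesis by eventually_elim simp
qed

context bsde_setup begin

definition columns :: "(real \<Rightarrow> 'w \<Rightarrow> 'h \<Rightarrow> 'h) \<Rightarrow> nat \<Rightarrow> real \<times> 'w \<Rightarrow> 'h" where
  "columns Q j z = Q (fst z) (snd z) (e j)"

text \<open>The data of the mild equation at time \<open>t\<close>: \<open>D\<close> and \<open>SI\<close> are the drift and
  the stochastic term, known only through their pairings with test variables.\<close>

definition decomposition ::
  "('w \<Rightarrow> 'h) \<Rightarrow> (real \<Rightarrow> 'w \<Rightarrow> 'h) \<Rightarrow> (real \<Rightarrow> 'w \<Rightarrow> 'h) \<Rightarrow> (real \<Rightarrow> 'w \<Rightarrow> 'h \<Rightarrow> 'h) \<Rightarrow> real \<Rightarrow> ('w \<Rightarrow> 'h) \<Rightarrow> ('w \<Rightarrow> 'h) \<Rightarrow> bool" where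
  "decomposition \<eta> f P Q t D SI \<longleftrightarrow> L2 M D \<and> L2 M SI \<and>
    (AE \<omega> in M. P t \<omega> = hadj (S (T - t)) (\<eta> \<omega>) + D \<omega>
       + integral\<^sup>L (restrict_space lborel {t..T}) (\<lambda>s. hadj (S (s - t)) (f s \<omega>)) - SI \<omega>) \<and>
    (\<forall>Y. L2 M Y \<longrightarrow> (\<lambda>n. \<integral>z. inner (drift (columns Q) n z) (S (max 0 (fst z - t)) (Y (snd z))) \<partial>slab M t T)
       \<longlonglongrightarrow> expectation (\<lambda>\<omega>. inner (D \<omega>) (Y \<omega>))) \<and>
    (\<forall>\<zeta> B j v. \<zeta> \<in> borel_measurable (F t) \<longrightarrow> (\<forall>\<omega>\<in>space M. norm (\<zeta> \<omega>) \<le> B) \<longrightarrow> t \<le> v \<longrightarrow> v \<le> T \<longrightarrow>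
       expectation (\<lambda>\<omega>. inner (SI \<omega>) (incr j t v \<omega> *\<^sub>R \<zeta> \<omega>))
       = (\<integral>z. inner (columns Q j z) (indicator {t..<v} (fst z) *\<^sub>R S (max 0 (fst z - t)) (\<zeta> (snd z))) \<partial>slab M t T)) \<and>
    (\<forall>\<zeta> B. \<zeta> \<in> borel_measurable (F t) \<longrightarrow> (\<forall>\<omega>\<in>space M. norm (\<zeta> \<omega>) \<le> B) \<longrightarrow>
       expectation (\<lambda>\<omega>. inner (SI \<omega>) (\<zeta> \<omega>)) = 0)"

lemma decompositionD:
  assumes "decomposition \<eta> f P Q t D SI"
  shows "L2 M D" "L2 M SI"
    "AE \<omega> in M. P t \<omega> = hadj (S (T - t)) (\<eta> \<omega>) + D \<omega>
       + integral\<^sup>L (restrict_space lborel {t..T}) (\<lambda>s. hadj (S (s - t)) (f s \<omega>)) - SI \<omega>"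
    "\<And>Y. L2 M Y \<Longrightarrow> (\<lambda>n. \<integral>z. inner (drift (columns Q) n z) (S (max 0 (fst z - t)) (Y (snd z))) \<partial>slab M t T)
       \<longlonglongrightarrow> expectation (\<lambda>\<omega>. inner (D \<omega>) (Y \<omega>))"
    "\<And>\<zeta> B j v. \<zeta> \<in> borel_measurable (F t) \<Longrightarrow> (\<And>\<omega>. \<omega> \<in> space M \<Longrightarrow> norm (\<zeta> \<omega>) \<le> B) \<Longrightarrow> t \<le> v \<Longrightarrow> v \<le> T \<Longrightarrow>
       expectation (\<lambda>\<omega>. inner (SI \<omega>) (incr j t v \<omega> *\<^sub>R \<zeta> \<omega>))
       = (\<integral>z. inner (columns Q j z) (indicator {t..<v} (fst z) *\<^sub>R S (max 0 (fst z - t)) (\<zeta> (snd z))) \<partial>slab M t T)"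
    "\<And>\<zeta> B. \<zeta> \<in> borel_measurable (F t) \<Longrightarrow> (\<And>\<omega>. \<omega> \<in> space M \<Longrightarrow> norm (\<zeta> \<omega>) \<le> B) \<Longrightarrow>
       expectation (\<lambda>\<omega>. inner (SI \<omega>) (\<zeta> \<omega>)) = 0"
proof -
  note a = assms[unfolded decomposition_def]
  note a3 = a[THEN conjunct2, THEN conjunct2]
  note a5 = a3[THEN conjunct2, THEN conjunct2]
  show "L2 M D" "L2 M SI" by (rule a[THEN conjunct1], rule a[THEN conjunct2, THEN conjunct1])
  show "AE \<omega> in M. P t \<omega> = hadj (S (T - t)) (\<eta> \<omega>) + D \<omega>
       + integral\<^sup>L (restrict_space lborel {t..T}) (\<lambda>s. hadj (S (s - t)) (f s \<omega>)) - SI \<omega>"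
    by (rule a3[THEN conjunct1])
  show "(\<lambda>n. \<integral>z. inner (drift (columns Q) n z) (S (max 0 (fst z - t)) (Y (snd z))) \<partial>slab M t T)
       \<longlonglongrightarrow> expectation (\<lambda>\<omega>. inner (D \<omega>) (Y \<omega>))" if "L2 M Y" for Y
    by (rule a3[THEN conjunct2, THEN conjunct1, rule_format, OF that])
  show "expectation (\<lambda>\<omega>. inner (SI \<omega>) (incr j t v \<omega> *\<^sub>R \<zeta> \<omega>))
       = (\<integral>z. inner (columns Q j z) (indicator {t..<v} (fst z) *\<^sub>R S (max 0 (fst z - t)) (\<zeta> (snd z))) \<partial>slab M t T)"
    if "\<zeta> \<in> borel_measurable (F t)" "\<And>\<omega>. \<omega> \<in> space M \<Longrightarrow> norm (\<zeta> \<omega>) \<le> B" "t \<le> v" "v \<le> T" for \<zeta> B j v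
    by (rule a5[THEN conjunct1, rule_format, OF that])
  show "expectation (\<lambda>\<omega>. inner (SI \<omega>) (\<zeta> \<omega>)) = 0"
    if "\<zeta> \<in> borel_measurable (F t)" "\<And>\<omega>. \<omega> \<in> space M \<Longrightarrow> norm (\<zeta> \<omega>) \<le> B" for \<zeta> B
    by (rule a5[THEN conjunct2, rule_format, OF that])
qed

context
  fixes \<eta> f P Q
  assumes sol: "mild_solution M \<beta> e S C T \<alpha> \<eta> f P Q"
begin

lemma solution_columns_progressive: "progressive M F T (\<lambda>s \<omega>. columns Q j (s, \<omega>))"
  using sol by (simp add: mild_solution_def columns_def)

lemma solution_columns_L2: "L2 (slab M 0 T) (columns Q j)"
proof -
  have "(\<lambda>z. columns Q j (fst z, snd z)) \<in> borel_measurable (slab M 0 T)"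
    using T_pos by (intro progressive_measurable[OF solution_columns_progressive]) auto
  then have m: "columns Q j \<in> borel_measurable (slab M 0 T)" by simp
  have "(\<integral>\<^sup>+z. ennreal ((norm (columns Q j z))\<^sup>2) \<partial>slab M 0 T) \<le> (\<integral>\<^sup>+z. hs_norm2 e (Q (fst z) (snd z)) \<partial>slab M 0 T)"
  proof (rule nn_integral_mono)
    fix z
    have "g j \<le> suminf g" for g :: "nat \<Rightarrow> ennreal"
      using sum_le_suminf[of g "{j}"] by simp
    then show "ennreal ((norm (columns Q j z))\<^sup>2) \<le> hs_norm2 e (Q (fst z) (snd z))"
      unfolding hs_norm2_def columns_def .
  qed
  also have "\<dots> < \<infinity>" using sol unfolding mild_solution_def by (elim conjE)
  finally show ?thesis using m unfolding L2_def by (rule_tac conjI)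
qed

lemma solution_weighted_drift: "\<exists>B<\<infinity>. \<forall>n. weighted (drift (columns Q) n) \<le> B"
proof (intro exI conjI allI)
  show "(SUP n. weighted (drift (columns Q) n)) < \<infinity>"
    using sol by (simp add: mild_solution_def weighted_def drift_def columns_def)
  show "weighted (drift (columns Q) n) \<le> (SUP n. weighted (drift (columns Q) n))" for n
    by (rule SUP_upper) simp
qed

text \<open>Against an increment of \<open>\<beta> j\<close> only the j-th stochastic integral
  contributes, so the pairings of the partial sums no longer change once n > j. The adjoint of S is
  moved onto the test variable on both the drift and the stochastic side.\<close>

lemma solution_decomposition:
  assumes t: "t \<in> {0..T}"
  shows "\<exists>D SI. decomposition \<eta> f P Q t D SI"
proof -
  have t0: "0 \<le> t" "t \<le> T" using t by auto
  obtain D I SI where D: "D \<in> borel_measurable M"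
    and limD: "(\<lambda>n. \<integral>\<^sup>+\<omega>. ennreal (norm ((\<Sum>i<n. integral\<^sup>L (restrict_space lborel {t..T})
               (\<lambda>s. hadj (S (s - t)) (hadj (C i s \<omega>) (Q s \<omega> (e i))))) - D \<omega>)) \<partial>M) \<longlonglongrightarrow> 0"
    and I: "\<And>i. ito_int M F (\<beta> i) t T (\<lambda>s \<omega>. hadj (S (s - t)) (Q s \<omega> (e i))) (I i)"
    and SI: "SI \<in> borel_measurable M"
    and limSI: "(\<lambda>n. \<integral>\<^sup>+\<omega>. ennreal ((norm ((\<Sum>i<n. I i \<omega>) - SI \<omega>))\<^sup>2) \<partial>M) \<longlonglongrightarrow> 0"
    and P: "AE \<omega> in M. P t \<omega> = hadj (S (T - t)) (\<eta> \<omega>) + D \<omega>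
            + integral\<^sup>L (restrict_space lborel {t..T}) (\<lambda>s. hadj (S (s - t)) (f s \<omega>)) - SI \<omega>"
    using sol[unfolded mild_solution_def, THEN conjunct2, THEN conjunct2, THEN conjunct2, THEN conjunct2,
        THEN conjunct2, THEN conjunct2, THEN conjunct2, THEN bspec, OF t] by blast
  have limD': "(\<lambda>n. \<integral>\<^sup>+\<omega>. ennreal (norm (drift_integral (columns Q) t n \<omega> - D \<omega>)) \<partial>M) \<longlonglongrightarrow> 0"
    using limD by (simp add: drift_integral_def time_integral_def columns_def)
  obtain B where B: "\<And>n. weighted (drift (columns Q) n) \<le> B" "B < \<infinity>"
    using solution_weighted_drift by blast
  have cols: "L2 (slab M t T) (columns Q i)" for i
    by (rule L2_slab_mono[OF prob_space_axioms _ solution_columns_L2]) (use t in auto)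
  have \<Phi>: "(\<lambda>z. hadj (S (fst z - t)) (Q (fst z) (snd z) (e i))) \<in> borel_measurable (slab M t T)" for i
    using hadj_S_measurable[OF L2_measurable[OF cols[of i]] t0(1)] by (simp add: columns_def)
  note ito = ito_int_pairing[OF I t0 \<Phi>]
  have lim: "(\<lambda>n. \<integral>\<^sup>+\<omega>. ennreal ((norm (SI \<omega> - (\<Sum>i<n. I i \<omega>)))\<^sup>2) \<partial>M) \<longlonglongrightarrow> 0"
    using limSI by (simp add: norm_minus_commute)
  note limit = L2_limit[OF SI L2_sum[OF ito(1)] lim]
  show ?thesis
    unfolding decomposition_def
  proof (rule exI[of _ D], rule exI[of _ SI], intro conjI allI impI limit(1) P)
    show "L2 M D"
      by (rule drift_integral_limit(1)[OF solution_columns_L2 t0 B D limD'])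
    show "(\<lambda>n. \<integral>z. inner (drift (columns Q) n z) (S (max 0 (fst z - t)) (Y (snd z))) \<partial>slab M t T)
       \<longlonglongrightarrow> expectation (\<lambda>\<omega>. inner (D \<omega>) (Y \<omega>))" if "L2 M Y" for Y
      by (rule drift_integral_limit(2)[OF solution_columns_L2 t0 B D limD' that])
  next
    fix \<zeta> :: "'w \<Rightarrow> 'h" and b j v
    assume \<zeta>m: "\<zeta> \<in> borel_measurable (F t)" and \<zeta>b: "\<forall>\<omega>\<in>space M. norm (\<zeta> \<omega>) \<le> b"
      and v: "t \<le> v" "v \<le> T"
    have \<zeta>: "\<zeta> \<in> borel_measurable (F t)" "\<And>\<omega>. \<omega> \<in> space M \<Longrightarrow> norm (\<zeta> \<omega>) \<le> b" using \<zeta>m \<zeta>b by auto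
    have Y: "L2 M (\<lambda>\<omega>. incr j t v \<omega> *\<^sub>R \<zeta> \<omega>)"
      by (rule L2_incr_scaleR[OF t0(1) v measurable_F_M[OF \<zeta>(1) t0(2)] \<zeta>(2)])
    let ?R = "\<integral>z. inner (columns Q j z) (indicator {t..<v} (fst z) *\<^sub>R S (max 0 (fst z - t)) (\<zeta> (snd z))) \<partial>slab M t T"
    have R: "(\<integral>z. inner (hadj (S (fst z - t)) (Q (fst z) (snd z) (e j))) (indicator {t..<v} (fst z) *\<^sub>R \<zeta> (snd z)) \<partial>slab M t T) = ?R"
      by (intro Bochner_Integration.integral_cong refl) (simp add: hadj_S_inner[OF _ t0(1)] columns_def)
    have E: "expectation (\<lambda>\<omega>. inner (I i \<omega>) (incr j t v \<omega> *\<^sub>R \<zeta> \<omega>)) = (if i = j then ?R else 0)" for i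
      using ito(2)[OF order_refl v \<zeta>, of i j] unfolding R[symmetric] by (cases "i = j") auto
    have "expectation (\<lambda>\<omega>. inner (\<Sum>i<n. I i \<omega>) (incr j t v \<omega> *\<^sub>R \<zeta> \<omega>)) = (if j < n then ?R else 0)" for n
    proof -
      have "expectation (\<lambda>\<omega>. inner (\<Sum>i<n. I i \<omega>) (incr j t v \<omega> *\<^sub>R \<zeta> \<omega>))
          = (\<Sum>i<n. expectation (\<lambda>\<omega>. inner (I i \<omega>) (incr j t v \<omega> *\<^sub>R \<zeta> \<omega>)))"
        unfolding inner_sum_left by (rule Bochner_Integration.integral_sum) (rule L2_inner_integrable[OF ito(1) Y])
      also have "\<dots> = (if j < n then ?R else 0)" unfolding E by simp
      finally show ?thesis .
    qed
    with limit(2)[OF Y] have "(\<lambda>n. if j < n then ?R else 0) \<longlonglongrightarrow> expectation (\<lambda>\<omega>. inner (SI \<omega>) (incr j t v \<omega> *\<^sub>R \<zeta> \<omega>))"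
      by (simp only:)
    moreover have "(\<lambda>n. if j < n then ?R else 0) \<longlonglongrightarrow> ?R"
      by (rule tendsto_eventually) (use eventually_gt_at_top[of j] in \<open>eventually_elim, simp\<close>)
    ultimately show "expectation (\<lambda>\<omega>. inner (SI \<omega>) (incr j t v \<omega> *\<^sub>R \<zeta> \<omega>)) = ?R"
      by (rule LIMSEQ_unique)
  next
    fix \<zeta> :: "'w \<Rightarrow> 'h" and b
    assume \<zeta>m: "\<zeta> \<in> borel_measurable (F t)" and \<zeta>b: "\<forall>\<omega>\<in>space M. norm (\<zeta> \<omega>) \<le> b"
    have \<zeta>: "\<zeta> \<in> borel_measurable (F t)" "\<And>\<omega>. \<omega> \<in> space M \<Longrightarrow> norm (\<zeta> \<omega>) \<le> b" using \<zeta>m \<zeta>b by auto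
    have Y: "L2 M \<zeta>" by (rule L2_bounded[OF measurable_F_M[OF \<zeta>(1) t0(2)] \<zeta>(2)])
    have "expectation (\<lambda>\<omega>. inner (\<Sum>i<n. I i \<omega>) (\<zeta> \<omega>)) = 0" for n
    proof -
      have "expectation (\<lambda>\<omega>. inner (\<Sum>i<n. I i \<omega>) (\<zeta> \<omega>)) = (\<Sum>i<n. expectation (\<lambda>\<omega>. inner (I i \<omega>) (\<zeta> \<omega>)))"
        unfolding inner_sum_left by (rule Bochner_Integration.integral_sum) (rule L2_inner_integrable[OF ito(1) Y])
      also have "\<dots> = 0" using ito(3)[OF \<zeta>] by simp
      finally show ?thesis .
    qed
    with limit(2)[OF Y] show "expectation (\<lambda>\<omega>. inner (SI \<omega>) (\<zeta> \<omega>)) = 0"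
      by (simp add: LIMSEQ_const_iff)
  qed
qed

end

context
  fixes \<eta> f P Q P' Q'
  assumes sol: "mild_solution M \<beta> e S C T \<alpha> \<eta> f P Q" and sol': "mild_solution M \<beta> e S C T \<alpha> \<eta> f P' Q'"
begin

private abbreviation "x \<equiv> (\<lambda>j z. columns Q j z - columns Q' j z)"

lemma columns_diff_L2: "L2 (slab M 0 T) (x j)"
  by (intro L2_diff solution_columns_L2[OF sol] solution_columns_L2[OF sol'])

lemma drift_diff:
  assumes "z \<in> space (slab M 0 T)"
  shows "drift x n z = drift (columns Q) n z - drift (columns Q') n z"
proof -
  have "hadj (C i (fst z) (snd z)) (x i z) = hadj (C i (fst z) (snd z)) (columns Q i z) - hadj (C i (fst z) (snd z)) (columns Q' i z)" for i
    by (rule hadj_diff[OF basis C_linear]) (use assms in \<open>auto simp: space_pair_measure space_restrict_space\<close>)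
  then show ?thesis by (simp add: drift_def sum_subtractf)
qed

lemma weighted_drift_diff: "\<exists>B<\<infinity>. \<forall>n. weighted (drift x n) \<le> B"
proof -
  obtain B where B: "B < \<infinity>" "\<And>n. weighted (drift (columns Q) n) \<le> B" using solution_weighted_drift[OF sol] by blast
  obtain B' where B': "B' < \<infinity>" "\<And>n. weighted (drift (columns Q') n) \<le> B'" using solution_weighted_drift[OF sol'] by blast
  have "weighted (drift x n) \<le> 2 * B + 2 * B'" for n
  proof -
    have wm[measurable]: "(\<lambda>z. (T - fst z) powr (2 * \<alpha>)) \<in> borel_measurable (slab M 0 T)"
      by (rule measurable_compose[OF measurable_fst measurable_restrict_space1]) simp
    note [measurable] = L2_measurable[OF L2_drift[OF solution_columns_L2[OF sol]]]
      L2_measurable[OF L2_drift[OF solution_columns_L2[OF sol']]]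
    let ?w = "\<lambda>z. (T - fst z) powr (2 * \<alpha>)"
    have "weighted (drift x n) \<le> (\<integral>\<^sup>+z. 2 * ennreal (?w z * (norm (drift (columns Q) n z))\<^sup>2)
        + 2 * ennreal (?w z * (norm (drift (columns Q') n z))\<^sup>2) \<partial>slab M 0 T)"
      unfolding weighted_def
    proof (rule nn_integral_mono)
      fix z assume z: "z \<in> space (slab M 0 T)"
      have "?w z * (norm (drift x n z))\<^sup>2 \<le> ?w z * (2 * (norm (drift (columns Q) n z))\<^sup>2 + 2 * (norm (drift (columns Q') n z))\<^sup>2)"
        unfolding drift_diff[OF z] by (intro mult_left_mono norm_diff_power2_le) auto
      then show "ennreal (?w z * (norm (drift x n z))\<^sup>2) \<le> 2 * ennreal (?w z * (norm (drift (columns Q) n z))\<^sup>2)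
        + 2 * ennreal (?w z * (norm (drift (columns Q') n z))\<^sup>2)"
        by (simp add: ennreal_leI algebra_simps flip: ennreal_numeral ennreal_mult ennreal_plus)
    qed
    also have "\<dots> = 2 * weighted (drift (columns Q) n) + 2 * weighted (drift (columns Q') n)"
      unfolding weighted_def by (rule nn_integral_lincomb) measurable
    also have "\<dots> \<le> 2 * B + 2 * B'" by (intro add_mono mult_left_mono B B') auto
    finally show ?thesis .
  qed
  moreover have "2 * B + 2 * B' < \<infinity>" using B(1) B'(1) by (simp add: ennreal_mult_less_top)
  ultimately show ?thesis by blast
qed

lemma drift_diff_pairing:
  assumes t: "t \<in> {0..T}" and Y: "L2 M Y"
  shows "(\<integral>z. inner (drift x n z) (S (max 0 (fst z - t)) (Y (snd z))) \<partial>slab M t T)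
    = (\<integral>z. inner (drift (columns Q) n z) (S (max 0 (fst z - t)) (Y (snd z))) \<partial>slab M t T)
    - (\<integral>z. inner (drift (columns Q') n z) (S (max 0 (fst z - t)) (Y (snd z))) \<partial>slab M t T)"
proof -
  have sub: "{t..T} \<subseteq> {0..T}" using t by auto
  have "L2 (slab M t T) (\<lambda>z. S (max 0 (fst z - t)) (Y (snd z)))"
  proof (rule L2_mono[OF L2_snd[OF prob_space_axioms Y], where K=K])
    have "(\<lambda>z. fst z - t) \<in> borel_measurable (slab M t T)"
      by (rule measurable_compose[OF measurable_fst measurable_restrict_space1]) simp
    then show "(\<lambda>z. S (max 0 (fst z - t)) (Y (snd z))) \<in> borel_measurable (slab M t T)"
      by (intro borel_measurable_semigroup measurable_compose[OF measurable_snd L2_measurable[OF Y]])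
    show "norm (S (max 0 (fst z - t)) (Y (snd z))) \<le> K * norm (Y (snd z))" if "z \<in> space (slab M t T)" for z
      using slab_time[OF that] t by (intro S_le) auto
  qed
  note int = L2_inner_integrable[OF L2_slab_mono[OF prob_space_axioms sub L2_drift] this]
  have "(\<integral>z. inner (drift x n z) (S (max 0 (fst z - t)) (Y (snd z))) \<partial>slab M t T)
    = (\<integral>z. inner (drift (columns Q) n z) (S (max 0 (fst z - t)) (Y (snd z)))
      - inner (drift (columns Q') n z) (S (max 0 (fst z - t)) (Y (snd z))) \<partial>slab M t T)"
  proof (intro Bochner_Integration.integral_cong refl)
    fix z assume "z \<in> space (slab M t T)"
    then have "z \<in> space (slab M 0 T)" using sub by (auto simp: space_pair_measure space_restrict_space)
    then show "inner (drift x n z) (S (max 0 (fst z - t)) (Y (snd z))) = inner (drift (columns Q) n z) (S (max 0 (fst z - t)) (Y (snd z)))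
      - inner (drift (columns Q') n z) (S (max 0 (fst z - t)) (Y (snd z)))"
      by (simp add: drift_diff inner_diff_left)
  qed
  also have "\<dots> = (\<integral>z. inner (drift (columns Q) n z) (S (max 0 (fst z - t)) (Y (snd z))) \<partial>slab M t T)
    - (\<integral>z. inner (drift (columns Q') n z) (S (max 0 (fst z - t)) (Y (snd z))) \<partial>slab M t T)"
    by (intro Bochner_Integration.integral_diff int solution_columns_L2[OF sol] solution_columns_L2[OF sol'])
  finally show ?thesis .
qed

lemma P_section_diff: "t \<in> {0..T} \<Longrightarrow> (\<lambda>\<omega>. P t \<omega> - P' t \<omega>) \<in> borel_measurable (F t)"
  using sol sol' by (intro borel_measurable_diff progressive_section) (auto simp: mild_solution_def)

text \<open>Testing the difference of the two mild equations at time \<open>u\<close> against an increment of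
  \<open>\<beta> j\<close> after \<open>u\<close> removes the \<open>P\<close>-terms.\<close>

lemma duality_identity:
  assumes uv: "0 \<le> u" "u \<le> v" "v \<le> T"
    and \<zeta>: "\<zeta> \<in> borel_measurable (F u)" "\<And>\<omega>. \<omega> \<in> space M \<Longrightarrow> norm (\<zeta> \<omega>) \<le> B"
  shows "(\<lambda>n. \<integral>z. inner (drift x n z) (S (max 0 (fst z - u)) (incr j u v (snd z) *\<^sub>R \<zeta> (snd z))) \<partial>slab M u T)
    \<longlonglongrightarrow> (\<integral>z. inner (x j z) (indicator {u..<v} (fst z) *\<^sub>R S (max 0 (fst z - u)) (\<zeta> (snd z))) \<partial>slab M u T)"
proof -
  have u: "u \<in> {0..T}" "u \<le> T" using uv by auto
  have sub: "{u..T} \<subseteq> {0..T}" using u by auto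
  obtain D SI where "decomposition \<eta> f P Q u D SI"
    using solution_decomposition[OF sol u(1)] by blast
  note D = decompositionD[OF this]
  obtain D' SI' where "decomposition \<eta> f P' Q' u D' SI'"
    using solution_decomposition[OF sol' u(1)] by blast
  note D' = decompositionD[OF this]
  let ?Y = "\<lambda>\<omega>. incr j u v \<omega> *\<^sub>R \<zeta> \<omega>"
  have \<zeta>M: "\<zeta> \<in> borel_measurable M" by (rule measurable_F_M[OF \<zeta>(1) u(2)])
  have \<zeta>2: "L2 M \<zeta>" by (rule L2_bounded[OF \<zeta>M \<zeta>(2)])
  have Y: "L2 M ?Y" by (rule L2_incr_scaleR[OF uv \<zeta>M \<zeta>(2)])
  let ?p = "\<lambda>\<omega>. P u \<omega> - P' u \<omega>" and ?p' = "\<lambda>\<omega>. (D \<omega> - D' \<omega>) - (SI \<omega> - SI' \<omega>)"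
  have pF: "?p \<in> borel_measurable (F u)" by (rule P_section_diff[OF u(1)])
  have pM: "?p \<in> borel_measurable M" by (rule measurable_F_M[OF pF u(2)])
  have p'2: "L2 M ?p'" by (intro L2_diff D(1,2) D'(1,2))
  \<comment> \<open>The terms with \<eta> and f are common to both equations and cancel.\<close>
  have pp: "AE \<omega> in M. ?p \<omega> = ?p' \<omega>" using D(3) D'(3) by eventually_elim (simp add: algebra_simps)
  \<comment> \<open>Condition (1) controls P on the product space; at the fixed time u integrability
    of the difference is taken from the almost surely equal right-hand side.\<close>
  have pint: "integrable M (\<lambda>\<omega>. inner (?p \<omega>) (\<zeta> \<omega>))"
  proof (rule integrable_cong_AE_imp[OF L2_inner_integrable[OF p'2 \<zeta>2]])
    show "(\<lambda>\<omega>. inner (?p \<omega>) (\<zeta> \<omega>)) \<in> borel_measurable M" by (intro borel_measurable_inner pM \<zeta>M)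
    show "AE \<omega> in M. inner (?p' \<omega>) (\<zeta> \<omega>) = inner (?p \<omega>) (\<zeta> \<omega>)" using pp by eventually_elim simp
  qed
  \<comment> \<open>The difference of the P-terms is \<open>F u\<close>-measurable because P and P'
    are progressive, so the centred increment after u is independent of it.\<close>
  have "expectation (\<lambda>\<omega>. incr j u v \<omega> * inner (?p \<omega>) (\<zeta> \<omega>)) = 0"
    by (rule expectation_incr_mult[OF uv measurable_F_indep_alg[OF _ u(2)] pint]) (intro borel_measurable_inner pF \<zeta>(1))
  moreover have "expectation (\<lambda>\<omega>. incr j u v \<omega> * inner (?p \<omega>) (\<zeta> \<omega>)) = expectation (\<lambda>\<omega>. inner (?p' \<omega>) (?Y \<omega>))"
  proof (rule integral_cong_AE)
    show "(\<lambda>\<omega>. incr j u v \<omega> * inner (?p \<omega>) (\<zeta> \<omega>)) \<in> borel_measurable M"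
      by (intro borel_measurable_times borel_measurable_incr uv borel_measurable_inner pM \<zeta>M)
    show "(\<lambda>\<omega>. inner (?p' \<omega>) (?Y \<omega>)) \<in> borel_measurable M"
      by (intro borel_measurable_inner L2_measurable[OF p'2] L2_measurable[OF Y])
    show "AE \<omega> in M. incr j u v \<omega> * inner (?p \<omega>) (\<zeta> \<omega>) = inner (?p' \<omega>) (?Y \<omega>)"
      using pp by eventually_elim simp
  qed
  moreover have "expectation (\<lambda>\<omega>. inner (?p' \<omega>) (?Y \<omega>))
      = (expectation (\<lambda>\<omega>. inner (D \<omega>) (?Y \<omega>)) - expectation (\<lambda>\<omega>. inner (D' \<omega>) (?Y \<omega>)))
      - (expectation (\<lambda>\<omega>. inner (SI \<omega>) (?Y \<omega>)) - expectation (\<lambda>\<omega>. inner (SI' \<omega>) (?Y \<omega>)))"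
    unfolding inner_diff_left
    by (simp only: Bochner_Integration.integral_diff Bochner_Integration.integrable_diff L2_inner_integrable[OF _ Y] D(1,2) D'(1,2))
  ultimately have E: "expectation (\<lambda>\<omega>. inner (D \<omega>) (?Y \<omega>)) - expectation (\<lambda>\<omega>. inner (D' \<omega>) (?Y \<omega>))
      = expectation (\<lambda>\<omega>. inner (SI \<omega>) (?Y \<omega>)) - expectation (\<lambda>\<omega>. inner (SI' \<omega>) (?Y \<omega>))" by linarith
  have L2S: "L2 (slab M u T) (\<lambda>z. indicator {u..<v} (fst z) *\<^sub>R S (max 0 (fst z - u)) (\<zeta> (snd z)))"
  proof (rule L2_mono[OF L2_snd[OF prob_space_axioms \<zeta>2], where K=K])
    have "(\<lambda>z. fst z - u) \<in> borel_measurable (slab M u T)"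
      by (rule measurable_compose[OF measurable_fst measurable_restrict_space1]) simp
    moreover have "(\<lambda>z. indicator {u..<v} (fst z) :: real) \<in> borel_measurable (slab M u T)"
      by (rule measurable_compose[OF measurable_fst measurable_restrict_space1]) simp
    ultimately show "(\<lambda>z. indicator {u..<v} (fst z) *\<^sub>R S (max 0 (fst z - u)) (\<zeta> (snd z))) \<in> borel_measurable (slab M u T)"
      by (intro borel_measurable_scaleR borel_measurable_semigroup measurable_compose[OF measurable_snd \<zeta>M])
    show "norm (indicator {u..<v} (fst z) *\<^sub>R S (max 0 (fst z - u)) (\<zeta> (snd z))) \<le> K * norm (\<zeta> (snd z))"
      if "z \<in> space (slab M u T)" for z
    proof -
      have "norm (S (max 0 (fst z - u)) (\<zeta> (snd z))) \<le> K * norm (\<zeta> (snd z))"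
        using slab_time[OF that] u by (intro S_le) auto
      moreover have "0 \<le> K * norm (\<zeta> (snd z))" using K_ge_1 by simp
      ultimately show ?thesis by (auto simp: indicator_def)
    qed
  qed
  note Sint = L2_inner_integrable[OF L2_slab_mono[OF prob_space_axioms sub] L2S]
  have "expectation (\<lambda>\<omega>. inner (SI \<omega>) (?Y \<omega>)) - expectation (\<lambda>\<omega>. inner (SI' \<omega>) (?Y \<omega>))
      = (\<integral>z. inner (x j z) (indicator {u..<v} (fst z) *\<^sub>R S (max 0 (fst z - u)) (\<zeta> (snd z))) \<partial>slab M u T)"
  proof -
    have "expectation (\<lambda>\<omega>. inner (SI \<omega>) (?Y \<omega>))
        = (\<integral>z. inner (columns Q j z) (indicator {u..<v} (fst z) *\<^sub>R S (max 0 (fst z - u)) (\<zeta> (snd z))) \<partial>slab M u T)"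
      by (rule D(5)[OF \<zeta> uv(2,3)])
    moreover have "expectation (\<lambda>\<omega>. inner (SI' \<omega>) (?Y \<omega>))
        = (\<integral>z. inner (columns Q' j z) (indicator {u..<v} (fst z) *\<^sub>R S (max 0 (fst z - u)) (\<zeta> (snd z))) \<partial>slab M u T)"
      by (rule D'(5)[OF \<zeta> uv(2,3)])
    ultimately show ?thesis
      unfolding inner_diff_left
      by (simp only: Bochner_Integration.integral_diff[OF Sint[OF solution_columns_L2[OF sol]] Sint[OF solution_columns_L2[OF sol']]])
  qed
  with E tendsto_diff[OF D(4)[OF Y] D'(4)[OF Y]] show ?thesis
    by (simp only: drift_diff_pairing[OF u(1) Y])
qed

text \<open>If all partial drifts vanish, D and D' have the same pairings and coincide. What remains
  is P - P' = SI' - SI, orthogonal to every bounded \<open>F t\<close>-measurable variable; as P -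
  P' is \<open>F t\<close>-measurable itself, its truncations are admissible tests.\<close>

lemma P_eq_of_drift_zero:
  assumes zero: "\<And>n. AE z in slab M 0 T. drift x n z = 0" and t: "t \<in> {0..T}"
  shows "AE \<omega> in M. P t \<omega> = P' t \<omega>"
proof -
  have tT: "t \<le> T" using t by simp
  obtain D SI where "decomposition \<eta> f P Q t D SI"
    using solution_decomposition[OF sol t] by blast
  note D = decompositionD[OF this]
  obtain D' SI' where "decomposition \<eta> f P' Q' t D' SI'"
    using solution_decomposition[OF sol' t] by blast
  note D' = decompositionD[OF this]
  let ?p = "\<lambda>\<omega>. P t \<omega> - P' t \<omega>"
  have pF: "?p \<in> borel_measurable (F t)" by (rule P_section_diff[OF t])
  have pM: "?p \<in> borel_measurable M" by (rule measurable_F_M[OF pF tT])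
  have zero': "AE z in slab M t T. drift x n z = 0" for n
    by (rule AE_slab_mono[OF prob_space_axioms _ _ zero])
      (use t L2_measurable[OF L2_drift[OF columns_diff_L2]] in auto)
  have DD: "expectation (\<lambda>\<omega>. inner (D \<omega>) (Y \<omega>)) = expectation (\<lambda>\<omega>. inner (D' \<omega>) (Y \<omega>))" if Y: "L2 M Y" for Y
  proof -
    have "(\<integral>z. inner (drift x n z) (S (max 0 (fst z - t)) (Y (snd z))) \<partial>slab M t T) = 0" for n
      using zero'[of n] by (intro integral_eq_zero_AE) (auto elim: eventually_mono)
    with tendsto_diff[OF D(4)[OF Y] D'(4)[OF Y]] show ?thesis
      by (simp add: drift_diff_pairing[OF t Y, symmetric] LIMSEQ_const_iff)
  qed
  have d2: "L2 M (\<lambda>\<omega>. D \<omega> - D' \<omega>)" by (intro L2_diff D(1,2) D'(1,2))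
  have "AE \<omega> in M. D \<omega> - D' \<omega> = 0"
  proof -
    have "expectation (\<lambda>\<omega>. (norm (D \<omega> - D' \<omega>))\<^sup>2) = 0"
      using DD[OF d2] unfolding power2_norm_eq_inner inner_diff_left
      by (subst Bochner_Integration.integral_diff) (auto intro: L2_inner_integrable[OF _ d2] D(1,2) D'(1,2))
    then have "AE \<omega> in M. (norm (D \<omega> - D' \<omega>))\<^sup>2 = 0"
      by (subst (asm) integral_nonneg_eq_0_iff_AE[OF L2_integrable_norm2[OF d2]]) auto
    then show ?thesis by eventually_elim simp
  qed
  with D(3) D'(3) have pp: "AE \<omega> in M. ?p \<omega> = - (SI \<omega> - SI' \<omega>)"
    by eventually_elim (simp add: algebra_simps)
  have "AE \<omega> in M. ?p \<omega> = 0"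
  proof (rule AE_zero_of_truncated_orthogonal[OF pM finite_measure_axioms])
    fix n
    let ?\<zeta> = "\<lambda>\<omega>. if norm (?p \<omega>) \<le> real n then ?p \<omega> else 0"
    have \<zeta>: "?\<zeta> \<in> borel_measurable (F t)" "\<And>\<omega>. norm (?\<zeta> \<omega>) \<le> real n" using pF by measurable
    have \<zeta>2: "L2 M ?\<zeta>" by (rule L2_bounded[OF measurable_F_M[OF \<zeta>(1) tT] \<zeta>(2)])
    have "expectation (\<lambda>\<omega>. inner (?p \<omega>) (?\<zeta> \<omega>)) = expectation (\<lambda>\<omega>. inner (SI' \<omega>) (?\<zeta> \<omega>) - inner (SI \<omega>) (?\<zeta> \<omega>))"
    proof (rule integral_cong_AE)
      show "AE \<omega> in M. inner (?p \<omega>) (?\<zeta> \<omega>) = inner (SI' \<omega>) (?\<zeta> \<omega>) - inner (SI \<omega>) (?\<zeta> \<omega>)"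
        using pp
      proof eventually_elim
        case (elim \<omega>)
        have "inner (?p \<omega>) w = inner (SI' \<omega>) w - inner (SI \<omega>) w" for w
          unfolding elim by (simp add: inner_diff_left)
        then show ?case .
      qed
    qed (intro borel_measurable_inner borel_measurable_diff pM L2_measurable[OF \<zeta>2] L2_measurable[OF D(2)] L2_measurable[OF D'(2)])+
    also have "\<dots> = 0"
      using D(6)[OF \<zeta>] D'(6)[OF \<zeta>]
      by (subst Bochner_Integration.integral_diff) (auto intro: L2_inner_integrable[OF _ \<zeta>2] D(1,2) D'(1,2))
    finally show "expectation (\<lambda>\<omega>. inner (?p \<omega>) (?\<zeta> \<omega>)) = 0" .
  qed
  then show ?thesis by eventually_elim simp
qed

end

end

section \<open>The contraction estimate\<close>


lemma integral_slab_restrict: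
  fixes f :: "real \<times> 'w \<Rightarrow> real"
  assumes M: "prob_space M" and sub: "{a..b} \<subseteq> {a'..b'}"
    and f: "f \<in> borel_measurable (slab M a' b')"
  shows "(\<integral>z. f z \<partial>slab M a b) = (\<integral>z. indicator {a..b} (fst z) * f z \<partial>slab M a' b')"
proof -
  have f': "f \<in> borel_measurable (slab M a b)" by (rule measurable_slab_mono[OF sub f])
  have [measurable]: "(\<lambda>z. indicator {a..b} (fst z) :: real) \<in> borel_measurable (slab M a' b')"
    by (rule measurable_compose[OF measurable_fst measurable_restrict_space1]) simp
  have nn: "(\<integral>\<^sup>+z. ennreal (g z) \<partial>slab M a b) = (\<integral>\<^sup>+z. ennreal (indicator {a..b} (fst z) * g z) \<partial>slab M a' b')"
    if [measurable]: "g \<in> borel_measurable (slab M a' b')" for g :: "_ \<Rightarrow> real"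
  proof -
    have "(\<integral>\<^sup>+z. ennreal (g z) \<partial>slab M a b) = (\<integral>\<^sup>+z. ennreal (g z) * indicator {a..b} (fst z) \<partial>slab M a' b')"
      by (rule nn_integral_slab_restrict[OF M sub]) measurable
    also have "\<dots> = (\<integral>\<^sup>+z. ennreal (indicator {a..b} (fst z) * g z) \<partial>slab M a' b')"
      by (intro nn_integral_cong) (auto simp: indicator_def)
    finally show ?thesis .
  qed
  note [measurable] = f
  have int: "integrable (slab M a b) f \<longleftrightarrow> integrable (slab M a' b') (\<lambda>z. indicator {a..b} (fst z) * f z)"
    unfolding integrable_iff_bounded using nn[of "\<lambda>z. norm (f z)"] f f' by (simp add: abs_mult)
  show ?thesis
  proof (cases "integrable (slab M a b) f")
    case True
    then show ?thesis
      using int nn[of f] nn[of "\<lambda>z. - f z"] by (simp add: real_lebesgue_integral_def)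
  next
    case False
    then show ?thesis using int by (simp add: not_integrable_integral_eq)
  qed
qed

lemma nn_integral_slab_cell:
  assumes M: "prob_space M" and ab: "a < b" and k: "k < m" and f: "f \<in> borel_measurable M"
  shows "(\<integral>\<^sup>+z. indicator (cell a b m k) (fst z) * f (snd z) \<partial>slab M a b) = ennreal ((b - a) / real m) * (\<integral>\<^sup>+\<omega>. f \<omega> \<partial>M)"
proof -
  interpret M: prob_space M by fact
  let ?L = "restrict_space lborel {a..b}"
  have [measurable]: "(\<lambda>z. indicator (cell a b m k) (fst z) :: ennreal) \<in> borel_measurable (slab M a b)"
    by (rule measurable_compose[OF measurable_fst measurable_restrict_space1]) simp
  have [measurable]: "(\<lambda>z. f (snd z)) \<in> borel_measurable (slab M a b)"
    by (rule measurable_compose[OF measurable_snd f])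
  have cL: "(\<lambda>s. indicator (cell a b m k) s :: ennreal) \<in> borel_measurable ?L"
    by (rule measurable_restrict_space1) simp
  have "(\<integral>\<^sup>+z. indicator (cell a b m k) (fst z) * f (snd z) \<partial>slab M a b)
      = (\<integral>\<^sup>+s. (\<integral>\<^sup>+\<omega>. indicator (cell a b m k) s * f \<omega> \<partial>M) \<partial>?L)"
    using M.nn_integral_fst[of "\<lambda>z. indicator (cell a b m k) (fst z) * f (snd z)" ?L] by simp
  also have "\<dots> = (\<integral>\<^sup>+s. indicator (cell a b m k) s * (\<integral>\<^sup>+\<omega>. f \<omega> \<partial>M) \<partial>?L)"
    by (intro nn_integral_cong nn_integral_cmult f)
  also have "\<dots> = (\<integral>\<^sup>+s. indicator (cell a b m k) s \<partial>?L) * (\<integral>\<^sup>+\<omega>. f \<omega> \<partial>M)"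
    by (rule nn_integral_multc[OF cL])
  also have "(\<integral>\<^sup>+s. indicator (cell a b m k) s \<partial>?L) = ennreal ((b - a) / real m)"
  proof -
    have "(\<integral>\<^sup>+s. ennreal (indicator (cell a b m k) s) \<partial>?L) = ennreal (\<integral>s. indicator (cell a b m k) s \<partial>?L)"
      by (rule nn_integral_eq_integral[OF integrable_indicator_cell]) simp
    then show ?thesis unfolding integral_indicator_cell[OF ab k] ennreal_indicator .
  qed
  finally show ?thesis .
qed

text \<open>For every r one of the distances b - r and r - s is at least (b - s) / 2, so one factor
  is at most ((b - s) / 2)^(-p) and the other is integrated. The halved distance gives
  \<open>2 powr p\<close>, and adding the integrals at both ends gives the other 2.\<close>

lemma powr_convolution_bound:
  fixes p :: real
  assumes p: "0 \<le> p" "p < 1" and sb: "s < b"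
  shows "(\<integral>\<^sup>+r. ennreal ((b - r) powr (- p) * (r - s) powr (- p)) * indicator {s<..b} r \<partial>lborel)
    \<le> ennreal (2 * 2 powr p / (1 - p) * (b - s) powr (1 - 2 * p))"
proof -
  let ?q = "((b - s) / 2) powr (- p)"
  have le: "(b - r) powr (- p) * (r - s) powr (- p) \<le> ?q * ((b - r) powr (- p) + (r - s) powr (- p))"
    if r: "s < r" "r \<le> b" for r
  proof (cases "(b - s) / 2 \<le> r - s")
    case True
    then have "(r - s) powr (- p) \<le> ?q" using p sb by (intro powr_mono2') auto
    then have "(b - r) powr (- p) * (r - s) powr (- p) \<le> (b - r) powr (- p) * ?q" by (intro mult_left_mono) auto
    also have "\<dots> \<le> ?q * ((b - r) powr (- p) + (r - s) powr (- p))" by (simp add: algebra_simps)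
    finally show ?thesis .
  next
    case False
    then have "(b - r) powr (- p) \<le> ?q" using p sb by (intro powr_mono2') auto
    then have "(b - r) powr (- p) * (r - s) powr (- p) \<le> ?q * (r - s) powr (- p)" by (intro mult_right_mono) auto
    also have "\<dots> \<le> ?q * ((b - r) powr (- p) + (r - s) powr (- p))" by (simp add: algebra_simps)
    finally show ?thesis .
  qed
  have "(\<integral>\<^sup>+r. ennreal ((b - r) powr (- p) * (r - s) powr (- p)) * indicator {s<..b} r \<partial>lborel)
    \<le> (\<integral>\<^sup>+r. ennreal ?q * (ennreal ((b - r) powr (- p)) * indicator {s..b} r)
        + ennreal ?q * (ennreal ((r - s) powr (- p)) * indicator {s..b} r) \<partial>lborel)"
  proof (rule nn_integral_mono)
    fix r
    show "ennreal ((b - r) powr (- p) * (r - s) powr (- p)) * indicator {s<..b} r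
      \<le> ennreal ?q * (ennreal ((b - r) powr (- p)) * indicator {s..b} r) + ennreal ?q * (ennreal ((r - s) powr (- p)) * indicator {s..b} r)"
      using ennreal_leI[OF le, of r]
      by (cases "s < r \<and> r \<le> b") (auto simp: indicator_def ennreal_mult ennreal_plus distrib_left)
  qed
  also have "\<dots> = ennreal ?q * ennreal ((b - s) powr (1 - p) / (1 - p)) + ennreal ?q * ennreal ((b - s) powr (1 - p) / (1 - p))"
    using nn_integral_powr[of p s b] p sb by (subst nn_integral_lincomb) auto
  also have "\<dots> = ennreal (2 * (?q * ((b - s) powr (1 - p) / (1 - p))))"
    using p by (simp add: algebra_simps flip: ennreal_mult ennreal_plus)
  also have "2 * (?q * ((b - s) powr (1 - p) / (1 - p))) = 2 * 2 powr p / (1 - p) * (b - s) powr (1 - 2 * p)"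
  proof -
    have "?q = (b - s) powr (- p) * 2 powr p"
      using sb by (simp add: powr_divide powr_minus field_simps)
    moreover have "(b - s) powr (- p) * (b - s) powr (1 - p) = (b - s) powr (1 - 2 * p)"
      by (simp flip: powr_add)
    ultimately show ?thesis by (simp add: field_simps)
  qed
  finally show ?thesis .
qed

context cyl_wiener_space begin

text \<open>Increments over different cells, or of different coordinates, stay orthogonal after
  multiplication by variables measurable at the left ends. Only the diagonal survives, and the
  variance of each increment is the mesh.\<close>

lemma grid_pythagoras:
  fixes Z :: "nat \<Rightarrow> nat \<Rightarrow> 'w \<Rightarrow> 'b::{real_inner,second_countable_topology}"
  assumes ab: "0 \<le> a" "a < b" "b \<le> T" and m: "0 < m"
    and Z: "\<And>i k. i < N \<Longrightarrow> k < m \<Longrightarrow> Z i k \<in> borel_measurable (F (grid a b m k))"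
    and B: "\<And>i k \<omega>. i < N \<Longrightarrow> k < m \<Longrightarrow> \<omega> \<in> space M \<Longrightarrow> norm (Z i k \<omega>) \<le> B"
  shows "(\<integral>\<^sup>+\<omega>. ennreal ((norm (\<Sum>i<N. \<Sum>k<m. incr i (grid a b m k) (grid a b m (Suc k)) \<omega> *\<^sub>R Z i k \<omega>))\<^sup>2) \<partial>M)
    = (\<Sum>i<N. \<Sum>k<m. ennreal ((b - a) / real m) * (\<integral>\<^sup>+\<omega>. ennreal ((norm (Z i k \<omega>))\<^sup>2) \<partial>M))"
proof -
  let ?u = "grid a b m" and ?I = "{..<N} \<times> {..<m}" and ?h = "(b - a) / real m"
  define Y where "Y p \<omega> = incr (fst p) (?u (snd p)) (?u (Suc (snd p))) \<omega> *\<^sub>R Z (fst p) (snd p) \<omega>" for p \<omega>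
  have u: "0 \<le> ?u k" "?u k \<le> ?u (Suc k)" "?u (Suc k) \<le> T" "?u k \<le> T" if "k < m" for k
    using grid_bounds[of a b k m] grid_bounds[of a b "Suc k" m] grid_mono[of a b k "Suc k" m] ab that by auto
  have ZM: "Z i k \<in> borel_measurable M" if "i < N" "k < m" for i k
    by (rule measurable_F_M[OF Z[OF that] u(4)]) (rule that)
  have Y2: "L2 M (Y p)" if p: "p \<in> ?I" for p
  proof -
    have p': "fst p < N" "snd p < m" using p by auto
    show ?thesis unfolding Y_def[abs_def]
      by (rule L2_incr_scaleR[OF u(1-3)[OF p'(2)] ZM[OF p'] B[OF p']])
  qed
  have Z2: "L2 M (Z i k)" if "i < N" "k < m" for i k
    by (rule L2_bounded[OF ZM[OF that] B[OF that]])
  have E: "expectation (\<lambda>\<omega>. inner (Y p \<omega>) (Y q \<omega>)) = (if p = q then ?h * expectation (\<lambda>\<omega>. (norm (Z (fst p) (snd p) \<omega>))\<^sup>2) else 0)"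
    if p: "p \<in> ?I" and q: "q \<in> ?I" for p q
  proof -
    obtain i k j l where pq: "p = (i, k)" "q = (j, l)" "i < N" "j < N" "k < m" "l < m" using p q by auto
    have zF: "(\<lambda>\<omega>. inner (Z i k \<omega>) (Z j l \<omega>)) \<in> borel_measurable (F (max (?u k) (?u l)))"
      by (intro borel_measurable_inner measurable_F_mono[OF Z] pq) auto
    have zB: "\<bar>inner (Z i k \<omega>) (Z j l \<omega>)\<bar> \<le> B * B" if \<omega>: "\<omega> \<in> space M" for \<omega>
    proof -
      have "\<bar>inner (Z i k \<omega>) (Z j l \<omega>)\<bar> \<le> norm (Z i k \<omega>) * norm (Z j l \<omega>)" by (rule Cauchy_Schwarz_ineq2)
      also have "\<dots> \<le> B * B"
        using B[OF pq(3,5) \<omega>] B[OF pq(4,6) \<omega>] by (intro mult_mono) (auto intro: order_trans[OF norm_ge_zero])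
      finally show ?thesis .
    qed
    have "expectation (\<lambda>\<omega>. inner (Y p \<omega>) (Y q \<omega>))
        = expectation (\<lambda>\<omega>. incr i (?u k) (?u (Suc k)) \<omega> * incr j (?u l) (?u (Suc l)) \<omega> * inner (Z i k \<omega>) (Z j l \<omega>))"
      by (simp add: Y_def pq mult_ac)
    also have "\<dots> = (if i = j then max 0 (min (?u (Suc k)) (?u (Suc l)) - max (?u k) (?u l)) * expectation (\<lambda>\<omega>. inner (Z i k \<omega>) (Z j l \<omega>)) else 0)"
      by (rule expectation_incr_overlap[OF u(1-3)[OF pq(5)] u(1-3)[OF pq(6)] zF zB])
    also have "\<dots> = (if p = q then ?h * expectation (\<lambda>\<omega>. (norm (Z (fst p) (snd p) \<omega>))\<^sup>2) else 0)"
    proof (cases "i = j \<and> k = l")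
      case True
      then show ?thesis using ab by (simp add: pq grid_Suc power2_norm_eq_inner)
    next
      case False
      show ?thesis
      proof (cases "i = j")
        case True
        then have "Suc k \<le> l \<or> Suc l \<le> k" using False by auto
        then have "min (?u (Suc k)) (?u (Suc l)) - max (?u k) (?u l) \<le> 0"
          using grid_mono[of a b "Suc k" l m] grid_mono[of a b "Suc l" k m] ab by auto
        then show ?thesis using False by (simp add: pq)
      qed (simp add: pq)
    qed
    finally show ?thesis .
  qed
  have sum_eq: "(\<Sum>i<N. \<Sum>k<m. incr i (?u k) (?u (Suc k)) \<omega> *\<^sub>R Z i k \<omega>) = (\<Sum>p\<in>?I. Y p \<omega>)" for \<omega>
    unfolding Y_def by (simp add: sum.cartesian_product case_prod_unfold)
  have L2S: "L2 M (\<lambda>\<omega>. \<Sum>p\<in>?I. Y p \<omega>)" by (rule L2_sum) (rule Y2)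
  have "expectation (\<lambda>\<omega>. (norm (\<Sum>p\<in>?I. Y p \<omega>))\<^sup>2) = expectation (\<lambda>\<omega>. \<Sum>p\<in>?I. \<Sum>q\<in>?I. inner (Y p \<omega>) (Y q \<omega>))"
    by (simp only: power2_norm_eq_inner inner_sum_left inner_sum_right)
      (intro Bochner_Integration.integral_cong refl sum.swap)
  also have "\<dots> = (\<Sum>p\<in>?I. \<Sum>q\<in>?I. expectation (\<lambda>\<omega>. inner (Y p \<omega>) (Y q \<omega>)))"
    by (subst Bochner_Integration.integral_sum, intro Bochner_Integration.integrable_sum L2_inner_integrable Y2, assumption, assumption,
        intro sum.cong refl Bochner_Integration.integral_sum L2_inner_integrable Y2)
  also have "\<dots> = (\<Sum>p\<in>?I. ?h * expectation (\<lambda>\<omega>. (norm (Z (fst p) (snd p) \<omega>))\<^sup>2))"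
    by (intro sum.cong refl) (simp add: E)
  also have "\<dots> = (\<Sum>i<N. \<Sum>k<m. ?h * expectation (\<lambda>\<omega>. (norm (Z i k \<omega>))\<^sup>2))"
    by (simp add: sum.cartesian_product case_prod_unfold)
  finally have "(\<integral>\<^sup>+\<omega>. ennreal ((norm (\<Sum>p\<in>?I. Y p \<omega>))\<^sup>2) \<partial>M) = ennreal (\<Sum>i<N. \<Sum>k<m. ?h * expectation (\<lambda>\<omega>. (norm (Z i k \<omega>))\<^sup>2))"
    unfolding L2_nn_integral[OF L2S] by simp
  also have "\<dots> = (\<Sum>i<N. ennreal (\<Sum>k<m. ?h * expectation (\<lambda>\<omega>. (norm (Z i k \<omega>))\<^sup>2)))"
    using ab by (intro sum_ennreal[symmetric] sum_nonneg mult_nonneg_nonneg integral_nonneg) auto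
  also have "\<dots> = (\<Sum>i<N. \<Sum>k<m. ennreal (?h * expectation (\<lambda>\<omega>. (norm (Z i k \<omega>))\<^sup>2)))"
    using ab by (intro sum.cong refl sum_ennreal[symmetric] mult_nonneg_nonneg integral_nonneg) auto
  also have "\<dots> = (\<Sum>i<N. \<Sum>k<m. ennreal ?h * (\<integral>\<^sup>+\<omega>. ennreal ((norm (Z i k \<omega>))\<^sup>2) \<partial>M))"
  proof (intro sum.cong refl)
    fix i k assume "i \<in> {..<N}" "k \<in> {..<m}"
    then have ik: "i < N" "k < m" by auto
    show "ennreal (?h * expectation (\<lambda>\<omega>. (norm (Z i k \<omega>))\<^sup>2)) = ennreal ?h * (\<integral>\<^sup>+\<omega>. ennreal ((norm (Z i k \<omega>))\<^sup>2) \<partial>M)"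
      unfolding L2_nn_integral[OF Z2[OF ik]] using ab by (intro ennreal_mult integral_nonneg) auto
  qed
  finally show ?thesis unfolding sum_eq .
qed

end


lemma AE_slab_extend:
  assumes M: "prob_space M" and g: "(g :: _ \<Rightarrow> 'b::real_normed_vector) \<in> borel_measurable (slab M a' c')"
    and sub: "{a..c} \<subseteq> {a'..c'}" and zero: "AE z in slab M a c. g z = 0"
  shows "AE z in slab M a' c'. fst z \<in> {a..c} \<longrightarrow> g z = 0"
proof -
  have [measurable]: "(\<lambda>z. indicator {a..c} (fst z) :: ennreal) \<in> borel_measurable (slab M a' c')"
    by (rule measurable_compose[OF measurable_fst measurable_restrict_space1]) simp
  have [measurable]: "(\<lambda>z. ennreal (norm (g z))) \<in> borel_measurable (slab M a' c')" using g by measurable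
  have "(\<integral>\<^sup>+z. ennreal (norm (g z)) * indicator {a..c} (fst z) \<partial>slab M a' c') = (\<integral>\<^sup>+z. ennreal (norm (g z)) \<partial>slab M a c)"
    by (intro nn_integral_slab_restrict[OF M sub, symmetric]) measurable
  also have "\<dots> = (\<integral>\<^sup>+z. 0 \<partial>slab M a c)"
    using zero by (intro nn_integral_cong_AE) (auto elim: eventually_mono)
  finally have "(\<integral>\<^sup>+z. ennreal (norm (g z)) * indicator {a..c} (fst z) \<partial>slab M a' c') = 0" by simp
  then have "AE z in slab M a' c'. ennreal (norm (g z)) * indicator {a..c} (fst z) = 0"
    by (subst (asm) nn_integral_0_iff_AE) measurable
  then show ?thesis by eventually_elim (auto simp: indicator_def split: if_splits)
qed

text \<open>The dual identity reaches up to T, whereas the estimate lives on \<open>{a..b}\<close>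
  with the drifts after b already known to vanish. The indicator remembers that the identity starts
  at u rather than at a.\<close>

lemma integral_slab_truncate:
  fixes f :: "real \<times> 'w \<Rightarrow> real"
  assumes M: "prob_space M" and abc: "a \<le> u" "u \<le> b" "b \<le> c"
    and f: "f \<in> borel_measurable (slab M a c)" and zero: "AE z in slab M b c. f z = 0"
  shows "(\<integral>z. f z \<partial>slab M u c) = (\<integral>z. indicator {u..} (fst z) * f z \<partial>slab M a b)"
proof -
  have fu: "f \<in> borel_measurable (slab M u c)" and fb: "f \<in> borel_measurable (slab M a b)"
    using abc by (auto intro!: measurable_slab_mono[OF _ f])
  have [measurable]: "(\<lambda>z. indicator {u..b} (fst z) :: real) \<in> borel_measurable (slab M u c)"
    by (rule measurable_compose[OF measurable_fst measurable_restrict_space1]) simp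
  have out: "AE z in slab M u c. fst z \<in> {b..c} \<longrightarrow> f z = 0"
    by (rule AE_slab_extend[OF M fu _ zero]) (use abc in auto)
  have "(\<integral>z. f z \<partial>slab M u c) = (\<integral>z. indicator {u..b} (fst z) * f z \<partial>slab M u c)"
  proof (rule integral_cong_AE)
    show "AE z in slab M u c. f z = indicator {u..b} (fst z) * f z"
      using out AE_space
      by eventually_elim (auto simp: indicator_def space_pair_measure space_restrict_space)
  qed (use fu in measurable)
  also have "\<dots> = (\<integral>z. f z \<partial>slab M u b)"
    using abc by (intro integral_slab_restrict[OF M, symmetric] fu) auto
  also have "\<dots> = (\<integral>z. indicator {u..b} (fst z) * f z \<partial>slab M a b)"
    using abc by (intro integral_slab_restrict[OF M] fb) auto
  also have "\<dots> = (\<integral>z. indicator {u..} (fst z) * f z \<partial>slab M a b)"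
    by (rule Bochner_Integration.integral_cong[OF refl])
      (auto simp: indicator_def space_pair_measure space_restrict_space)
  finally show ?thesis .
qed

text \<open>The weights (b - s)^\<alpha> and (b - s)^(-\<alpha>) are split between the factors; they
  cancel except at s = b, a null time.\<close>

lemma weighted_Cauchy_Schwarz:
  fixes g X :: "real \<times> 'w \<Rightarrow> 'b::{real_inner,second_countable_topology}"
  assumes M: "prob_space M" and g: "L2 (slab M a b) g" and X: "L2 (slab M a b) X" and nn: "0 \<le> \<mu>" "0 \<le> \<rho>"
    and \<mu>: "(\<integral>\<^sup>+z. ennreal ((b - fst z) powr (2 * \<alpha>) * (norm (g z))\<^sup>2) \<partial>slab M a b) \<le> ennreal \<mu>"
    and \<rho>: "(\<integral>\<^sup>+z. ennreal ((b - fst z) powr (- 2 * \<alpha>) * (norm (X z))\<^sup>2) \<partial>slab M a b) \<le> ennreal \<rho>"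
  shows "(\<integral>z. inner (g z) (X z) \<partial>slab M a b)\<^sup>2 \<le> \<mu> * \<rho>"
proof -
  let ?f = "\<lambda>p (y :: real \<times> 'w \<Rightarrow> 'b) z. (b - fst z) powr p * norm (y z)"
  have fst_m[measurable]: "(\<lambda>z. b - fst z) \<in> borel_measurable (slab M a b)"
    by (rule measurable_compose[OF measurable_fst measurable_restrict_space1]) simp
  note [measurable] = L2_measurable[OF g] L2_measurable[OF X]
  have sq: "(?f p y z)\<^sup>2 = (b - fst z) powr (2 * p) * (norm (y z))\<^sup>2" for p y z
  proof -
    have "((b - fst z) powr p)\<^sup>2 = (b - fst z) powr (2 * p)" by (simp add: power2_eq_square flip: powr_add)
    then show ?thesis by (simp add: power_mult_distrib)
  qed
  have b1: "(\<integral>\<^sup>+z. ennreal ((?f \<alpha> g z)\<^sup>2) \<partial>slab M a b) \<le> ennreal \<mu>" unfolding sq using \<mu> .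
  have b2: "(\<integral>\<^sup>+z. ennreal ((?f (- \<alpha>) X z)\<^sup>2) \<partial>slab M a b) \<le> ennreal \<rho>" unfolding sq using \<rho> by simp
  have "ennreal \<bar>\<integral>z. inner (g z) (X z) \<partial>slab M a b\<bar> \<le> (\<integral>\<^sup>+z. ennreal \<bar>inner (g z) (X z)\<bar> \<partial>slab M a b)"
    using integral_norm_bound_ennreal[OF L2_inner_integrable[OF g X]] by simp
  also have "\<dots> \<le> (\<integral>\<^sup>+z. ennreal (?f \<alpha> g z * ?f (- \<alpha>) X z) \<partial>slab M a b)"
  proof (rule nn_integral_mono_AE)
    show "AE z in slab M a b. ennreal \<bar>inner (g z) (X z)\<bar> \<le> ennreal (?f \<alpha> g z * ?f (- \<alpha>) X z)"
      using AE_slab_fst_neq[OF M, of b a b] AE_space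
    proof eventually_elim
      case (elim z)
      then have "0 < b - fst z" by (auto simp: space_pair_measure space_restrict_space)
      then have "?f \<alpha> g z * ?f (- \<alpha>) X z = norm (g z) * norm (X z)" by (simp add: powr_minus field_simps)
      then show ?case by (simp only: Cauchy_Schwarz_ineq2 ennreal_leI)
    qed
  qed
  finally have le: "ennreal \<bar>\<integral>z. inner (g z) (X z) \<partial>slab M a b\<bar> \<le> (\<integral>\<^sup>+z. ennreal (?f \<alpha> g z * ?f (- \<alpha>) X z) \<partial>slab M a b)" .
  have "(ennreal \<bar>\<integral>z. inner (g z) (X z) \<partial>slab M a b\<bar>)\<^sup>2 \<le> (\<integral>\<^sup>+z. ennreal (?f \<alpha> g z * ?f (- \<alpha>) X z) \<partial>slab M a b)\<^sup>2"
    by (rule power_mono[OF le]) simp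
  also have "\<dots> \<le> (\<integral>\<^sup>+z. ennreal ((?f \<alpha> g z)\<^sup>2) \<partial>slab M a b) * (\<integral>\<^sup>+z. ennreal ((?f (- \<alpha>) X z)\<^sup>2) \<partial>slab M a b)"
    by (rule nn_integral_Cauchy_Schwarz) (measurable, rule le_less_trans[OF b1], simp, simp, measurable, rule le_less_trans[OF b2], simp, simp)
  also have "\<dots> \<le> ennreal \<mu> * ennreal \<rho>" by (rule mult_mono[OF b1 b2]) auto
  finally have "ennreal (\<bar>\<integral>z. inner (g z) (X z) \<partial>slab M a b\<bar>\<^sup>2) \<le> ennreal (\<mu> * \<rho>)"
    using nn by (simp add: ennreal_mult ennreal_power)
  then show ?thesis using nn by simp
qed

section \<open>The grid form of the duality on a time interval\<close>

text \<open>What the contraction retains of two solutions: the column differences x, the uniform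
  weighted bound and the dual identity. Neither P nor the equations themselves occur any
  more.\<close>

locale dual_family = bsde_setup M T \<beta> e S K C c \<alpha>
  for M :: "'w measure" and T \<beta> and e :: "nat \<Rightarrow> 'h::{real_inner,complete_space,second_countable_topology}"
    and S :: "real \<Rightarrow> 'h \<Rightarrow> 'h" and K and C :: "nat \<Rightarrow> real \<Rightarrow> 'w \<Rightarrow> 'h \<Rightarrow> 'h" and c \<alpha> +
  fixes x :: "nat \<Rightarrow> real \<times> 'w \<Rightarrow> 'h"
  assumes x_prog: "\<And>j. progressive M F T (\<lambda>s \<omega>. x j (s, \<omega>))"
    and x_L2: "\<And>j. L2 (slab M 0 T) (x j)"
    and weighted_bounded: "\<exists>B<\<infinity>. \<forall>n. weighted (drift x n) \<le> B"
    and duality: "\<And>u v \<zeta> B j. 0 \<le> u \<Longrightarrow> u \<le> v \<Longrightarrow> v \<le> T \<Longrightarrow> \<zeta> \<in> borel_measurable (F u) \<Longrightarrow>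
      (\<And>\<omega>. \<omega> \<in> space M \<Longrightarrow> norm (\<zeta> \<omega>) \<le> B) \<Longrightarrow>
      (\<lambda>n. \<integral>z. inner (drift x n z) (S (max 0 (fst z - u)) (incr j u v (snd z) *\<^sub>R \<zeta> (snd z))) \<partial>slab M u T)
      \<longlonglongrightarrow> (\<integral>z. inner (x j z) (indicator {u..<v} (fst z) *\<^sub>R S (max 0 (fst z - u)) (\<zeta> (snd z))) \<partial>slab M u T)"
    and C_HS: "\<And>s \<omega> t y. s \<in> {0..T} \<Longrightarrow> \<omega> \<in> space M \<Longrightarrow> t \<in> {0<..1} \<Longrightarrow>
      (\<Sum>i. ennreal ((norm (S t (C i s \<omega> y)))\<^sup>2)) \<le> ennreal (c * t powr (- 2 * \<alpha>) * (norm y)\<^sup>2)"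
begin

definition step_proc :: "real \<Rightarrow> real \<Rightarrow> nat \<Rightarrow> (nat \<Rightarrow> 'w \<Rightarrow> 'h) \<Rightarrow> real \<times> 'w \<Rightarrow> 'h" where
  "step_proc a b m \<zeta> z = (\<Sum>k<m. indicator (cell a b m k) (fst z) *\<^sub>R S (max 0 (fst z - grid a b m k)) (\<zeta> k (snd z)))"

text \<open>The discrete X. The factor S (r - u) here matches the factor S (s - u) in
  \<open>step_proc\<close>, since S (r - s) S (s - u) = S (r - u). For r inside cell k the increment
  over the whole cell is already present; this anticipation causes the error term in
  \<open>step_energy\<close>.\<close>

definition step_convolution :: "real \<Rightarrow> real \<Rightarrow> nat \<Rightarrow> nat \<Rightarrow> (nat \<Rightarrow> nat \<Rightarrow> 'w \<Rightarrow> 'h) \<Rightarrow> real \<times> 'w \<Rightarrow> 'h" where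
  "step_convolution a b m N \<zeta> z = (\<Sum>i<N. \<Sum>k<m. indicator {grid a b m k..} (fst z) *\<^sub>R
     S (max 0 (fst z - grid a b m k)) (incr i (grid a b m k) (grid a b m (Suc k)) (snd z) *\<^sub>R \<zeta> i k (snd z)))"

lemma drift_L2: "0 \<le> a \<Longrightarrow> b \<le> T \<Longrightarrow> L2 (slab M a b) (drift x n)"
  by (rule L2_slab_mono[OF prob_space_axioms _ L2_drift[OF x_L2]]) auto

lemma family_L2: "0 \<le> a \<Longrightarrow> b \<le> T \<Longrightarrow> L2 (slab M a b) (x j)"
  by (rule L2_slab_mono[OF prob_space_axioms _ x_L2]) auto

lemma L2_semigroup:
  assumes Y: "L2 (slab M a b) Y" and ab: "b \<le> T" and u: "0 \<le> u"
  shows "L2 (slab M a b) (\<lambda>z. S (max 0 (fst z - u)) (Y z))"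
proof (rule L2_mono[OF Y, where K=K])
  show "(\<lambda>z. S (max 0 (fst z - u)) (Y z)) \<in> borel_measurable (slab M a b)"
    by (intro borel_measurable_semigroup L2_measurable[OF Y])
      (rule measurable_compose[OF measurable_fst measurable_restrict_space1], simp)
  show "norm (S (max 0 (fst z - u)) (Y z)) \<le> K * norm (Y z)" if "z \<in> space (slab M a b)" for z
    using that ab u T_pos by (intro S_le) (auto simp: space_pair_measure space_restrict_space)
qed

lemma L2_indicator_fst:
  assumes Y: "L2 (slab M a b) (Y :: _ \<Rightarrow> 'h)" and I: "I \<in> sets borel"
  shows "L2 (slab M a b) (\<lambda>z. indicator I (fst z) *\<^sub>R Y z)"
proof (rule L2_mono[OF Y, where K=1])
  have "(\<lambda>z. indicator I (fst z) :: real) \<in> borel_measurable (slab M a b)"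
    by (rule measurable_compose[OF measurable_fst measurable_restrict_space1]) (use I in simp)
  then show "(\<lambda>z. indicator I (fst z) *\<^sub>R Y z) \<in> borel_measurable (slab M a b)"
    using L2_measurable[OF Y] by (intro borel_measurable_scaleR)
qed (simp add: indicator_def)

context
  fixes a b :: real and m N :: nat and \<zeta> :: "nat \<Rightarrow> nat \<Rightarrow> 'w \<Rightarrow> 'h" and B :: real
  assumes ab: "0 \<le> a" "a < b" "b \<le> T" and m: "0 < m"
    and \<zeta>F: "\<And>i k. i < N \<Longrightarrow> k < m \<Longrightarrow> \<zeta> i k \<in> borel_measurable (F (grid a b m k))"
    and \<zeta>B: "\<And>i k \<omega>. i < N \<Longrightarrow> k < m \<Longrightarrow> \<omega> \<in> space M \<Longrightarrow> norm (\<zeta> i k \<omega>) \<le> B"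
begin

private abbreviation "u \<equiv> grid a b m"
private abbreviation "V \<equiv> \<lambda>i. step_proc a b m (\<zeta> i)"
private abbreviation "X \<equiv> step_convolution a b m N \<zeta>"

private lemma u: assumes "k < m" shows "0 \<le> u k" "a \<le> u k" "u k \<le> u (Suc k)" "u (Suc k) \<le> b" "u (Suc k) \<le> T" "u k \<le> b" "u k \<le> T"
  using grid_bounds[of a b k m] grid_bounds[of a b "Suc k" m] grid_mono[of a b k "Suc k" m] ab assms by auto

private lemma \<zeta>M: "i < N \<Longrightarrow> k < m \<Longrightarrow> \<zeta> i k \<in> borel_measurable M"
  by (rule measurable_F_M[OF \<zeta>F u(7)])

private lemma \<zeta>2: "i < N \<Longrightarrow> k < m \<Longrightarrow> L2 M (\<zeta> i k)"
  by (rule L2_bounded[OF \<zeta>M \<zeta>B])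

private lemma incr2: "i < N \<Longrightarrow> k < m \<Longrightarrow> L2 M (\<lambda>\<omega>. incr i (u k) (u (Suc k)) \<omega> *\<^sub>R \<zeta> i k \<omega>)"
  by (rule L2_incr_scaleR[OF u(1,3,5) \<zeta>M \<zeta>B])

private lemma S\<zeta>2: "i < N \<Longrightarrow> k < m \<Longrightarrow> b' \<le> T \<Longrightarrow> L2 (slab M a b') (\<lambda>z. S (max 0 (fst z - u k)) (\<zeta> i k (snd z)))"
  by (rule L2_semigroup[OF L2_snd[OF prob_space_axioms \<zeta>2] _ u(1)])

private lemma S_incr2: "i < N \<Longrightarrow> k < m \<Longrightarrow> b' \<le> T \<Longrightarrow>
    L2 (slab M a b') (\<lambda>z. S (max 0 (fst z - u k)) (incr i (u k) (u (Suc k)) (snd z) *\<^sub>R \<zeta> i k (snd z)))"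
  by (rule L2_semigroup[OF L2_snd[OF prob_space_axioms incr2] _ u(1)])

lemma L2_step_proc: "i < N \<Longrightarrow> L2 (slab M a b) (V i)"
  unfolding step_proc_def[abs_def] by (intro L2_sum L2_indicator_fst S\<zeta>2 ab cell_in_borel) auto

lemma L2_step_convolution: "L2 (slab M a b) X"
  unfolding step_convolution_def[abs_def] by (intro L2_sum L2_indicator_fst S_incr2 ab) auto

text \<open>The sum of the dual identities over all i < N and all cells. Both sides may be
  restricted to \<open>{a..b}\<close>: the left because the drifts vanish after b, the right because
  the cells lie in the interval.\<close>

lemma step_duality:
  assumes zero: "\<And>n. AE z in slab M b T. drift x n z = 0"
  shows "(\<lambda>n. \<integral>z. inner (drift x n z) (X z) \<partial>slab M a b) \<longlonglongrightarrow> (\<Sum>i<N. \<integral>z. inner (x i z) (V i z) \<partial>slab M a b)"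
proof -
  let ?Y = "\<lambda>i k z. S (max 0 (fst z - u k)) (incr i (u k) (u (Suc k)) (snd z) *\<^sub>R \<zeta> i k (snd z))"
  let ?Z = "\<lambda>i k z. S (max 0 (fst z - u k)) (\<zeta> i k (snd z))"
  have lim: "(\<lambda>n. \<integral>z. inner (drift x n z) (indicator {u k..} (fst z) *\<^sub>R ?Y i k z) \<partial>slab M a b)
      \<longlonglongrightarrow> (\<integral>z. inner (x i z) (indicator (cell a b m k) (fst z) *\<^sub>R ?Z i k z) \<partial>slab M a b)"
    if ik: "i < N" "k < m" for i k
  proof -
    have 1: "(\<integral>z. inner (drift x n z) (?Y i k z) \<partial>slab M (u k) T)
        = (\<integral>z. inner (drift x n z) (indicator {u k..} (fst z) *\<^sub>R ?Y i k z) \<partial>slab M a b)" for n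
    proof -
      have "(\<integral>z. inner (drift x n z) (?Y i k z) \<partial>slab M (u k) T)
          = (\<integral>z. indicator {u k..} (fst z) * inner (drift x n z) (?Y i k z) \<partial>slab M a b)"
      proof (rule integral_slab_truncate[OF prob_space_axioms u(2,6)[OF ik(2)] ab(3)])
        show "(\<lambda>z. inner (drift x n z) (?Y i k z)) \<in> borel_measurable (slab M a T)"
          by (intro borel_measurable_inner L2_measurable[OF drift_L2] L2_measurable[OF S_incr2[OF ik]] ab) auto
        show "AE z in slab M b T. inner (drift x n z) (?Y i k z) = 0"
          using zero[of n] by eventually_elim simp
      qed
      then show ?thesis by simp
    qed
    have 2: "(\<integral>z. inner (x i z) (indicator {u k..<u (Suc k)} (fst z) *\<^sub>R ?Z i k z) \<partial>slab M (u k) T)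
        = (\<integral>z. inner (x i z) (indicator (cell a b m k) (fst z) *\<^sub>R ?Z i k z) \<partial>slab M a b)"
    proof -
      have "(\<integral>z. inner (x i z) (indicator {u k..<u (Suc k)} (fst z) *\<^sub>R ?Z i k z) \<partial>slab M (u k) T)
          = (\<integral>z. indicator {u k..} (fst z) * inner (x i z) (indicator {u k..<u (Suc k)} (fst z) *\<^sub>R ?Z i k z) \<partial>slab M a b)"
      proof (rule integral_slab_truncate[OF prob_space_axioms u(2,6)[OF ik(2)] ab(3)])
        show "(\<lambda>z. inner (x i z) (indicator {u k..<u (Suc k)} (fst z) *\<^sub>R ?Z i k z)) \<in> borel_measurable (slab M a T)"
          by (intro borel_measurable_inner L2_measurable[OF family_L2] L2_measurable[OF L2_indicator_fst[OF S\<zeta>2[OF ik]]] ab) auto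
        show "AE z in slab M b T. inner (x i z) (indicator {u k..<u (Suc k)} (fst z) *\<^sub>R ?Z i k z) = 0"
          using u(4)[OF ik(2)] by (intro AE_I2) (auto simp: space_pair_measure space_restrict_space)
      qed
      also have "\<dots> = (\<integral>z. inner (x i z) (indicator (cell a b m k) (fst z) *\<^sub>R ?Z i k z) \<partial>slab M a b)"
        by (rule Bochner_Integration.integral_cong[OF refl]) (auto simp: cell_def indicator_def)
      finally show ?thesis .
    qed
    show ?thesis
      using duality[OF u(1,3,5)[OF ik(2)] \<zeta>F[OF ik] \<zeta>B[OF ik], of i] unfolding 1 2 by simp
  qed
  have int: "integrable (slab M a b) (\<lambda>z. inner (drift x n z) (indicator {u k..} (fst z) *\<^sub>R ?Y i k z))"
    if "i < N" "k < m" for n i k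
    by (intro L2_inner_integrable drift_L2 L2_indicator_fst S_incr2 ab that) auto
  have int': "integrable (slab M a b) (\<lambda>z. inner (x i z) (indicator (cell a b m k) (fst z) *\<^sub>R ?Z i k z))"
    if "i < N" "k < m" for i k
    by (intro L2_inner_integrable family_L2 L2_indicator_fst S\<zeta>2 ab that) auto
  have 1: "(\<integral>z. inner (drift x n z) (X z) \<partial>slab M a b)
      = (\<Sum>i<N. \<Sum>k<m. \<integral>z. inner (drift x n z) (indicator {u k..} (fst z) *\<^sub>R ?Y i k z) \<partial>slab M a b)" for n
  proof -
    have "(\<integral>z. inner (drift x n z) (X z) \<partial>slab M a b)
        = (\<integral>z. (\<Sum>i<N. \<Sum>k<m. inner (drift x n z) (indicator {u k..} (fst z) *\<^sub>R ?Y i k z)) \<partial>slab M a b)"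
      by (simp only: step_convolution_def inner_sum_right)
    also have "\<dots> = (\<Sum>i<N. \<integral>z. (\<Sum>k<m. inner (drift x n z) (indicator {u k..} (fst z) *\<^sub>R ?Y i k z)) \<partial>slab M a b)"
      by (rule Bochner_Integration.integral_sum) (rule Bochner_Integration.integrable_sum, rule int, auto)
    also have "\<dots> = (\<Sum>i<N. \<Sum>k<m. \<integral>z. inner (drift x n z) (indicator {u k..} (fst z) *\<^sub>R ?Y i k z) \<partial>slab M a b)"
      by (intro sum.cong refl Bochner_Integration.integral_sum) (rule int, auto)
    finally show ?thesis .
  qed
  have 2: "(\<integral>z. inner (x i z) (V i z) \<partial>slab M a b)
      = (\<Sum>k<m. \<integral>z. inner (x i z) (indicator (cell a b m k) (fst z) *\<^sub>R ?Z i k z) \<partial>slab M a b)" if "i < N" for i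
    unfolding step_proc_def inner_sum_right by (rule Bochner_Integration.integral_sum) (rule int', use that in auto)
  have "(\<lambda>n. \<Sum>i<N. \<Sum>k<m. \<integral>z. inner (drift x n z) (indicator {u k..} (fst z) *\<^sub>R ?Y i k z) \<partial>slab M a b)
      \<longlonglongrightarrow> (\<Sum>i<N. \<Sum>k<m. \<integral>z. inner (x i z) (indicator (cell a b m k) (fst z) *\<^sub>R ?Z i k z) \<partial>slab M a b)"
    by (intro tendsto_sum lim) auto
  then show ?thesis unfolding 1 using 2 by simp
qed

text \<open>\<open>grid_pythagoras\<close> turns the second moment into a sum over cells. On a cell
  before r the semigroup law identifies the term with the integral of |S (r - s) V(s)|^2 over that
  cell. The cell containing r is estimated by the mesh times (K B)^2, once for each i.\<close>

lemma step_energy: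
  assumes r: "a \<le> r" "r \<le> b"
  shows "(\<integral>\<^sup>+\<omega>. ennreal ((norm (X (r, \<omega>)))\<^sup>2) \<partial>M)
    \<le> (\<Sum>i<N. (\<integral>\<^sup>+z. indicator {..<r} (fst z) * ennreal ((norm (S (max 0 (r - fst z)) (V i z)))\<^sup>2) \<partial>slab M a b)
        + ennreal ((b - a) / real m * (K * B)\<^sup>2))"
proof -
  let ?h = "(b - a) / real m"
  define Z where "Z i k \<omega> = indicator {u k..} r *\<^sub>R S (max 0 (r - u k)) (\<zeta> i k \<omega>)" for i k \<omega>
  let ?G = "\<lambda>i z. ennreal ((norm (S (max 0 (r - fst z)) (V i z)))\<^sup>2)"
  have h0: "0 \<le> ?h" using ab by simp
  have Sle: "norm (S (max 0 (r - u k)) y) \<le> K * norm y" if "k < m" for k y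
    using u[OF that] r ab by (intro S_le) auto
  have ZF: "Z i k \<in> borel_measurable (F (u k))" if ik: "i < N" "k < m" for i k
    unfolding Z_def[abs_def] by (intro borel_measurable_scaleR borel_measurable_const borel_measurable_semigroup \<zeta>F ik)
  have ZB: "norm (Z i k \<omega>) \<le> K * B" if ik: "i < N" "k < m" and \<omega>: "\<omega> \<in> space M" for i k \<omega>
  proof -
    have "norm (Z i k \<omega>) \<le> norm (S (max 0 (r - u k)) (\<zeta> i k \<omega>))" by (simp add: Z_def indicator_def)
    also have "\<dots> \<le> K * norm (\<zeta> i k \<omega>)" by (rule Sle[OF ik(2)])
    also have "\<dots> \<le> K * B" using \<zeta>B[OF ik \<omega>] K_ge_1 by (intro mult_left_mono) auto
    finally show ?thesis .
  qed
  have XZ: "X (r, \<omega>) = (\<Sum>i<N. \<Sum>k<m. incr i (u k) (u (Suc k)) \<omega> *\<^sub>R Z i k \<omega>)" for \<omega>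
    unfolding step_convolution_def Z_def
    by (intro sum.cong refl) (simp add: linear_scale[OF bounded_linear.linear[OF S_linear]])
  have fst_m: "(\<lambda>z. r - fst z) \<in> borel_measurable (slab M a b)"
    by (rule measurable_compose[OF measurable_fst measurable_restrict_space1]) simp
  have Gm[measurable]: "?G i \<in> borel_measurable (slab M a b)" if "i < N" for i
    using borel_measurable_semigroup[OF L2_measurable[OF L2_step_proc[OF that]] fst_m] by measurable
  have ind: "(\<lambda>z. indicator {..<r} (fst z) :: ennreal) \<in> borel_measurable (slab M a b)"
    "(\<lambda>z. indicator (cell a b m k) (fst z) :: ennreal) \<in> borel_measurable (slab M a b)" for k
    by (rule measurable_compose[OF measurable_fst measurable_restrict_space1], simp)+
  have cell: "ennreal ?h * (\<integral>\<^sup>+\<omega>. ennreal ((norm (Z i k \<omega>))\<^sup>2) \<partial>M)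
      \<le> (\<integral>\<^sup>+z. indicator (cell a b m k) (fst z) * (indicator {..<r} (fst z) * ?G i z) \<partial>slab M a b)
        + indicator (cell a b m k) r * ennreal (?h * (K * B)\<^sup>2)" if ik: "i < N" "k < m" for i k
  proof -
    \<comment> \<open>Cells after r contribute nothing, cells before r their exact share of the
      integral, and the cell around r only the error.\<close>
    consider "r < u k" | "r \<in> cell a b m k" | "u (Suc k) \<le> r"
      unfolding cell_def atLeastLessThan_iff by linarith
    then show ?thesis
    proof cases
      case 1
      then show ?thesis by (simp add: Z_def)
    next
      case 2
      have "(\<integral>\<^sup>+\<omega>. ennreal ((norm (Z i k \<omega>))\<^sup>2) \<partial>M) \<le> (\<integral>\<^sup>+\<omega>. ennreal ((K * B)\<^sup>2) \<partial>M)"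
        by (intro nn_integral_mono ennreal_leI power_mono ZB ik) auto
      then have "(\<integral>\<^sup>+\<omega>. ennreal ((norm (Z i k \<omega>))\<^sup>2) \<partial>M) \<le> ennreal ((K * B)\<^sup>2)" by (simp add: emeasure_space_1)
      then have "ennreal ?h * (\<integral>\<^sup>+\<omega>. ennreal ((norm (Z i k \<omega>))\<^sup>2) \<partial>M) \<le> ennreal ?h * ennreal ((K * B)\<^sup>2)"
        by (rule mult_left_mono) simp
      also have "\<dots> = indicator (cell a b m k) r * ennreal (?h * (K * B)\<^sup>2)"
        unfolding ennreal_mult[OF h0 zero_le_power2] using 2 by simp
      finally show ?thesis by (rule add_increasing[OF zero_le])
    next
      case 3
      have "ennreal ?h * (\<integral>\<^sup>+\<omega>. ennreal ((norm (Z i k \<omega>))\<^sup>2) \<partial>M)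
          = (\<integral>\<^sup>+z. indicator (cell a b m k) (fst z) * ennreal ((norm (Z i k (snd z)))\<^sup>2) \<partial>slab M a b)"
        using measurable_F_M[OF ZF[OF ik] u(7)[OF ik(2)]]
        by (intro nn_integral_slab_cell[OF prob_space_axioms ab(2) ik(2), symmetric]) measurable
      also have "\<dots> = (\<integral>\<^sup>+z. indicator (cell a b m k) (fst z) * (indicator {..<r} (fst z) * ?G i z) \<partial>slab M a b)"
      proof (rule nn_integral_cong)
        fix z
        show "indicator (cell a b m k) (fst z) * ennreal ((norm (Z i k (snd z)))\<^sup>2)
            = indicator (cell a b m k) (fst z) * (indicator {..<r} (fst z) * ?G i z)"
        proof (cases "fst z \<in> cell a b m k")
          case True
          then have z: "u k \<le> fst z" "fst z < r" using 3 by (auto simp: cell_def)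
          have "V i z = S (max 0 (fst z - u k)) (\<zeta> i k (snd z))"
            unfolding step_proc_def by (rule sum_cell_collapse[OF _ ik(2) True]) (use ab in simp)
          then have "S (max 0 (r - fst z)) (V i z) = S (r - u k) (\<zeta> i k (snd z))"
            using z S_add[of "r - fst z" "fst z - u k"] by simp
          moreover have "Z i k (snd z) = S (r - u k) (\<zeta> i k (snd z))" using z by (simp add: Z_def)
          ultimately show ?thesis using z by simp
        qed simp
      qed
      finally show ?thesis by simp
    qed
  qed
  \<comment> \<open>A given time lies in at most one cell, so summing over the cells costs no factor
    m.\<close>
  have cells: "(\<Sum>k<m. indicator (cell a b m k) s) \<le> (1 :: ennreal)" for s
  proof -
    have "(\<Sum>k<m. indicator (cell a b m k) s) = ennreal (\<Sum>k<m. indicator (cell a b m k) s)"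
      by (simp add: ennreal_indicator flip: sum_ennreal)
    also have "\<dots> = ennreal (indicator {a..<u m} s)" using ab by (subst sum_indicator_cell) auto
    finally show ?thesis by (simp add: indicator_def)
  qed
  have "(\<integral>\<^sup>+\<omega>. ennreal ((norm (X (r, \<omega>)))\<^sup>2) \<partial>M) = (\<Sum>i<N. \<Sum>k<m. ennreal ?h * (\<integral>\<^sup>+\<omega>. ennreal ((norm (Z i k \<omega>))\<^sup>2) \<partial>M))"
    unfolding XZ by (rule grid_pythagoras[OF ab m ZF ZB])
  also have "\<dots> \<le> (\<Sum>i<N. \<Sum>k<m. (\<integral>\<^sup>+z. indicator (cell a b m k) (fst z) * (indicator {..<r} (fst z) * ?G i z) \<partial>slab M a b)
        + indicator (cell a b m k) r * ennreal (?h * (K * B)\<^sup>2))"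
    by (intro sum_mono cell) auto
  also have "\<dots> \<le> (\<Sum>i<N. (\<integral>\<^sup>+z. indicator {..<r} (fst z) * ?G i z \<partial>slab M a b) + ennreal (?h * (K * B)\<^sup>2))"
  proof (rule sum_mono)
    fix i assume "i \<in> {..<N}"
    then have i: "i < N" by simp
    have "(\<Sum>k<m. \<integral>\<^sup>+z. indicator (cell a b m k) (fst z) * (indicator {..<r} (fst z) * ?G i z) \<partial>slab M a b)
        = (\<integral>\<^sup>+z. (\<Sum>k<m. indicator (cell a b m k) (fst z)) * (indicator {..<r} (fst z) * ?G i z) \<partial>slab M a b)"
      unfolding sum_distrib_right
      by (intro nn_integral_sum[symmetric] borel_measurable_times_ennreal ind Gm[OF i])
    also have "\<dots> \<le> (\<integral>\<^sup>+z. 1 * (indicator {..<r} (fst z) * ?G i z) \<partial>slab M a b)"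
      by (intro nn_integral_mono mult_right_mono cells) simp
    finally have A: "(\<Sum>k<m. \<integral>\<^sup>+z. indicator (cell a b m k) (fst z) * (indicator {..<r} (fst z) * ?G i z) \<partial>slab M a b)
        \<le> (\<integral>\<^sup>+z. indicator {..<r} (fst z) * ?G i z \<partial>slab M a b)" by simp
    have "(\<Sum>k<m. indicator (cell a b m k) r * ennreal (?h * (K * B)\<^sup>2)) \<le> 1 * ennreal (?h * (K * B)\<^sup>2)"
      unfolding sum_distrib_right[symmetric] by (intro mult_right_mono cells) simp
    then show "(\<Sum>k<m. (\<integral>\<^sup>+z. indicator (cell a b m k) (fst z) * (indicator {..<r} (fst z) * ?G i z) \<partial>slab M a b)
        + indicator (cell a b m k) r * ennreal (?h * (K * B)\<^sup>2))
      \<le> (\<integral>\<^sup>+z. indicator {..<r} (fst z) * ?G i z \<partial>slab M a b) + ennreal (?h * (K * B)\<^sup>2)"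
      unfolding sum.distrib using A by (intro add_mono) simp_all
  qed
  finally show ?thesis .
qed

end

end


section \<open>From the grid to arbitrary bounded test processes\<close>

context dual_family begin

text \<open>By the Ito isometry this is the integral over r of (b - r)^(-2\<alpha>) E|X_r|^2, for
  the stochastic convolution X of \<Gamma>. Written as an iterated integral it makes sense without
  constructing X beyond step processes.\<close>

definition green :: "real \<Rightarrow> real \<Rightarrow> nat \<Rightarrow> (nat \<Rightarrow> real \<times> 'w \<Rightarrow> 'h) \<Rightarrow> ennreal" where
  "green a b N \<Gamma> = (\<integral>\<^sup>+r. ennreal ((b - r) powr (- 2 * \<alpha>)) *
     (\<Sum>i<N. \<integral>\<^sup>+z. indicator {..<r} (fst z) * ennreal ((norm (S (max 0 (r - fst z)) (\<Gamma> i z)))\<^sup>2) \<partial>slab M a b)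
     \<partial>restrict_space lborel {a..b})"

lemma green_integrand_measurable:
  assumes \<Gamma>: "\<Gamma> \<in> borel_measurable (slab M a b)"
  shows "(\<lambda>p. indicator {..<fst p} (fst (snd p)) * ennreal ((norm (S (max 0 (fst p - fst (snd p))) (\<Gamma> (snd p))))\<^sup>2))
    \<in> borel_measurable (restrict_space lborel {a..b} \<Otimes>\<^sub>M slab M a b)"
proof -
  let ?R = "restrict_space lborel {a..b} \<Otimes>\<^sub>M slab M a b"
  have r[measurable]: "(\<lambda>p. fst p) \<in> borel_measurable ?R"
    by (rule measurable_compose[OF measurable_fst measurable_restrict_space1]) simp
  have s[measurable]: "(\<lambda>p. fst (snd p)) \<in> borel_measurable ?R"
    by (rule measurable_compose[OF measurable_snd measurable_compose[OF measurable_fst measurable_restrict_space1]]) simp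
  have "(\<lambda>p. S (max 0 (fst p - fst (snd p))) (\<Gamma> (snd p))) \<in> borel_measurable ?R"
    by (intro borel_measurable_semigroup measurable_compose[OF measurable_snd \<Gamma>] borel_measurable_diff r s)
  then have "(\<lambda>p. ennreal ((norm (S (max 0 (fst p - fst (snd p))) (\<Gamma> (snd p))))\<^sup>2)) \<in> borel_measurable ?R" by measurable
  moreover have "(\<lambda>p. if fst (snd p) < fst p then 1 else 0 :: ennreal) \<in> borel_measurable ?R"
    by measurable
  ultimately have "(\<lambda>p. (if fst (snd p) < fst p then 1 else 0) * ennreal ((norm (S (max 0 (fst p - fst (snd p))) (\<Gamma> (snd p))))\<^sup>2))
      \<in> borel_measurable ?R" by (intro borel_measurable_times_ennreal)
  then show ?thesis by (simp add: indicator_def of_bool_def)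
qed

lemma green_section_measurable:
  assumes \<Gamma>: "\<Gamma> \<in> borel_measurable (slab M a b)"
  shows "(\<lambda>r. \<integral>\<^sup>+z. indicator {..<r} (fst z) * ennreal ((norm (S (max 0 (r - fst z)) (\<Gamma> z)))\<^sup>2) \<partial>slab M a b)
    \<in> borel_measurable (restrict_space lborel {a..b})"
proof -
  interpret N: finite_measure "slab M a b" by (rule finite_measure_slab) unfold_locales
  show ?thesis
    using green_integrand_measurable[OF \<Gamma>] by (intro N.borel_measurable_nn_integral) (simp add: case_prod_unfold)
qed

lemma green_weight: "(\<lambda>r. ennreal ((b - r) powr (- 2 * \<alpha>))) \<in> borel_measurable (restrict_space lborel {a..b})"
  by (rule measurable_restrict_space1) simp

lemma nn_integral_green_weight:
  assumes "a \<le> b"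
  shows "(\<integral>\<^sup>+r. ennreal ((b - r) powr (- 2 * \<alpha>)) \<partial>restrict_space lborel {a..b}) = ennreal ((b - a) powr (1 - 2 * \<alpha>) / (1 - 2 * \<alpha>))"
  using nn_integral_powr_right[of "2 * \<alpha>" a b] assms alpha by (simp add: nn_integral_restrict_space)

lemma norm_S_le: "0 \<le> a \<Longrightarrow> b \<le> T \<Longrightarrow> r \<in> {a..b} \<Longrightarrow> z \<in> space (slab M a b) \<Longrightarrow> norm (S (max 0 (r - fst z)) y) \<le> K * norm y"
  using T_pos by (intro S_le) (auto simp: space_pair_measure space_restrict_space)

text \<open>Expand S V as S \<Gamma> + S (V - \<Gamma>) and square. The factor 2 on the main term is
  never removed: it is the 2 in \<open>pairing_bound\<close> and accounts for half of the 4 in the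
  smallness condition.\<close>

lemma green_perturbation:
  assumes ab: "0 \<le> a" "b \<le> T" and r: "r \<in> {a..b}" and \<epsilon>: "0 \<le> \<epsilon>"
    and V: "V \<in> borel_measurable (slab M a b)" and \<Gamma>: "\<Gamma> \<in> borel_measurable (slab M a b)"
    and close: "(\<integral>\<^sup>+z. ennreal ((norm (V z - \<Gamma> z))\<^sup>2) \<partial>slab M a b) \<le> ennreal \<epsilon>"
  shows "(\<integral>\<^sup>+z. indicator {..<r} (fst z) * ennreal ((norm (S (max 0 (r - fst z)) (V z)))\<^sup>2) \<partial>slab M a b)
    \<le> 2 * (\<integral>\<^sup>+z. indicator {..<r} (fst z) * ennreal ((norm (S (max 0 (r - fst z)) (\<Gamma> z)))\<^sup>2) \<partial>slab M a b) + ennreal (2 * K\<^sup>2 * \<epsilon>)"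
proof -
  let ?I = "\<lambda>z. indicator {..<r} (fst z) :: ennreal"
  let ?G = "\<lambda>z. ?I z * ennreal ((norm (S (max 0 (r - fst z)) (\<Gamma> z)))\<^sup>2)"
  have I[measurable]: "?I \<in> borel_measurable (slab M a b)"
    by (rule measurable_compose[OF measurable_fst measurable_restrict_space1]) simp
  have "(\<lambda>z. r - fst z) \<in> borel_measurable (slab M a b)"
    by (rule measurable_compose[OF measurable_fst measurable_restrict_space1]) simp
  note [measurable] = borel_measurable_semigroup[OF \<Gamma> this] V \<Gamma>
  have "(\<integral>\<^sup>+z. ?I z * ennreal ((norm (S (max 0 (r - fst z)) (V z)))\<^sup>2) \<partial>slab M a b)
    \<le> (\<integral>\<^sup>+z. 2 * ?G z + ennreal (2 * K\<^sup>2) * ennreal ((norm (V z - \<Gamma> z))\<^sup>2) \<partial>slab M a b)"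
  proof (rule nn_integral_mono)
    fix z assume z: "z \<in> space (slab M a b)"
    let ?s = "S (max 0 (r - fst z))"
    have "?s (V z) = ?s (\<Gamma> z) + ?s (V z - \<Gamma> z)"
      by (simp add: linear_diff[OF bounded_linear.linear[OF S_linear]])
    then have "(norm (?s (V z)))\<^sup>2 \<le> 2 * (norm (?s (\<Gamma> z)))\<^sup>2 + 2 * (norm (?s (V z - \<Gamma> z)))\<^sup>2"
      using norm_add_power2_le[of "?s (\<Gamma> z)" "?s (V z - \<Gamma> z)"] by simp
    also have "(norm (?s (V z - \<Gamma> z)))\<^sup>2 \<le> (K * norm (V z - \<Gamma> z))\<^sup>2"
      by (intro power_mono norm_S_le[OF ab r z]) simp
    finally have "(norm (?s (V z)))\<^sup>2 \<le> 2 * (norm (?s (\<Gamma> z)))\<^sup>2 + 2 * K\<^sup>2 * (norm (V z - \<Gamma> z))\<^sup>2"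
      by (simp add: power_mult_distrib)
    from ennreal_leI[OF this] show "?I z * ennreal ((norm (?s (V z)))\<^sup>2) \<le> 2 * ?G z + ennreal (2 * K\<^sup>2) * ennreal ((norm (V z - \<Gamma> z))\<^sup>2)"
      by (cases "fst z < r") (simp_all add: ennreal_mult ennreal_plus)
  qed
  also have "\<dots> = 2 * (\<integral>\<^sup>+z. ?G z \<partial>slab M a b) + ennreal (2 * K\<^sup>2) * (\<integral>\<^sup>+z. ennreal ((norm (V z - \<Gamma> z))\<^sup>2) \<partial>slab M a b)"
    by (rule nn_integral_lincomb) measurable
  also have "\<dots> \<le> 2 * (\<integral>\<^sup>+z. ?G z \<partial>slab M a b) + ennreal (2 * K\<^sup>2) * ennreal \<epsilon>"
    by (intro add_left_mono mult_left_mono close) simp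
  finally show ?thesis using \<epsilon> by (simp add: ennreal_mult)
qed

text \<open>Integrating \<open>step_energy\<close> against the weight, whose mass is finite as 2
  \<alpha> < 1, leaves 2 \<rho> and two errors: one from approximating \<Gamma>, one from the
  mesh.\<close>

lemma step_energy_total:
  assumes ab: "0 \<le> a" "a < b" "b \<le> T" and m: "0 < m"
    and \<zeta>F: "\<And>i k. i < N \<Longrightarrow> k < m \<Longrightarrow> \<zeta> i k \<in> borel_measurable (F (grid a b m k))"
    and \<zeta>B: "\<And>i k \<omega>. i < N \<Longrightarrow> k < m \<Longrightarrow> \<omega> \<in> space M \<Longrightarrow> norm (\<zeta> i k \<omega>) \<le> B"
    and \<Gamma>: "\<And>i. i < N \<Longrightarrow> \<Gamma> i \<in> borel_measurable (slab M a b)" and nn: "0 \<le> \<epsilon>" "0 \<le> \<rho>"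
    and close: "\<And>i. i < N \<Longrightarrow> (\<integral>\<^sup>+z. ennreal ((norm (step_proc a b m (\<zeta> i) z - \<Gamma> i z))\<^sup>2) \<partial>slab M a b) \<le> ennreal \<epsilon>"
    and green: "green a b N \<Gamma> \<le> ennreal \<rho>"
  shows "(\<integral>\<^sup>+z. ennreal ((b - fst z) powr (- 2 * \<alpha>) * (norm (step_convolution a b m N \<zeta> z))\<^sup>2) \<partial>slab M a b)
    \<le> ennreal (2 * \<rho> + (b - a) powr (1 - 2 * \<alpha>) / (1 - 2 * \<alpha>) * (real N * (2 * K\<^sup>2 * \<epsilon> + (b - a) / real m * (K * B)\<^sup>2)))"
proof -
  let ?X = "step_convolution a b m N \<zeta>" and ?L = "restrict_space lborel {a..b}"
  let ?w = "\<lambda>r. ennreal ((b - r) powr (- 2 * \<alpha>))" and ?\<kappa> = "(b - a) powr (1 - 2 * \<alpha>) / (1 - 2 * \<alpha>)"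
  let ?h = "(b - a) / real m * (K * B)\<^sup>2"
  let ?G = "\<lambda>i r. \<integral>\<^sup>+z. indicator {..<r} (fst z) * ennreal ((norm (S (max 0 (r - fst z)) (\<Gamma> i z)))\<^sup>2) \<partial>slab M a b"
  define q where "q = real N * (2 * K\<^sup>2 * \<epsilon> + ?h)"
  have q0: "0 \<le> q" and h0: "0 \<le> ?h" and \<kappa>0: "0 \<le> ?\<kappa>" unfolding q_def using nn ab alpha by auto
  interpret L: sigma_finite_measure ?L by (intro finite_measure.axioms finite_measure_Icc)
  have Xm[measurable]: "?X \<in> borel_measurable (slab M a b)"
    by (rule L2_measurable[OF L2_step_convolution[OF ab m \<zeta>F \<zeta>B]])
  have [measurable]: "(\<lambda>z. b - fst z) \<in> borel_measurable (slab M a b)"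
    by (rule measurable_compose[OF measurable_fst measurable_restrict_space1]) simp
  have V2: "L2 (slab M a b) (step_proc a b m (\<zeta> i))" if "i < N" for i
    by (rule L2_step_proc[OF ab m \<zeta>F \<zeta>B that])
  have E: "(\<integral>\<^sup>+\<omega>. ennreal ((norm (?X (r, \<omega>)))\<^sup>2) \<partial>M) \<le> 2 * (\<Sum>i<N. ?G i r) + ennreal q" if r: "r \<in> {a..b}" for r
  proof -
    have "(\<integral>\<^sup>+\<omega>. ennreal ((norm (?X (r, \<omega>)))\<^sup>2) \<partial>M)
      \<le> (\<Sum>i<N. (\<integral>\<^sup>+z. indicator {..<r} (fst z) * ennreal ((norm (S (max 0 (r - fst z)) (step_proc a b m (\<zeta> i) z)))\<^sup>2) \<partial>slab M a b)
          + ennreal ?h)"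
      by (rule step_energy[OF ab m \<zeta>F \<zeta>B]) (use r in auto)
    also have "\<dots> \<le> (\<Sum>i<N. (2 * ?G i r + ennreal (2 * K\<^sup>2 * \<epsilon>)) + ennreal ?h)"
      using ab r nn by (intro sum_mono add_right_mono green_perturbation L2_measurable[OF V2] \<Gamma> close) auto
    also have "\<dots> = (\<Sum>i<N. 2 * ?G i r) + (\<Sum>i<N. ennreal (2 * K\<^sup>2 * \<epsilon> + ?h))"
      using nn h0 by (simp only: sum.distrib[symmetric] add.assoc ennreal_plus[symmetric] mult_nonneg_nonneg zero_le_power2 zero_le_numeral)
    also have "\<dots> = 2 * (\<Sum>i<N. ?G i r) + ennreal q"
      using nn h0 by (simp add: sum_distrib_left q_def ennreal_mult ennreal_of_nat_eq_real_of_nat)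
    finally show ?thesis .
  qed
  have "(\<integral>\<^sup>+z. ennreal ((b - fst z) powr (- 2 * \<alpha>) * (norm (?X z))\<^sup>2) \<partial>slab M a b)
      = (\<integral>\<^sup>+r. (\<integral>\<^sup>+\<omega>. ennreal ((b - r) powr (- 2 * \<alpha>) * (norm (?X (r, \<omega>)))\<^sup>2) \<partial>M) \<partial>?L)"
    using nn_integral_fst[of "\<lambda>z. ennreal ((b - fst z) powr (- 2 * \<alpha>) * (norm (?X z))\<^sup>2)" ?L] by simp
  also have "\<dots> \<le> (\<integral>\<^sup>+r. 2 * (?w r * (\<Sum>i<N. ?G i r)) + ennreal q * ?w r \<partial>?L)"
  proof (rule nn_integral_mono)
    fix r assume "r \<in> space ?L"
    then have r: "r \<in> {a..b}" by (simp add: space_restrict_space)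
    then have rL: "r \<in> space ?L" by (simp add: space_restrict_space)
    have "(\<lambda>\<omega>. ?X (r, \<omega>)) \<in> borel_measurable M" by (rule measurable_compose[OF measurable_Pair1'[OF rL] Xm])
    then have "(\<integral>\<^sup>+\<omega>. ennreal ((b - r) powr (- 2 * \<alpha>) * (norm (?X (r, \<omega>)))\<^sup>2) \<partial>M) = ?w r * (\<integral>\<^sup>+\<omega>. ennreal ((norm (?X (r, \<omega>)))\<^sup>2) \<partial>M)"
      by (subst nn_integral_cmult[symmetric]) (auto simp: ennreal_mult)
    also have "\<dots> \<le> ?w r * (2 * (\<Sum>i<N. ?G i r) + ennreal q)" by (intro mult_left_mono E r) simp
    finally show "(\<integral>\<^sup>+\<omega>. ennreal ((b - r) powr (- 2 * \<alpha>) * (norm (?X (r, \<omega>)))\<^sup>2) \<partial>M) \<le> 2 * (?w r * (\<Sum>i<N. ?G i r)) + ennreal q * ?w r"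
      by (simp add: distrib_left mult_ac)
  qed
  also have "\<dots> = 2 * (\<integral>\<^sup>+r. ?w r * (\<Sum>i<N. ?G i r) \<partial>?L) + ennreal q * (\<integral>\<^sup>+r. ?w r \<partial>?L)"
    by (intro nn_integral_lincomb borel_measurable_times_ennreal green_weight borel_measurable_sum green_section_measurable \<Gamma>) auto
  also have "\<dots> \<le> 2 * ennreal \<rho> + ennreal q * ennreal ?\<kappa>"
    using green ab unfolding green_def by (intro add_mono mult_left_mono) (simp_all only: nn_integral_green_weight[OF less_imp_le] order_refl zero_le)
  also have "\<dots> = ennreal (2 * \<rho> + ?\<kappa> * q)"
  proof -
    have "ennreal (2 * \<rho> + ?\<kappa> * q) = ennreal (2 * \<rho>) + ennreal (?\<kappa> * q)"
      by (intro ennreal_plus mult_nonneg_nonneg nn q0 \<kappa>0) simp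
    moreover have "ennreal (2 * \<rho>) = 2 * ennreal \<rho>" using nn by (simp add: ennreal_mult)
    moreover have "ennreal (?\<kappa> * q) = ennreal q * ennreal ?\<kappa>" by (subst mult.commute) (rule ennreal_mult[OF q0 \<kappa>0])
    ultimately show ?thesis by (simp only:)
  qed
  finally show ?thesis unfolding q_def .
qed

text \<open>For each tolerance \<epsilon> one grid is fixed on which all N processes are
  approximated and the mesh error is small. On this grid n tends to infinity in the dual identity,
  under a Cauchy-Schwarz bound uniform in n. Only afterwards does \<epsilon> tend to 0, so no limits
  are exchanged.\<close>

lemma pairing_bound:
  assumes ab: "0 \<le> a" "a < b" "b \<le> T" and zero: "\<And>n. AE z in slab M b T. drift x n z = 0"
    and prog: "\<And>i. i < N \<Longrightarrow> progressive M F T (\<lambda>s \<omega>. \<Gamma> i (s, \<omega>))"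
    and bound: "\<And>i s \<omega>. i < N \<Longrightarrow> s \<in> {0..T} \<Longrightarrow> \<omega> \<in> space M \<Longrightarrow> norm (\<Gamma> i (s, \<omega>)) \<le> B"
    and \<mu>: "\<And>n. (\<integral>\<^sup>+z. ennreal ((b - fst z) powr (2 * \<alpha>) * (norm (drift x n z))\<^sup>2) \<partial>slab M a b) \<le> ennreal \<mu>"
    and \<rho>: "green a b N \<Gamma> \<le> ennreal \<rho>" and nn: "0 \<le> \<mu>" "0 \<le> \<rho>"
  shows "(\<Sum>i<N. \<integral>z. inner (x i z) (\<Gamma> i z) \<partial>slab M a b)\<^sup>2 \<le> \<mu> * (2 * \<rho>)"
proof -
  interpret FS: finite_measure "slab M a b" by (rule finite_measure_slab) unfold_locales
  let ?s = "\<Sum>i<N. \<integral>z. inner (x i z) (\<Gamma> i z) \<partial>slab M a b"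
  define \<kappa> where "\<kappa> = (b - a) powr (1 - 2 * \<alpha>) / (1 - 2 * \<alpha>)"
  define D where "D = (\<Sum>i<N. sqrt (\<integral>z. (norm (x i z))\<^sup>2 \<partial>slab M a b))"
  have \<kappa>0: "0 \<le> \<kappa>" unfolding \<kappa>_def using alpha by simp
  have \<Gamma>m: "\<Gamma> i \<in> borel_measurable (slab M a b)" if "i < N" for i
    using progressive_measurable[OF prog[OF that] ab(1,3)] T_pos by simp
  have \<Gamma>2: "L2 (slab M a b) (\<Gamma> i)" if i: "i < N" for i
    by (rule FS.L2_bounded[OF \<Gamma>m[OF i], of B]) (use ab bound[OF i] in \<open>auto simp: space_pair_measure space_restrict_space\<close>)
  have x2: "L2 (slab M a b) (x i)" for i using ab by (intro family_L2) auto
  have main: "\<bar>?s\<bar> \<le> sqrt (\<mu> * (2 * \<rho> + \<kappa> * (real N * (2 * K\<^sup>2 * \<epsilon> + \<epsilon>)))) + D * sqrt \<epsilon>" if \<epsilon>: "\<epsilon> > 0" for \<epsilon>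
  proof -
    have "\<forall>i. \<exists>B'. \<exists>\<zeta>. i < N \<longrightarrow> (\<forall>m k. k < m \<longrightarrow> \<zeta> m k \<in> borel_measurable (F (grid a b m k))) \<and>
        (\<forall>m k. \<forall>\<omega>\<in>space M. k < m \<longrightarrow> norm (\<zeta> m k \<omega>) \<le> B') \<and>
        (\<forall>\<^sub>F m in sequentially. (\<integral>\<^sup>+z. ennreal ((norm (step_proc a b m (\<zeta> m) z - \<Gamma> i z))\<^sup>2) \<partial>slab M a b) < ennreal \<epsilon>)"
      (is "\<forall>i. \<exists>B'. \<exists>\<zeta>. i < N \<longrightarrow> ?P i B' \<zeta>")
    proof
      fix i
      show "\<exists>B'. \<exists>\<zeta>. i < N \<longrightarrow> ?P i B' \<zeta>"
      proof (cases "i < N")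
        case True
        obtain B' \<zeta> where z: "\<And>m k. k < m \<Longrightarrow> \<zeta> m k \<in> borel_measurable (F (grid a b m k))"
          "\<And>m k \<omega>. k < m \<Longrightarrow> \<omega> \<in> space M \<Longrightarrow> norm (\<zeta> m k \<omega>) \<le> B'"
          "\<forall>\<^sub>F m in sequentially. (\<integral>\<^sup>+z. ennreal ((norm ((\<Sum>k<m. indicator (cell a b m k) (fst z) *\<^sub>R
            S (max 0 (fst z - grid a b m k)) (\<zeta> m k (snd z))) - \<Gamma> i (fst z, snd z)))\<^sup>2) \<partial>slab M a b) < ennreal \<epsilon>"
          by (rule semigroup_approximation[OF prog[OF True] ab _ \<epsilon>, of B])
            (rule bound[OF True], assumption, assumption, rule that, assumption+)
        have "?P i B' \<zeta>" using z unfolding step_proc_def by auto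
        then show ?thesis by blast
      qed blast
    qed
    then obtain B' \<zeta> where P: "\<And>i. i < N \<Longrightarrow> ?P i (B' i) (\<zeta> i)" unfolding choice_iff by blast
    \<comment> \<open>One bound for all N families of coefficients; absolute values guard against
      negative individual bounds.\<close>
    define B'' where "B'' = (\<Sum>i<N. \<bar>B' i\<bar>)"
    have B'': "B' i \<le> B''" if "i < N" for i
      unfolding B''_def using member_le_sum[of i "{..<N}" "\<lambda>i. \<bar>B' i\<bar>"] that by auto
    have "(\<lambda>m. (b - a) / real m * (K * B'')\<^sup>2) \<longlonglongrightarrow> 0"
      by (rule tendsto_eq_intros real_tendsto_divide_at_top filterlim_real_sequentially tendsto_const | simp)+
    then have "\<forall>\<^sub>F m in sequentially. (b - a) / real m * (K * B'')\<^sup>2 < \<epsilon>"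
      by (rule order_tendstoD) (rule \<epsilon>)
    moreover have "\<forall>\<^sub>F m in sequentially. \<forall>i\<in>{..<N}. (\<integral>\<^sup>+z. ennreal ((norm (step_proc a b m (\<zeta> i m) z - \<Gamma> i z))\<^sup>2) \<partial>slab M a b) < ennreal \<epsilon>"
      by (rule eventually_ball_finite) (use P in auto)
    ultimately have "\<forall>\<^sub>F m in sequentially. 0 < m \<and> (b - a) / real m * (K * B'')\<^sup>2 < \<epsilon> \<and>
        (\<forall>i\<in>{..<N}. (\<integral>\<^sup>+z. ennreal ((norm (step_proc a b m (\<zeta> i m) z - \<Gamma> i z))\<^sup>2) \<partial>slab M a b) < ennreal \<epsilon>)"
      using eventually_gt_at_top[of "0 :: nat"] by eventually_elim blast
    from eventually_happens'[OF sequentially_bot this]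
    obtain m where m: "0 < m" "(b - a) / real m * (K * B'')\<^sup>2 < \<epsilon>"
      and close': "\<forall>i\<in>{..<N}. (\<integral>\<^sup>+z. ennreal ((norm (step_proc a b m (\<zeta> i m) z - \<Gamma> i z))\<^sup>2) \<partial>slab M a b) < ennreal \<epsilon>"
      by (elim exE conjE)
    have close: "(\<integral>\<^sup>+z. ennreal ((norm (step_proc a b m (\<zeta> i m) z - \<Gamma> i z))\<^sup>2) \<partial>slab M a b) \<le> ennreal \<epsilon>" if "i < N" for i
      by (rule less_imp_le, rule close'[rule_format]) (use that in simp)
    let ?V = "\<lambda>i. step_proc a b m (\<zeta> i m)" and ?X = "step_convolution a b m N (\<lambda>i. \<zeta> i m)"
    have \<zeta>F: "\<zeta> i m k \<in> borel_measurable (F (grid a b m k))" if "i < N" "k < m" for i k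
      by (rule P[OF that(1), THEN conjunct1, rule_format, OF that(2)])
    have \<zeta>B: "norm (\<zeta> i m k \<omega>) \<le> B''" if "i < N" "k < m" "\<omega> \<in> space M" for i k \<omega>
      by (rule order_trans[OF P[OF that(1), THEN conjunct2, THEN conjunct1, rule_format, OF that(3,2)] B''[OF that(1)]])
    have V2: "L2 (slab M a b) (?V i)" if "i < N" for i by (rule L2_step_proc[OF ab m(1) \<zeta>F \<zeta>B that])
    have X2: "L2 (slab M a b) ?X" by (rule L2_step_convolution[OF ab m(1) \<zeta>F \<zeta>B])
    let ?R = "2 * \<rho> + \<kappa> * (real N * (2 * K\<^sup>2 * \<epsilon> + \<epsilon>))"
    have "(\<integral>\<^sup>+z. ennreal ((b - fst z) powr (- 2 * \<alpha>) * (norm (?X z))\<^sup>2) \<partial>slab M a b)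
        \<le> ennreal (2 * \<rho> + \<kappa> * (real N * (2 * K\<^sup>2 * \<epsilon> + (b - a) / real m * (K * B'')\<^sup>2)))"
      unfolding \<kappa>_def by (rule step_energy_total[OF ab m(1) \<zeta>F \<zeta>B \<Gamma>m _ nn(2) close \<rho>]) (use \<epsilon> in auto)
    also have "\<dots> \<le> ennreal ?R"
      using m(2) \<kappa>0 by (intro ennreal_leI add_left_mono mult_left_mono) auto
    finally have XR: "(\<integral>\<^sup>+z. ennreal ((b - fst z) powr (- 2 * \<alpha>) * (norm (?X z))\<^sup>2) \<partial>slab M a b) \<le> ennreal ?R" .
    have R0: "0 \<le> ?R" using nn \<kappa>0 \<epsilon> by simp
    let ?v = "\<Sum>i<N. \<integral>z. inner (x i z) (?V i z) \<partial>slab M a b"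
    have lim: "(\<lambda>n. (\<integral>z. inner (drift x n z) (?X z) \<partial>slab M a b)\<^sup>2) \<longlonglongrightarrow> ?v\<^sup>2"
      by (intro tendsto_power step_duality[OF ab m(1) \<zeta>F \<zeta>B zero])
    have "?v\<^sup>2 \<le> \<mu> * ?R"
    proof (rule LIMSEQ_le_const2[OF lim], intro exI allI impI)
      fix n
      show "(\<integral>z. inner (drift x n z) (?X z) \<partial>slab M a b)\<^sup>2 \<le> \<mu> * ?R"
        by (rule weighted_Cauchy_Schwarz[OF prob_space_axioms drift_L2[OF ab(1,3)] X2 nn(1) R0 \<mu> XR])
    qed
    then have v: "\<bar>?v\<bar> \<le> sqrt (\<mu> * ?R)" by (intro real_le_rsqrt) (simp only: power2_abs)
    \<comment> \<open>Replacing \<Gamma> by the step processes costs at most D sqrt \<epsilon>,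
      where D does not depend on the grid.\<close>
    have "\<bar>?s - ?v\<bar> = \<bar>\<Sum>i<N. \<integral>z. inner (x i z) (\<Gamma> i z - ?V i z) \<partial>slab M a b\<bar>"
    proof -
      have "(\<integral>z. inner (x i z) (\<Gamma> i z - ?V i z) \<partial>slab M a b)
          = (\<integral>z. inner (x i z) (\<Gamma> i z) \<partial>slab M a b) - (\<integral>z. inner (x i z) (?V i z) \<partial>slab M a b)" if i: "i < N" for i
        unfolding inner_diff_right
        by (rule Bochner_Integration.integral_diff[OF L2_inner_integrable[OF x2 \<Gamma>2[OF i]] L2_inner_integrable[OF x2 V2[OF i]]])
      then show ?thesis by (simp add: sum_subtractf)
    qed
    also have "\<dots> \<le> (\<Sum>i<N. \<bar>\<integral>z. inner (x i z) (\<Gamma> i z - ?V i z) \<partial>slab M a b\<bar>)" by (rule sum_abs)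
    also have "\<dots> \<le> (\<Sum>i<N. sqrt (\<integral>z. (norm (x i z))\<^sup>2 \<partial>slab M a b) * sqrt \<epsilon>)"
    proof (rule sum_mono)
      fix i assume "i \<in> {..<N}"
      then have i: "i < N" by simp
      have d2: "L2 (slab M a b) (\<lambda>z. \<Gamma> i z - ?V i z)" by (intro L2_diff \<Gamma>2 V2 i)
      have "ennreal (\<integral>z. (norm (\<Gamma> i z - ?V i z))\<^sup>2 \<partial>slab M a b) \<le> ennreal \<epsilon>"
        using close[OF i] unfolding L2_nn_integral[OF d2, symmetric] by (simp add: norm_minus_commute)
      then have "(\<integral>z. (norm (\<Gamma> i z - ?V i z))\<^sup>2 \<partial>slab M a b) \<le> \<epsilon>" using \<epsilon> by simp
      then show "\<bar>\<integral>z. inner (x i z) (\<Gamma> i z - ?V i z) \<partial>slab M a b\<bar> \<le> sqrt (\<integral>z. (norm (x i z))\<^sup>2 \<partial>slab M a b) * sqrt \<epsilon>"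
        by (intro order_trans[OF L2_Cauchy_Schwarz_sqrt[OF x2 d2]] mult_left_mono) auto
    qed
    also have "\<dots> = D * sqrt \<epsilon>" by (simp add: D_def sum_distrib_right)
    finally show ?thesis using v by linarith
  qed
  \<comment> \<open>The estimate is taken at \<epsilon> = 1 / (n + 1).\<close>
  have "(\<lambda>n. sqrt (\<mu> * (2 * \<rho> + \<kappa> * (real N * (2 * K\<^sup>2 * inverse (real (Suc n)) + inverse (real (Suc n)))))) + D * sqrt (inverse (real (Suc n))))
      \<longlonglongrightarrow> sqrt (\<mu> * (2 * \<rho> + \<kappa> * (real N * (2 * K\<^sup>2 * 0 + 0)))) + D * sqrt 0"
    by (intro tendsto_add tendsto_mult tendsto_real_sqrt tendsto_const LIMSEQ_inverse_real_of_nat)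
  then have "\<bar>?s\<bar> \<le> sqrt (\<mu> * (2 * \<rho> + \<kappa> * (real N * (2 * K\<^sup>2 * 0 + 0)))) + D * sqrt 0"
    by (rule LIMSEQ_le_const) (intro exI allI impI main, simp)
  then have "\<bar>?s\<bar> \<le> sqrt (\<mu> * (2 * \<rho>))" by (simp only: mult_zero_right add_0_right real_sqrt_zero)
  then have "\<bar>?s\<bar>\<^sup>2 \<le> (sqrt (\<mu> * (2 * \<rho>)))\<^sup>2" by (intro power_mono abs_ge_zero)
  then show ?thesis using nn by (simp only: power2_abs real_sqrt_pow2 mult_nonneg_nonneg zero_le_numeral)
qed

text \<open>A crude bound from |S \<Gamma>| <= K B, meant for use with \<mu> = 0, where any finite
  \<rho> will do.\<close>

lemma green_finite:
  assumes ab: "0 \<le> a" "a < b" "b \<le> T"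
    and bound: "\<And>i z. i < N \<Longrightarrow> z \<in> space (slab M a b) \<Longrightarrow> norm (\<Gamma> i z) \<le> B"
  shows "\<exists>\<rho>\<ge>0. green a b N \<Gamma> \<le> ennreal \<rho>"
proof -
  interpret FS: finite_measure "slab M a b" by (rule finite_measure_slab) unfold_locales
  let ?\<kappa> = "(b - a) powr (1 - 2 * \<alpha>) / (1 - 2 * \<alpha>)" and ?q = "real N * ((K * B)\<^sup>2 * measure (slab M a b) (space (slab M a b)))"
  have "green a b N \<Gamma> \<le> (\<integral>\<^sup>+r. ennreal ((b - r) powr (- 2 * \<alpha>)) * ennreal ?q \<partial>restrict_space lborel {a..b})"
    unfolding green_def
  proof (intro nn_integral_mono mult_left_mono)
    fix r assume "r \<in> space (restrict_space lborel {a..b})"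
    then have r: "r \<in> {a..b}" by (simp add: space_restrict_space)
    have "(\<Sum>i<N. \<integral>\<^sup>+z. indicator {..<r} (fst z) * ennreal ((norm (S (max 0 (r - fst z)) (\<Gamma> i z)))\<^sup>2) \<partial>slab M a b)
      \<le> (\<Sum>i<N. \<integral>\<^sup>+z. ennreal ((K * B)\<^sup>2) \<partial>slab M a b)"
    proof (intro sum_mono nn_integral_mono)
      fix i z assume i: "i \<in> {..<N}" and z: "z \<in> space (slab M a b)"
      have "norm (S (max 0 (r - fst z)) (\<Gamma> i z)) \<le> K * B"
        by (rule order_trans[OF norm_S_le[OF ab(1,3) r z] mult_left_mono[OF bound[OF _ z]]]) (use i K_ge_1 in auto)
      then have "ennreal ((norm (S (max 0 (r - fst z)) (\<Gamma> i z)))\<^sup>2) \<le> ennreal ((K * B)\<^sup>2)"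
        by (intro ennreal_leI power_mono) auto
      then show "indicator {..<r} (fst z) * ennreal ((norm (S (max 0 (r - fst z)) (\<Gamma> i z)))\<^sup>2) \<le> ennreal ((K * B)\<^sup>2)"
        unfolding indicator_def of_bool_def lessThan_iff
        by (cases "fst z < r") (simp_all only: if_True if_False mult_1 mult_zero_left zero_le)
    qed
    also have "\<dots> = ennreal ?q"
      by (simp add: FS.emeasure_eq_measure ennreal_mult ennreal_of_nat_eq_real_of_nat)
    finally show "(\<Sum>i<N. \<integral>\<^sup>+z. indicator {..<r} (fst z) * ennreal ((norm (S (max 0 (r - fst z)) (\<Gamma> i z)))\<^sup>2) \<partial>slab M a b) \<le> ennreal ?q" .
  qed simp
  also have "\<dots> = ennreal ?\<kappa> * ennreal ?q"
    unfolding nn_integral_multc[OF green_weight] nn_integral_green_weight[OF less_imp_le[OF ab(2)]] ..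
  also have "\<dots> = ennreal (?\<kappa> * ?q)" using alpha by (intro ennreal_mult[symmetric]) auto
  finally show ?thesis using alpha by (intro exI[of _ "?\<kappa> * ?q"]) auto
qed

end


section \<open>The contraction for the partial drifts\<close>

context dual_family begin

lemma progressive_pair: "progressive M F T (\<lambda>s \<omega>. g (s, \<omega>)) \<longleftrightarrow> (\<forall>t\<in>{0..T}. g \<in> borel_measurable (slab (F t) 0 t))"
  by (simp add: progressive_def)

lemma space_slab_F: "t \<in> {0..T} \<Longrightarrow> space (slab (F t) 0 t) \<subseteq> {0..T} \<times> space M"
  by (auto simp: space_pair_measure space_restrict_space space_F)

lemma drift_progressive: "progressive M F T (\<lambda>s \<omega>. drift x n (s, \<omega>))"
  unfolding progressive_pair
proof
  fix t assume t: "t \<in> {0..T}"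
  have "x i \<in> borel_measurable (slab (F t) 0 t)" for i using x_prog t unfolding progressive_pair by blast
  moreover have "(\<lambda>z. C i (fst z) (snd z) (e k)) \<in> borel_measurable (slab (F t) 0 t)" for i k
    using C_prog t unfolding progressive_def by blast
  ultimately show "drift x n \<in> borel_measurable (slab (F t) 0 t)"
    unfolding drift_def[abs_def] by (intro borel_measurable_sum hadj_C_measurable space_slab_F t)
qed

lemma apply_C_progressive:
  assumes Y: "progressive M F T (\<lambda>s \<omega>. Y (s, \<omega>))"
  shows "progressive M F T (\<lambda>s \<omega>. C i (fst (s, \<omega>)) (snd (s, \<omega>)) (Y (s, \<omega>)))"
  unfolding progressive_pair[where g="\<lambda>z. C i (fst z) (snd z) (Y z)"]
proof
  fix t assume t: "t \<in> {0..T}"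
  show "(\<lambda>z. C i (fst z) (snd z) (Y z)) \<in> borel_measurable (slab (F t) 0 t)"
  proof (rule borel_measurable_apply_operator[OF basis, where K="\<lambda>z. C i (fst z) (snd z)" and X=Y])
    show "(\<lambda>z. C i (fst z) (snd z) (e k)) \<in> borel_measurable (slab (F t) 0 t)" for k
      using C_prog t unfolding progressive_def by blast
    show "Y \<in> borel_measurable (slab (F t) 0 t)" using Y t unfolding progressive_pair by blast
    show "bounded_linear (C i (fst z) (snd z))" if "z \<in> space (slab (F t) 0 t)" for z
      using space_slab_F[OF t] that by (intro C_linear) auto
  qed
qed

text \<open>The constant c of the smoothing hypothesis times the constant of
  \<open>powr_convolution_bound\<close> at p = 2 \<alpha>.\<close>

definition green_const :: real where
  "green_const = c * (2 * 2 powr (2 * \<alpha>) / (1 - 2 * \<alpha>))"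

lemma green_const_nonneg: "0 \<le> green_const"
  unfolding green_const_def using alpha c_nonneg by simp

text \<open>The smoothing hypothesis bounds the sum over all i at once, so the estimate does not
  depend on N; it concerns time lags up to 1, hence b - a <= 1. After Tonelli the weight (b -
  r)^(-2\<alpha>) meets (r - s)^(-2\<alpha>), and the integral over r is at most a multiple of (b -
  s)^(1 - 4\<alpha>).\<close>

lemma green_C_bound:
  assumes ab: "0 \<le> a" "a < b" "b \<le> T" "b - a \<le> 1"
    and Y: "Y \<in> borel_measurable (slab M a b)"
    and CY: "\<And>i. (\<lambda>z. C i (fst z) (snd z) (Y z)) \<in> borel_measurable (slab M a b)"
  shows "green a b N (\<lambda>i z. C i (fst z) (snd z) (Y z))
    \<le> ennreal green_const * (\<integral>\<^sup>+z. ennreal ((b - fst z) powr (1 - 4 * \<alpha>) * (norm (Y z))\<^sup>2) \<partial>slab M a b)"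
proof -
  interpret FS: finite_measure "slab M a b" by (rule finite_measure_slab) unfold_locales
  interpret L: finite_measure "restrict_space lborel {a..b}" by (rule finite_measure_Icc)
  interpret LS: pair_sigma_finite "restrict_space lborel {a..b}" "slab M a b" ..
  let ?L = "restrict_space lborel {a..b}"
  let ?H = "\<lambda>r z. ennreal ((b - r) powr (- 2 * \<alpha>)) * ((if fst z < r then 1 else 0) * ennreal (c * (r - fst z) powr (- 2 * \<alpha>) * (norm (Y z))\<^sup>2))"
  have fst_m[measurable]: "(\<lambda>z. fst z) \<in> borel_measurable (slab M a b)"
    by (rule measurable_compose[OF measurable_fst measurable_restrict_space1]) simp
  have r[measurable]: "(\<lambda>p. fst p) \<in> borel_measurable (?L \<Otimes>\<^sub>M slab M a b)"
    by (rule measurable_compose[OF measurable_fst measurable_restrict_space1]) simp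
  have s[measurable]: "(\<lambda>p. fst (snd p)) \<in> borel_measurable (?L \<Otimes>\<^sub>M slab M a b)"
    by (rule measurable_compose[OF measurable_snd fst_m])
  have Ym[measurable]: "(\<lambda>p. Y (snd p)) \<in> borel_measurable (?L \<Otimes>\<^sub>M slab M a b)"
    by (rule measurable_compose[OF measurable_snd Y])
  have Hm: "(\<lambda>p. ?H (fst p) (snd p)) \<in> borel_measurable (?L \<Otimes>\<^sub>M slab M a b)" by measurable
  have "green a b N (\<lambda>i z. C i (fst z) (snd z) (Y z)) \<le> (\<integral>\<^sup>+r. (\<integral>\<^sup>+z. ?H r z \<partial>slab M a b) \<partial>?L)"
    unfolding green_def
  proof (rule nn_integral_mono)
    fix r assume "r \<in> space ?L"
    then have r: "r \<in> {a..b}" by (simp add: space_restrict_space)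
    let ?G = "\<lambda>i z. indicator {..<r} (fst z) * ennreal ((norm (S (max 0 (r - fst z)) (C i (fst z) (snd z) (Y z))))\<^sup>2)"
    have I: "(\<lambda>z. indicator {..<r} (fst z) :: ennreal) \<in> borel_measurable (slab M a b)"
      by (rule measurable_compose[OF measurable_fst measurable_restrict_space1]) simp
    have Gm: "?G i \<in> borel_measurable (slab M a b)" for i
    proof -
      have [measurable]: "(\<lambda>z. S (max 0 (r - fst z)) (C i (fst z) (snd z) (Y z))) \<in> borel_measurable (slab M a b)"
        by (intro borel_measurable_semigroup CY) measurable
      show ?thesis by (intro borel_measurable_times_ennreal I) measurable
    qed
    have "(\<Sum>i<N. \<integral>\<^sup>+z. ?G i z \<partial>slab M a b) = (\<integral>\<^sup>+z. (\<Sum>i<N. ?G i z) \<partial>slab M a b)"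
      by (rule nn_integral_sum[symmetric]) (rule Gm)
    also have "\<dots> \<le> (\<integral>\<^sup>+z. (if fst z < r then 1 else 0) * ennreal (c * (r - fst z) powr (- 2 * \<alpha>) * (norm (Y z))\<^sup>2) \<partial>slab M a b)"
    proof (rule nn_integral_mono)
      fix z assume z: "z \<in> space (slab M a b)"
      show "(\<Sum>i<N. ?G i z) \<le> (if fst z < r then 1 else 0) * ennreal (c * (r - fst z) powr (- 2 * \<alpha>) * (norm (Y z))\<^sup>2)"
      proof (cases "fst z < r")
        case True
        have t: "fst z \<in> {0..T}" "snd z \<in> space M" "r - fst z \<in> {0<..1}"
          using z r ab True by (auto simp: space_pair_measure space_restrict_space)
        have "(\<Sum>i<N. ?G i z) = (\<Sum>i<N. ennreal ((norm (S (r - fst z) (C i (fst z) (snd z) (Y z))))\<^sup>2))"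
          using True by simp
        also have "\<dots> \<le> (\<Sum>i. ennreal ((norm (S (r - fst z) (C i (fst z) (snd z) (Y z))))\<^sup>2))"
          by (rule sum_le_suminf) auto
        also have "\<dots> \<le> ennreal (c * (r - fst z) powr (- 2 * \<alpha>) * (norm (Y z))\<^sup>2)" by (rule C_HS[OF t])
        finally show ?thesis using True by simp
      qed simp
    qed
    finally have le: "(\<Sum>i<N. \<integral>\<^sup>+z. ?G i z \<partial>slab M a b)
      \<le> (\<integral>\<^sup>+z. (if fst z < r then 1 else 0) * ennreal (c * (r - fst z) powr (- 2 * \<alpha>) * (norm (Y z))\<^sup>2) \<partial>slab M a b)" .
    show "ennreal ((b - r) powr (- 2 * \<alpha>)) * (\<Sum>i<N. \<integral>\<^sup>+z. ?G i z \<partial>slab M a b) \<le> (\<integral>\<^sup>+z. ?H r z \<partial>slab M a b)"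
      by (subst nn_integral_cmult) (use Y in measurable, intro mult_left_mono le, simp)
  qed
  also have "\<dots> = (\<integral>\<^sup>+z. (\<integral>\<^sup>+r. ?H r z \<partial>?L) \<partial>slab M a b)"
    using Hm by (intro LS.Fubini'[symmetric]) (simp add: case_prod_unfold)
  also have "\<dots> \<le> (\<integral>\<^sup>+z. ennreal green_const * ennreal ((b - fst z) powr (1 - 4 * \<alpha>) * (norm (Y z))\<^sup>2) \<partial>slab M a b)"
  proof (rule nn_integral_mono)
    fix z assume "z \<in> space (slab M a b)"
    then have sb: "fst z \<le> b" by (auto simp: space_pair_measure space_restrict_space)
    let ?s = "fst z" and ?y = "c * (norm (Y z))\<^sup>2"
    let ?k = "\<lambda>r. ennreal ((b - r) powr (- (2 * \<alpha>)) * (r - ?s) powr (- (2 * \<alpha>))) * indicator {?s<..b} r"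
    have y0: "0 \<le> ?y" using c_nonneg by simp
    have "(\<integral>\<^sup>+r. ?H r z \<partial>?L) = (\<integral>\<^sup>+r. ?H r z * indicator {a..b} r \<partial>lborel)"
      by (rule nn_integral_restrict_space) simp
    also have "\<dots> \<le> (\<integral>\<^sup>+r. ennreal ?y * ?k r \<partial>lborel)"
    proof (rule nn_integral_mono)
      fix r
      have "ennreal ((b - r) powr (- 2 * \<alpha>)) * ennreal (c * (r - ?s) powr (- 2 * \<alpha>) * (norm (Y z))\<^sup>2)
          = ennreal ?y * ennreal ((b - r) powr (- (2 * \<alpha>)) * (r - ?s) powr (- (2 * \<alpha>)))"
        using c_nonneg by (simp add: mult_ac flip: ennreal_mult)
      then show "?H r z * indicator {a..b} r \<le> ennreal ?y * ?k r"
        by (cases "?s < r \<and> r \<le> b") (auto simp: indicator_def)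
    qed
    also have "\<dots> = ennreal ?y * (\<integral>\<^sup>+r. ?k r \<partial>lborel)"
      by (rule nn_integral_cmult) measurable
    also have "\<dots> \<le> ennreal ?y * ennreal (2 * 2 powr (2 * \<alpha>) / (1 - 2 * \<alpha>) * (b - ?s) powr (1 - 2 * (2 * \<alpha>)))"
    proof (cases "?s < b")
      case True
      then show ?thesis using alpha by (intro mult_left_mono powr_convolution_bound) auto
    next
      case False
      then have "{?s<..b} = {}" by auto
      then show ?thesis by simp
    qed
    also have "\<dots> = ennreal green_const * ennreal ((b - ?s) powr (1 - 4 * \<alpha>) * (norm (Y z))\<^sup>2)"
      using y0 green_const_nonneg alpha c_nonneg
      by (subst (1 2) ennreal_mult[symmetric]) (auto simp: green_const_def mult_ac)
    finally show "(\<integral>\<^sup>+r. ?H r z \<partial>?L) \<le> ennreal green_const * ennreal ((b - ?s) powr (1 - 4 * \<alpha>) * (norm (Y z))\<^sup>2)" .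
  qed
  also have "\<dots> = ennreal green_const * (\<integral>\<^sup>+z. ennreal ((b - fst z) powr (1 - 4 * \<alpha>) * (norm (Y z))\<^sup>2) \<partial>slab M a b)"
    by (intro nn_integral_cmult measurable_compose[OF _ measurable_ennreal] borel_measurable_times powr_real_measurable
        borel_measurable_power borel_measurable_const borel_measurable_diff fst_m measurable_compose[OF Y borel_measurable_norm])
  finally show ?thesis .
qed

definition weighted_on :: "real \<Rightarrow> real \<Rightarrow> (real \<times> 'w \<Rightarrow> 'h) \<Rightarrow> ennreal" where
  "weighted_on a b g = (\<integral>\<^sup>+z. ennreal ((b - fst z) powr (2 * \<alpha>) * (norm (g z))\<^sup>2) \<partial>slab M a b)"

text \<open>The test process is the weighted drift itself, cut off so that it is bounded; the
  resulting estimate \<open>A\<^sup>2 \<le> \<mu> A / 2\<close> does not depend on the cut-off level.\<close>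

lemma drift_halving:
  assumes ab: "0 \<le> a" "a < b" "b \<le> T" "b - a \<le> 1" and small: "4 * green_const * (b - a) powr (1 - 2 * \<alpha>) \<le> 1"
    and zero: "\<And>n. AE z in slab M b T. drift x n z = 0"
    and \<mu>: "\<And>n. weighted_on a b (drift x n) \<le> ennreal \<mu>" "0 \<le> \<mu>"
  shows "weighted_on a b (drift x N) \<le> ennreal (\<mu> / 2)"
proof -
  let ?g = "drift x N"
  define g where "g n z = (if norm (?g z) \<le> real n then ?g z else 0)" for n z
  \<comment> \<open>The exponent is chosen so that the pairing of Y with the drift is the weighted
    energy of the truncated drift. Clipping at 0 makes Y vanish after b, so it is bounded and
    progressive on all of \<open>{0..T}\<close>.\<close>
  define Y where "Y n z = (max 0 (b - fst z)) powr (2 * \<alpha>) *\<^sub>R g n z" for n z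
  let ?\<Gamma> = "\<lambda>n i z. C i (fst z) (snd z) (Y n z)"
  have gprog: "progressive M F T (\<lambda>s \<omega>. g n (s, \<omega>))" for n
    unfolding progressive_pair
  proof
    fix t assume "t \<in> {0..T}"
    then have [measurable]: "?g \<in> borel_measurable (slab (F t) 0 t)" using drift_progressive unfolding progressive_pair by blast
    show "g n \<in> borel_measurable (slab (F t) 0 t)" unfolding g_def[abs_def] by measurable
  qed
  have Yprog: "progressive M F T (\<lambda>s \<omega>. Y n (s, \<omega>))" for n
    unfolding progressive_pair
  proof
    fix t assume "t \<in> {0..T}"
    then have "g n \<in> borel_measurable (slab (F t) 0 t)" using gprog unfolding progressive_pair by blast
    moreover have "(\<lambda>z. (max 0 (b - fst z)) powr (2 * \<alpha>)) \<in> borel_measurable (slab (F t) 0 t)"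
      by (rule measurable_compose[OF measurable_fst measurable_restrict_space1]) simp
    ultimately show "Y n \<in> borel_measurable (slab (F t) 0 t)" unfolding Y_def[abs_def] by (intro borel_measurable_scaleR)
  qed
  have \<Gamma>prog: "progressive M F T (\<lambda>s \<omega>. ?\<Gamma> n i (s, \<omega>))" for n i
    by (rule apply_C_progressive[OF Yprog])
  have meas: "h \<in> borel_measurable (slab M a b)" if "progressive M F T (\<lambda>s \<omega>. h (s, \<omega>))" for h :: "real \<times> 'w \<Rightarrow> 'h"
    using progressive_measurable[OF that ab(1,3)] T_pos by simp
  have gm[measurable]: "g n \<in> borel_measurable (slab M a b)" for n by (rule meas[OF gprog])
  have Ym[measurable]: "Y n \<in> borel_measurable (slab M a b)" for n by (rule meas[OF Yprog])
  have \<Gamma>m: "?\<Gamma> n i \<in> borel_measurable (slab M a b)" for n i by (rule meas[OF \<Gamma>prog])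
  have \<Gamma>B: "norm (?\<Gamma> n i (s, \<omega>)) \<le> c * (T powr (2 * \<alpha>) * real n)" if "s \<in> {0..T}" "\<omega> \<in> space M" for n i s \<omega>
  proof -
    have "norm (g n (s, \<omega>)) \<le> real n" by (simp add: g_def)
    moreover have "(max 0 (b - s)) powr (2 * \<alpha>) \<le> T powr (2 * \<alpha>)"
      using that ab T_pos alpha by (intro powr_mono2) auto
    ultimately have "norm (Y n (s, \<omega>)) \<le> T powr (2 * \<alpha>) * real n"
      unfolding Y_def by (simp add: mult_mono)
    then have "c * norm (Y n (s, \<omega>)) \<le> c * (T powr (2 * \<alpha>) * real n)" by (rule mult_left_mono[OF _ c_nonneg])
    then show ?thesis using C_le[OF that, of i "Y n (s, \<omega>)"] by simp
  qed
  interpret FS: finite_measure "slab M a b" by (rule finite_measure_slab) unfold_locales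
  have fst_m[measurable]: "(\<lambda>z. b - fst z) \<in> borel_measurable (slab M a b)"
    by (rule measurable_compose[OF measurable_fst measurable_restrict_space1]) simp
  \<comment> \<open>A real number: its finiteness, inherited from \<mu>, permits the final division
    by \<open>A n\<close>.\<close>
  define A where "A n = (\<integral>z. (b - fst z) powr (2 * \<alpha>) * (norm (g n z))\<^sup>2 \<partial>slab M a b)" for n
  have g_le: "norm (g n z) \<le> norm (?g z)" for n z by (simp add: g_def)
  have int: "integrable (slab M a b) (\<lambda>z. (b - fst z) powr (2 * \<alpha>) * (norm (g n z))\<^sup>2)" for n
  proof (rule integrableI_nonneg)
    have "(\<integral>\<^sup>+z. ennreal ((b - fst z) powr (2 * \<alpha>) * (norm (g n z))\<^sup>2) \<partial>slab M a b) \<le> weighted_on a b ?g"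
      unfolding weighted_on_def by (intro nn_integral_mono ennreal_leI mult_left_mono power_mono g_le) auto
    also have "\<dots> < \<infinity>" using \<mu>(1)[of N] by (rule le_less_trans) simp
    finally show "(\<integral>\<^sup>+z. ennreal ((b - fst z) powr (2 * \<alpha>) * (norm (g n z))\<^sup>2) \<partial>slab M a b) < \<infinity>" .
  qed (intro borel_measurable_times powr_real_measurable borel_measurable_power borel_measurable_const fst_m measurable_compose[OF gm borel_measurable_norm],
      intro AE_I2 mult_nonneg_nonneg powr_ge_zero zero_le_power2)
  have A: "(\<integral>\<^sup>+z. ennreal ((b - fst z) powr (2 * \<alpha>) * (norm (g n z))\<^sup>2) \<partial>slab M a b) = ennreal (A n)" for n
    unfolding A_def by (rule nn_integral_eq_integral[OF int]) simp
  have A0: "0 \<le> A n" for n unfolding A_def by (intro Bochner_Integration.integral_nonneg) simp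
  have Ale: "A n \<le> \<mu> / 2" for n
  proof -
    have \<Gamma>2: "L2 (slab M a b) (?\<Gamma> n i)" for i
      by (rule FS.L2_bounded[OF \<Gamma>m, where B="c * (T powr (2 * \<alpha>) * real n)"]) (use \<Gamma>B ab in \<open>auto simp: space_pair_measure space_restrict_space\<close>)
    have "(\<Sum>i<N. \<integral>z. inner (x i z) (?\<Gamma> n i z) \<partial>slab M a b) = (\<integral>z. (\<Sum>i<N. inner (x i z) (?\<Gamma> n i z)) \<partial>slab M a b)"
      by (rule Bochner_Integration.integral_sum[symmetric]) (rule L2_inner_integrable[OF family_L2[OF ab(1,3)] \<Gamma>2])
    also have "\<dots> = A n" unfolding A_def
    proof (rule Bochner_Integration.integral_cong[OF refl])
      fix z assume "z \<in> space (slab M a b)"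
      then have z: "fst z \<in> {0..T}" "snd z \<in> space M" "fst z \<le> b" using ab by (auto simp: space_pair_measure space_restrict_space)
      \<comment> \<open>Moving each C_i to the other side as its adjoint reassembles the partial
        drift g_N.\<close>
      have "(\<Sum>i<N. inner (x i z) (?\<Gamma> n i z)) = inner (?g z) (Y n z)"
        unfolding drift_def inner_sum_left by (intro sum.cong refl) (simp add: hadj_inner[OF basis C_linear[OF z(1,2)]])
      also have "\<dots> = (b - fst z) powr (2 * \<alpha>) * (norm (g n z))\<^sup>2"
        using z(3) by (simp add: Y_def g_def power2_norm_eq_inner)
      finally show "(\<Sum>i<N. inner (x i z) (?\<Gamma> n i z)) = (b - fst z) powr (2 * \<alpha>) * (norm (g n z))\<^sup>2" .
    qed
    finally have eq: "(\<Sum>i<N. \<integral>z. inner (x i z) (?\<Gamma> n i z) \<partial>slab M a b) = A n" .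
    let ?\<theta> = "green_const * (b - a) powr (1 - 2 * \<alpha>)"
    have "green a b N (?\<Gamma> n) \<le> ennreal green_const * (\<integral>\<^sup>+z. ennreal ((b - fst z) powr (1 - 4 * \<alpha>) * (norm (Y n z))\<^sup>2) \<partial>slab M a b)"
      by (rule green_C_bound[OF ab Ym \<Gamma>m])
    also have "\<dots> \<le> ennreal green_const * (\<integral>\<^sup>+z. ennreal ((b - a) powr (1 - 2 * \<alpha>)) * ennreal ((b - fst z) powr (2 * \<alpha>) * (norm (g n z))\<^sup>2) \<partial>slab M a b)"
    proof (intro mult_left_mono nn_integral_mono)
      fix z assume "z \<in> space (slab M a b)"
      then have z: "a \<le> fst z" "fst z \<le> b" by (auto simp: space_pair_measure space_restrict_space)
      \<comment> \<open>|Y|^2 carries (b - s)^(4\<alpha>), which absorbs the possibly negative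
        exponent; splitting the total exponent 1 as (1 - 2\<alpha>) + 2\<alpha> isolates the small
        factor.\<close>
      have "(b - fst z) powr (1 - 4 * \<alpha>) * (norm (Y n z))\<^sup>2
          = ((b - fst z) powr (1 - 2 * \<alpha>)) * ((b - fst z) powr (2 * \<alpha>) * (norm (g n z))\<^sup>2)"
      proof -
        have "(norm (Y n z))\<^sup>2 = (b - fst z) powr (4 * \<alpha>) * (norm (g n z))\<^sup>2"
          using z by (simp add: Y_def power_mult_distrib) (simp add: power2_eq_square flip: powr_add)
        then show ?thesis by (simp add: mult.assoc[symmetric] flip: powr_add)
      qed
      also have "\<dots> \<le> (b - a) powr (1 - 2 * \<alpha>) * ((b - fst z) powr (2 * \<alpha>) * (norm (g n z))\<^sup>2)"
        using z alpha by (intro mult_right_mono powr_mono2) auto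
      finally show "ennreal ((b - fst z) powr (1 - 4 * \<alpha>) * (norm (Y n z))\<^sup>2)
          \<le> ennreal ((b - a) powr (1 - 2 * \<alpha>)) * ennreal ((b - fst z) powr (2 * \<alpha>) * (norm (g n z))\<^sup>2)"
        by (subst ennreal_mult[symmetric]) (auto intro: ennreal_leI)
    qed simp
    also have "\<dots> = ennreal green_const * (ennreal ((b - a) powr (1 - 2 * \<alpha>)) * ennreal (A n))"
      unfolding A[symmetric] by (subst nn_integral_cmult) measurable
    also have "\<dots> = ennreal (?\<theta> * A n)"
      using green_const_nonneg A0 by (simp add: ennreal_mult mult.assoc)
    finally have gr: "green a b N (?\<Gamma> n) \<le> ennreal (?\<theta> * A n)" .
    have "(A n)\<^sup>2 \<le> \<mu> * (2 * (?\<theta> * A n))"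
      unfolding eq[symmetric]
      by (rule pairing_bound[OF ab(1-3) zero \<Gamma>prog \<Gamma>B \<mu>(1)[unfolded weighted_on_def] gr[folded eq] \<mu>(2)])
        (use green_const_nonneg A0[of n, folded eq] in simp_all)
    \<comment> \<open>The smallness condition says 4 \<theta> <= 1: one factor 2 pays for
      \<open>pairing_bound\<close>, the other yields the halving.\<close>
    also have "\<dots> \<le> \<mu> * (A n / 2)"
      using mult_right_mono[OF small A0[of n]] \<mu>(2) by (intro mult_left_mono) auto
    finally have "A n * A n \<le> \<mu> / 2 * A n" by (simp add: power2_eq_square)
    then show ?thesis using A0[of n] \<mu>(2) by (cases "A n = 0") (auto simp: mult_le_cancel_right)
  qed
  \<comment> \<open>Monotone convergence removes the cut-off.\<close>
  have "weighted_on a b ?g = (\<integral>\<^sup>+z. (SUP n. ennreal ((b - fst z) powr (2 * \<alpha>) * (norm (g n z))\<^sup>2)) \<partial>slab M a b)"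
    unfolding weighted_on_def
  proof (rule nn_integral_cong)
    fix z
    obtain k where k: "norm (?g z) \<le> real k" using real_arch_simple by blast
    show "ennreal ((b - fst z) powr (2 * \<alpha>) * (norm (?g z))\<^sup>2) = (SUP n. ennreal ((b - fst z) powr (2 * \<alpha>) * (norm (g n z))\<^sup>2))"
    proof (rule antisym)
      show "ennreal ((b - fst z) powr (2 * \<alpha>) * (norm (?g z))\<^sup>2) \<le> (SUP n. ennreal ((b - fst z) powr (2 * \<alpha>) * (norm (g n z))\<^sup>2))"
        by (rule SUP_upper2[of k]) (use k in \<open>simp_all add: g_def\<close>)
      show "(SUP n. ennreal ((b - fst z) powr (2 * \<alpha>) * (norm (g n z))\<^sup>2)) \<le> ennreal ((b - fst z) powr (2 * \<alpha>) * (norm (?g z))\<^sup>2)"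
        by (intro SUP_least ennreal_leI mult_left_mono power_mono g_le) auto
    qed
  qed
  also have "\<dots> = (SUP n. \<integral>\<^sup>+z. ennreal ((b - fst z) powr (2 * \<alpha>) * (norm (g n z))\<^sup>2) \<partial>slab M a b)"
  proof (rule nn_integral_monotone_convergence_SUP)
    show "incseq (\<lambda>n z. ennreal ((b - fst z) powr (2 * \<alpha>) * (norm (g n z))\<^sup>2))"
    proof (intro incseq_SucI le_funI ennreal_leI mult_left_mono power_mono)
      show "norm (g n z) \<le> norm (g (Suc n) z)" for n z by (simp add: g_def)
    qed auto
  qed measurable
  also have "\<dots> \<le> ennreal (\<mu> / 2)" unfolding A by (intro SUP_least ennreal_leI Ale)
  finally show ?thesis .
qed

end

section \<open>Uniqueness\<close>


context dual_family begin

text \<open>The local weight vanishes at b instead of T and is the smaller one, so condition (3)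
  supplies the initial bound on every interval.\<close>

lemma weighted_on_le:
  assumes ab: "0 \<le> a" "b \<le> T" and g: "g \<in> borel_measurable (slab M 0 T)"
  shows "weighted_on a b g \<le> weighted g"
proof -
  have sub: "{a..b} \<subseteq> {0..T}" using ab by auto
  have fst_m: "(\<lambda>z. b - fst z) \<in> borel_measurable (slab M 0 T)"
    by (rule measurable_compose[OF measurable_fst measurable_restrict_space1]) simp
  have "weighted_on a b g = (\<integral>\<^sup>+z. ennreal ((b - fst z) powr (2 * \<alpha>) * (norm (g z))\<^sup>2) * indicator {a..b} (fst z) \<partial>slab M 0 T)"
    unfolding weighted_on_def
    by (rule nn_integral_slab_restrict[OF prob_space_axioms sub], intro measurable_compose[OF _ measurable_ennreal] borel_measurable_times
        powr_real_measurable borel_measurable_power borel_measurable_const fst_m measurable_compose[OF g borel_measurable_norm])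
  also have "\<dots> \<le> weighted g"
    unfolding weighted_def
  proof (rule nn_integral_mono)
    fix z
    show "ennreal ((b - fst z) powr (2 * \<alpha>) * (norm (g z))\<^sup>2) * indicator {a..b} (fst z) \<le> ennreal ((T - fst z) powr (2 * \<alpha>) * (norm (g z))\<^sup>2)"
    proof (cases "fst z \<in> {a..b}")
      case True
      then have "(b - fst z) powr (2 * \<alpha>) \<le> (T - fst z) powr (2 * \<alpha>)" using ab alpha by (intro powr_mono2) auto
      then show ?thesis using True by (simp add: ennreal_leI mult_right_mono)
    qed simp
  qed
  finally show ?thesis .
qed

text \<open>\<open>drift_halving\<close> turns a bound valid for all n into half of it, again valid
  for all n, so it can be iterated from the bound of condition (3). The weight is positive before b;
  a vanishing weighted norm therefore kills the drift.\<close>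

lemma drift_zero_interval:
  assumes ab: "0 \<le> a" "a < b" "b \<le> T" "b - a \<le> 1" and small: "4 * green_const * (b - a) powr (1 - 2 * \<alpha>) \<le> 1"
    and zero: "\<And>n. AE z in slab M b T. drift x n z = 0"
  shows "AE z in slab M a b. drift x n z = 0"
proof -
  obtain B where B: "B < \<infinity>" "\<And>n. weighted (drift x n) \<le> B" using weighted_bounded by blast
  then obtain \<mu> where \<mu>: "B = ennreal \<mu>" "0 \<le> \<mu>" by (cases B) auto
  have start: "weighted_on a b (drift x n) \<le> ennreal \<mu>" for n
    using order_trans[OF weighted_on_le[OF ab(1,3) L2_measurable[OF drift_L2[OF order_refl order_refl]]] B(2)] unfolding \<mu>(1) .
  have "weighted_on a b (drift x n) \<le> ennreal (\<mu> / 2 ^ k)" for n k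
  proof (induction k arbitrary: n)
    case 0
    then show ?case using start by simp
  next
    case (Suc k)
    have "0 \<le> \<mu> / 2 ^ k" using \<mu>(2) by simp
    from drift_halving[OF ab small zero Suc.IH this] show ?case by (simp add: mult.commute)
  qed
  moreover have "(\<lambda>k. ennreal (\<mu> / 2 ^ k)) \<longlonglongrightarrow> ennreal 0"
    by (intro tendsto_ennrealI LIMSEQ_divide_realpow_zero) simp
  ultimately have "weighted_on a b (drift x n) \<le> ennreal 0"
    by (intro LIMSEQ_le_const[of _ "ennreal 0"]) auto
  then have 0: "(\<integral>\<^sup>+z. ennreal ((b - fst z) powr (2 * \<alpha>) * (norm (drift x n z))\<^sup>2) \<partial>slab M a b) = 0"
    by (simp add: weighted_on_def)
  have fst_m: "(\<lambda>z. b - fst z) \<in> borel_measurable (slab M a b)"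
    by (rule measurable_compose[OF measurable_fst measurable_restrict_space1]) simp
  have "(\<lambda>z. ennreal ((b - fst z) powr (2 * \<alpha>) * (norm (drift x n z))\<^sup>2)) \<in> borel_measurable (slab M a b)"
    by (intro measurable_compose[OF _ measurable_ennreal] borel_measurable_times powr_real_measurable borel_measurable_power
        borel_measurable_const fst_m measurable_compose[OF L2_measurable[OF drift_L2[OF ab(1,3)]] borel_measurable_norm])
  with 0 have "AE z in slab M a b. ennreal ((b - fst z) powr (2 * \<alpha>) * (norm (drift x n z))\<^sup>2) = 0"
    by (subst (asm) nn_integral_0_iff_AE) auto
  then show ?thesis
    using AE_slab_fst_neq[OF prob_space_axioms, of b a b] AE_space
  proof eventually_elim
    case (elim z)
    then have "0 < (b - fst z) powr (2 * \<alpha>)" by (auto simp: space_pair_measure space_restrict_space)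
    moreover have "(b - fst z) powr (2 * \<alpha>) * (norm (drift x n z))\<^sup>2 \<le> 0" using elim(1) by (simp only: ennreal_eq_0_iff)
    ultimately have "(norm (drift x n z))\<^sup>2 \<le> 0" by (simp add: mult_le_0_iff)
    then show ?case by simp
  qed
qed

lemma AE_slab_point: "AE z in slab M t t. Q z"
  using AE_slab_fst_neq[OF prob_space_axioms, of t t t] AE_space
  by eventually_elim (auto simp: space_pair_measure space_restrict_space)

lemma drift_zero: "AE z in slab M 0 T. drift x n z = 0"
proof -
  \<comment> \<open>The length l satisfies l^(1 - 2\<alpha>) <= q with 4 q
    \<open>green_const\<close> <= 1. The summand 1 keeps q meaningful for \<open>green_const\<close>
    = 0, and l <= 1 respects the range of the smoothing hypothesis.\<close>
  define q where "q = 1 / (4 * green_const + 1)"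
  define l where "l = min 1 (q powr (1 / (1 - 2 * \<alpha>)))"
  have q: "0 < q" "4 * green_const * q \<le> 1" using green_const_nonneg by (simp_all add: q_def)
  have l: "0 < l" "l \<le> 1" using q by (simp_all add: l_def)
  have lq: "l powr (1 - 2 * \<alpha>) \<le> q"
  proof -
    have "l powr (1 - 2 * \<alpha>) \<le> (q powr (1 / (1 - 2 * \<alpha>))) powr (1 - 2 * \<alpha>)"
      using l alpha by (intro powr_mono2) (auto simp: l_def)
    also have "\<dots> = q" using q alpha by (simp add: powr_powr)
    finally show ?thesis .
  qed
  \<comment> \<open>Backward induction from T. The base is the degenerate interval at T, a null
    slab; clipping at 0 allows a shorter last step.\<close>
  have "\<forall>n. AE z in slab M (max 0 (T - real j * l)) T. drift x n z = 0" for j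
  proof (induction j)
    case 0
    have "max 0 (T - real 0 * l) = T" using T_pos by simp
    then show ?case using AE_slab_point by (simp only:) blast
  next
    case (Suc j)
    define b where "b = max 0 (T - real j * l)"
    define a where "a = max 0 (T - real (Suc j) * l)"
    have IH: "AE z in slab M b T. drift x n z = 0" for n using Suc.IH unfolding b_def by (rule spec)
    have bT: "b \<le> T" using T_pos l by (simp add: b_def)
    show ?case unfolding a_def[symmetric]
    proof (cases "a < b")
      case False
      then have "a = b" using l by (auto simp: a_def b_def algebra_simps)
      show "\<forall>n. AE z in slab M a T. drift x n z = 0" unfolding \<open>a = b\<close> by (rule allI) (rule IH)
    next
      case True
      have a0: "0 \<le> a" by (simp add: a_def)
      have ba: "b - a \<le> l" unfolding a_def b_def using l by (simp add: algebra_simps max_def)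
      have "(b - a) powr (1 - 2 * \<alpha>) \<le> q"
        using ba True alpha by (intro order_trans[OF powr_mono2 lq]) auto
      then have small: "4 * green_const * (b - a) powr (1 - 2 * \<alpha>) \<le> 1"
        using green_const_nonneg by (intro order_trans[OF mult_left_mono q(2)]) auto
      have left: "AE z in slab M a b. drift x n z = 0" for n
        by (rule drift_zero_interval[OF a0 True bT _ small IH]) (use ba l in auto)
      show "\<forall>n. AE z in slab M a T. drift x n z = 0"
      proof
        fix n
        have m: "drift x n \<in> borel_measurable (slab M a T)" by (rule L2_measurable[OF drift_L2[OF a0]]) simp
        have "AE z in slab M a T. fst z \<in> {a..b} \<longrightarrow> drift x n z = 0"
          by (rule AE_slab_extend[OF prob_space_axioms m _ left]) (use bT in auto)
        moreover have "AE z in slab M a T. fst z \<in> {b..T} \<longrightarrow> drift x n z = 0"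
          by (rule AE_slab_extend[OF prob_space_axioms m _ IH]) (use True in auto)
        ultimately show "AE z in slab M a T. drift x n z = 0"
          using AE_space by eventually_elim (auto simp: space_pair_measure space_restrict_space)
      qed
    qed
  qed
  moreover obtain j where "T < real j * l" using reals_Archimedean3[OF l(1)] by blast
  then have "max 0 (T - real j * l) = 0" by linarith
  ultimately show ?thesis by (metis (no_types))
qed

text \<open>With vanishing drifts \<open>pairing_bound\<close> applies with \<mu> = 0 on all of
  \<open>{0..T}\<close>, whatever its length. The test family is concentrated in index j, where it
  is the truncation of \<open>x j\<close>; N = \<open>Suc j\<close> is the smallest number of
  indices that includes it.\<close>

lemma family_zero: "AE z in slab M 0 T. x j z = 0"
proof (rule AE_zero_of_truncated_orthogonal[OF L2_measurable[OF x_L2] finite_measure_slab[OF prob_space_axioms]])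
  fix n
  define \<Gamma> where "\<Gamma> i z = (if i = j \<and> norm (x j z) \<le> real n then x j z else 0)" for i z
  have prog: "progressive M F T (\<lambda>s \<omega>. \<Gamma> i (s, \<omega>))" for i
    unfolding progressive_pair
  proof
    fix t assume "t \<in> {0..T}"
    then have [measurable]: "x j \<in> borel_measurable (slab (F t) 0 t)" using x_prog unfolding progressive_pair by blast
    show "\<Gamma> i \<in> borel_measurable (slab (F t) 0 t)" unfolding \<Gamma>_def[abs_def] by measurable
  qed
  have bound: "norm (\<Gamma> i z) \<le> real n" for i z by (simp add: \<Gamma>_def)
  obtain \<rho> where \<rho>: "0 \<le> \<rho>" "green 0 T (Suc j) \<Gamma> \<le> ennreal \<rho>"
    using green_finite[OF _ T_pos, of "Suc j" \<Gamma> "real n"] bound by auto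
  have "(\<Sum>i<Suc j. \<integral>z. inner (x i z) (\<Gamma> i z) \<partial>slab M 0 T)\<^sup>2 \<le> 0 * (2 * \<rho>)"
  proof (rule pairing_bound[OF order_refl T_pos order_refl AE_slab_point prog bound _ \<rho>(2) order_refl \<rho>(1)])
    fix m
    have "(\<integral>\<^sup>+z. ennreal ((T - fst z) powr (2 * \<alpha>) * (norm (drift x m z))\<^sup>2) \<partial>slab M 0 T) = (\<integral>\<^sup>+z. 0 \<partial>slab M 0 T)"
      using drift_zero[of m] by (intro nn_integral_cong_AE) (auto elim: eventually_mono)
    then show "(\<integral>\<^sup>+z. ennreal ((T - fst z) powr (2 * \<alpha>) * (norm (drift x m z))\<^sup>2) \<partial>slab M 0 T) \<le> ennreal 0" by simp
  qed
  then have "(\<Sum>i<Suc j. \<integral>z. inner (x i z) (\<Gamma> i z) \<partial>slab M 0 T) = 0" by simp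
  moreover have "(\<integral>z. inner (x i z) (\<Gamma> i z) \<partial>slab M 0 T) = 0" if "i < j" for i using that by (simp add: \<Gamma>_def)
  ultimately have "(\<integral>z. inner (x j z) (\<Gamma> j z) \<partial>slab M 0 T) = 0" by simp
  then show "(\<integral>z. inner (x j z) (if norm (x j z) \<le> real n then x j z else 0) \<partial>slab M 0 T) = 0" by (simp add: \<Gamma>_def)
qed

end

lemma progressive_diff:
  fixes X Y :: "real \<Rightarrow> 'w \<Rightarrow> 'b::{real_normed_vector,second_countable_topology}"
  assumes X: "progressive M G T X" and Y: "progressive M G T Y"
  shows "progressive M G T (\<lambda>s \<omega>. X s \<omega> - Y s \<omega>)"
  unfolding progressive_def
proof
  fix t assume t: "t \<in> {0..T}"
  show "(\<lambda>z. X (fst z) (snd z) - Y (fst z) (snd z)) \<in> borel_measurable (restrict_space lborel {0..t} \<Otimes>\<^sub>M G t)"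
    by (rule borel_measurable_diff[OF X[unfolded progressive_def, THEN bspec, OF t] Y[unfolded progressive_def, THEN bspec, OF t]])
qed

theorem theorem4p17:
  fixes M :: "'w measure"
    and \<beta> :: "nat \<Rightarrow> real \<Rightarrow> 'w \<Rightarrow> real"
    and e :: "nat \<Rightarrow> 'h::{real_inner,complete_space,second_countable_topology}"
    and S :: "real \<Rightarrow> 'h \<Rightarrow> 'h"
    and C :: "nat \<Rightarrow> real \<Rightarrow> 'w \<Rightarrow> 'h \<Rightarrow> 'h"
    and T \<alpha> c :: real
    and \<eta> :: "'w \<Rightarrow> 'h"
    and f P P' :: "real \<Rightarrow> 'w \<Rightarrow> 'h"
    and Q Q' :: "real \<Rightarrow> 'w \<Rightarrow> 'h \<Rightarrow> 'h"
  assumes T_pos: "T > 0"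
    and alpha: "0 \<le> \<alpha>" "\<alpha> < 1/2"
    and W: "cyl_wiener M T \<beta>"
    and basis: "orthonormal_basis e"
    and semigroup: "c0_semigroup S"
    and S_HS: "\<forall>t\<in>{0<..1}. hs_norm2 e (S t) \<le> ennreal (c * t powr (- 2 * \<alpha>))"
    and C_bdd: "\<forall>i. \<forall>s\<in>{0..T}. \<forall>\<omega>\<in>space M.
                   bounded_linear (C i s \<omega>) \<and> (\<forall>y. norm (C i s \<omega> y) \<le> c * norm y)"
    and C_prog: "\<forall>i y. progressive M (nat_filtration M \<beta>) T (\<lambda>s \<omega>. C i s \<omega> y)"
    and C_HS: "\<forall>s\<in>{0..T}. \<forall>\<omega>\<in>space M. \<forall>t\<in>{0<..1}. \<forall>y.
                 (\<Sum>i. ennreal ((norm (S t (C i s \<omega> y)))\<^sup>2)) \<le> ennreal (c * t powr (- 2 * \<alpha>) * (norm y)\<^sup>2)"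
    and eta_meas: "\<eta> \<in> borel_measurable (nat_filtration M \<beta> T)"
    and eta_L2: "(\<integral>\<^sup>+\<omega>. ennreal ((norm (\<eta> \<omega>))\<^sup>2) \<partial>M) < \<infinity>"
    and f_prog: "progressive M (nat_filtration M \<beta>) T f"
    and f_L2: "sq_int M T f"
    and sol1: "mild_solution M \<beta> e S C T \<alpha> \<eta> f P Q"
    and sol2: "mild_solution M \<beta> e S C T \<alpha> \<eta> f P' Q'"
  shows "AE z in restrict_space lborel {0..T} \<Otimes>\<^sub>M M.
           P (fst z) (snd z) = P' (fst z) (snd z) \<and> Q (fst z) (snd z) = Q' (fst z) (snd z)"
proof -
  obtain K where K: "K \<ge> 1" "\<forall>t\<in>{0..T}. \<forall>x. norm (S t x) \<le> K * norm x"
    using c0_semigroup_bounded[OF semigroup] by blast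
  \<comment> \<open>Replacing c by |c| preserves the bounds and makes the constant
    nonnegative.\<close>
  have C_le: "norm (C i s \<omega> y) \<le> \<bar>c\<bar> * norm y" if "s \<in> {0..T}" "\<omega> \<in> space M" for i s \<omega> y
  proof -
    have "norm (C i s \<omega> y) \<le> c * norm y" using C_bdd that by blast
    also have "\<dots> \<le> \<bar>c\<bar> * norm y" by (intro mult_right_mono) auto
    finally show ?thesis .
  qed
  have prob: "prob_space M" using W by (simp add: cyl_wiener_def)
  have is_bsde_setup: "bsde_setup M T \<beta> e S K C \<bar>c\<bar> \<alpha>"
  proof (intro bsde_setup.intro mild_setup.intro cyl_wiener_space.intro cyl_wiener_space_axioms.intro mild_setup_axioms.intro bsde_setup_axioms.intro)
    show "norm (S t x) \<le> K * norm x" if "t \<in> {0..T}" for t x using K(2) that by blast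
    show "bounded_linear (C i s \<omega>)" if "s \<in> {0..T}" "\<omega> \<in> space M" for i s \<omega> using C_bdd that by blast
    show "progressive M (nat_filtration M \<beta>) T (\<lambda>s \<omega>. C i s \<omega> y)" for i y using C_prog by blast
  qed (fact prob W basis semigroup K(1) T_pos alpha abs_ge_zero C_le)+
  interpret B: bsde_setup M T \<beta> e S K C "\<bar>c\<bar>" \<alpha> by (rule is_bsde_setup)
  let ?x = "\<lambda>j z. B.columns Q j z - B.columns Q' j z"
  have prog: "progressive M (nat_filtration M \<beta>) T (\<lambda>s \<omega>. ?x j (s, \<omega>))" for j
    by (rule progressive_diff[OF B.solution_columns_progressive[OF sol1] B.solution_columns_progressive[OF sol2]])
  interpret D: dual_family M T \<beta> e S K C "\<bar>c\<bar>" \<alpha> ?x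
  proof (rule dual_family.intro[OF B.bsde_setup_axioms dual_family_axioms.intro], rule prog,
      rule B.columns_diff_L2[OF sol1 sol2], rule B.weighted_drift_diff[OF sol1 sol2],
      rule B.duality_identity[OF sol1 sol2], assumption+)
    show "(\<Sum>i. ennreal ((norm (S t (C i s \<omega> y)))\<^sup>2)) \<le> ennreal (\<bar>c\<bar> * t powr (- 2 * \<alpha>) * (norm y)\<^sup>2)"
      if "s \<in> {0..T}" "\<omega> \<in> space M" "t \<in> {0<..1}" for s \<omega> t y
    proof -
      have "(\<Sum>i. ennreal ((norm (S t (C i s \<omega> y)))\<^sup>2)) \<le> ennreal (c * t powr (- 2 * \<alpha>) * (norm y)\<^sup>2)"
        using C_HS that by blast
      also have "\<dots> \<le> ennreal (\<bar>c\<bar> * t powr (- 2 * \<alpha>) * (norm y)\<^sup>2)"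
        by (intro ennreal_leI mult_right_mono) auto
      finally show ?thesis .
    qed
  qed

  have Pm: "(\<lambda>z. P (fst z) (snd z)) \<in> borel_measurable (slab M 0 T)" "(\<lambda>z. P' (fst z) (snd z)) \<in> borel_measurable (slab M 0 T)"
    using sol1 sol2 T_pos by (auto simp: mild_solution_def intro!: B.progressive_measurable)
  \<comment> \<open>For each t the values agree outside a null set that depends on t. As the set of
    agreement is measurable in the product, Fubini merges these into one null set.\<close>
  have "AE z in slab M 0 T. P (fst z) (snd z) = P' (fst z) (snd z)"
  proof (rule pair_sigma_finite.AE_pair_measure[OF pair_sigma_finite_slab[OF prob]])
    have "(\<lambda>z. norm (P (fst z) (snd z) - P' (fst z) (snd z))) \<in> borel_measurable (slab M 0 T)"
      by (intro measurable_compose[OF _ borel_measurable_norm] borel_measurable_diff Pm)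
    then have "{z \<in> space (slab M 0 T). norm (P (fst z) (snd z) - P' (fst z) (snd z)) = 0} \<in> sets (slab M 0 T)" by measurable
    then show "{z \<in> space (slab M 0 T). P (fst z) (snd z) = P' (fst z) (snd z)} \<in> sets (slab M 0 T)" by simp
    show "AE t in restrict_space lborel {0..T}. AE \<omega> in M. P (fst (t, \<omega>)) (snd (t, \<omega>)) = P' (fst (t, \<omega>)) (snd (t, \<omega>))"
    proof (rule AE_I2)
      fix t assume "t \<in> space (restrict_space lborel {0..T})"
      then have t: "t \<in> {0..T}" by (simp add: space_restrict_space)
      show "AE \<omega> in M. P (fst (t, \<omega>)) (snd (t, \<omega>)) = P' (fst (t, \<omega>)) (snd (t, \<omega>))"
        using B.P_eq_of_drift_zero[OF sol1 sol2 D.drift_zero t] by simp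
    qed
  qed
  moreover have "AE z in slab M 0 T. Q (fst z) (snd z) = Q' (fst z) (snd z)"
  proof -
    \<comment> \<open>Countably many columns share one null set; outside it two bounded operators
      agree on the basis and, by continuity, everywhere.\<close>
    have "AE z in slab M 0 T. \<forall>j. ?x j z = 0" unfolding AE_all_countable using D.family_zero by blast
    then show ?thesis
      using AE_space
    proof eventually_elim
      case (elim z)
      let ?A = "Q (fst z) (snd z)" and ?A' = "Q' (fst z) (snd z)"
      have z: "fst z \<in> {0..T}" "snd z \<in> space M" using elim(2) by (auto simp: space_pair_measure space_restrict_space)
      have lin: "bounded_linear ?A" "bounded_linear ?A'" using sol1 sol2 z unfolding mild_solution_def by blast+
      have eq: "?A (e j) = ?A' (e j)" for j using elim(1) by (simp add: B.columns_def)
      show ?case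
      proof
        fix y
        let ?s = "\<lambda>n. \<Sum>i<n. inner y (e i) *\<^sub>R e i"
        have "?A (?s n) = ?A' (?s n)" for n
          using lin[THEN bounded_linear.linear] by (simp add: linear_sum linear_scale eq)
        then have "(\<lambda>n. ?A (?s n)) \<longlonglongrightarrow> ?A' y" using bounded_linear.tendsto[OF lin(2) B.basis_expansion[of y]] by simp
        then show "?A y = ?A' y" using bounded_linear.tendsto[OF lin(1) B.basis_expansion[of y]] by (rule LIMSEQ_unique[rotated])
      qed
    qed
  qed
  ultimately show ?thesis by eventually_elim simp
qed

end
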